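(* If $U$ is an ultrafilter in $V$ on the complete Boolean algebra $\mathbb{B}$, then the following are equivalent: (1) The Boolean ultrapower $\check V_U$ is well-founded. (2) The Boolean ultrapower $\check V_U$ is an $\omega$-model; that is, it has only standard natural numbers. (3) $U$ meets all countable maximal antichains of $\mathbb{B}$ in $V$. That is, if $A\subseteq\mathbb{B}$ is a countable maximal antichain in $V$, then $U\cap A\neq\emptyset$. (4) $U$ is countably complete over $V$. That is, if $a_n\in U$ for all $n<\omega$ and $\langle a_n : n<\omega\rangle\in V$, then $\bigwedge_n a_n\in U$. (5) $U$ is weakly countably complete over $V$. That is, if $a_n\in U$ for all $n<\omega$ and $\langle a_n : n<\omega\rangle\in V$, then $\bigwedge_n a_n\neq 0$. If the ultrafilter $U$ is not in $V$, but in some larger set-theoretic universe $\overline V\supseteq V$, then nevertheless statements (2) through (5) remain equivalent, and each of them is implied by statement (1).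
   Context: $V$ is the universe of sets (a model of ZFC) and $\mathbb{B}\in V$ is a complete Boolean algebra in $V$. $\mathbb{B}$-names (elements of $V^{\mathbb{B}}$) are defined recursively in $V$: $\tau$ is a $\mathbb{B}$-name if $\tau$ is a set of pairs $\langle\sigma,b\rangle$ with $\sigma$ a $\mathbb{B}$-name and $b\in\mathbb{B}$. Boolean values: $[\![\tau\in\sigma]\!]=\bigvee_{\langle\eta,b\rangle\in\sigma}[\![\tau=\eta]\!]\wedge b$, $[\![\tau=\sigma]\!]=[\![\tau\subseteq\sigma]\!]\wedge[\![\sigma\subseteq\tau]\!]$, $[\![\tau\subseteq\sigma]\!]=\bigwedge_{\eta\in\mathrm{dom}(\tau)}(\neg[\![\eta\in\tau]\!]\vee[\![\eta\in\sigma]\!])$. For $x\in V$, $\check x=\{\langle\check y,1\rangle : y\in x\}$. The ground-model predicate has $[\![\tau\in\check V]\!]=\bigvee_{x\in V}[\![\tau=\check x]\!]$. For an ultrafilter $U$ on $\mathbb{B}$ let $\tau=_U\sigma$ iff $[\![\tau=\sigma]\!]\in U$, and $\tau\in_U\sigma$ iff $[\![\tau\in\sigma]\!]\in U$; $[\tau]_U$ is the $=_U$-equivalence class of $\tau$ (restricted to members of minimal rank). The Boolean ultrapower is the structure $\check V_U=\{[\tau]_U : [\![\tau\in\check V]\!]\in U\}$ under $\in_U$, with the elementary map $j_U:V\to\check V_U$, $j_U(x)=[\check x]_U$. "$\check V_U$ is an $\omega$-model" means every $\in_U$-element of $[\check\omega]_U$ has the form $[\check n]_U$ with $n<\omega$.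 *)

theory Defs
  imports "HOL-Algebra.Lattice"
begin

datatype fm = Mem nat nat | Equal nat nat | Neg fm | Conj fm fm | Forall nat fm

primrec sat :: "'a set \<Rightarrow> ('a \<Rightarrow> 'a \<Rightarrow> bool) \<Rightarrow> (nat \<Rightarrow> 'a) \<Rightarrow> fm \<Rightarrow> bool" where
  "sat V E v (Mem i j) \<longleftrightarrow> E (v i) (v j)"
| "sat V E v (Equal i j) \<longleftrightarrow> v i = v j"
| "sat V E v (Neg \<phi>) \<longleftrightarrow> \<not> sat V E v \<phi>"
| "sat V E v (Conj \<phi> \<psi>) \<longleftrightarrow> sat V E v \<phi> \<and> sat V E v \<psi>"
| "sat V E v (Forall i \<phi>) \<longleftrightarrow> (\<forall>x\<in>V. sat V E (v(i := x)) \<phi>)"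

text \<open>
  A structure for the language of set theory: \<open>V\<close> is its domain and \<open>E x y\<close> says that \<open>x\<close> is a
  member of \<open>y\<close>.  Nothing is assumed about \<open>E\<close> from the outside; in particular it need not be
  well-founded.  Sets of type \<open>'a set\<close> are collections of elements of the structure, and such a
  collection \<open>X\<close> is a set of the structure only if \<open>X = elts x\<close> for some \<open>x \<in> V\<close>.
\<close>

locale membership_structure =
  fixes V :: "'a set" and E :: "'a \<Rightarrow> 'a \<Rightarrow> bool"
begin

definition elts :: "'a \<Rightarrow> 'a set" where
  "elts x = {y \<in> V. E y x}"

definition set_of :: "'a set \<Rightarrow> 'a" where
  "set_of X = (THE z. z \<in> V \<and> elts z = X)"

definition is_inductive :: "'a \<Rightarrow> bool" where
  "is_inductive w \<longleftrightarrow> (\<exists>z\<in>elts w. elts z = {}) \<and>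
     (\<forall>x\<in>elts w. \<exists>y\<in>elts w. elts y = insert x (elts x))"

text \<open>
  The conjuncts are Extensionality, Foundation, Pairing, Union, Power Set, Infinity, the Separation and
  Replacement schemes, and Choice.  In the schemes, variable 0 is the argument and (for Replacement)
  variable 1 the value of the formula; all other variables are parameters from \<open>V\<close>.
\<close>

definition zfc_model :: bool where
  "zfc_model \<longleftrightarrow>
     (\<forall>x\<in>V. \<forall>y\<in>V. elts x = elts y \<longrightarrow> x = y) \<and>
     (\<forall>x\<in>V. elts x \<noteq> {} \<longrightarrow> (\<exists>y\<in>elts x. elts y \<inter> elts x = {})) \<and>
     (\<forall>x\<in>V. \<forall>y\<in>V. \<exists>z\<in>V. elts z = {x, y}) \<and>
     (\<forall>x\<in>V. \<exists>z\<in>V. elts z = (\<Union>y\<in>elts x. elts y)) \<and>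
     (\<forall>x\<in>V. \<exists>z\<in>V. elts z = {y \<in> V. elts y \<subseteq> elts x}) \<and>
     (\<exists>w\<in>V. is_inductive w) \<and>
     (\<forall>\<phi> v. range v \<subseteq> V \<longrightarrow>
        (\<forall>x\<in>V. \<exists>z\<in>V. elts z = {y \<in> elts x. sat V E (v(0 := y)) \<phi>})) \<and>
     (\<forall>\<phi> v. range v \<subseteq> V \<longrightarrow>
        (\<forall>x\<in>V. (\<forall>y\<in>elts x. \<exists>!u. u \<in> V \<and> sat V E (v(0 := y, 1 := u)) \<phi>) \<longrightarrow>
           (\<exists>z\<in>V. elts z = {u \<in> V. \<exists>y\<in>elts x. sat V E (v(0 := y, 1 := u)) \<phi>}))) \<and>
     (\<forall>x\<in>V. (\<forall>y\<in>elts x. elts y \<noteq> {}) \<and>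
        (\<forall>y\<in>elts x. \<forall>z\<in>elts x. y \<noteq> z \<longrightarrow> elts y \<inter> elts z = {}) \<longrightarrow>
        (\<exists>c\<in>V. \<forall>y\<in>elts x. \<exists>!u. u \<in> elts c \<inter> elts y))"

definition opair :: "'a \<Rightarrow> 'a \<Rightarrow> 'a" where
  "opair x y = set_of {set_of {x}, set_of {x, y}}"

definition omega :: 'a where
  "omega = set_of (\<Inter>w\<in>{w \<in> V. is_inductive w}. elts w)"

definition transitive_set :: "'a \<Rightarrow> bool" where
  "transitive_set d \<longleftrightarrow> d \<in> V \<and> (\<forall>x\<in>elts d. elts x \<subseteq> elts d)"

definition fun_on :: "'a \<Rightarrow> 'a set \<Rightarrow> bool" where
  "fun_on f D \<longleftrightarrow> f \<in> V \<and> (\<forall>p\<in>elts f. \<exists>x\<in>D. \<exists>y\<in>V. p = opair x y) \<and>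
     (\<forall>x\<in>D. \<exists>!y. y \<in> V \<and> opair x y \<in> elts f)"

definition app :: "'a \<Rightarrow> 'a \<Rightarrow> 'a" where
  "app f x = (THE y. y \<in> V \<and> opair x y \<in> elts f)"

text \<open>
  Definition by recursion on membership, carried out inside the structure:  \<open>rec_in H\<close> is the class
  function \<open>F\<close> with \<open>F x = H F x\<close>, where \<open>H F x\<close> may only use the values of \<open>F\<close> on the elements of
  \<open>x\<close>.  As usual, \<open>F x\<close> is the value at \<open>x\<close> of a set function satisfying the recursion equation on
  a transitive set containing \<open>x\<close>.
\<close>

definition rec_in :: "(('a \<Rightarrow> 'a) \<Rightarrow> 'a \<Rightarrow> 'a) \<Rightarrow> 'a \<Rightarrow> 'a" where
  "rec_in H x = (THE y. \<exists>d f. transitive_set d \<and> x \<in> elts d \<and> fun_on f (elts d) \<and>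
     (\<forall>z\<in>elts d. app f z = H (app f) z) \<and> y = app f x)"

definition rank :: "'a \<Rightarrow> 'a" where
  "rank = rec_in (\<lambda>F x. set_of (\<Union>y\<in>elts x. insert (F y) (elts (F y))))"

definition countable_in :: "'a \<Rightarrow> bool" where
  "countable_in A \<longleftrightarrow>
     (\<exists>f. fun_on f (elts A) \<and> app f ` elts A \<subseteq> elts omega \<and> inj_on (app f) (elts A))"

end

definition transitive_substructure :: "'a set \<Rightarrow> 'a set \<Rightarrow> ('a \<Rightarrow> 'a \<Rightarrow> bool) \<Rightarrow> bool" where
  "transitive_substructure V W E \<longleftrightarrow> V \<subseteq> W \<and> (\<forall>x\<in>V. \<forall>y\<in>W. E y x \<longrightarrow> y \<in> V)"

definition complement :: "('a, 'b) gorder_scheme \<Rightarrow> 'a \<Rightarrow> 'a" where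
  "complement G x =
     (THE y. y \<in> carrier G \<and> x \<sqinter>\<^bsub>G\<^esub> y = \<bottom>\<^bsub>G\<^esub> \<and> x \<squnion>\<^bsub>G\<^esub> y = \<top>\<^bsub>G\<^esub>)"

definition boolean_lattice :: "('a, 'b) gorder_scheme \<Rightarrow> bool" where
  "boolean_lattice G \<longleftrightarrow> bounded_lattice G \<and>
     (\<forall>x\<in>carrier G. \<forall>y\<in>carrier G. \<forall>z\<in>carrier G.
        x \<sqinter>\<^bsub>G\<^esub> (y \<squnion>\<^bsub>G\<^esub> z) = (x \<sqinter>\<^bsub>G\<^esub> y) \<squnion>\<^bsub>G\<^esub> (x \<sqinter>\<^bsub>G\<^esub> z)) \<and>
     (\<forall>x\<in>carrier G. \<exists>y\<in>carrier G. x \<sqinter>\<^bsub>G\<^esub> y = \<bottom>\<^bsub>G\<^esub> \<and> x \<squnion>\<^bsub>G\<^esub> y = \<top>\<^bsub>G\<^esub>)"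

definition ultrafilter_on :: "('a, 'b) gorder_scheme \<Rightarrow> 'a set \<Rightarrow> bool" where
  "ultrafilter_on G u \<longleftrightarrow> u \<subseteq> carrier G \<and> \<top>\<^bsub>G\<^esub> \<in> u \<and> \<bottom>\<^bsub>G\<^esub> \<notin> u \<and>
     (\<forall>x\<in>u. \<forall>y\<in>carrier G. x \<sqsubseteq>\<^bsub>G\<^esub> y \<longrightarrow> y \<in> u) \<and>
     (\<forall>x\<in>u. \<forall>y\<in>u. x \<sqinter>\<^bsub>G\<^esub> y \<in> u) \<and>
     (\<forall>x\<in>carrier G. x \<in> u \<or> complement G x \<in> u)"

definition antichain_in :: "('a, 'b) gorder_scheme \<Rightarrow> 'a set \<Rightarrow> bool" where
  "antichain_in G A \<longleftrightarrow> A \<subseteq> carrier G \<and> \<bottom>\<^bsub>G\<^esub> \<notin> A \<and>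
     (\<forall>x\<in>A. \<forall>y\<in>A. x \<noteq> y \<longrightarrow> x \<sqinter>\<^bsub>G\<^esub> y = \<bottom>\<^bsub>G\<^esub>)"

text \<open>The Boolean algebra is given in the structure by its underlying set \<open>B\<close> and its order \<open>L\<close>.\<close>

locale boolean_ultrapower = membership_structure V E
  for V :: "'a set" and E :: "'a \<Rightarrow> 'a \<Rightarrow> bool" +
  fixes B L :: 'a
begin

definition \<BB> :: "'a gorder" where
  "\<BB> = \<lparr>carrier = elts B, eq = (=), le = (\<lambda>x y. opair x y \<in> elts L)\<rparr>"

text \<open>Completeness only concerns those subsets of \<open>B\<close> that are sets of the structure.\<close>

definition complete_boolean_algebra :: bool where
  "complete_boolean_algebra \<longleftrightarrow> B \<in> V \<and> L \<in> V \<and> boolean_lattice \<BB> \<and>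
     (\<forall>A\<in>V. elts A \<subseteq> elts B \<longrightarrow>
        (\<exists>s. least \<BB> s (Upper \<BB> (elts A))) \<and> (\<exists>s. greatest \<BB> s (Lower \<BB> (elts A))))"

text \<open>
  The recursion defining names, restricted to a transitive set \<open>t\<close>, of which \<open>N\<close> is the set of
  names.  Since \<open>t\<close> is transitive, it contains \<open>\<sigma>\<close> whenever it contains a set with element
  \<open>opair \<sigma> b\<close>.
\<close>

definition is_name :: "'a \<Rightarrow> bool" where
  "is_name \<tau> \<longleftrightarrow> (\<exists>t N. transitive_set t \<and> N \<in> V \<and>
     elts N = {x \<in> elts t. \<forall>p\<in>elts x. \<exists>\<sigma>\<in>elts N. \<exists>b\<in>elts B. p = opair \<sigma> b} \<and>
     \<tau> \<in> elts N)"

definition name_dom :: "'a \<Rightarrow> 'a set" where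
  "name_dom \<tau> = {\<eta> \<in> V. \<exists>b\<in>V. opair \<eta> b \<in> elts \<tau>}"

text \<open>
  The simultaneous recursion defining Boolean values, restricted to a set \<open>N\<close> of names that contains
  the domains of its elements: \<open>m\<close>, \<open>s\<close>, \<open>e\<close> are set functions giving the Boolean values of
  membership, inclusion and equality.
\<close>

definition bv_functions :: "'a \<Rightarrow> 'a \<Rightarrow> 'a \<Rightarrow> 'a \<Rightarrow> bool" where
  "bv_functions N m s e \<longleftrightarrow>
     N \<in> V \<and> (\<forall>\<tau>\<in>elts N. is_name \<tau> \<and> name_dom \<tau> \<subseteq> elts N) \<and>
     (let D = {opair \<tau> \<sigma> | \<tau> \<sigma>. \<tau> \<in> elts N \<and> \<sigma> \<in> elts N}
      in fun_on m D \<and> fun_on s D \<and> fun_on e D) \<and>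
     (\<forall>\<tau>\<in>elts N. \<forall>\<sigma>\<in>elts N.
        app m (opair \<tau> \<sigma>) =
          \<Squnion>\<^bsub>\<BB>\<^esub> {app e (opair \<tau> \<eta>) \<sqinter>\<^bsub>\<BB>\<^esub> b | \<eta> b. \<eta> \<in> V \<and> b \<in> V \<and> opair \<eta> b \<in> elts \<sigma>} \<and>
        app s (opair \<tau> \<sigma>) =
          \<Sqinter>\<^bsub>\<BB>\<^esub> {complement \<BB> (app m (opair \<eta> \<tau>)) \<squnion>\<^bsub>\<BB>\<^esub> app m (opair \<eta> \<sigma>) | \<eta>. \<eta> \<in> name_dom \<tau>} \<and>
        app e (opair \<tau> \<sigma>) = app s (opair \<tau> \<sigma>) \<sqinter>\<^bsub>\<BB>\<^esub> app s (opair \<sigma> \<tau>))"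

definition bv_mem :: "'a \<Rightarrow> 'a \<Rightarrow> 'a" where
  "bv_mem \<tau> \<sigma> = (THE b. \<exists>N m s e. bv_functions N m s e \<and> \<tau> \<in> elts N \<and> \<sigma> \<in> elts N \<and>
     b = app m (opair \<tau> \<sigma>))"

definition bv_eq :: "'a \<Rightarrow> 'a \<Rightarrow> 'a" where
  "bv_eq \<tau> \<sigma> = (THE b. \<exists>N m s e. bv_functions N m s e \<and> \<tau> \<in> elts N \<and> \<sigma> \<in> elts N \<and>
     b = app e (opair \<tau> \<sigma>))"

definition check :: "'a \<Rightarrow> 'a" where
  "check = rec_in (\<lambda>F x. set_of {opair (F y) \<top>\<^bsub>\<BB>\<^esub> | y. y \<in> elts x})"

definition bv_ground :: "'a \<Rightarrow> 'a" where
  "bv_ground \<tau> = \<Squnion>\<^bsub>\<BB>\<^esub> {bv_eq \<tau> (check x) | x. x \<in> V}"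

text \<open>
  In what follows \<open>u\<close> is the collection of members of the ultrafilter; the ultrafilter itself need
  not be an element of \<open>V\<close>.
\<close>

definition name_class :: "'a set \<Rightarrow> 'a \<Rightarrow> 'a set" where
  "name_class u \<tau> = {\<sigma>. is_name \<sigma> \<and> bv_eq \<tau> \<sigma> \<in> u \<and>
     (\<forall>\<rho>. is_name \<rho> \<and> bv_eq \<tau> \<rho> \<in> u \<longrightarrow> rank \<rho> \<notin> elts (rank \<sigma>))}"

definition ultrapower :: "'a set \<Rightarrow> 'a set set" where
  "ultrapower u = {name_class u \<tau> | \<tau>. is_name \<tau> \<and> bv_ground \<tau> \<in> u}"

definition ultrapower_mem :: "'a set \<Rightarrow> 'a set \<Rightarrow> 'a set \<Rightarrow> bool" where
  "ultrapower_mem u c d \<longleftrightarrow> (\<exists>\<tau>\<in>c. \<exists>\<sigma>\<in>d. bv_mem \<tau> \<sigma> \<in> u)"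

definition ultrapower_map :: "'a set \<Rightarrow> 'a \<Rightarrow> 'a set" where
  "ultrapower_map u x = name_class u (check x)"

text \<open>
  Well-foundedness as seen by a structure \<open>W\<close> with the same membership relation: every nonempty set
  \<open>X\<close> of \<open>W\<close> whose elements are elements of the ultrapower has a minimal element.
\<close>

definition ultrapower_wf_in :: "'a set \<Rightarrow> 'a set \<Rightarrow> bool" where
  "ultrapower_wf_in W u \<longleftrightarrow>
     (\<forall>X\<in>W. let S = membership_structure.elts W E ` membership_structure.elts W E X
       in S \<noteq> {} \<and> S \<subseteq> ultrapower u \<longrightarrow> (\<exists>c\<in>S. \<forall>d\<in>S. \<not> ultrapower_mem u d c))"

definition ultrapower_omega_model :: "'a set \<Rightarrow> bool" where
  "ultrapower_omega_model u \<longleftrightarrow>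
     (\<forall>c\<in>ultrapower u. ultrapower_mem u c (ultrapower_map u omega) \<longrightarrow>
        (\<exists>n\<in>elts omega. c = ultrapower_map u n))"

definition countable_maximal_antichain :: "'a \<Rightarrow> bool" where
  "countable_maximal_antichain A \<longleftrightarrow> A \<in> V \<and> countable_in A \<and> antichain_in \<BB> (elts A) \<and>
     (\<forall>A'\<in>V. antichain_in \<BB> (elts A') \<and> elts A \<subseteq> elts A' \<longrightarrow> elts A' = elts A)"

definition meets_countable_maximal_antichains :: "'a set \<Rightarrow> bool" where
  "meets_countable_maximal_antichains u \<longleftrightarrow>
     (\<forall>A. countable_maximal_antichain A \<longrightarrow> u \<inter> elts A \<noteq> {})"

definition countably_complete :: "'a set \<Rightarrow> bool" where
  "countably_complete u \<longleftrightarrow>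
     (\<forall>a. fun_on a (elts omega) \<and> (\<forall>n\<in>elts omega. app a n \<in> u) \<longrightarrow>
        \<Sqinter>\<^bsub>\<BB>\<^esub> (app a ` elts omega) \<in> u)"

definition weakly_countably_complete :: "'a set \<Rightarrow> bool" where
  "weakly_countably_complete u \<longleftrightarrow>
     (\<forall>a. fun_on a (elts omega) \<and> (\<forall>n\<in>elts omega. app a n \<in> u) \<longrightarrow>
        \<Sqinter>\<^bsub>\<BB>\<^esub> (app a ` elts omega) \<noteq> \<bottom>\<^bsub>\<BB>\<^esub>)"

end

end

theory Submission
  imports Defs
begin

text \<open>
  Put \<open>a \<lesssim> b\<close> for the order of the Boolean algebra.  The completeness properties are tied together by one
  construction.  A sequence \<open>a\<close> of members of \<open>u\<close> with infimum \<open>\<bottom>\<close> yields the elements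
  \<open>d n = - a n \<sqinter> (\<Sqinter>k\<in>n. a k)\<close>, ``\<open>n\<close> is the first index at which \<open>a\<close> fails'' (\<open>first_fail\<close>).  They
  are disjoint, cover \<open>\<top>\<close>, and avoid \<open>u\<close>, so the nonzero ones form a countable maximal antichain missed by \<open>u\<close>
  (\<open>missed_antichain\<close>): if \<open>u\<close> meets all of these, it is weakly complete.  Conversely, a countable maximal antichain missed by \<open>u\<close> gives
  the sequence of its complements, whose infimum is \<open>\<bottom>\<close> (\<open>weakly_imp_meets\<close>).  Weak completeness is completeness:
  if the infimum \<open>I\<close> of members of \<open>u\<close> is not in \<open>u\<close>, then \<open>a n \<sqinter> - I\<close> is a sequence of members of \<open>u\<close> with infimum
  \<open>\<bottom>\<close> (\<open>weakly_imp_countably_complete\<close>).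

  The link with natural numbers is that \<open>[\<tau> \<in> \<omega>] = (\<Squnion>n. [\<tau> = n])\<close>.  If \<open>u\<close> is countably complete
  and contains the left-hand side, it contains some \<open>[\<tau> = n]\<close> (\<open>countably_complete_imp_omega_model\<close>).  In the other
  direction, a disjoint family can be mixed: there is a name that equals \<open>g i\<close> with value at least \<open>d i\<close>, for all
  \<open>i\<close> at once (\<open>mixname\<close>).  Mixing distinct natural numbers along a countable maximal antichain produces a name for a
  natural number, and it is standard only if \<open>u\<close> meets the antichain (\<open>omega_model_imp_meets\<close>).

  If \<open>u\<close> is not weakly complete, mixing the values of functions \<open>F\<close> from \<open>\<omega>\<close> to \<open>\<omega>\<close> along \<open>first_fail\<close> gives
  natural numbers of the ultrapower.  The identity gives a nonstandard one, and from a nonstandard one, passing to the predecessor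
  of \<open>F\<close> goes down in the ultrapower to another nonstandard one.  So the nonstandard numbers obtained in
  this way form a set without a minimal element (\<open>ill_founded\<close>); this set exists in the outer model because
  it is cut out, inside a set of the ground model, by relations that are sets of the ground model together with membership in
  \<open>u\<close>.  If \<open>u\<close> lies in the ground model, a set without minimal element yields, by dependent choice there, a
  sequence of names with \<open>[f (n + 1) \<in> f n]\<close> and \<open>[f n \<in> V]\<close> in \<open>u\<close>.  By weak completeness these values have a
  nonzero common lower bound \<open>I\<close>, and membership induction shows \<open>I \<sqinter> [f n = x] = \<bottom>\<close> for every \<open>x\<close>: below a
  value \<open>[f n = x]\<close> there would be a value \<open>[f (n + 1) = w]\<close> with \<open>w \<in> x\<close>.  This contradicts
  \<open>I \<lesssim> [f 0 \<in> V]\<close> (\<open>weakly_imp_wf\<close>).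

  The remaining work is to carry out this argument inside a model that may be ill-founded from the outside.  Every
  instance of separation, replacement or induction needs a first-order definition of the predicate involved.  These are supplied by
  a closure calculus: \<open>definable\<close> for predicates and \<open>defterm\<close> for class functions, whose rules
  \<open>definable_intros\<close> follow the syntax of the predicate.  For the calculus to apply without side conditions, all
  operations are given total versions.
\<close>

section \<open>Definable predicates\<close>

text \<open>
  Renaming also acts on bound variables, so \<open>sat_rename\<close> needs an injective renaming.
\<close>

primrec rename :: "(nat \<Rightarrow> nat) \<Rightarrow> fm \<Rightarrow> fm" where
  "rename r (Mem i j) = Mem (r i) (r j)"
| "rename r (Equal i j) = Equal (r i) (r j)"
| "rename r (Neg \<phi>) = Neg (rename r \<phi>)"
| "rename r (Conj \<phi> \<psi>) = Conj (rename r \<phi>) (rename r \<psi>)"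
| "rename r (Forall i \<phi>) = Forall (r i) (rename r \<phi>)"

lemma sat_rename: "inj r \<Longrightarrow> sat V E v (rename r \<phi>) \<longleftrightarrow> sat V E (\<lambda>n. v (r n)) \<phi>"
proof (induction \<phi> arbitrary: v)
  case (Forall i \<phi>)
  have "(\<lambda>n. (v(r i := x)) (r n)) = (\<lambda>n. v (r n))(i := x)" for x
    using Forall.prems by (auto simp: fun_eq_iff inj_eq)
  then show ?case using Forall by simp
qed auto

text \<open>
  A formula has finitely many variables; this provides a fresh one to bind in \<open>definable_imp_sat\<close>.
\<close>

lemma sat_bounded_variables:
  "\<exists>K. \<forall>v w. (\<forall>n<K. v n = w n) \<longrightarrow> (sat V E v \<phi> \<longleftrightarrow> sat V E w \<phi>)"
proof (induction \<phi>)
  case (Mem i j)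
  show ?case by (rule exI[of _ "Suc (max i j)"]) auto
next
  case (Equal i j)
  show ?case by (rule exI[of _ "Suc (max i j)"]) auto
next
  case (Neg \<phi>)
  then show ?case by auto
next
  case (Conj \<phi> \<psi>)
  then obtain K L where
    K: "\<And>v w. (\<forall>n<K. v n = w n) \<Longrightarrow> (sat V E v \<phi> \<longleftrightarrow> sat V E w \<phi>)" and
    L: "\<And>v w. (\<forall>n<L. v n = w n) \<Longrightarrow> (sat V E v \<psi> \<longleftrightarrow> sat V E w \<psi>)" by blast
  have "sat V E v (Conj \<phi> \<psi>) = sat V E w (Conj \<phi> \<psi>)" if "\<forall>n<max K L. v n = w n" for v w
    using K[of v w] L[of v w] that by simp
  then show ?case by blast
next
  case (Forall i \<phi>)
  then obtain K where K: "\<And>v w. (\<forall>n<K. v n = w n) \<Longrightarrow> (sat V E v \<phi> \<longleftrightarrow> sat V E w \<phi>)" by blast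
  have "sat V E v (Forall i \<phi>) = sat V E w (Forall i \<phi>)" if "\<forall>n<K. v n = w n" for v w
  proof -
    have "sat V E (v(i := x)) \<phi> = sat V E (w(i := x)) \<phi>" for x
      using that by (intro K) auto
    then show ?thesis by simp
  qed
  then show ?case by blast
qed

text \<open>
  Environments are stacks: variable \<open>0\<close> is bound by the innermost quantifier and the others are shifted by one.  Definability
  of a predicate under a quantifier can then be stated without choosing fresh variable names.
\<close>

definition scons :: "'a \<Rightarrow> (nat \<Rightarrow> 'a) \<Rightarrow> nat \<Rightarrow> 'a" where
  "scons x v n = (case n of 0 \<Rightarrow> x | Suc m \<Rightarrow> v m)"

lemma scons_simps [simp]: "scons x v 0 = x" "scons x v (Suc n) = v n"
  by (simp_all add: scons_def)

lemma range_scons [simp]: "range (scons x v) \<subseteq> V \<longleftrightarrow> x \<in> V \<and> range v \<subseteq> V"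
proof
  assume A: "range (scons x v) \<subseteq> V"
  have "scons x v 0 \<in> V" "\<And>n. scons x v (Suc n) \<in> V" using A by blast+
  then show "x \<in> V \<and> range v \<subseteq> V" by auto
next
  assume "x \<in> V \<and> range v \<subseteq> V"
  then show "range (scons x v) \<subseteq> V"
    by (auto simp: scons_def image_subset_iff split: nat.splits)
qed

definition prepend :: "'a list \<Rightarrow> (nat \<Rightarrow> 'a) \<Rightarrow> nat \<Rightarrow> 'a" where
  "prepend ps v n = (if n < length ps then ps ! n else v (n - length ps))"

context membership_structure
begin

text \<open>
  Predicates of environments that are first-order definable with parameters.  The last clause makes the notion
  depend only on environments with values in \<open>V\<close>.
\<close>

inductive definable :: "((nat \<Rightarrow> 'a) \<Rightarrow> bool) \<Rightarrow> bool" where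
  definable_Mem: "definable (\<lambda>v. E (v i) (v j))"
| definable_Equal: "definable (\<lambda>v. v i = v j)"
| definable_param: "c \<in> V \<Longrightarrow> definable (\<lambda>v. v i = c)"
| definable_not: "definable P \<Longrightarrow> definable (\<lambda>v. \<not> P v)"
| definable_and: "definable P \<Longrightarrow> definable Q \<Longrightarrow> definable (\<lambda>v. P v \<and> Q v)"
| definable_all_scons: "definable P \<Longrightarrow> definable (\<lambda>v. \<forall>x\<in>V. P (scons x v))"
| definable_cong: "definable P \<Longrightarrow> (\<And>v. range v \<subseteq> V \<Longrightarrow> P v \<longleftrightarrow> Q v) \<Longrightarrow> definable Q"

text \<open>
  The soundness of the calculus.  In the case of a conjunction the two parameter lists are concatenated; in the case of a
  quantifier the stack variable after the parameters is moved to a variable \<open>K\<close> beyond all those in use.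
\<close>

lemma definable_imp_sat:
  "definable P \<Longrightarrow> \<exists>\<phi> ps. set ps \<subseteq> V \<and> (\<forall>v. range v \<subseteq> V \<longrightarrow> (P v \<longleftrightarrow> sat V E (prepend ps v) \<phi>))"
proof (induction rule: definable.induct)
  case (definable_Mem i j)
  show ?case by (rule exI[of _ "Mem i j"], rule exI[of _ "[]"]) (simp add: prepend_def)
next
  case (definable_Equal i j)
  show ?case by (rule exI[of _ "Equal i j"], rule exI[of _ "[]"]) (simp add: prepend_def)
next
  case (definable_param c i)
  then show ?case
    by (intro exI[of _ "Equal (Suc i) 0"] exI[of _ "[c]"]) (simp add: prepend_def)
next
  case (definable_not P)
  then obtain \<phi> ps where "set ps \<subseteq> V" "\<forall>v. range v \<subseteq> V \<longrightarrow> (P v \<longleftrightarrow> sat V E (prepend ps v) \<phi>)"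
    by blast
  then show ?case by (intro exI[of _ "Neg \<phi>"] exI[of _ ps]) simp
next
  case (definable_and P Q)
  then obtain \<phi> ps \<psi> qs where
    1: "set ps \<subseteq> V" "\<forall>v. range v \<subseteq> V \<longrightarrow> (P v \<longleftrightarrow> sat V E (prepend ps v) \<phi>)" and
    2: "set qs \<subseteq> V" "\<forall>v. range v \<subseteq> V \<longrightarrow> (Q v \<longleftrightarrow> sat V E (prepend qs v) \<psi>)" by blast
  define r where "r n = (if n < length ps then n else n + length qs)" for n
  have r: "inj r" by (rule injI) (auto simp: r_def split: if_splits)
  have 3: "inj (\<lambda>n. n + length ps)" by (auto simp: inj_def)
  have 4: "(\<lambda>n. prepend (ps @ qs) v (r n)) = prepend ps v" for v
    by (auto simp: fun_eq_iff prepend_def r_def nth_append)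
  have 5: "(\<lambda>n. prepend (ps @ qs) v (n + length ps)) = prepend qs v" for v
    by (auto simp: fun_eq_iff prepend_def nth_append)
  show ?case
    by (intro exI[of _ "Conj (rename r \<phi>) (rename (\<lambda>n. n + length ps) \<psi>)"] exI[of _ "ps @ qs"])
      (use 1 2 in \<open>simp add: sat_rename[OF r] sat_rename[OF 3] 4 5\<close>)
next
  case (definable_all_scons P)
  then obtain \<phi> ps where
    1: "set ps \<subseteq> V" "\<forall>v. range v \<subseteq> V \<longrightarrow> (P v \<longleftrightarrow> sat V E (prepend ps v) \<phi>)" by blast
  obtain K0 where K0: "\<And>v w. (\<forall>n<K0. v n = w n) \<Longrightarrow> (sat V E v \<phi> \<longleftrightarrow> sat V E w \<phi>)"
    using sat_bounded_variables by blast
  define k where "k = length ps"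
  define K where "K = Suc (max K0 k)"
  \<comment> \<open>a permutation of the variables, as \<open>sat_rename\<close> demands, which sends the quantified stack variable \<open>k\<close> to \<open>K\<close>\<close>
  define r where "r n = (if n < k then n else if n = k then K else if n \<le> K then n - 1 else n)" for n
  have K: "k < K" "K0 < K" by (simp_all add: K_def)
  have r: "inj r"
  proof (rule injI)
    fix a b assume "r a = r b"
    then show "a = b"
      using K(1) by (cases "a < k"; cases "a = k"; cases "a \<le> K"; cases "b < k"; cases "b = k"; cases "b \<le> K";
        simp add: r_def)
  qed
  have "sat V E (prepend ps v) (Forall K (rename r \<phi>)) \<longleftrightarrow> (\<forall>x\<in>V. P (scons x v))"
    if v: "range v \<subseteq> V" for v
  proof -
    have "sat V E ((prepend ps v)(K := x)) (rename r \<phi>) \<longleftrightarrow> P (scons x v)" if x: "x \<in> V" for x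
    proof -
      have "sat V E ((prepend ps v)(K := x)) (rename r \<phi>)
          \<longleftrightarrow> sat V E (\<lambda>n. ((prepend ps v)(K := x)) (r n)) \<phi>"
        by (rule sat_rename[OF r])
      also have "\<dots> \<longleftrightarrow> sat V E (prepend ps (scons x v)) \<phi>"
      proof (rule K0, intro allI impI)
        fix n assume n: "n < K0"
        consider "n < k" | "n = k" | m where "n = Suc (k + m)"
          using less_imp_Suc_add[of k n] by (cases n k rule: linorder_cases) auto
        then show "((prepend ps v)(K := x)) (r n) = prepend ps (scons x v) n"
          by cases (use n K in \<open>simp_all add: r_def prepend_def flip: k_def\<close>)
      qed
      also have "\<dots> \<longleftrightarrow> P (scons x v)" using 1(2) v x by simp
      finally show ?thesis .
    qed
    then show ?thesis by simp
  qed
  then show ?case using 1(1) by blast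
next
  case (definable_cong P Q)
  then obtain \<phi> ps where "set ps \<subseteq> V" "\<forall>v. range v \<subseteq> V \<longrightarrow> (P v \<longleftrightarrow> sat V E (prepend ps v) \<phi>)"
    by blast
  then show ?case using definable_cong.hyps(2) by (intro exI[of _ \<phi>] exI[of _ ps]) simp
qed

lemma definable_rename: "definable P \<Longrightarrow> definable (\<lambda>v. P (\<lambda>n. v (r n)))"
proof (induction arbitrary: r rule: definable.induct)
  case (definable_Mem i j)
  show ?case by (rule definable.definable_Mem)
next
  case (definable_Equal i j)
  show ?case by (rule definable.definable_Equal)
next
  case (definable_param c i)
  then show ?case by (rule definable.definable_param)
next
  case (definable_not P)
  show ?case by (rule definable.definable_not) (rule definable_not.IH)
next
  case (definable_and P Q)
  show ?case by (rule definable.definable_and) (rule definable_and.IH)+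
next
  case (definable_all_scons P)
  have eq: "(\<lambda>n. scons x v (case n of 0 \<Rightarrow> 0 | Suc m \<Rightarrow> Suc (r m))) = scons x (\<lambda>n. v (r n))" for x :: 'a and v
    by (auto simp: fun_eq_iff scons_def split: nat.splits)
  show ?case
    using definable.definable_all_scons[OF definable_all_scons.IH[of "\<lambda>n. case n of 0 \<Rightarrow> 0 | Suc m \<Rightarrow> Suc (r m)"]]
    unfolding eq .
next
  case (definable_cong P Q)
  show ?case
  proof (rule definable.definable_cong[OF definable_cong.IH[of r]])
    fix v :: "nat \<Rightarrow> 'a" assume "range v \<subseteq> V"
    then have "range (\<lambda>n. v (r n)) \<subseteq> V" by auto
    then show "P (\<lambda>n. v (r n)) \<longleftrightarrow> Q (\<lambda>n. v (r n))" by (rule definable_cong.hyps(2))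
  qed
qed

named_theorems definable_intros

lemma definable_or:
  assumes "definable P" "definable Q" shows "definable (\<lambda>v. P v \<or> Q v)"
proof -
  have "definable (\<lambda>v. \<not> (\<not> P v \<and> \<not> Q v))" by (rule definable_not definable_and assms)+
  then show ?thesis by (rule definable_cong) blast
qed

lemma definable_imp:
  assumes "definable P" "definable Q" shows "definable (\<lambda>v. P v \<longrightarrow> Q v)"
proof -
  have "definable (\<lambda>v. \<not> P v \<or> Q v)" by (rule definable_not definable_or assms)+
  then show ?thesis by (rule definable_cong) blast
qed

lemma definable_iff:
  assumes "definable P" "definable Q" shows "definable (\<lambda>v. P v \<longleftrightarrow> Q v)"
proof -
  have "definable (\<lambda>v. (P v \<longrightarrow> Q v) \<and> (Q v \<longrightarrow> P v))" by (rule definable_and definable_imp assms)+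
  then show ?thesis by (rule definable_cong) blast
qed

lemma definable_const: "definable (\<lambda>v. Q)"
proof (cases Q)
  case True
  show ?thesis by (rule definable_cong[OF definable_Equal[of 0 0]]) (simp add: True)
next
  case False
  show ?thesis by (rule definable_cong[OF definable_not[OF definable_Equal[of 0 0]]]) (simp add: False)
qed

lemma definable_all:
  assumes "definable (\<lambda>v. P (v 0) (\<lambda>n. v (Suc n)))" shows "definable (\<lambda>v. \<forall>x\<in>V. P x v)"
  by (rule definable_cong[OF definable_all_scons[OF assms]]) simp

lemma definable_ex:
  assumes "definable (\<lambda>v. P (v 0) (\<lambda>n. v (Suc n)))" shows "definable (\<lambda>v. \<exists>x\<in>V. P x v)"
  by (rule definable_cong[OF definable_not[OF definable_all_scons[OF definable_not[OF assms]]]]) simp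

lemmas [definable_intros] = definable_not definable_and definable_or definable_imp definable_iff definable_const definable_all definable_ex

text \<open>
  A term is definable if its values stay in \<open>V\<close> and its graph is definable.  With both conditions it may be substituted
  into definable predicates (\<open>definable_bind\<close>).
\<close>

definition defterm :: "((nat \<Rightarrow> 'a) \<Rightarrow> 'a) \<Rightarrow> bool" where
  "defterm t \<longleftrightarrow> (\<forall>v. range v \<subseteq> V \<longrightarrow> t v \<in> V) \<and> definable (\<lambda>v. v 0 = t (\<lambda>n. v (Suc n)))"

lemma defterm_closed: "defterm t \<Longrightarrow> range v \<subseteq> V \<Longrightarrow> t v \<in> V"
  by (simp add: defterm_def)

lemma defterm_rename: "defterm t \<Longrightarrow> defterm (\<lambda>v. t (\<lambda>n. v (r n)))"
  unfolding defterm_def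
proof (elim conjE, intro conjI allI impI)
  fix v :: "nat \<Rightarrow> 'a"
  assume "\<forall>v. range v \<subseteq> V \<longrightarrow> t v \<in> V" "range v \<subseteq> V"
  then show "t (\<lambda>n. v (r n)) \<in> V" by (simp add: image_subset_iff)
next
  assume "definable (\<lambda>v. v 0 = t (\<lambda>n. v (Suc n)))"
  from definable_rename[OF this, of "\<lambda>n. case n of 0 \<Rightarrow> 0 | Suc m \<Rightarrow> Suc (r m)"]
  show "definable (\<lambda>v. v 0 = t (\<lambda>n. v (Suc (r n))))" by simp
qed

lemma defterm_var: "defterm (\<lambda>v. v i)"
  unfolding defterm_def using definable_Equal[of 0 "Suc i"] by auto

lemma defterm_const: "c \<in> V \<Longrightarrow> defterm (\<lambda>v. c)"
  unfolding defterm_def using definable_param[of c 0] by auto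

text \<open>
  Substitution of a term for the innermost variable, by the formula \<open>\<exists>x. x = t \<and> P x\<close>.  The lemmas
  \<open>definable1\<close> to \<open>definable3\<close> and \<open>defterm1\<close> to \<open>defterm3\<close> are the instances in which a relation or class
  function is applied to terms.
\<close>

lemma definable_bind:
  assumes "defterm t" "definable (\<lambda>v. P (v 0) (\<lambda>n. v (Suc n)))" shows "definable (\<lambda>v. P (t v) v)"
proof -
  have "definable (\<lambda>v. \<exists>x\<in>V. x = t v \<and> P x v)"
    by (rule definable_ex, rule definable_and, use assms(1) in \<open>simp add: defterm_def\<close>, rule assms(2))
  then show ?thesis
    by (rule definable_cong) (use defterm_closed[OF assms(1)] in auto)
qed

lemma definable1: "definable (\<lambda>v. R (v 0)) \<Longrightarrow> defterm t \<Longrightarrow> definable (\<lambda>v. R (t v))"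
  by (rule definable_bind[where P = "\<lambda>x v. R x"])

lemma definable2:
  assumes "definable (\<lambda>v. R (v 0) (v (Suc 0)))" "defterm t" "defterm s" shows "definable (\<lambda>v. R (t v) (s v))"
proof -
  have 1: "definable (\<lambda>v. R (v (Suc 0)) (v 0))"
    using definable_rename[OF assms(1), of "\<lambda>n. if n = 0 then Suc 0 else 0"] by simp
  have 2: "definable (\<lambda>v. R (v 0) (s (\<lambda>n. v (Suc n))))"
    by (rule definable_bind[where P = "\<lambda>y v. R (v 0) y", OF defterm_rename[OF assms(3), of Suc] 1])
  show ?thesis
    by (rule definable_bind[where P = "\<lambda>x v. R x (s v)", OF assms(2) 2])
qed

lemma definable3:
  assumes "definable (\<lambda>v. R (v 0) (v (Suc 0)) (v (Suc (Suc 0))))" "defterm t" "defterm s" "defterm r"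
  shows "definable (\<lambda>v. R (t v) (s v) (r v))"
proof -
  have 1: "definable (\<lambda>v. R (v (Suc 0)) (v (Suc (Suc 0))) (v 0))"
    using definable_rename[OF assms(1), of "\<lambda>n. if n = 0 then Suc 0 else if n = Suc 0 then Suc (Suc 0) else 0"]
    by simp
  have 2: "definable (\<lambda>v. R (v (Suc 0)) (v 0) (r (\<lambda>n. v (Suc (Suc n)))))"
    using definable_bind[where P = "\<lambda>y v. R (v 0) (v (Suc 0)) y", OF defterm_rename[OF assms(4), of "\<lambda>n. Suc (Suc n)"] 1]
      definable_rename[of "\<lambda>v. R (v 0) (v (Suc 0)) (r (\<lambda>n. v (Suc (Suc n))))"
        "\<lambda>n. case n of 0 \<Rightarrow> Suc 0 | Suc 0 \<Rightarrow> 0 | Suc (Suc m) \<Rightarrow> Suc (Suc m)"] by simp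
  have 3: "definable (\<lambda>v. R (v 0) (s (\<lambda>n. v (Suc n))) (r (\<lambda>n. v (Suc n))))"
    by (rule definable_bind[where P = "\<lambda>y v. R (v 0) y (r (\<lambda>n. v (Suc n)))", OF defterm_rename[OF assms(3), of Suc] 2])
  show ?thesis
    by (rule definable_bind[where P = "\<lambda>x v. R x (s v) (r v)", OF assms(2) 3])
qed

lemma defterm1:
  assumes "defterm (\<lambda>v. F (v 0))" "defterm t" shows "defterm (\<lambda>v. F (t v))"
  unfolding defterm_def
proof (intro conjI allI impI)
  fix v :: "nat \<Rightarrow> 'a" assume "range v \<subseteq> V"
  then show "F (t v) \<in> V"
    using defterm_closed[OF assms(1), of "scons (t v) v"] defterm_closed[OF assms(2)] by simp
next
  have "definable (\<lambda>v. v 0 = F (v (Suc 0)))" using assms(1) by (simp add: defterm_def)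
  from definable2[where R = "\<lambda>y x. y = F x", OF this defterm_var[of 0] defterm_rename[OF assms(2), of Suc]]
  show "definable (\<lambda>v. v 0 = F (t (\<lambda>n. v (Suc n))))" .
qed

lemma defterm2:
  assumes "defterm (\<lambda>v. F (v 0) (v (Suc 0)))" "defterm t" "defterm s" shows "defterm (\<lambda>v. F (t v) (s v))"
  unfolding defterm_def
proof (intro conjI allI impI)
  fix v :: "nat \<Rightarrow> 'a" assume "range v \<subseteq> V"
  then show "F (t v) (s v) \<in> V"
    using defterm_closed[OF assms(1), of "scons (t v) (scons (s v) v)"]
      defterm_closed[OF assms(2)] defterm_closed[OF assms(3)] by simp
next
  have "definable (\<lambda>v. v 0 = F (v (Suc 0)) (v (Suc (Suc 0))))" using assms(1) by (simp add: defterm_def)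
  from definable3[where R = "\<lambda>z x y. z = F x y", OF this defterm_var[of 0] defterm_rename[OF assms(2), of Suc] defterm_rename[OF assms(3), of Suc]]
  show "definable (\<lambda>v. v 0 = F (t (\<lambda>n. v (Suc n))) (s (\<lambda>n. v (Suc n))))" .
qed

lemma defterm_bind:
  assumes "defterm t" "defterm (\<lambda>v. F (v 0) (\<lambda>n. v (Suc n)))" shows "defterm (\<lambda>v. F (t v) v)"
  unfolding defterm_def
proof (intro conjI allI impI)
  fix v :: "nat \<Rightarrow> 'a" assume "range v \<subseteq> V"
  then show "F (t v) v \<in> V"
    using defterm_closed[OF assms(2), of "scons (t v) v"] defterm_closed[OF assms(1)] by simp
next
  have "definable (\<lambda>v. v 0 = F (v (Suc 0)) (\<lambda>n. v (Suc (Suc n))))" using assms(2) by (simp add: defterm_def)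
  from definable_rename[OF this, of "\<lambda>n. case n of 0 \<Rightarrow> Suc 0 | Suc 0 \<Rightarrow> 0 | Suc (Suc m) \<Rightarrow> Suc (Suc m)"]
  have "definable (\<lambda>v. v (Suc 0) = F (v 0) (\<lambda>n. v (Suc (Suc n))))" by simp
  from definable_bind[OF defterm_rename[OF assms(1), of Suc], of "\<lambda>y v. v 0 = F y (\<lambda>n. v (Suc n))", OF this]
  show "definable (\<lambda>v. v 0 = F (t (\<lambda>n. v (Suc n))) (\<lambda>n. v (Suc n)))" .
qed

lemma defterm3:
  assumes "defterm (\<lambda>v. F (v 0) (v (Suc 0)) (v (Suc (Suc 0))))" "defterm t" "defterm s" "defterm r"
  shows "defterm (\<lambda>v. F (t v) (s v) (r v))"
proof -
  have 1: "defterm (\<lambda>v. F (v (Suc 0)) (v (Suc (Suc 0))) (v 0))"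
    using defterm_rename[OF assms(1), of "\<lambda>n. if n = 0 then Suc 0 else if n = Suc 0 then Suc (Suc 0) else 0"]
    by simp
  have 2: "defterm (\<lambda>v. F (v (Suc 0)) (v 0) (r (\<lambda>n. v (Suc (Suc n)))))"
    using defterm_bind[where F = "\<lambda>y v. F (v 0) (v (Suc 0)) y", OF defterm_rename[OF assms(4), of "\<lambda>n. Suc (Suc n)"] 1]
      defterm_rename[of "\<lambda>v. F (v 0) (v (Suc 0)) (r (\<lambda>n. v (Suc (Suc n))))"
        "\<lambda>n. case n of 0 \<Rightarrow> Suc 0 | Suc 0 \<Rightarrow> 0 | Suc (Suc m) \<Rightarrow> Suc (Suc m)"] by simp
  have 3: "defterm (\<lambda>v. F (v 0) (s (\<lambda>n. v (Suc n))) (r (\<lambda>n. v (Suc n))))"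
    by (rule defterm_bind[where F = "\<lambda>y v. F (v 0) y (r (\<lambda>n. v (Suc n)))", OF defterm_rename[OF assms(3), of Suc] 2])
  show ?thesis
    by (rule defterm_bind[where F = "\<lambda>x v. F x (s v) (r v)", OF assms(2) 3])
qed

lemma definable_E: "defterm t \<Longrightarrow> defterm s \<Longrightarrow> definable (\<lambda>v. E (t v) (s v))"
  by (rule definable2[where R = E, OF definable_Mem])

lemma definable_eq: "defterm t \<Longrightarrow> defterm s \<Longrightarrow> definable (\<lambda>v. t v = s v)"
  by (rule definable2[where R = "(=)", OF definable_Equal])

lemma definable_in_elts:
  assumes "defterm t" "defterm s" shows "definable (\<lambda>v. t v \<in> elts (s v))"
  by (rule definable_cong[OF definable_E[OF assms]]) (simp add: elts_def defterm_closed[OF assms(1)])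

lemma definable_ball:
  assumes "defterm s" "definable (\<lambda>v. P (v 0) (\<lambda>n. v (Suc n)))"
  shows "definable (\<lambda>v. \<forall>x\<in>elts (s v). P x v)"
proof -
  have "definable (\<lambda>v. \<forall>x\<in>V. x \<in> elts (s v) \<longrightarrow> P x v)"
    by (rule definable_all, rule definable_imp, rule definable_in_elts, rule defterm_var, rule defterm_rename, rule assms, rule assms)
  then show ?thesis by (rule definable_cong) (auto simp: elts_def)
qed

lemma definable_bex:
  assumes "defterm s" "definable (\<lambda>v. P (v 0) (\<lambda>n. v (Suc n)))"
  shows "definable (\<lambda>v. \<exists>x\<in>elts (s v). P x v)"
  by (rule definable_cong[OF definable_not[OF definable_ball[OF assms(1) definable_not[OF assms(2)]]]]) blast

lemmas [definable_intros] = definable_E definable_eq definable_in_elts definable_ball definable_bex defterm_var defterm_const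

lemma definable_subset [definable_intros]: "defterm t \<Longrightarrow> defterm s \<Longrightarrow> definable (\<lambda>v. elts (t v) \<subseteq> elts (s v))"
  by (rule definable2[where R = "\<lambda>x y. elts x \<subseteq> elts y"], unfold subset_eq, intro definable_intros)

lemma definable_in_V [definable_intros]:
  assumes "defterm t" shows "definable (\<lambda>v. t v \<in> V)"
  by (rule definable_cong[OF definable_const[of True]]) (simp add: defterm_closed[OF assms])

text \<open>
  A collection of elements of \<open>V\<close> is small if it is a set of the structure.
\<close>

definition small :: "'a set \<Rightarrow> bool" where
  "small X \<longleftrightarrow> (\<exists>z\<in>V. elts z = X)"

end

section \<open>Sets inside a model of ZFC\<close>

locale zfc = membership_structure V E
  for V :: "'a set" and E :: "'a \<Rightarrow> 'a \<Rightarrow> bool" +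
  assumes zfc: zfc_model
begin

lemmas axiom_of_extensionality = zfc[unfolded zfc_model_def, THEN conjunct1]
lemmas axiom_of_foundation = zfc[unfolded zfc_model_def, THEN conjunct2, THEN conjunct1]
lemmas axiom_of_pairing = zfc[unfolded zfc_model_def, THEN conjunct2, THEN conjunct2, THEN conjunct1]
lemmas axiom_of_union = zfc[unfolded zfc_model_def, THEN conjunct2, THEN conjunct2, THEN conjunct2, THEN conjunct1]
lemmas axiom_of_powerset = zfc[unfolded zfc_model_def, THEN conjunct2, THEN conjunct2, THEN conjunct2, THEN conjunct2, THEN conjunct1]
lemmas axiom_of_infinity = zfc[unfolded zfc_model_def, THEN conjunct2, THEN conjunct2, THEN conjunct2, THEN conjunct2, THEN conjunct2, THEN conjunct1]
lemmas axiom_of_separation = zfc[unfolded zfc_model_def, THEN conjunct2, THEN conjunct2, THEN conjunct2, THEN conjunct2, THEN conjunct2, THEN conjunct2, THEN conjunct1]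
lemmas axiom_of_replacement = zfc[unfolded zfc_model_def, THEN conjunct2, THEN conjunct2, THEN conjunct2, THEN conjunct2, THEN conjunct2, THEN conjunct2, THEN conjunct2, THEN conjunct1]
lemmas axiom_of_choice = zfc[unfolded zfc_model_def, THEN conjunct2, THEN conjunct2, THEN conjunct2, THEN conjunct2, THEN conjunct2, THEN conjunct2, THEN conjunct2, THEN conjunct2]

lemma elts_in_V: "y \<in> elts x \<Longrightarrow> y \<in> V"
  by (simp add: elts_def)

lemma elts_subset_V: "elts x \<subseteq> V"
  by (auto simp: elts_def)

lemma extensionality: "x \<in> V \<Longrightarrow> y \<in> V \<Longrightarrow> elts x = elts y \<Longrightarrow> x = y"
  using axiom_of_extensionality by blast

lemma foundation: "x \<in> V \<Longrightarrow> elts x \<noteq> {} \<Longrightarrow> \<exists>y\<in>elts x. elts y \<inter> elts x = {}"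
  using axiom_of_foundation by blast

lemma small_elts [simp]: "x \<in> V \<Longrightarrow> small (elts x)"
  by (auto simp: small_def)

lemma set_of_eqI: "z \<in> V \<Longrightarrow> elts z = X \<Longrightarrow> set_of X = z"
  unfolding set_of_def by (rule the_equality) (auto intro: extensionality)

lemma set_of_elts [simp]: "x \<in> V \<Longrightarrow> set_of (elts x) = x"
  by (rule set_of_eqI) auto

lemma small_set_of: assumes "small X"
  shows set_of_in_V: "set_of X \<in> V" and elts_set_of: "elts (set_of X) = X"
  using assms set_of_eqI by (auto simp: small_def)

lemma small_subset_V: "small X \<Longrightarrow> X \<subseteq> V"
  by (auto simp: small_def elts_def)

lemma small_insert2: "x \<in> V \<Longrightarrow> y \<in> V \<Longrightarrow> small {x, y}"
  using axiom_of_pairing unfolding small_def by blast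

lemma small_UN_elts: "x \<in> V \<Longrightarrow> small (\<Union>y\<in>elts x. elts y)"
  using axiom_of_union unfolding small_def by blast

lemma small_Pow: "x \<in> V \<Longrightarrow> small {y \<in> V. elts y \<subseteq> elts x}"
  using axiom_of_powerset unfolding small_def by blast

text \<open>
  Brings a definable relation into the form used by the separation and replacement schemes, where the
  arguments are the variables \<open>0\<close> and \<open>1\<close> and the parameters come after them.
\<close>

lemma definable_imp_sat2:
  assumes "definable (\<lambda>v. P (v 0) (v (Suc 0)))" "c \<in> V"
  shows "\<exists>\<phi> w. range w \<subseteq> V \<and> (\<forall>x\<in>V. \<forall>y\<in>V. sat V E (w(0 := x, 1 := y)) \<phi> \<longleftrightarrow> P x y)"
proof -
  obtain \<phi> ps where ps: "set ps \<subseteq> V" and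
    \<phi>: "\<And>v. range v \<subseteq> V \<Longrightarrow> (P (v 0) (v (Suc 0)) \<longleftrightarrow> sat V E (prepend ps v) \<phi>)"
    using definable_imp_sat[OF assms(1)] by blast
  define k where "k = length ps"
  define r where "r n = (if n < k then n + 2 else if n = k then 0 else if n = Suc k then 1 else n)" for n
  have r: "inj r"
  proof (rule injI)
    fix a b assume "r a = r b"
    then show "a = b"
      by (cases "a < k"; cases "a = k"; cases "a = Suc k"; cases "b < k"; cases "b = k"; cases "b = Suc k";
        simp add: r_def)
  qed
  define w where "w n = (if n < 2 then c else if n < k + 2 then ps ! (n - 2) else c)" for n
  have w: "range w \<subseteq> V"
  proof
    fix z assume "z \<in> range w"
    then obtain n where "z = w n" by blast
    then show "z \<in> V" using ps assms(2) nth_mem[of "n - 2" ps] by (simp add: w_def k_def subset_iff)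
  qed
  have "sat V E (w(0 := x, 1 := y)) (rename r \<phi>) \<longleftrightarrow> P x y" if "x \<in> V" "y \<in> V" for x y
  proof -
    have "(\<lambda>n. (w(0 := x, 1 := y)) (r n)) = prepend ps (scons x (scons y (\<lambda>_. c)))"
    proof
      fix n
      consider "n < k" | "n = k" | "n = Suc k" | m where "n = Suc (Suc (k + m))"
        using less_imp_Suc_add[of "Suc k" n]
        by (cases n "Suc k" rule: linorder_cases) (auto simp: less_Suc_eq)
      then show "(w(0 := x, 1 := y)) (r n) = prepend ps (scons x (scons y (\<lambda>_. c))) n"
      proof cases
        case 4
        then have "n - k = Suc (Suc m)" by simp
        then show ?thesis using 4 by (simp add: r_def prepend_def w_def flip: k_def)
      qed (simp_all add: r_def prepend_def w_def Suc_diff_le flip: k_def)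
    qed
    moreover have "range (\<lambda>_::nat. c) \<subseteq> V" using assms(2) by auto
    ultimately show ?thesis
      using \<phi>[of "scons x (scons y (\<lambda>_. c))"] that by (simp only: sat_rename[OF r]) simp
  qed
  then show ?thesis using w by blast
qed

lemma small_Collect:
  assumes "small X" "definable (\<lambda>v. P (v 0))"
  shows "small {x \<in> X. P x}"
proof -
  obtain x where x: "x \<in> V" "elts x = X" using assms(1) by (auto simp: small_def)
  from definable_imp_sat2[of "\<lambda>y z. P y", OF assms(2) x(1)]
  obtain \<phi> w where w: "range w \<subseteq> V" and
    \<phi>: "\<forall>y\<in>V. \<forall>z\<in>V. sat V E (w(0 := y, 1 := z)) \<phi> \<longleftrightarrow> P y"
    by (elim exE conjE)
  have "w 1 \<in> V" using w by auto
  have "sat V E (w(0 := y)) \<phi> \<longleftrightarrow> P y" if "y \<in> V" for y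
  proof -
    have "w(0 := y, 1 := w 1) = w(0 := y)" by auto
    then show ?thesis using \<phi>[rule_format, OF that \<open>w 1 \<in> V\<close>] by simp
  qed
  then have "{y \<in> elts x. sat V E (w(0 := y)) \<phi>} = {y \<in> X. P y}"
    using x elts_in_V by auto
  moreover have "\<exists>z\<in>V. elts z = {y \<in> elts x. sat V E (w(0 := y)) \<phi>}"
    using axiom_of_separation w x(1) by blast
  ultimately show ?thesis by (simp add: small_def)
qed

lemma small_image:
  assumes "small X" "defterm (\<lambda>v. F (v 0))"
  shows "small (F ` X)"
proof -
  obtain x where x: "x \<in> V" "elts x = X" using assms(1) by (auto simp: small_def)
  have F: "F y \<in> V" if "y \<in> V" for y
    using defterm_closed[OF assms(2), of "\<lambda>_. y"] that by auto
  have "definable (\<lambda>v. v (Suc 0) = F (v 0))"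
    using assms(2) defterm_rename[OF assms(2), of "\<lambda>n. n"]
    by (intro definable_intros)
  from definable_imp_sat2[of "\<lambda>y z. z = F y", OF this x(1)]
  obtain \<phi> w where w: "range w \<subseteq> V" and
    \<phi>: "\<forall>y\<in>V. \<forall>z\<in>V. sat V E (w(0 := y, 1 := z)) \<phi> \<longleftrightarrow> z = F y"
    by (elim exE conjE)
  have "\<forall>y\<in>elts x. \<exists>!u. u \<in> V \<and> sat V E (w(0 := y, 1 := u)) \<phi>"
  proof
    fix y assume "y \<in> elts x"
    then have y: "y \<in> V" by (rule elts_in_V)
    show "\<exists>!u. u \<in> V \<and> sat V E (w(0 := y, 1 := u)) \<phi>"
      by (rule ex1I[of _ "F y"]) (use \<phi> F[OF y] y in auto)
  qed
  then have "\<exists>z\<in>V. elts z = {u \<in> V. \<exists>y\<in>elts x. sat V E (w(0 := y, 1 := u)) \<phi>}"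
    using axiom_of_replacement w x(1) by blast
  moreover have "{u \<in> V. \<exists>y\<in>elts x. sat V E (w(0 := y, 1 := u)) \<phi>} = F ` X"
  proof (intro Set.set_eqI iffI)
    fix u assume "u \<in> {u \<in> V. \<exists>y\<in>elts x. sat V E (w(0 := y, 1 := u)) \<phi>}"
    then show "u \<in> F ` X" using \<phi> elts_in_V x by blast
  next
    fix u assume "u \<in> F ` X"
    then obtain y where y: "y \<in> elts x" "u = F y" using x by blast
    then have "sat V E (w(0 := y, 1 := u)) \<phi>" "u \<in> V" using \<phi> F elts_in_V by simp_all
    then show "u \<in> {u \<in> V. \<exists>y\<in>elts x. sat V E (w(0 := y, 1 := u)) \<phi>}" using y(1) by blast
  qed
  ultimately show ?thesis by (simp add: small_def)
qed

lemma small_UN: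
  assumes "small X" "defterm (\<lambda>v. F (v 0))"
  shows "small (\<Union>x\<in>X. elts (F x))"
  using small_UN_elts[OF set_of_in_V[OF small_image[OF assms]]]
  by (simp add: elts_set_of[OF small_image[OF assms]])

lemma V_nonempty: "\<exists>c. c \<in> V"
  using axiom_of_infinity by blast

lemma small_empty [simp]: "small {}"
proof -
  obtain c where c: "c \<in> V" using V_nonempty by blast
  show ?thesis using small_Collect[OF small_elts[OF c], of "\<lambda>_. False", OF definable_const] by simp
qed

lemma small_Un:
  assumes "small X" "small Y" shows "small (X \<union> Y)"
proof -
  have "small (\<Union>y\<in>elts (set_of {set_of X, set_of Y}). elts y)"
    using assms by (intro small_UN_elts set_of_in_V small_insert2)
  then show ?thesis
    using assms by (simp add: elts_set_of small_insert2 set_of_in_V)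
qed

lemma small_insert [simp]: "x \<in> V \<Longrightarrow> small X \<Longrightarrow> small (insert x X)"
  using small_Un[of "{x, x}" X] small_insert2[of x x] by simp

lemma defterm_set_of:
  assumes "\<And>v. range v \<subseteq> V \<Longrightarrow> small (X v)" "definable (\<lambda>v. v 0 \<in> X (\<lambda>n. v (Suc n)))"
  shows "defterm (\<lambda>v. set_of (X v))"
  unfolding defterm_def
proof (intro conjI allI impI)
  fix v :: "nat \<Rightarrow> 'a" assume "range v \<subseteq> V"
  then show "set_of (X v) \<in> V" by (intro set_of_in_V assms(1))
next
  have 1: "definable (\<lambda>v. v 0 \<in> X (\<lambda>n. v (Suc (Suc n))))"
    using definable_rename[OF assms(2), of "\<lambda>n. case n of 0 \<Rightarrow> 0 | Suc m \<Rightarrow> Suc (Suc m)"] by simp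
  have "definable (\<lambda>v. \<forall>y\<in>V. y \<in> elts (v 0) \<longleftrightarrow> y \<in> X (\<lambda>n. v (Suc n)))"
    by (intro definable_intros 1)
  then show "definable (\<lambda>v. v 0 = set_of (X (\<lambda>n. v (Suc n))))"
  proof (rule definable_cong)
    fix v :: "nat \<Rightarrow> 'a" assume v: "range v \<subseteq> V"
    then have "range (\<lambda>n. v (Suc n)) \<subseteq> V" by auto
    note X = small_set_of[OF assms(1)[OF this]]
    have "X (\<lambda>n. v (Suc n)) \<subseteq> V" using X elts_subset_V by metis
    then have "(\<forall>y\<in>V. y \<in> elts (v 0) \<longleftrightarrow> y \<in> X (\<lambda>n. v (Suc n))) \<longleftrightarrow> elts (v 0) = X (\<lambda>n. v (Suc n))"
      using elts_subset_V by blast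
    also have "\<dots> \<longleftrightarrow> v 0 = set_of (X (\<lambda>n. v (Suc n)))"
    proof -
      have "v 0 \<in> V" using v by auto
      from set_of_elts[OF this] X(2) show ?thesis by metis
    qed
    finally show "(\<forall>y\<in>V. y \<in> elts (v 0) \<longleftrightarrow> y \<in> X (\<lambda>n. v (Suc n))) \<longleftrightarrow> v 0 = set_of (X (\<lambda>n. v (Suc n)))" .
  qed
qed

definition emp :: 'a where "emp = set_of {}"

lemma emp [simp]: "emp \<in> V" "elts emp = {}"
  by (simp_all add: emp_def set_of_in_V elts_set_of)

lemma eq_empI: "x \<in> V \<Longrightarrow> elts x = {} \<Longrightarrow> x = emp"
  by (simp add: extensionality)

lemma defterm_set_of_insert2 [definable_intros]:
  assumes "defterm t" "defterm s" shows "defterm (\<lambda>v. set_of {t v, s v})"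
proof -
  have "defterm (\<lambda>v. set_of {v 0, v (Suc 0)})"
  proof (rule defterm_set_of)
    show "definable (\<lambda>v. v 0 \<in> {v (Suc 0), v (Suc (Suc 0))})"
      unfolding insert_iff empty_iff by (intro definable_intros)
  qed (simp add: image_subset_iff)
  from defterm2[where F = "\<lambda>x y. set_of {x, y}", OF this assms] show ?thesis .
qed

lemma defterm_set_of_insert1 [definable_intros]:
  assumes "defterm t" shows "defterm (\<lambda>v. set_of {t v})"
  using defterm_set_of_insert2[OF assms assms] by simp

lemma defterm_set_of_insert_elts [definable_intros]:
  assumes "defterm t" "defterm s" shows "defterm (\<lambda>v. set_of (insert (t v) (elts (s v))))"
proof -
  have "defterm (\<lambda>v. set_of (insert (v 0) (elts (v (Suc 0)))))"
  proof (rule defterm_set_of)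
    show "definable (\<lambda>v. v 0 \<in> insert (v (Suc 0)) (elts (v (Suc (Suc 0)))))"
      unfolding insert_iff by (intro definable_intros)
  qed (simp add: image_subset_iff)
  from defterm2[where F = "\<lambda>x y. set_of (insert x (elts y))", OF this assms] show ?thesis .
qed

lemma opair_in_V [simp, intro]: "x \<in> V \<Longrightarrow> y \<in> V \<Longrightarrow> opair x y \<in> V"
  unfolding opair_def by (intro set_of_in_V small_insert small_empty)

lemma defterm_opair [definable_intros]: "defterm t \<Longrightarrow> defterm s \<Longrightarrow> defterm (\<lambda>v. opair (t v) (s v))"
  unfolding opair_def by (rule defterm_set_of_insert2 defterm_set_of_insert1 | assumption)+

lemma opair_inject [simp]:
  assumes "x \<in> V" "y \<in> V" "x' \<in> V" "y' \<in> V"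
  shows "opair x y = opair x' y' \<longleftrightarrow> x = x' \<and> y = y'"
proof
  assume A: "opair x y = opair x' y'"
  have S: "elts (set_of {a, b}) = {a, b}" if "a \<in> V" "b \<in> V" for a b
    using that by (simp add: elts_set_of)
  have P: "{{a}, {a, b}} = elts ` elts (opair a b)" if "a \<in> V" "b \<in> V" for a b
    using that S[of a b] S[of a a] by (simp add: opair_def elts_set_of set_of_in_V)
  have "{{x}, {x, y}} = {{x'}, {x', y'}}" using P[of x y] P[of x' y'] A assms by simp
  then show "x = x' \<and> y = y'" by (auto simp: doubleton_eq_iff)
qed simp

lemma opair_components_in_transitive:
  assumes "transitive_set d" "opair x y \<in> elts d" "x \<in> V" "y \<in> V"
  shows "x \<in> elts d" "y \<in> elts d"
proof -
  have "set_of {x, y} \<in> elts (opair x y)"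
    using assms by (simp add: opair_def elts_set_of set_of_in_V)
  then have "set_of {x, y} \<in> elts d" using assms(1,2) by (auto simp: transitive_set_def)
  then have "elts (set_of {x, y}) \<subseteq> elts d" using assms(1) by (auto simp: transitive_set_def)
  then show "x \<in> elts d" "y \<in> elts d" using assms by (simp_all add: elts_set_of)
qed

lemma definable_transitive_set [definable_intros]:
  assumes "defterm t" shows "definable (\<lambda>v. transitive_set (t v))"
proof -
  have "definable (\<lambda>v. transitive_set (v 0))" unfolding transitive_set_def by (intro definable_intros)
  from definable1[where R = transitive_set, OF this assms] show ?thesis .
qed

text \<open>
  Definite description with a default value, so that its value is always in \<open>V\<close> and it is a definable term
  without any proof of existence or uniqueness.
\<close>

definition the0 :: "('a \<Rightarrow> bool) \<Rightarrow> 'a" where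
  "the0 P = (if \<exists>!y. y \<in> V \<and> P y then THE y. y \<in> V \<and> P y else emp)"

lemma the0_equality: "y \<in> V \<Longrightarrow> P y \<Longrightarrow> (\<And>z. z \<in> V \<Longrightarrow> P z \<Longrightarrow> z = y) \<Longrightarrow> the0 P = y"
  unfolding the0_def by (subst if_P) blast+

lemma the0_in_V [simp]: "the0 P \<in> V"
proof (cases "\<exists>!y. y \<in> V \<and> P y")
  case True
  from theI'[OF True] show ?thesis by (simp add: the0_def True)
qed (simp add: the0_def)

lemma the0_works: assumes "\<exists>!y. y \<in> V \<and> P y" shows "P (the0 P)"
  using theI'[OF assms] by (simp add: the0_def assms)

lemma eq_the0_iff:
  assumes "\<exists>!y. y \<in> V \<and> P y" "x \<in> V" shows "x = the0 P \<longleftrightarrow> P x"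
proof
  show "x = the0 P \<Longrightarrow> P x" using the0_works[OF assms(1)] by simp
  show "P x \<Longrightarrow> x = the0 P" using assms the0_works[OF assms(1)] the0_in_V by blast
qed

lemma ex1_V_iff: "(\<exists>!y. y \<in> V \<and> P y) \<longleftrightarrow> (\<exists>y\<in>V. \<forall>z\<in>V. P z \<longleftrightarrow> z = y)"
  by metis

lemma definable_ex1:
  assumes "definable (\<lambda>v. P (v 0) (\<lambda>n. v (Suc n)))" shows "definable (\<lambda>v. \<exists>!y. y \<in> V \<and> P y v)"
proof -
  have 1: "definable (\<lambda>v. P (v 0) (\<lambda>n. v (Suc (Suc n))))"
    using definable_rename[OF assms, of "\<lambda>n. case n of 0 \<Rightarrow> 0 | Suc m \<Rightarrow> Suc (Suc m)"] by simp
  show ?thesis unfolding ex1_V_iff by (intro definable_intros 1)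
qed

lemma defterm_the0:
  assumes "definable (\<lambda>v. P (v 0) (\<lambda>n. v (Suc n)))" shows "defterm (\<lambda>v. the0 (\<lambda>y. P y v))"
  unfolding defterm_def
proof (intro conjI allI impI)
  have 1: "definable (\<lambda>v. \<exists>!y. y \<in> V \<and> P y (\<lambda>n. v (Suc n)))"
    by (rule definable_rename[OF definable_ex1[OF assms]])
  have "definable (\<lambda>v. ((\<exists>!y. y \<in> V \<and> P y (\<lambda>n. v (Suc n))) \<and> P (v 0) (\<lambda>n. v (Suc n))) \<or>
      (\<not> (\<exists>!y. y \<in> V \<and> P y (\<lambda>n. v (Suc n))) \<and> v 0 = emp))"
    by (rule definable_or definable_and definable_not 1 assms definable_eq defterm_var defterm_const emp)+
  then show "definable (\<lambda>v. v 0 = the0 (\<lambda>y. P y (\<lambda>n. v (Suc n))))"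
  proof (rule definable_cong)
    fix v :: "nat \<Rightarrow> 'a" assume v: "range v \<subseteq> V"
    show "(((\<exists>!y. y \<in> V \<and> P y (\<lambda>n. v (Suc n))) \<and> P (v 0) (\<lambda>n. v (Suc n))) \<or>
      (\<not> (\<exists>!y. y \<in> V \<and> P y (\<lambda>n. v (Suc n))) \<and> v 0 = emp)) \<longleftrightarrow>
      v 0 = the0 (\<lambda>y. P y (\<lambda>n. v (Suc n)))"
    proof (cases "\<exists>!y. y \<in> V \<and> P y (\<lambda>n. v (Suc n))")
      case True
      have "v 0 \<in> V" using v by auto
      from eq_the0_iff[OF True this] show ?thesis by (simp only: True) simp
    next
      case False
      show ?thesis by (simp only: False the0_def) simp
    qed
  qed
qed simp

lemmas [definable_intros] = definable_ex1 defterm_the0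

end

context zfc
begin

section \<open>Functions and natural numbers\<close>

lemma mem_not_refl: "x \<in> V \<Longrightarrow> x \<notin> elts x"
  using foundation[of "set_of {x}"] by (auto simp: elts_set_of set_of_in_V)

lemma mem_asym: "x \<in> elts y \<Longrightarrow> y \<in> elts x \<Longrightarrow> False"
  using foundation[of "set_of {x, y}"] elts_in_V[of x y] elts_in_V[of y x]
  by (auto simp: elts_set_of set_of_in_V)

lemma fun_on_app:
  assumes "fun_on f D" "x \<in> D"
  shows fun_on_app_in_V: "app f x \<in> V" and fun_on_app_graph: "opair x (app f x) \<in> elts f"
proof -
  have "\<exists>!y. y \<in> V \<and> opair x y \<in> elts f" using assms by (simp add: fun_on_def)
  from theI'[OF this] show "app f x \<in> V" "opair x (app f x) \<in> elts f" by (simp_all add: app_def)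
qed

lemma fun_on_graph_iff:
  assumes "fun_on f D" "x \<in> D" "y \<in> V"
  shows "opair x y \<in> elts f \<longleftrightarrow> y = app f x"
proof -
  have "\<exists>!y. y \<in> V \<and> opair x y \<in> elts f" using assms by (simp add: fun_on_def)
  then show ?thesis using fun_on_app[OF assms(1,2)] assms(3) by metis
qed

text \<open>
  Total application: equal to \<open>app\<close> on the domain of a function, and always a definable term of both arguments.
\<close>

definition app0 :: "'a \<Rightarrow> 'a \<Rightarrow> 'a" where
  "app0 f x = the0 (\<lambda>y. opair x y \<in> elts f)"

lemma app0_in_V [simp]: "app0 f x \<in> V" by (simp add: app0_def)

lemma app0_eq: assumes "fun_on f D" "x \<in> D" shows "app0 f x = app f x"
  unfolding app0_def
  by (rule the0_equality) (use fun_on_app[OF assms] fun_on_graph_iff[OF assms] in auto)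

lemma defterm_app0 [definable_intros]: assumes "defterm t" "defterm s" shows "defterm (\<lambda>v. app0 (t v) (s v))"
proof -
  have "defterm (\<lambda>v. app0 (v 0) (v (Suc 0)))" unfolding app0_def by (intro definable_intros)
  from defterm2[where F = app0, OF this assms] show ?thesis .
qed

lemma definable_fun_on [definable_intros]:
  assumes "defterm t" "defterm s" shows "definable (\<lambda>v. fun_on (t v) (elts (s v)))"
proof -
  have "definable (\<lambda>v. fun_on (v 0) (elts (v (Suc 0))))" unfolding fun_on_def by (intro definable_intros)
  from definable2[where R = "\<lambda>f d. fun_on f (elts d)", OF this assms] show ?thesis .
qed

definition lam :: "'a set \<Rightarrow> ('a \<Rightarrow> 'a) \<Rightarrow> 'a" where
  "lam D F = set_of ((\<lambda>x. opair x (F x)) ` D)"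

lemma defterm_fun_in_V: "defterm (\<lambda>v. F (v 0)) \<Longrightarrow> x \<in> V \<Longrightarrow> F x \<in> V"
  using defterm_closed[of "\<lambda>v. F (v 0)" "\<lambda>_. x"] by auto

lemma small_graph:
  assumes "small D" "defterm (\<lambda>v. F (v 0))"
  shows "small ((\<lambda>x. opair x (F x)) ` D)"
  by (rule small_image[OF assms(1)], rule defterm_opair, rule defterm_var, rule assms(2))

lemma lam:
  assumes "small D" "defterm (\<lambda>v. F (v 0))"
  shows lam_in_V: "lam D F \<in> V" and fun_on_lam: "fun_on (lam D F) D"
    and app_lam: "\<And>x. x \<in> D \<Longrightarrow> app (lam D F) x = F x"
    and app0_lam: "\<And>x. x \<in> D \<Longrightarrow> app0 (lam D F) x = F x"
proof -
  note S = small_set_of[OF small_graph[OF assms], folded lam_def]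
  have D: "\<And>x. x \<in> D \<Longrightarrow> x \<in> V" using small_subset_V[OF assms(1)] by auto
  note F = defterm_fun_in_V[OF assms(2)]
  show "lam D F \<in> V" by (rule S)
  have graph: "opair x y \<in> elts (lam D F) \<longleftrightarrow> y = F x" if "x \<in> D" "y \<in> V" for x y
    using that D F by (auto simp: S(2) image_iff)
  show f: "fun_on (lam D F) D"
    unfolding fun_on_def
  proof (intro conjI ballI)
    show "lam D F \<in> V" by (rule S)
  next
    fix p assume "p \<in> elts (lam D F)"
    then show "\<exists>x\<in>D. \<exists>y\<in>V. p = opair x y" using D F by (auto simp: S(2))
  next
    fix x assume x: "x \<in> D"
    show "\<exists>!y. y \<in> V \<and> opair x y \<in> elts (lam D F)"
      by (rule ex1I[of _ "F x"]) (use graph[OF x] F[OF D[OF x]] in auto)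
  qed
  fix x assume x: "x \<in> D"
  show "app (lam D F) x = F x"
    using graph[OF x fun_on_app_in_V[OF f x]] fun_on_app_graph[OF f x] by simp
  then show "app0 (lam D F) x = F x" by (simp add: app0_eq[OF f x])
qed

lemma defterm1_local: assumes "defterm (\<lambda>v. F (v 0))" shows "defterm t \<Longrightarrow> defterm (\<lambda>v. F (t v))"
  by (rule defterm1[where F = F, OF assms])

definition big_union :: "'a \<Rightarrow> 'a" where "big_union x = set_of (\<Union>y\<in>elts x. elts y)"

lemma big_union: "x \<in> V \<Longrightarrow> big_union x \<in> V" "x \<in> V \<Longrightarrow> elts (big_union x) = (\<Union>y\<in>elts x. elts y)"
  by (simp_all add: big_union_def set_of_in_V elts_set_of small_UN_elts)

lemma defterm_big_union [definable_intros]: assumes "defterm t" shows "defterm (\<lambda>v. big_union (t v))"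
proof -
  have "defterm (\<lambda>v. big_union (v 0))" unfolding big_union_def
  proof (rule defterm_set_of)
    fix v :: "nat \<Rightarrow> 'a" assume "range v \<subseteq> V"
    then show "small (\<Union>y\<in>elts (v 0). elts y)" by (intro small_UN_elts) auto
  next
    show "definable (\<lambda>v. v 0 \<in> (\<Union>y\<in>elts (v (Suc 0)). elts y))"
      unfolding UN_iff by (intro definable_intros)
  qed
  from defterm1[where F = big_union, OF this assms] show ?thesis .
qed

definition succ :: "'a \<Rightarrow> 'a" where "succ n = set_of (insert n (elts n))"

lemma succ [simp]: "n \<in> V \<Longrightarrow> succ n \<in> V" "n \<in> V \<Longrightarrow> elts (succ n) = insert n (elts n)"
  by (simp_all add: succ_def set_of_in_V elts_set_of)

lemma defterm_succ [definable_intros]: "defterm t \<Longrightarrow> defterm (\<lambda>v. succ (t v))"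
  unfolding succ_def by (rule defterm_set_of_insert_elts)

lemma is_inductive_iff:
  assumes "w \<in> V"
  shows "is_inductive w \<longleftrightarrow> emp \<in> elts w \<and> (\<forall>x\<in>elts w. succ x \<in> elts w)"
proof -
  have 1: "(\<exists>z\<in>elts w. elts z = {}) \<longleftrightarrow> emp \<in> elts w"
    using eq_empI elts_in_V emp(2) by metis
  have 2: "(\<exists>y\<in>elts w. elts y = insert x (elts x)) \<longleftrightarrow> succ x \<in> elts w" if "x \<in> elts w" for x
    using extensionality[of _ "succ x"] elts_in_V succ that by metis
  show ?thesis by (simp add: is_inductive_def 1 2)
qed

lemma small_omega: "small (\<Inter>w\<in>{w \<in> V. is_inductive w}. elts w)"
proof -
  obtain w0 where w0: "w0 \<in> V" "is_inductive w0" using axiom_of_infinity by blast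
  have "definable (\<lambda>v. \<forall>w\<in>V. (emp \<in> elts w \<and> (\<forall>x\<in>elts w. succ x \<in> elts w)) \<longrightarrow> v 0 \<in> elts w)"
    by (intro definable_intros emp)
  from small_Collect[OF small_elts[OF w0(1)], of "\<lambda>x. \<forall>w\<in>V. (emp \<in> elts w \<and> (\<forall>x\<in>elts w. succ x \<in> elts w)) \<longrightarrow> x \<in> elts w", OF this]
  have "small {x \<in> elts w0. \<forall>w\<in>V. (emp \<in> elts w \<and> (\<forall>x\<in>elts w. succ x \<in> elts w)) \<longrightarrow> x \<in> elts w}" .
  also have "{x \<in> elts w0. \<forall>w\<in>V. (emp \<in> elts w \<and> (\<forall>x\<in>elts w. succ x \<in> elts w)) \<longrightarrow> x \<in> elts w}
      = (\<Inter>w\<in>{w \<in> V. is_inductive w}. elts w)"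
    (is "?L = ?R")
  proof (rule Set.set_eqI)
    fix x
    have w0x: "emp \<in> elts w0 \<and> (\<forall>x\<in>elts w0. succ x \<in> elts w0)" using w0 is_inductive_iff by blast
    have "x \<in> ?R \<longleftrightarrow> (\<forall>w\<in>V. (emp \<in> elts w \<and> (\<forall>x\<in>elts w. succ x \<in> elts w)) \<longrightarrow> x \<in> elts w)"
      unfolding INT_iff mem_Collect_eq Ball_def using is_inductive_iff by auto
    also have "\<dots> \<longleftrightarrow> x \<in> ?L" using w0x w0(1) by blast
    finally show "x \<in> ?L \<longleftrightarrow> x \<in> ?R" by (rule sym)
  qed
  finally show ?thesis .
qed

lemma omega_in_V [simp]: "omega \<in> V"
  by (simp add: omega_def set_of_in_V small_omega)

lemma elts_omega: "elts omega = (\<Inter>w\<in>{w \<in> V. is_inductive w}. elts w)"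
  by (simp add: omega_def elts_set_of small_omega)

lemma emp_in_omega [simp]: "emp \<in> elts omega"
  using is_inductive_iff by (auto simp: elts_omega)

lemma succ_in_omega [simp]: "n \<in> elts omega \<Longrightarrow> succ n \<in> elts omega"
  using is_inductive_iff by (auto simp: elts_omega)

lemma omega_induct [consumes 2, case_names emp succ]:
  assumes "n \<in> elts omega" "definable (\<lambda>v. P (v 0))" "P emp" "\<And>n. n \<in> elts omega \<Longrightarrow> P n \<Longrightarrow> P (succ n)"
  shows "P n"
proof -
  note S = small_set_of[OF small_Collect[OF small_elts[OF omega_in_V], of P, OF assms(2)]]
  have "is_inductive (set_of {n \<in> elts omega. P n})"
    using assms(3,4) by (simp add: is_inductive_iff S)
  then have "n \<in> elts (set_of {n \<in> elts omega. P n})"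
    using assms(1) S(1) unfolding elts_omega by blast
  then show ?thesis by (simp add: S)
qed

lemma omega_transitive:
  assumes "n \<in> elts omega" shows "elts n \<subseteq> elts omega"
  by (rule omega_induct[OF assms])
    (intro definable_intros omega_in_V, simp, use elts_in_V in auto)

lemma nat_transitive:
  assumes "n \<in> elts omega" shows "\<forall>k\<in>elts n. elts k \<subseteq> elts n"
  by (rule omega_induct[OF assms]) (intro definable_intros, simp, use elts_in_V in auto)

lemma nat_cases:
  assumes "n \<in> elts omega" shows "n = emp \<or> (\<exists>m\<in>elts omega. n = succ m)"
  by (rule omega_induct[OF assms]) (intro definable_intros emp omega_in_V, simp, blast)

lemma big_union_succ: assumes "n \<in> elts omega" shows "big_union (succ n) = n"
  by (rule extensionality) (use assms nat_transitive[OF assms] elts_in_V[OF assms] in \<open>auto simp: big_union\<close>)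

lemma big_union_emp: "big_union emp = emp"
  by (rule extensionality) (auto simp: big_union)

lemma succ_mono:
  assumes "n \<in> elts omega" shows "\<forall>k\<in>elts n. succ k \<in> elts (succ n)"
proof (rule omega_induct[OF assms])
  fix n assume n: "n \<in> elts omega" "\<forall>k\<in>elts n. succ k \<in> elts (succ n)"
  then show "\<forall>k\<in>elts (succ n). succ k \<in> elts (succ (succ n))"
    using elts_in_V[OF n(1)] by simp
qed (intro definable_intros, simp)

lemma emp_least:
  assumes "n \<in> elts omega" shows "n = emp \<or> emp \<in> elts n"
  by (rule omega_induct[OF assms]) (intro definable_intros emp, simp, use elts_in_V in auto)

lemma omega_linear:
  assumes "n \<in> elts omega" shows "\<forall>m\<in>elts omega. m \<in> elts n \<or> m = n \<or> n \<in> elts m"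
proof (rule omega_induct[OF assms])
  show "\<forall>m\<in>elts omega. m \<in> elts emp \<or> m = emp \<or> emp \<in> elts m" using emp_least by auto
next
  fix n assume n: "n \<in> elts omega" and IH: "\<forall>m\<in>elts omega. m \<in> elts n \<or> m = n \<or> n \<in> elts m"
  show "\<forall>m\<in>elts omega. m \<in> elts (succ n) \<or> m = succ n \<or> succ n \<in> elts m"
  proof
    fix m assume m: "m \<in> elts omega"
    consider "m \<in> elts n" | "m = n" | "n \<in> elts m" using IH m by blast
    then show "m \<in> elts (succ n) \<or> m = succ n \<or> succ n \<in> elts m"
    proof cases
      case 3
      then have "succ n \<in> elts (succ m)" using succ_mono[OF m] by blast
      then show ?thesis using elts_in_V[OF m] by auto
    qed (use elts_in_V[OF n] in auto)
  qed
qed (intro definable_intros omega_in_V)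

lemma succ_neq_emp: "n \<in> V \<Longrightarrow> succ n \<noteq> emp"
  by (metis emp(2) insert_not_empty succ(2))

lemma succ_inject: assumes "m \<in> V" "n \<in> V" "succ m = succ n" shows "m = n"
proof (rule ccontr)
  assume neq: "m \<noteq> n"
  have "m \<in> elts (succ m)" using assms(1) by simp
  then have 1: "m \<in> elts (succ n)" unfolding assms(3) .
  have "n \<in> elts (succ n)" using assms(2) by simp
  then have "n \<in> elts (succ m)" unfolding assms(3) .
  then have "m \<in> elts n" "n \<in> elts m" using 1 neq assms(1,2) by simp_all
  then show False by (rule mem_asym)
qed

section \<open>Recursion\<close>

text \<open>
  Recursion on natural numbers for a class function \<open>S\<close>.  It precedes membership induction, since the
  transitive closures on which that induction rests are obtained from it.  An approximation \<open>f\<close> up to \<open>n\<close> is treated as a relation: its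
  entries at \<open>emp\<close> and at successors are prescribed, and uniqueness of the values is expressed by \<open>val\<close>.
\<close>

lemma omega_recursion:
  assumes a: "a \<in> V" and S: "defterm (\<lambda>v. S (v 0))"
  shows "\<exists>f. fun_on f (elts omega) \<and> app f emp = a \<and> (\<forall>n\<in>elts omega. app f (succ n) = S (app f n))"
proof -
  note SV = defterm_fun_in_V[OF S] and Sdt = defterm1_local[OF S]
  define appr where "appr f n \<longleftrightarrow>
    (\<forall>p\<in>elts f. \<exists>k\<in>elts (succ n). \<exists>z\<in>V. p = opair k z) \<and>
    (\<forall>z\<in>V. opair emp z \<in> elts f \<longleftrightarrow> z = a) \<and>
    (\<forall>k\<in>elts n. \<forall>z\<in>V. opair (succ k) z \<in> elts f \<longleftrightarrow> (\<exists>w\<in>V. opair k w \<in> elts f \<and> z = S w))" for f n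
  have appr_definable: "definable (\<lambda>v. appr (v i) (v j))" for i j
    unfolding appr_def by (intro definable_intros Sdt emp a)
  define val where "val k y \<longleftrightarrow> (\<forall>n\<in>elts omega. \<forall>f\<in>V. k \<in> elts (succ n) \<and> appr f n \<longrightarrow>
    (\<forall>z\<in>V. opair k z \<in> elts f \<longleftrightarrow> z = y))" for k y
  have val_definable: "definable (\<lambda>v. val (v i) (v j))" for i j
    unfolding val_def by (intro definable_intros appr_definable omega_in_V)
  have val_emp: "val emp a" unfolding val_def appr_def by blast
  have val_succ: "val (succ k) (S y)" if k: "k \<in> elts omega" and y: "y \<in> V" "val k y" for k y
    unfolding val_def
  proof (intro ballI impI, elim conjE)
    fix n f z assume n: "n \<in> elts omega" and f: "f \<in> V" "appr f n" and kn: "succ k \<in> elts (succ n)" and z: "z \<in> V"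
    have kn': "k \<in> elts n"
      using kn nat_transitive[OF n] elts_in_V[OF n] elts_in_V[OF k] by auto
    then have "opair k w \<in> elts f \<longleftrightarrow> w = y" if "w \<in> V" for w
      using y(2) n f elts_in_V[OF n] that unfolding val_def by auto
    moreover have "opair (succ k) z \<in> elts f \<longleftrightarrow> (\<exists>w\<in>V. opair k w \<in> elts f \<and> z = S w)"
      using f(2) kn' z unfolding appr_def by blast
    ultimately show "opair (succ k) z \<in> elts f \<longleftrightarrow> z = S y" using y(1) by auto
  qed
  have ex_val: "\<exists>y\<in>V. val k y" if "k \<in> elts omega" for k
  proof (rule omega_induct[OF that])
    show "\<exists>y\<in>V. val emp y" using val_emp a by blast
    show "\<exists>y\<in>V. val (succ n) y" if "n \<in> elts omega" "\<exists>y\<in>V. val n y" for n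
      using that val_succ SV by blast
  qed (intro definable_intros val_definable)
  have ex_appr: "\<exists>f\<in>V. appr f n" if "n \<in> elts omega" for n
  proof (rule omega_induct[OF that])
    show "\<exists>f\<in>V. appr f emp"
    proof (rule bexI[of _ "set_of {opair emp a}"])
      show "appr (set_of {opair emp a}) emp"
        using a by (auto simp: appr_def elts_set_of)
    qed (use a in \<open>auto intro!: set_of_in_V\<close>)
  next
    fix n assume n: "n \<in> elts omega" and "\<exists>f\<in>V. appr f n"
    then obtain f where f: "f \<in> V" "appr f n" by blast
    obtain y where y: "y \<in> V" "val n y" using ex_val[OF n] by blast
    note nV = elts_in_V[OF n]
    have fn: "opair n w \<in> elts f \<longleftrightarrow> w = y" if "w \<in> V" for w
      using y(2) n f nV that unfolding val_def by auto
    have keys: "k \<in> elts (succ n)" if "opair k z \<in> elts f" "k \<in> V" "z \<in> V" for k z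
    proof -
      have "\<forall>p\<in>elts f. \<exists>k\<in>elts (succ n). \<exists>z\<in>V. p = opair k z"
        using f(2) unfolding appr_def by (rule conjunct1)
      from bspec[OF this that(1)]
      obtain k' z' where k': "k' \<in> elts (succ n)" and z': "z' \<in> V" and eq: "opair k z = opair k' z'"
        by (elim bexE)
      have "k = k'" using eq that(2,3) elts_in_V[OF k'] z' by simp
      then show ?thesis using k' by simp
    qed
    have f_emp: "opair emp z \<in> elts f \<longleftrightarrow> z = a" if "z \<in> V" for z
      using f(2) that unfolding appr_def by blast
    have f_succ: "opair (succ k) z \<in> elts f \<longleftrightarrow> (\<exists>w\<in>V. opair k w \<in> elts f \<and> z = S w)"
      if "z \<in> V" "k \<in> elts n" for k z
      using f(2) that unfolding appr_def by blast
    define g where "g = set_of (insert (opair (succ n) (S y)) (elts f))"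
    have g: "g \<in> V" "elts g = insert (opair (succ n) (S y)) (elts f)"
      using f(1) y(1) SV nV by (simp_all add: g_def set_of_in_V elts_set_of)
    have old: "opair k z \<in> elts g \<longleftrightarrow> opair k z \<in> elts f" if "k \<noteq> succ n" "k \<in> V" "z \<in> V" for k z
      using that nV SV y(1) by (auto simp: g(2))
    have new: "opair (succ n) z \<in> elts g \<longleftrightarrow> z = S y" if "z \<in> V" for z
    proof -
      have "opair (succ n) z \<notin> elts f"
        using keys[of "succ n" z] mem_not_refl[of "succ n"] that nV by auto
      then show ?thesis using that nV SV y(1) by (auto simp: g(2))
    qed
    have "appr g (succ n)"
      unfolding appr_def
    proof (intro conjI ballI)
      fix p assume p: "p \<in> elts g"
      show "\<exists>k\<in>elts (succ (succ n)). \<exists>z\<in>V. p = opair k z"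
      proof (cases "p \<in> elts f")
        case True
        then have "\<exists>k\<in>elts (succ n). \<exists>z\<in>V. p = opair k z" using f(2) unfolding appr_def by blast
        then show ?thesis using nV by auto
      qed (use p nV SV y(1) in \<open>auto simp: g(2)\<close>)
    next
      fix z assume z: "z \<in> V"
      show "opair emp z \<in> elts g \<longleftrightarrow> z = a"
        using old[OF not_sym[OF succ_neq_emp[OF nV]] emp(1) z] f_emp[OF z] by (rule trans)
    next
      fix k z assume k: "k \<in> elts (succ n)" and z: "z \<in> V"
      have kV: "k \<in> V" using k by (rule elts_in_V)
      have k_neq: "k \<noteq> succ n" using k mem_not_refl[of "succ n"] nV by auto
      show "opair (succ k) z \<in> elts g \<longleftrightarrow> (\<exists>w\<in>V. opair k w \<in> elts g \<and> z = S w)"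
      proof (cases "k = n")
        case True
        have "(\<exists>w\<in>V. opair k w \<in> elts g \<and> z = S w) \<longleftrightarrow> z = S y"
          using old[OF k_neq kV] fn y(1) True by (auto cong: conj_cong)
        then show ?thesis using new[OF z] True by simp
      next
        case False
        then have kn: "k \<in> elts n" using k nV by simp
        have "succ k \<noteq> succ n" using succ_inject[OF kV nV] False by blast
        have "(\<exists>w\<in>V. opair k w \<in> elts g \<and> z = S w) \<longleftrightarrow> (\<exists>w\<in>V. opair k w \<in> elts f \<and> z = S w)"
          using old[OF k_neq kV] by (rule bex_cong[OF refl, OF conj_cong[OF _ refl]])
        then show ?thesis
          using old[OF \<open>succ k \<noteq> succ n\<close> succ(1)[OF kV] z] f_succ[OF z kn] by simp
      qed
    qed
    then show "\<exists>f\<in>V. appr f (succ n)" using g(1) by blast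
  qed (intro definable_intros appr_definable)
  define G where "G k = the0 (\<lambda>y. \<exists>f\<in>V. appr f k \<and> opair k y \<in> elts f)" for k
  have G_defterm: "defterm (\<lambda>v. G (v 0))" unfolding G_def by (intro definable_intros appr_definable)
  have G_val: "G k = y" if k: "k \<in> elts omega" and y: "y \<in> V" "val k y" for k y
  proof -
    note kV = elts_in_V[OF k]
    obtain f where f: "f \<in> V" "appr f k" using ex_appr[OF k] by blast
    have *: "opair k z \<in> elts f' \<longleftrightarrow> z = y" if "z \<in> V" "f' \<in> V" "appr f' k" for f' z
      using y(2) that k kV unfolding val_def by auto
    show ?thesis unfolding G_def
      by (rule the0_equality[OF y(1)]) (use * f y(1) in blast)+
  qed
  have G_succ: "G (succ n) = S (G n)" if n: "n \<in> elts omega" for n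
  proof -
    obtain y where y: "y \<in> V" "val n y" using ex_val[OF n] by blast
    show ?thesis
      using G_val[OF n y] G_val[OF succ_in_omega[OF n] SV[OF y(1)] val_succ[OF n y]] by simp
  qed
  note L = lam[OF small_elts[OF omega_in_V] G_defterm]
  have "app (lam (elts omega) G) emp = a"
    using G_val[OF emp_in_omega a val_emp] by (simp add: L)
  moreover have "\<forall>n\<in>elts omega. app (lam (elts omega) G) (succ n) = S (app (lam (elts omega) G) n)"
    by (simp add: L G_succ)
  ultimately show ?thesis using L(2) by blast
qed

text \<open>
  The union of the iterated unions of \<open>{x}\<close>.
\<close>

lemma ex_transitive_set:
  assumes x: "x \<in> V" shows "\<exists>d. transitive_set d \<and> x \<in> elts d"
proof -
  have x1: "set_of {x} \<in> V" "elts (set_of {x}) = {x}" using x by (simp_all add: set_of_in_V elts_set_of)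
  have "defterm (\<lambda>v. big_union (v 0))" by (intro definable_intros)
  from omega_recursion[of _ big_union, OF x1(1) this] obtain f where
    f: "fun_on f (elts omega)" "app f emp = set_of {x}" "\<And>n. n \<in> elts omega \<Longrightarrow> app f (succ n) = big_union (app f n)"
    by blast
  have fV: "f \<in> V" using f(1) by (simp add: fun_on_def)
  have "defterm (\<lambda>v. app0 f (v 0))" by (intro definable_intros fV)
  from small_set_of[OF small_UN[of _ "app0 f", OF small_elts[OF omega_in_V] this]]
  obtain d where d: "d \<in> V" "elts d = (\<Union>n\<in>elts omega. elts (app0 f n))" by blast
  have "x \<in> elts (app0 f emp)"
    using app0_eq[OF f(1) emp_in_omega] f(2) x1(2) by simp
  then have "x \<in> elts d" unfolding d(2) using emp_in_omega by blast
  moreover have "elts z \<subseteq> elts d" if z: "z \<in> elts d" for z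
  proof -
    obtain n where n: "n \<in> elts omega" "z \<in> elts (app0 f n)" using z d(2) by blast
    have "elts z \<subseteq> elts (app0 f (succ n))"
    proof -
      have "app0 f (succ n) = big_union (app0 f n)"
        using app0_eq[OF f(1) n(1)] app0_eq[OF f(1) succ_in_omega[OF n(1)]] f(3)[OF n(1)] by simp
      then show ?thesis using n(2) by (auto simp: big_union)
    qed
    then show ?thesis using d(2) succ_in_omega[OF n(1)] by blast
  qed
  ultimately show ?thesis using d(1) by (auto simp: transitive_set_def)
qed

text \<open>
  Membership induction holds only for definable predicates: the axiom of foundation speaks about sets of the structure, and
  the structure need not be well-founded from the outside.  A transitive set containing a counterexample reduces the claim to
  foundation for the set of counterexamples in it.
\<close>

lemma eps_induct [consumes 2, case_names mem]:
  assumes "x \<in> V" "definable (\<lambda>v. P (v 0))" "\<And>x. x \<in> V \<Longrightarrow> (\<And>y. y \<in> elts x \<Longrightarrow> P y) \<Longrightarrow> P x"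
  shows "P x"
proof (rule ccontr)
  assume "\<not> P x"
  obtain d where d: "transitive_set d" "x \<in> elts d" using ex_transitive_set[OF assms(1)] by blast
  have dV: "d \<in> V" using d(1) by (simp add: transitive_set_def)
  note S = small_set_of[OF small_Collect[OF small_elts[OF dV], of "\<lambda>x. \<not> P x", OF definable_not[OF assms(2)]]]
  have "x \<in> elts (set_of {z \<in> elts d. \<not> P z})" using d(2) \<open>\<not> P x\<close> S(2) by blast
  then obtain y where y: "y \<in> elts d" "\<not> P y" "elts y \<inter> {z \<in> elts d. \<not> P z} = {}"
    using foundation[OF S(1)] S(2) by auto
  have "elts y \<subseteq> elts d" using d(1) y(1) by (auto simp: transitive_set_def)
  then have "\<And>z. z \<in> elts y \<Longrightarrow> P z" using y(3) by blast
  then show False using assms(3)[OF elts_in_V[OF y(1)]] y(2) by blast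
qed

context
  fixes H :: "'a \<Rightarrow> ('a \<Rightarrow> 'a) \<Rightarrow> 'a \<Rightarrow> 'a"
  assumes H_cong: "\<And>p F G x. p \<in> V \<Longrightarrow> x \<in> V \<Longrightarrow> (\<And>y. y \<in> elts x \<Longrightarrow> F y = G y) \<Longrightarrow> H p F x = H p G x"
    and H_defterm: "defterm (\<lambda>v. H (v 0) (app0 (v (Suc 0))) (v (Suc (Suc 0))))"
begin

text \<open>
  The approximations used in \<open>rec_in\<close>, with the total application, which makes them definable.
\<close>

definition rec_approx :: "'a \<Rightarrow> 'a \<Rightarrow> 'a \<Rightarrow> bool" where
  "rec_approx p d f \<longleftrightarrow> transitive_set d \<and> fun_on f (elts d) \<and> (\<forall>z\<in>elts d. app0 f z = H p (app0 f) z)"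

definition rec_val :: "'a \<Rightarrow> 'a \<Rightarrow> 'a" where
  "rec_val p x = the0 (\<lambda>y. \<exists>d\<in>V. \<exists>f\<in>V. rec_approx p d f \<and> x \<in> elts d \<and> y = app0 f x)"

private lemma H_defterm': "defterm r \<Longrightarrow> defterm t \<Longrightarrow> defterm s \<Longrightarrow> defterm (\<lambda>v. H (r v) (app0 (t v)) (s v))"
  by (rule defterm3[where F = "\<lambda>p f x. H p (app0 f) x", OF H_defterm])

private lemma rec_approx_definable: "defterm r \<Longrightarrow> defterm t \<Longrightarrow> defterm s \<Longrightarrow> definable (\<lambda>v. rec_approx (r v) (t v) (s v))"
proof (rule definable3[where R = rec_approx])
  show "definable (\<lambda>v. rec_approx (v 0) (v (Suc 0)) (v (Suc (Suc 0))))"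
    unfolding rec_approx_def by (intro definable_intros H_defterm')
qed

private lemma rec_val_defterm: "defterm t \<Longrightarrow> defterm s \<Longrightarrow> defterm (\<lambda>v. rec_val (t v) (s v))"
proof (rule defterm2[where F = rec_val])
  show "defterm (\<lambda>v. rec_val (v 0) (v (Suc 0)))"
    unfolding rec_val_def by (intro definable_intros rec_approx_definable)
qed

private lemma rec_approx_unique:
  assumes p: "p \<in> V" and df: "d \<in> V" "f \<in> V" "d' \<in> V" "f' \<in> V"
    and A: "rec_approx p d f" "rec_approx p d' f'"
    and x: "x \<in> elts d" "x \<in> elts d'"
  shows "app0 f x = app0 f' x"
proof -
  have "x \<in> elts d \<and> x \<in> elts d' \<longrightarrow> app0 f x = app0 f' x"
  proof (rule eps_induct[where P = "\<lambda>x. x \<in> elts d \<and> x \<in> elts d' \<longrightarrow> app0 f x = app0 f' x"])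
    show "x \<in> V" using x elts_in_V by blast
    show "definable (\<lambda>v. v 0 \<in> elts d \<and> v 0 \<in> elts d' \<longrightarrow> app0 f (v 0) = app0 f' (v 0))"
      by (intro definable_intros df)
  next
    fix z assume z: "z \<in> V" and IH: "\<And>y. y \<in> elts z \<Longrightarrow> y \<in> elts d \<and> y \<in> elts d' \<longrightarrow> app0 f y = app0 f' y"
    show "z \<in> elts d \<and> z \<in> elts d' \<longrightarrow> app0 f z = app0 f' z"
    proof (intro impI, elim conjE)
      assume zd: "z \<in> elts d" "z \<in> elts d'"
      then have sub: "elts z \<subseteq> elts d" "elts z \<subseteq> elts d'"
        using A by (auto simp: rec_approx_def transitive_set_def)
      have "app0 f z = H p (app0 f) z" "app0 f' z = H p (app0 f') z"
        using A zd by (auto simp: rec_approx_def)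
      moreover have "H p (app0 f) z = H p (app0 f') z"
        by (rule H_cong[OF p z]) (use IH sub in blast)
      ultimately show "app0 f z = app0 f' z" by simp
    qed
  qed
  then show ?thesis using x by blast
qed

private lemma rec_val_eq:
  assumes p: "p \<in> V" and df: "d \<in> V" "f \<in> V" and A: "rec_approx p d f" and x: "x \<in> elts d"
  shows "rec_val p x = app0 f x"
  unfolding rec_val_def
proof (rule the0_equality)
  show "\<exists>d\<in>V. \<exists>fa\<in>V. rec_approx p d fa \<and> x \<in> elts d \<and> app0 f x = app0 fa x" using assms by blast
next
  fix z assume "\<exists>d\<in>V. \<exists>f\<in>V. rec_approx p d f \<and> x \<in> elts d \<and> z = app0 f x"
  then obtain d' f' where "d' \<in> V" "f' \<in> V" "rec_approx p d' f'" "x \<in> elts d'" "z = app0 f' x" by blast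
  then show "z = app0 f x" using rec_approx_unique[OF p _ _ df _ A _ x] by blast
qed simp

private lemma ex_rec_approx:
  assumes p: "p \<in> V" and x: "x \<in> V"
  shows "\<exists>d\<in>V. \<exists>f\<in>V. rec_approx p d f \<and> x \<in> elts d"
proof (rule eps_induct[where P = "\<lambda>x. \<exists>d\<in>V. \<exists>f\<in>V. rec_approx p d f \<and> x \<in> elts d", OF x])
  show "definable (\<lambda>v. \<exists>d\<in>V. \<exists>f\<in>V. rec_approx p d f \<and> v 0 \<in> elts d)"
    by (intro definable_intros rec_approx_definable p)
next
  fix x assume x: "x \<in> V" and IH: "\<And>y. y \<in> elts x \<Longrightarrow> \<exists>d\<in>V. \<exists>f\<in>V. rec_approx p d f \<and> y \<in> elts d"
  let ?Q = "\<lambda>z. \<exists>d\<in>V. \<exists>f\<in>V. rec_approx p d f \<and> z \<in> elts d"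
  have Qdfn: "definable (\<lambda>v. ?Q (v 0))" by (intro definable_intros rec_approx_definable p)
  have Q_down: "?Q w" if "?Q z" "w \<in> elts z" for z w
  proof -
    obtain d f where df: "d \<in> V" "f \<in> V" "rec_approx p d f" "z \<in> elts d" using \<open>?Q z\<close> by blast
    then have "w \<in> elts d" using that(2) by (auto simp: rec_approx_def transitive_set_def)
    then show ?thesis using df by blast
  qed
  obtain d where d: "transitive_set d" "x \<in> elts d" using ex_transitive_set[OF x] by blast
  have dV: "d \<in> V" using d(1) by (simp add: transitive_set_def)
  note S1 = small_Collect[OF small_elts[OF dV], of ?Q, OF Qdfn]
  \<comment> \<open>\<open>g\<close> collects the known values on \<open>D1\<close>, and one more step of the recursion extends it to \<open>x\<close>\<close>
  define D1 where "D1 = {z \<in> elts d. ?Q z}"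
  define D2 where "D2 = insert x D1"
  have s1: "small D1" unfolding D1_def by (rule S1)
  then have s2: "small D2" unfolding D2_def using x by simp
  have sub: "elts z \<subseteq> D1" if "z \<in> D2" for z
  proof
    fix w assume w: "w \<in> elts z"
    have "z \<in> elts d" using that d(2) by (auto simp: D1_def D2_def)
    then have "w \<in> elts d" using d(1) w by (auto simp: transitive_set_def)
    moreover have "?Q w"
    proof (cases "z = x")
      case True
      then show ?thesis using IH w by blast
    next
      case False
      then have "?Q z" using that by (auto simp: D1_def D2_def)
      then show ?thesis using Q_down w by blast
    qed
    ultimately show "w \<in> D1" by (simp add: D1_def)
  qed
  have rec_val_defterm1: "defterm (\<lambda>v. rec_val p (v 0))" by (intro rec_val_defterm definable_intros p)
  note L1 = lam[OF s1 rec_val_defterm1]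
  define g where "g = lam D1 (rec_val p)"
  have gV: "g \<in> V" using L1(1) by (simp add: g_def)
  have "defterm (\<lambda>v. H p (app0 g) (v 0))" by (intro H_defterm' definable_intros p gV)
  note L2 = lam[of D2 "H p (app0 g)", OF s2 this]
  define f where "f = lam D2 (H p (app0 g))"
  note L2 = L2[folded f_def] and L1 = L1[folded g_def]
  have D2V: "z \<in> V" if "z \<in> D2" for z using that small_subset_V[OF s2] by blast
  have D1_eq: "H p (app0 g) z = rec_val p z" if zD: "z \<in> D1" for z
  proof -
    obtain d' f' where df: "d' \<in> V" "f' \<in> V" "rec_approx p d' f'" "z \<in> elts d'"
      using zD unfolding D1_def by blast
    have "elts z \<subseteq> elts d'" using df by (auto simp: rec_approx_def transitive_set_def)
    have "H p (app0 g) z = H p (app0 f') z"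
    proof (rule H_cong[OF p])
      show "z \<in> V" using df(4) by (rule elts_in_V)
    next
      fix y assume y: "y \<in> elts z"
      have "y \<in> D1" using sub[of z] that y by (auto simp: D2_def)
      moreover have "rec_val p y = app0 f' y"
        by (rule rec_val_eq[OF p df(1-3)]) (use y \<open>elts z \<subseteq> elts d'\<close> in blast)
      ultimately show "app0 g y = app0 f' y" by (simp add: L1)
    qed
    also have "\<dots> = app0 f' z" using df by (simp add: rec_approx_def)
    also have "\<dots> = rec_val p z" by (rule rec_val_eq[symmetric, OF p df])
    finally show ?thesis .
  qed
  define d2 where "d2 = set_of D2"
  have d2: "d2 \<in> V" "elts d2 = D2" using s2 by (simp_all add: d2_def small_set_of)
  have "rec_approx p d2 f"
    unfolding rec_approx_def
  proof (intro conjI ballI)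
    show "transitive_set d2"
      unfolding transitive_set_def using d2 sub by (auto simp: D2_def)
    show "fun_on f (elts d2)" using L2(2) d2(2) by simp
  next
    fix z assume "z \<in> elts d2"
    then have z: "z \<in> D2" using d2 by simp
    have "H p (app0 f) z = H p (app0 g) z"
    proof (rule H_cong[OF p D2V[OF z]])
      fix y assume "y \<in> elts z"
      then have y: "y \<in> D1" using sub[OF z] by blast
      then have "y \<in> D2" by (simp add: D2_def)
      then show "app0 f y = app0 g y" using y by (simp add: L2 L1 D1_eq)
    qed
    then show "app0 f z = H p (app0 f) z" using z by (simp add: L2)
  qed
  then show "\<exists>d\<in>V. \<exists>f\<in>V. rec_approx p d f \<and> x \<in> elts d"
    using d2 L2(1) by (auto simp: D2_def)
qed

private lemma rec_in_eq_rec_val: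
  assumes p: "p \<in> V" and x: "x \<in> V" shows "rec_in (H p) x = rec_val p x"
proof -
  have A: "(transitive_set d \<and> x \<in> elts d \<and> fun_on f (elts d) \<and>
     (\<forall>z\<in>elts d. app f z = H p (app f) z) \<and> y = app f x) \<longleftrightarrow>
     (d \<in> V \<and> f \<in> V \<and> rec_approx p d f \<and> x \<in> elts d \<and> y = app0 f x)" for d f y
  proof (cases "transitive_set d \<and> fun_on f (elts d) \<and> x \<in> elts d")
    case True
    then have T: "d \<in> V" "f \<in> V" by (auto simp: transitive_set_def fun_on_def)
    have sub: "elts z \<subseteq> elts d" if "z \<in> elts d" for z using True that by (auto simp: transitive_set_def)
    have a: "app0 f z = app f z" if "z \<in> elts d" for z using True that app0_eq by blast
    have "H p (app f) z = H p (app0 f) z" if "z \<in> elts d" for z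
      by (rule H_cong[OF p elts_in_V[OF that]]) (use a sub[OF that] in auto)
    then show ?thesis using True T a by (auto simp: rec_approx_def)
  qed (auto simp: rec_approx_def)
  obtain d f where df: "d \<in> V" "f \<in> V" "rec_approx p d f" "x \<in> elts d"
    using ex_rec_approx[OF p x] by blast
  show ?thesis
    unfolding rec_in_def A
  proof (rule the_equality)
    show "\<exists>d f. d \<in> V \<and> f \<in> V \<and> rec_approx p d f \<and> x \<in> elts d \<and> rec_val p x = app0 f x"
      using df rec_val_eq[OF p df] by blast
  next
    fix y assume "\<exists>d f. d \<in> V \<and> f \<in> V \<and> rec_approx p d f \<and> x \<in> elts d \<and> y = app0 f x"
    then show "y = rec_val p x" using rec_val_eq[OF p] by metis
  qed
qed

lemma rec_in_in_V: assumes "p \<in> V" "x \<in> V" shows "rec_in (H p) x \<in> V"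
  unfolding rec_in_eq_rec_val[OF assms] rec_val_def by simp

lemma rec_in_unfold:
  assumes p: "p \<in> V" and x: "x \<in> V" shows "rec_in (H p) x = H p (rec_in (H p)) x"
proof -
  obtain d f where df: "d \<in> V" "f \<in> V" "rec_approx p d f" "x \<in> elts d"
    using ex_rec_approx[OF p x] by blast
  have "rec_in (H p) x = app0 f x" using rec_in_eq_rec_val[OF p x] rec_val_eq[OF p df] by simp
  also have "\<dots> = H p (app0 f) x" using df by (simp add: rec_approx_def)
  also have "\<dots> = H p (rec_in (H p)) x"
  proof (rule H_cong[OF p x])
    fix y assume y: "y \<in> elts x"
    then have "y \<in> elts d" using df by (auto simp: rec_approx_def transitive_set_def)
    then show "app0 f y = rec_in (H p) y"
      using rec_in_eq_rec_val[OF p elts_in_V[OF y]] rec_val_eq[OF p df(1-3)] by simp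
  qed
  finally show ?thesis .
qed

lemma rec_in_defterm: assumes "defterm t" "defterm s" shows "defterm (\<lambda>v. rec_in (H (t v)) (s v))"
proof -
  have "defterm (\<lambda>v. rec_in (H (v 0)) (v (Suc 0)))"
    unfolding defterm_def
  proof (intro conjI allI impI)
    fix v :: "nat \<Rightarrow> 'a" assume "range v \<subseteq> V"
    then show "rec_in (H (v 0)) (v (Suc 0)) \<in> V" by (intro rec_in_in_V) auto
  next
    have "definable (\<lambda>v. v 0 = rec_val (v (Suc 0)) (v (Suc (Suc 0))))" by (intro definable_intros rec_val_defterm)
    then show "definable (\<lambda>v. v 0 = rec_in (H (v (Suc 0))) (v (Suc (Suc 0))))"
    proof (rule definable_cong)
      fix v :: "nat \<Rightarrow> 'a" assume "range v \<subseteq> V"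
      then have "v (Suc 0) \<in> V" "v (Suc (Suc 0)) \<in> V" by auto
      then show "v 0 = rec_val (v (Suc 0)) (v (Suc (Suc 0))) \<longleftrightarrow> v 0 = rec_in (H (v (Suc 0))) (v (Suc (Suc 0)))"
        by (simp add: rec_in_eq_rec_val)
    qed
  qed
  from defterm2[where F = "\<lambda>p. rec_in (H p)", OF this assms] show ?thesis .
qed

end

end

section \<open>Definable sets, images and dependent choice\<close>

context membership_structure
begin

text \<open>
  Fixing all but finitely many variables of a definable predicate keeps it definable: a definition mentions
  only finitely many of the fixed values, which become parameters.
\<close>

lemma definable_fix_tail:
  assumes "definable P" "range w \<subseteq> V"
  shows "definable (\<lambda>v. P (\<lambda>n. if n < k then v n else w (n - k)))"
  using assms
proof (induction arbitrary: k rule: definable.induct)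
  case (definable_Mem i j)
  have "defterm (\<lambda>v. if i < k then v i else w (i - k))" for i
    by (cases "i < k") (use definable_Mem in \<open>simp_all add: defterm_var defterm_const image_subset_iff\<close>)
  then show ?case by (rule definable_E) fact
next
  case (definable_Equal i j)
  have "defterm (\<lambda>v. if i < k then v i else w (i - k))" for i
    by (cases "i < k") (use definable_Equal in \<open>simp_all add: defterm_var defterm_const image_subset_iff\<close>)
  then show ?case by (rule definable_eq) fact
next
  case (definable_param c i)
  have "defterm (\<lambda>v. if i < k then v i else w (i - k))"
    by (cases "i < k") (use definable_param in \<open>simp_all add: defterm_var defterm_const image_subset_iff\<close>)
  then show ?case by (rule definable_eq) (rule defterm_const, fact)
next
  case (definable_not P)
  then show ?case by (intro definable.definable_not)
next
  case (definable_and P Q)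
  then show ?case by (intro definable.definable_and)
next
  case (definable_all_scons P)
  have "(\<lambda>n. if n < Suc k then scons x v n else w (n - Suc k)) = scons x (\<lambda>n. if n < k then v n else w (n - k))"
    for x :: 'a and v
  proof
    fix n show "(if n < Suc k then scons x v n else w (n - Suc k)) = scons x (\<lambda>n. if n < k then v n else w (n - k)) n"
      by (cases n) simp_all
  qed
  then show ?case
    using definable.definable_all_scons[OF definable_all_scons.IH[OF definable_all_scons.prems, of "Suc k"]] by simp
next
  case (definable_cong P Q)
  show ?case
  proof (rule definable.definable_cong[OF definable_cong.IH[OF definable_cong.prems, of k]])
    fix v :: "nat \<Rightarrow> 'a" assume "range v \<subseteq> V"
    then have "range (\<lambda>n. if n < k then v n else w (n - k)) \<subseteq> V"
      using definable_cong.prems by auto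
    then show "P (\<lambda>n. if n < k then v n else w (n - k)) \<longleftrightarrow> Q (\<lambda>n. if n < k then v n else w (n - k))"
      by (rule definable_cong.hyps(2))
  qed
qed

lemma definable_fix:
  assumes "definable (\<lambda>v. P (v 0) (\<lambda>n. v (Suc n)))" "range w \<subseteq> V"
  shows "definable (\<lambda>v. P (v 0) w)"
  using definable_fix_tail[OF assms, of "Suc 0"] by simp

end

context zfc
begin

text \<open>
  The set of all \<open>y\<close> with \<open>P y\<close> if there is one, as a total definable term.
\<close>

definition cset :: "('a \<Rightarrow> bool) \<Rightarrow> 'a" where
  "cset P = the0 (\<lambda>z. \<forall>y\<in>V. y \<in> elts z \<longleftrightarrow> P y)"

lemma cset_in_V [simp]: "cset P \<in> V" by (simp add: cset_def)

lemma elts_cset: assumes "small {y \<in> V. P y}" shows "elts (cset P) = {y \<in> V. P y}"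
proof -
  note S = small_set_of[OF assms]
  have "cset P = set_of {y \<in> V. P y}"
    unfolding cset_def
  proof (rule the0_equality[OF S(1)])
    show "\<forall>y\<in>V. y \<in> elts (set_of {y \<in> V. P y}) \<longleftrightarrow> P y" by (simp add: S)
  next
    fix z assume z: "z \<in> V" "\<forall>y\<in>V. y \<in> elts z \<longleftrightarrow> P y"
    then have "elts z = {y \<in> V. P y}" using elts_subset_V by blast
    then show "z = set_of {y \<in> V. P y}" using set_of_elts[OF z(1)] by simp
  qed
  then show ?thesis by (simp add: S)
qed

lemma defterm_cset [definable_intros]:
  assumes "definable (\<lambda>v. P (v 0) (\<lambda>n. v (Suc n)))" shows "defterm (\<lambda>v. cset (\<lambda>y. P y v))"
  unfolding cset_def
proof (rule defterm_the0, rule definable_all, rule definable_iff)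
  show "definable (\<lambda>v. v 0 \<in> elts (v (Suc 0)))" by (intro definable_intros)
  show "definable (\<lambda>v. P (v 0) (\<lambda>n. v (Suc (Suc n))))"
    using definable_rename[OF assms, of "\<lambda>n. case n of 0 \<Rightarrow> 0 | Suc m \<Rightarrow> Suc (Suc m)"] by simp
qed

lemma definable2_local: assumes "definable (\<lambda>v. R (v 0) (v (Suc 0)))" shows "defterm t \<Longrightarrow> defterm s \<Longrightarrow> definable (\<lambda>v. R (t v) (s v))"
  by (rule definable2[where R = R, OF assms])

lemma defterm2_local: assumes "defterm (\<lambda>v. F (v 0) (v (Suc 0)))" shows "defterm t \<Longrightarrow> defterm s \<Longrightarrow> defterm (\<lambda>v. F (t v) (s v))"
  by (rule defterm2[where F = F, OF assms])

lemma definable1_local: assumes "definable (\<lambda>v. R (v 0))" shows "defterm t \<Longrightarrow> definable (\<lambda>v. R (t v))"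
  by (rule definable1[where R = R, OF assms])

lemma small_image_Sigma:
  assumes X: "small X" and G: "defterm (\<lambda>v. G (v 0))" and F: "defterm (\<lambda>v. F (v 0) (v (Suc 0)))"
  shows "small {F x y | x y. x \<in> X \<and> y \<in> elts (G x)}"
proof -
  note Fdt = defterm2_local[of F, OF F] and Gdt = defterm1_local[of G, OF G]
  have sm: "small (F x ` elts (G x))" if "x \<in> V" for x
    using that defterm_fun_in_V[OF G] by (intro small_image small_elts Fdt definable_intros)
  have "defterm (\<lambda>v. set_of (F (v 0) ` elts (G (v 0))))"
  proof (rule defterm_set_of)
    fix v :: "nat \<Rightarrow> 'a" assume "range v \<subseteq> V"
    then show "small (F (v 0) ` elts (G (v 0)))" by (intro sm) auto
  next
    show "definable (\<lambda>v. v 0 \<in> F (v (Suc 0)) ` elts (G (v (Suc 0))))"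
      unfolding image_iff by (intro definable_intros Fdt Gdt)
  qed
  from small_UN[of X "\<lambda>x. set_of (F x ` elts (G x))", OF X this]
  have "small (\<Union>x\<in>X. elts (set_of (F x ` elts (G x))))" .
  also have "(\<Union>x\<in>X. elts (set_of (F x ` elts (G x)))) = (\<Union>x\<in>X. F x ` elts (G x))"
    using elts_set_of[OF sm] small_subset_V[OF X] by (intro SUP_cong) auto
  also have "\<dots> = {F x y | x y. x \<in> X \<and> y \<in> elts (G x)}" by auto
  finally show ?thesis .
qed

lemma small_image2:
  assumes "small X" "small Y" "defterm (\<lambda>v. F (v 0) (v (Suc 0)))"
  shows "small {F x y | x y. x \<in> X \<and> y \<in> Y}"
proof -
  note S = small_set_of[OF assms(2)]
  have "defterm (\<lambda>v. set_of Y)" by (intro definable_intros S)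
  from small_image_Sigma[of X "\<lambda>_. set_of Y" F, OF assms(1) this assms(3)] show ?thesis by (simp add: S)
qed

text \<open>
  The axiom of choice is only available for families of disjoint sets.  Tagging the \<open>R\<close>-successors of \<open>x\<close> with \<open>x\<close> makes them
  disjoint, and a choice set then defines a successor function to iterate.
\<close>

lemma dependent_choice:
  assumes T: "T \<in> V" and R: "definable (\<lambda>v. R (v 0) (v (Suc 0)))"
    and total: "\<And>x. x \<in> elts T \<Longrightarrow> \<exists>y\<in>elts T. R x y" and t0: "t0 \<in> elts T"
  shows "\<exists>f. fun_on f (elts omega) \<and> (\<forall>n\<in>elts omega. app f n \<in> elts T \<and> R (app f n) (app f (succ n)))"
proof -
  note Rdfn = definable2_local[of R, OF R]
  define fam where "fam x = set_of ((\<lambda>y. opair x y) ` {y \<in> elts T. R x y})" for x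
  have sm: "small ((\<lambda>y. opair x y) ` {y \<in> elts T. R x y})" if "x \<in> V" for x
  proof (rule small_image)
    show "small {y \<in> elts T. R x y}"
      by (rule small_Collect[OF small_elts[OF T]]) (intro Rdfn definable_intros that)
    show "defterm (\<lambda>v. opair x (v 0))" by (intro definable_intros that)
  qed
  have fam: "fam x \<in> V" "elts (fam x) = (\<lambda>y. opair x y) ` {y \<in> elts T. R x y}" if "x \<in> V" for x
    using small_set_of[OF sm[OF that]] by (simp_all add: fam_def)
  have "defterm (\<lambda>v. fam (v 0))"
    unfolding fam_def
  proof (rule defterm_set_of)
    fix v :: "nat \<Rightarrow> 'a" assume "range v \<subseteq> V"
    then show "small ((\<lambda>y. opair (v 0) y) ` {y \<in> elts T. R (v 0) y})" by (intro sm) auto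
  next
    have "definable (\<lambda>v. \<exists>y\<in>elts T. R (v (Suc 0)) y \<and> v 0 = opair (v (Suc 0)) y)"
      by (intro definable_intros Rdfn T)
    then show "definable (\<lambda>v. v 0 \<in> (\<lambda>y. opair (v (Suc 0)) y) ` {y \<in> elts T. R (v (Suc 0)) y})"
      by (rule definable_cong) blast
  qed
  note X = small_set_of[OF small_image[of _ fam, OF small_elts[OF T] this]]
  have TV: "x \<in> V" if "x \<in> elts T" for x using that by (rule elts_in_V)
  have "\<exists>c\<in>V. \<forall>y\<in>elts (set_of (fam ` elts T)). \<exists>!u. u \<in> elts c \<inter> elts y"
  proof (rule axiom_of_choice[rule_format, OF X(1)], intro conjI ballI impI)
    fix y assume "y \<in> elts (set_of (fam ` elts T))"
    then obtain x where x: "x \<in> elts T" "y = fam x" using X(2) by auto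
    then show "elts y \<noteq> {}" using total[OF x(1)] fam(2)[OF TV[OF x(1)]] by auto
  next
    fix y z assume "y \<in> elts (set_of (fam ` elts T))" "z \<in> elts (set_of (fam ` elts T))" and neq: "y \<noteq> z"
    then obtain x x' where x: "x \<in> elts T" "y = fam x" "x' \<in> elts T" "z = fam x'" using X(2) by auto
    have "x \<noteq> x'" using x neq by auto
    then have "opair x a \<noteq> opair x' b" if "a \<in> elts T" "b \<in> elts T" for a b
      using x that TV by simp
    then show "elts y \<inter> elts z = {}"
      using x fam(2)[OF TV[OF x(1)]] fam(2)[OF TV[OF x(3)]] by auto
  qed
  then obtain c where cV: "c \<in> V" and c: "\<forall>y\<in>elts (set_of (fam ` elts T)). \<exists>!u. u \<in> elts c \<inter> elts y"
    by (elim bexE)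
  define g where "g x = the0 (\<lambda>y. y \<in> elts T \<and> R x y \<and> opair x y \<in> elts c)" for x
  have g: "g x \<in> elts T \<and> R x (g x)" if x: "x \<in> elts T" for x
  proof -
    have "fam x \<in> elts (set_of (fam ` elts T))" using x X(2) by simp
    from bspec[OF c this] obtain u where u: "u \<in> elts c" "u \<in> elts (fam x)"
      and uniq: "\<And>u'. u' \<in> elts c \<Longrightarrow> u' \<in> elts (fam x) \<Longrightarrow> u' = u" by (elim ex1E) auto
    from u(2) obtain y where y: "y \<in> elts T" "R x y" "u = opair x y" using fam(2)[OF TV[OF x]] by auto
    have "g x = y"
      unfolding g_def
    proof (rule the0_equality)
      show "y \<in> elts T \<and> R x y \<and> opair x y \<in> elts c" using y u by simp
    next
      fix z assume z: "z \<in> V" "z \<in> elts T \<and> R x z \<and> opair x z \<in> elts c"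
      then have "opair x z = u" using uniq[of "opair x z"] fam(2)[OF TV[OF x]] by simp
      then show "z = y" using y z TV x by simp
    qed (rule TV[OF y(1)])
    then show ?thesis using y by simp
  qed
  have "defterm (\<lambda>v. g (v 0))" unfolding g_def by (intro definable_intros Rdfn T cV)
  from omega_recursion[of t0 g, OF TV[OF t0] this] obtain f where
    f: "fun_on f (elts omega)" "app f emp = t0" "\<And>n. n \<in> elts omega \<Longrightarrow> app f (succ n) = g (app f n)"
    by blast
  have fV: "f \<in> V" using f(1) by (simp add: fun_on_def)
  have inT: "app0 f n \<in> elts T" if "n \<in> elts omega" for n
  proof (rule omega_induct[where P = "\<lambda>n. app0 f n \<in> elts T", OF that])
    show "definable (\<lambda>v. app0 f (v 0) \<in> elts T)" by (intro definable_intros fV T)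
    show "app0 f emp \<in> elts T" using f(2) t0 app0_eq[OF f(1) emp_in_omega] by simp
  next
    fix n assume n: "n \<in> elts omega" "app0 f n \<in> elts T"
    then show "app0 f (succ n) \<in> elts T"
      using f(3)[OF n(1)] app0_eq[OF f(1) n(1)] app0_eq[OF f(1) succ_in_omega[OF n(1)]] g by simp
  qed
  show ?thesis
    using f(1,3) inT app0_eq[OF f(1)] g by (intro exI[of _ f]) simp
qed

section \<open>Ranks\<close>

lemma small_rank_aux:
  assumes "x \<in> V" "f \<in> V"
  shows "small (\<Union>y\<in>elts x. insert (app0 f y) (elts (app0 f y)))"
proof -
  have "defterm (\<lambda>v. succ (app0 f (v 0)))" by (intro definable_intros assms)
  from small_UN[OF small_elts[OF assms(1)], of "\<lambda>y. succ (app0 f y)", OF this] show ?thesis by simp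
qed

lemma rank_cong:
  fixes F G :: "'a \<Rightarrow> 'a"
  assumes "\<And>y. y \<in> elts x \<Longrightarrow> F y = G y"
  shows "set_of (\<Union>y\<in>elts x. insert (F y) (elts (F y))) = set_of (\<Union>y\<in>elts x. insert (G y) (elts (G y)))"
  using assms by simp

lemma defterm_rank_step:
  "defterm (\<lambda>v. set_of (\<Union>y\<in>elts (v (Suc (Suc 0))). insert (app0 (v (Suc 0)) y) (elts (app0 (v (Suc 0)) y))))"
proof (rule defterm_set_of)
  fix v :: "nat \<Rightarrow> 'a" assume "range v \<subseteq> V"
  then show "small (\<Union>y\<in>elts (v (Suc (Suc 0))). insert (app0 (v (Suc 0)) y) (elts (app0 (v (Suc 0)) y)))"
    by (intro small_rank_aux) auto
next
  show "definable (\<lambda>v. v 0 \<in> (\<Union>y\<in>elts (v (Suc (Suc (Suc 0)))). insert (app0 (v (Suc (Suc 0))) y) (elts (app0 (v (Suc (Suc 0))) y))))"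
    unfolding UN_iff insert_iff by (intro definable_intros)
qed

lemmas rank_rec =
  rec_in_in_V[where H = "\<lambda>_ F x. set_of (\<Union>y\<in>elts x. insert (F y) (elts (F y)))", OF rank_cong defterm_rank_step emp(1), folded rank_def]
  rec_in_unfold[where H = "\<lambda>_ F x. set_of (\<Union>y\<in>elts x. insert (F y) (elts (F y)))", OF rank_cong defterm_rank_step emp(1), folded rank_def]
  rec_in_defterm[where H = "\<lambda>_ F x. set_of (\<Union>y\<in>elts x. insert (F y) (elts (F y)))", OF rank_cong defterm_rank_step defterm_const[OF emp(1)], folded rank_def]

lemma rank_in_V [simp]: "x \<in> V \<Longrightarrow> rank x \<in> V"
  by (rule rank_rec(1)) auto

lemma defterm_rank [definable_intros]: "defterm t \<Longrightarrow> defterm (\<lambda>v. rank (t v))"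
  by (rule rank_rec(3)) auto

lemma elts_rank:
  assumes "x \<in> V" shows "elts (rank x) = (\<Union>y\<in>elts x. insert (rank y) (elts (rank y)))"
proof -
  have "rank x = set_of (\<Union>y\<in>elts x. insert (rank y) (elts (rank y)))"
    by (rule rank_rec(2)[OF _ assms]) auto
  moreover have "small (\<Union>y\<in>elts x. insert (rank y) (elts (rank y)))"
  proof -
    have "defterm (\<lambda>v. succ (rank (v 0)))" by (intro definable_intros)
    from small_UN[OF small_elts[OF assms], of "\<lambda>y. succ (rank y)", OF this]
    have "small (\<Union>y\<in>elts x. elts (succ (rank y)))" .
    also have "(\<Union>y\<in>elts x. elts (succ (rank y))) = (\<Union>y\<in>elts x. insert (rank y) (elts (rank y)))"
      by (intro SUP_cong refl succ(2) rank_in_V) (rule elts_in_V)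
    finally show ?thesis .
  qed
  ultimately show ?thesis using elts_set_of by metis
qed

lemma rank_mono: "y \<in> elts x \<Longrightarrow> x \<in> V \<Longrightarrow> rank y \<in> elts (rank x)"
  by (auto simp: elts_rank)

lemma rank_transitive:
  assumes "x \<in> V" shows "\<forall>w\<in>elts (rank x). elts w \<subseteq> elts (rank x)"
proof (rule eps_induct[where P = "\<lambda>x. \<forall>w\<in>elts (rank x). elts w \<subseteq> elts (rank x)", OF assms])
  show "definable (\<lambda>v. \<forall>w\<in>elts (rank (v 0)). elts w \<subseteq> elts (rank (v 0)))" by (intro definable_intros)
next
  fix x assume x: "x \<in> V" and IH: "\<And>y. y \<in> elts x \<Longrightarrow> \<forall>w\<in>elts (rank y). elts w \<subseteq> elts (rank y)"
  show "\<forall>w\<in>elts (rank x). elts w \<subseteq> elts (rank x)"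
  proof
    fix w assume "w \<in> elts (rank x)"
    then obtain y where y: "y \<in> elts x" "w = rank y \<or> w \<in> elts (rank y)" using elts_rank[OF x] by auto
    then have "elts w \<subseteq> elts (rank y)" using IH[OF y(1)] by auto
    then show "elts w \<subseteq> elts (rank x)" using elts_rank[OF x] y(1) by blast
  qed
qed

lemma rank_trans: "a \<in> elts (rank y) \<Longrightarrow> rank y \<in> elts (rank x) \<Longrightarrow> x \<in> V \<Longrightarrow> a \<in> elts (rank x)"
  using rank_transitive by blast

lemma rank_linear_aux:
  assumes x: "x \<in> V"
    and IH: "\<And>z. z \<in> elts x \<Longrightarrow> rank z \<in> elts (rank y) \<or> rank z = rank y \<or> rank y \<in> elts (rank z)"
    and y: "y \<in> V" and ny: "rank y \<notin> elts (rank x)"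
  shows "elts (rank x) \<subseteq> elts (rank y)"
proof
  fix w assume "w \<in> elts (rank x)"
  then obtain z where z: "z \<in> elts x" "w = rank z \<or> w \<in> elts (rank z)" using elts_rank[OF x] by auto
  have "rank z \<in> elts (rank x)" using rank_mono[OF z(1) x] .
  then have "rank z \<in> elts (rank y)" using IH[OF z(1)] ny rank_trans[OF _ _ x] by metis
  then show "w \<in> elts (rank y)" using z(2) rank_trans[OF _ _ y] by auto
qed

text \<open>
  A double membership induction on \<open>x\<close> and \<open>y\<close>, with \<open>rank_linear_aux\<close> as
  the step in both arguments.
\<close>

lemma rank_linear:
  assumes "x \<in> V" "y \<in> V"
  shows "rank x \<in> elts (rank y) \<or> rank x = rank y \<or> rank y \<in> elts (rank x)"
proof -
  let ?C = "\<lambda>x y. rank x \<in> elts (rank y) \<or> rank x = rank y \<or> rank y \<in> elts (rank x)"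
  have "\<forall>y\<in>V. ?C x y"
  proof (rule eps_induct[where P = "\<lambda>x. \<forall>y\<in>V. ?C x y", OF assms(1)])
    show "definable (\<lambda>v. \<forall>y\<in>V. ?C (v 0) y)" by (intro definable_intros)
  next
    fix x assume x: "x \<in> V" and IHx: "\<And>z. z \<in> elts x \<Longrightarrow> \<forall>y\<in>V. ?C z y"
    show "\<forall>y\<in>V. ?C x y"
    proof
      fix y assume "y \<in> V"
      then show "?C x y"
      proof (rule eps_induct[where P = "\<lambda>y. ?C x y"])
        show "definable (\<lambda>v. ?C x (v 0))" by (intro definable_intros x)
      next
        fix y assume y: "y \<in> V" and IHy: "\<And>z. z \<in> elts y \<Longrightarrow> ?C x z"
        show "?C x y"
        proof (rule ccontr)
          assume n: "\<not> ?C x y"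
          have "elts (rank x) \<subseteq> elts (rank y)"
            by (rule rank_linear_aux[OF x _ y]) (use IHx y n in blast)+
          moreover have "elts (rank y) \<subseteq> elts (rank x)"
          proof (rule rank_linear_aux[OF y _ x])
            fix z assume "z \<in> elts y"
            then show "?C z x" using IHy by metis
          qed (use n in blast)
          ultimately show False
            using extensionality[OF rank_in_V[OF x] rank_in_V[OF y]] n by blast
        qed
      qed
    qed
  qed
  then show ?thesis using assms(2) by blast
qed

text \<open>
  The levels of the cumulative hierarchy are sets.  An element of rank \<open>b\<close> is a subset of the level below \<open>b\<close>, so the level of
  \<open>a\<close> is covered by the power sets \<open>P b\<close> with \<open>b \<in> a\<close>.
\<close>

lemma small_rank_less:
  assumes "a \<in> V" shows "small {x \<in> V. rank x \<in> elts a}"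
proof -
  have cover: "small {x \<in> V. rank x \<in> elts a}" if z: "z \<in> V" "\<forall>x\<in>V. rank x \<in> elts a \<longrightarrow> x \<in> elts z" and a: "a \<in> V" for a z
  proof -
    have "{x \<in> V. rank x \<in> elts a} = {x \<in> elts z. rank x \<in> elts a}" using z elts_subset_V by blast
    moreover have "small {x \<in> elts z. rank x \<in> elts a}"
      by (rule small_Collect[OF small_elts[OF z(1)]]) (intro definable_intros a)
    ultimately show ?thesis by simp
  qed
  have "\<exists>z\<in>V. \<forall>x\<in>V. rank x \<in> elts a \<longrightarrow> x \<in> elts z"
  proof (rule eps_induct[where P = "\<lambda>a. \<exists>z\<in>V. \<forall>x\<in>V. rank x \<in> elts a \<longrightarrow> x \<in> elts z", OF assms])
    show "definable (\<lambda>v. \<exists>z\<in>V. \<forall>x\<in>V. rank x \<in> elts (v 0) \<longrightarrow> x \<in> elts z)" by (intro definable_intros)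
  next
    fix a assume a: "a \<in> V" and IH: "\<And>b. b \<in> elts a \<Longrightarrow> \<exists>z\<in>V. \<forall>x\<in>V. rank x \<in> elts b \<longrightarrow> x \<in> elts z"
    have less: "elts (cset (\<lambda>x. rank x \<in> elts b)) = {x \<in> V. rank x \<in> elts b}" if "b \<in> elts a" for b
    proof -
      from IH[OF that] obtain z where z: "z \<in> V" "\<forall>x\<in>V. rank x \<in> elts b \<longrightarrow> x \<in> elts z" by (elim bexE)
      show ?thesis by (rule elts_cset, rule cover[OF z elts_in_V[OF that]])
    qed
    define P where "P b = cset (\<lambda>y. \<forall>x\<in>elts y. rank x \<in> elts b)" for b
    have P: "elts (P b) = {y \<in> V. \<forall>x\<in>elts y. rank x \<in> elts b}" if "b \<in> elts a" for b
      unfolding P_def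
    proof (rule elts_cset)
      have "{y \<in> V. \<forall>x\<in>elts y. rank x \<in> elts b} = {y \<in> V. elts y \<subseteq> elts (cset (\<lambda>x. rank x \<in> elts b))}"
        unfolding less[OF that] using elts_subset_V by auto
      then show "small {y \<in> V. \<forall>x\<in>elts y. rank x \<in> elts b}" using small_Pow[OF cset_in_V] by simp
    qed
    have "defterm (\<lambda>v. P (v 0))" unfolding P_def by (intro definable_intros)
    from small_set_of[OF small_UN[of _ P, OF small_elts[OF a] this]]
    obtain z where z: "z \<in> V" "elts z = (\<Union>b\<in>elts a. elts (P b))" by blast
    have "x \<in> elts z" if x: "x \<in> V" "rank x \<in> elts a" for x
    proof -
      have "x \<in> elts (P (rank x))" using P[OF x(2)] x(1) rank_mono by blast
      then show ?thesis using z(2) x(2) by blast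
    qed
    then show "\<exists>z\<in>V. \<forall>x\<in>V. rank x \<in> elts a \<longrightarrow> x \<in> elts z" using z(1) by blast
  qed
  then obtain z where z: "z \<in> V" "\<forall>x\<in>V. rank x \<in> elts a \<longrightarrow> x \<in> elts z" by (elim bexE)
  show ?thesis by (rule cover[OF z assms])
qed

end

section \<open>The complete Boolean algebra\<close>

locale zfc_cba = zfc V E + boolean_ultrapower V E B L
  for V :: "'a set" and E :: "'a \<Rightarrow> 'a \<Rightarrow> bool" and B L :: 'a +
  assumes cba: complete_boolean_algebra
begin

lemma B_in_V [simp]: "B \<in> V" and L_in_V [simp]: "L \<in> V" and boolean: "boolean_lattice \<BB>"
  using cba by (simp_all add: complete_boolean_algebra_def)

lemma carrier_BB [simp]: "carrier \<BB> = elts B" and eq_BB [simp]: "eq \<BB> = (=)"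
  by (simp_all add: \<BB>_def)

definition bleq :: "'a \<Rightarrow> 'a \<Rightarrow> bool" (infix "\<preceq>" 50) where
  "x \<preceq> y \<longleftrightarrow> opair x y \<in> elts L"

lemma le_BB [simp]: "x \<sqsubseteq>\<^bsub>\<BB>\<^esub> y \<longleftrightarrow> x \<preceq> y"
  by (simp add: \<BB>_def bleq_def)

lemma definable_bleq [definable_intros]: "defterm t \<Longrightarrow> defterm s \<Longrightarrow> definable (\<lambda>v. t v \<preceq> s v)"
  unfolding bleq_def by (rule definable_in_elts, rule defterm_opair, assumption, assumption, rule defterm_const, rule L_in_V)

lemma B_V: "b \<in> elts B \<Longrightarrow> b \<in> V" by (rule elts_in_V)

sublocale BL: bounded_lattice \<BB>
  using boolean by (simp add: boolean_lattice_def)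

lemma le_refl [simp]: "x \<in> elts B \<Longrightarrow> x \<preceq> x"
  using BL.le_refl[of x] by simp

lemma le_antisym: "x \<preceq> y \<Longrightarrow> y \<preceq> x \<Longrightarrow> x \<in> elts B \<Longrightarrow> y \<in> elts B \<Longrightarrow> x = y"
  using BL.le_antisym[of x y] by simp

lemma le_trans: "x \<preceq> y \<Longrightarrow> y \<preceq> z \<Longrightarrow> x \<in> elts B \<Longrightarrow> y \<in> elts B \<Longrightarrow> z \<in> elts B \<Longrightarrow> x \<preceq> z"
  using BL.le_trans[of x y z] by simp

abbreviation btop :: 'a where "btop \<equiv> \<top>\<^bsub>\<BB>\<^esub>"
abbreviation bbot :: 'a where "bbot \<equiv> \<bottom>\<^bsub>\<BB>\<^esub>"

lemma btop_in_B [simp]: "btop \<in> elts B" using BL.top_closed by simp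
lemma bbot_in_B [simp]: "bbot \<in> elts B" using BL.bottom_closed by simp
lemma btop_in_V [simp]: "btop \<in> V" by (rule B_V) simp
lemma bbot_in_V [simp]: "bbot \<in> V" by (rule B_V) simp
lemma le_btop [simp]: "x \<in> elts B \<Longrightarrow> x \<preceq> btop" using BL.top_higher[of x] by simp
lemma bbot_le [simp]: "x \<in> elts B \<Longrightarrow> bbot \<preceq> x" using BL.bottom_lower[of x] by simp
lemma le_bbot_iff: "x \<in> elts B \<Longrightarrow> x \<preceq> bbot \<longleftrightarrow> x = bbot" using le_antisym[of x bbot] by auto

abbreviation bsup :: "'a set \<Rightarrow> 'a" where "bsup X \<equiv> \<Squnion>\<^bsub>\<BB>\<^esub> X"

lemma bsup:
  assumes "small X" "X \<subseteq> elts B"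
  shows bsup_in_B: "bsup X \<in> elts B" and bsup_upper: "\<And>x. x \<in> X \<Longrightarrow> x \<preceq> bsup X"
    and bsup_least: "\<And>z. z \<in> elts B \<Longrightarrow> (\<And>x. x \<in> X \<Longrightarrow> x \<preceq> z) \<Longrightarrow> bsup X \<preceq> z"
proof -
  note S = small_set_of[OF assms(1)]
  have "\<forall>A\<in>V. elts A \<subseteq> elts B \<longrightarrow> (\<exists>s. least \<BB> s (Upper \<BB> (elts A)))"
    using cba unfolding complete_boolean_algebra_def by blast
  then have "\<exists>s. least \<BB> s (Upper \<BB> X)" using S assms(2) by metis
  then have l: "least \<BB> (bsup X) (Upper \<BB> X)" unfolding sup_def by (rule someI_ex)
  show "bsup X \<in> elts B" using least_closed[OF l] by simp
  show "\<And>x. x \<in> X \<Longrightarrow> x \<preceq> bsup X" using l assms(2) by (auto simp: least_def Upper_def)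
  show "bsup X \<preceq> z" if "z \<in> elts B" "\<And>x. x \<in> X \<Longrightarrow> x \<preceq> z" for z
  proof -
    have "z \<in> Upper \<BB> X" using that by (auto simp: Upper_def)
    then show ?thesis using l by (simp add: least_def)
  qed
qed

lemma binf:
  assumes "small X" "X \<subseteq> elts B"
  shows binf_in_B: "\<Sqinter>\<^bsub>\<BB>\<^esub> X \<in> elts B" and binf_lower: "\<And>x. x \<in> X \<Longrightarrow> \<Sqinter>\<^bsub>\<BB>\<^esub> X \<preceq> x"
    and binf_greatest: "\<And>z. z \<in> elts B \<Longrightarrow> (\<And>x. x \<in> X \<Longrightarrow> z \<preceq> x) \<Longrightarrow> z \<preceq> \<Sqinter>\<^bsub>\<BB>\<^esub> X"
proof -
  note S = small_set_of[OF assms(1)]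
  have "\<forall>A\<in>V. elts A \<subseteq> elts B \<longrightarrow> (\<exists>s. greatest \<BB> s (Lower \<BB> (elts A)))"
    using cba unfolding complete_boolean_algebra_def by blast
  then have "\<exists>s. greatest \<BB> s (Lower \<BB> X)" using S assms(2) by metis
  then have l: "greatest \<BB> (\<Sqinter>\<^bsub>\<BB>\<^esub> X) (Lower \<BB> X)" unfolding inf_def by (rule someI_ex)
  show "\<Sqinter>\<^bsub>\<BB>\<^esub> X \<in> elts B" using greatest_closed[OF l] by simp
  show "\<And>x. x \<in> X \<Longrightarrow> \<Sqinter>\<^bsub>\<BB>\<^esub> X \<preceq> x" using l assms(2) by (auto simp: greatest_def Lower_def)
  show "z \<preceq> \<Sqinter>\<^bsub>\<BB>\<^esub> X" if "z \<in> elts B" "\<And>x. x \<in> X \<Longrightarrow> z \<preceq> x" for z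
  proof -
    have "z \<in> Lower \<BB> X" using that by (auto simp: Lower_def)
    then show ?thesis using l by (simp add: greatest_def)
  qed
qed

lemma small_B_Collect: "definable (\<lambda>v. P (v 0)) \<Longrightarrow> small {x \<in> elts B. P x}"
  by (rule small_Collect[OF small_elts[OF B_in_V]])

text \<open>
  Suprema of definable subsets of \<open>B\<close> exist without conditions on the predicate.  Operations that
  occur in definable predicates are written as such suprema, which makes them total and definable.
\<close>

lemma defterm_bsup:
  assumes X: "definable (\<lambda>v. P (v 0) (\<lambda>n. v (Suc n)))"
  shows "defterm (\<lambda>v. bsup {x \<in> elts B. P x v})"
proof -
  have sm: "small {x \<in> elts B. P x v}" if "range v \<subseteq> V" for v
    by (rule small_B_Collect, rule definable_fix[OF X that])
  have P2: "definable (\<lambda>v. P (v 0) (\<lambda>n. v (Suc (Suc n))))"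
    using definable_rename[OF X, of "\<lambda>n. case n of 0 \<Rightarrow> 0 | Suc m \<Rightarrow> Suc (Suc m)"] by simp
  have P3: "definable (\<lambda>v. P (v 0) (\<lambda>n. v (Suc (Suc (Suc n)))))"
    using definable_rename[OF X, of "\<lambda>n. case n of 0 \<Rightarrow> 0 | Suc m \<Rightarrow> Suc (Suc (Suc m))"] by simp
  show ?thesis
    unfolding defterm_def
  proof (intro conjI allI impI)
    fix v :: "nat \<Rightarrow> 'a" assume "range v \<subseteq> V"
    from bsup_in_B[OF sm[OF this]] show "bsup {x \<in> elts B. P x v} \<in> V" by (intro B_V) auto
  next
    have "definable (\<lambda>v. v 0 \<in> elts B \<and> (\<forall>x\<in>elts B. P x (\<lambda>n. v (Suc n)) \<longrightarrow> x \<preceq> v 0) \<and>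
      (\<forall>z\<in>elts B. (\<forall>x\<in>elts B. P x (\<lambda>n. v (Suc n)) \<longrightarrow> x \<preceq> z) \<longrightarrow> v 0 \<preceq> z))"
      by (intro definable_intros B_in_V P2 P3)
    then show "definable (\<lambda>v. v 0 = bsup {x \<in> elts B. P x (\<lambda>n. v (Suc n))})"
    proof (rule definable_cong)
      fix v :: "nat \<Rightarrow> 'a" assume "range v \<subseteq> V"
      then have "range (\<lambda>n. v (Suc n)) \<subseteq> V" by auto
      note S = bsup[OF sm[OF this]]
      let ?X = "{x \<in> elts B. P x (\<lambda>n. v (Suc n))}"
      have XB: "?X \<subseteq> elts B" by auto
      note S = S[OF XB]
      show "(v 0 \<in> elts B \<and> (\<forall>x\<in>elts B. P x (\<lambda>n. v (Suc n)) \<longrightarrow> x \<preceq> v 0) \<and>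
        (\<forall>z\<in>elts B. (\<forall>x\<in>elts B. P x (\<lambda>n. v (Suc n)) \<longrightarrow> x \<preceq> z) \<longrightarrow> v 0 \<preceq> z)) \<longleftrightarrow> v 0 = bsup ?X"
        (is "?l = ?r")
      proof
        assume l: ?l
        show ?r
          by (rule le_antisym) (use l S in auto)
      next
        assume r: ?r
        show ?l unfolding r using S by auto
      qed
    qed
  qed
qed

text \<open>
  On \<open>B\<close> this is the meet of the lattice; as a supremum it is also a definable term.
\<close>

definition bmeet :: "'a \<Rightarrow> 'a \<Rightarrow> 'a" where
  "bmeet x y = bsup {z \<in> elts B. z \<preceq> x \<and> z \<preceq> y}"

lemma defterm_bmeet [definable_intros]: "defterm t \<Longrightarrow> defterm s \<Longrightarrow> defterm (\<lambda>v. bmeet (t v) (s v))"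
proof (rule defterm2[where F = bmeet])
  show "defterm (\<lambda>v. bmeet (v 0) (v (Suc 0)))" unfolding bmeet_def by (intro defterm_bsup definable_intros)
qed

lemma bmeet_eq_meet: assumes "x \<in> elts B" "y \<in> elts B" shows "bmeet x y = x \<sqinter>\<^bsub>\<BB>\<^esub> y"
proof -
  have sm: "small {z \<in> elts B. z \<preceq> x \<and> z \<preceq> y}"
    by (intro small_B_Collect definable_intros B_V assms)
  note S = bsup[OF sm]
  have m: "x \<sqinter>\<^bsub>\<BB>\<^esub> y \<in> elts B" using BL.meet_closed[of x y] assms by simp
  have "x \<sqinter>\<^bsub>\<BB>\<^esub> y \<preceq> x" "x \<sqinter>\<^bsub>\<BB>\<^esub> y \<preceq> y"
    using BL.meet_left[of x y] BL.meet_right[of x y] assms by simp_all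
  then have 1: "x \<sqinter>\<^bsub>\<BB>\<^esub> y \<preceq> bmeet x y" unfolding bmeet_def using m by (intro S) auto
  have "z \<preceq> x \<sqinter>\<^bsub>\<BB>\<^esub> y" if "z \<in> elts B" "z \<preceq> x" "z \<preceq> y" for z
    using BL.meet_le[of z x y] that assms by simp
  then have 2: "bmeet x y \<preceq> x \<sqinter>\<^bsub>\<BB>\<^esub> y" unfolding bmeet_def using m by (intro S) auto
  have "bmeet x y \<in> elts B" unfolding bmeet_def by (rule S) auto
  then show ?thesis using le_antisym[OF 2 1] m by simp
qed

lemma bmeet:
  assumes "x \<in> elts B" "y \<in> elts B"
  shows bmeet_in_B: "bmeet x y \<in> elts B" and bmeet_le1: "bmeet x y \<preceq> x" and bmeet_le2: "bmeet x y \<preceq> y"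
  using BL.meet_closed[of x y] BL.meet_left[of x y] BL.meet_right[of x y] assms
  by (simp_all add: bmeet_eq_meet)

lemma bmeet_in_B' [simp]: "x \<in> elts B \<Longrightarrow> y \<in> elts B \<Longrightarrow> bmeet x y \<in> elts B" by (rule bmeet_in_B)

lemma le_bmeet_iff:
  assumes "x \<in> elts B" "y \<in> elts B" "z \<in> elts B"
  shows "z \<preceq> bmeet x y \<longleftrightarrow> z \<preceq> x \<and> z \<preceq> y"
proof
  assume A: "z \<preceq> bmeet x y"
  show "z \<preceq> x \<and> z \<preceq> y"
    using le_trans[OF A bmeet_le1[OF assms(1,2)]] le_trans[OF A bmeet_le2[OF assms(1,2)]] assms by simp
next
  assume "z \<preceq> x \<and> z \<preceq> y"
  then show "z \<preceq> bmeet x y" using BL.meet_le[of z x y] assms by (simp add: bmeet_eq_meet)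
qed

lemma bmeet_comm: assumes "x \<in> elts B" "y \<in> elts B" shows "bmeet x y = bmeet y x"
  by (rule le_antisym) (use assms in \<open>simp_all add: le_bmeet_iff bmeet_le1 bmeet_le2\<close>)

lemma bmeet_mono:
  assumes "x \<preceq> x'" "y \<preceq> y'" "x \<in> elts B" "y \<in> elts B" "x' \<in> elts B" "y' \<in> elts B"
  shows "bmeet x y \<preceq> bmeet x' y'"
  using assms le_trans[OF bmeet_le1 assms(1)] le_trans[OF bmeet_le2 assms(2)] by (simp add: le_bmeet_iff)

lemma bmeet_btop: "x \<in> elts B \<Longrightarrow> bmeet x btop = x" "x \<in> elts B \<Longrightarrow> bmeet btop x = x"
  by (rule le_antisym; simp add: le_bmeet_iff bmeet_le1 bmeet_le2)+

lemma bmeet_bbot: "x \<in> elts B \<Longrightarrow> bmeet x bbot = bbot" "x \<in> elts B \<Longrightarrow> bmeet bbot x = bbot"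
  using bmeet_le2[of x bbot] bmeet_le1[of bbot x] by (simp_all add: le_bbot_iff)

lemma bmeet_absorb: "x \<preceq> y \<Longrightarrow> x \<in> elts B \<Longrightarrow> y \<in> elts B \<Longrightarrow> bmeet x y = x"
  by (rule le_antisym) (simp_all add: le_bmeet_iff bmeet_le1)

abbreviation bjoin :: "'a \<Rightarrow> 'a \<Rightarrow> 'a" where "bjoin x y \<equiv> x \<squnion>\<^bsub>\<BB>\<^esub> y"

lemma bjoin:
  assumes "x \<in> elts B" "y \<in> elts B"
  shows bjoin_in_B: "bjoin x y \<in> elts B" and le_jn1: "x \<preceq> bjoin x y" and le_jn2: "y \<preceq> bjoin x y"
    and bjoin_le: "\<And>z. x \<preceq> z \<Longrightarrow> y \<preceq> z \<Longrightarrow> z \<in> elts B \<Longrightarrow> bjoin x y \<preceq> z"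
proof -
  show "bjoin x y \<in> elts B" "x \<preceq> bjoin x y" "y \<preceq> bjoin x y"
    using BL.join_closed[of x y] BL.join_left[of x y] BL.join_right[of x y] assms by simp_all
  show "bjoin x y \<preceq> z" if "x \<preceq> z" "y \<preceq> z" "z \<in> elts B" for z
    using BL.join_le[of x z y] that assms by simp
qed

lemma distrib:
  assumes "x \<in> elts B" "y \<in> elts B" "z \<in> elts B"
  shows "bmeet x (bjoin y z) = bjoin (bmeet x y) (bmeet x z)"
  using boolean assms by (simp add: boolean_lattice_def bmeet_eq_meet bjoin_in_B)

abbreviation bcompl :: "'a \<Rightarrow> 'a" where "bcompl x \<equiv> complement \<BB> x"

lemma complement_ex1:
  assumes x: "x \<in> elts B"
  shows "\<exists>!y. y \<in> elts B \<and> bmeet x y = bbot \<and> bjoin x y = btop"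
proof -
  obtain y where y: "y \<in> elts B" "bmeet x y = bbot" "bjoin x y = btop"
    using boolean x by (auto simp: boolean_lattice_def bmeet_eq_meet)
  have sub: "a \<preceq> b" if a: "a \<in> elts B" "bmeet x a = bbot" and b: "b \<in> elts B" "bjoin x b = btop" for a b
  proof -
    have "a = bmeet a (bjoin x b)" using a b by (simp add: bmeet_btop)
    also have "\<dots> = bjoin (bmeet a x) (bmeet a b)" by (rule distrib) (use x a b in auto)
    also have "bmeet a x = bbot" using a x bmeet_comm by simp
    finally have eq: "a = bjoin bbot (bmeet a b)" .
    have "bjoin bbot (bmeet a b) \<preceq> b" by (rule bjoin_le) (use a b in \<open>auto simp: bmeet_le2\<close>)
    then show ?thesis using eq by simp
  qed
  show ?thesis
  proof (rule ex1I[of _ y])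
    fix z assume z: "z \<in> elts B \<and> bmeet x z = bbot \<and> bjoin x z = btop"
    show "z = y" by (rule le_antisym) (use sub z y in auto)
  qed (use y in simp)
qed

lemma bcompl:
  assumes x: "x \<in> elts B"
  shows bcompl_in_B: "bcompl x \<in> elts B" and bmeet_bcompl: "bmeet x (bcompl x) = bbot" and bjoin_bcompl: "bjoin x (bcompl x) = btop"
proof -
  have "bcompl x = (THE y. y \<in> elts B \<and> bmeet x y = bbot \<and> bjoin x y = btop)"
    unfolding complement_def using x by (auto simp: bmeet_eq_meet intro!: arg_cong[where f = The])
  then show "bcompl x \<in> elts B" "bmeet x (bcompl x) = bbot" "bjoin x (bcompl x) = btop"
    using theI'[OF complement_ex1[OF x]] by simp_all
qed

lemma bcompl_in_B' [simp]: "x \<in> elts B \<Longrightarrow> bcompl x \<in> elts B" by (rule bcompl_in_B)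

text \<open>
  The Heyting adjunction, from which the infinite distributive law \<open>bmeet_bsup_le\<close> follows.
\<close>

lemma le_imp_iff:
  assumes x: "x \<in> elts B" and a: "a \<in> elts B" and c: "c \<in> elts B"
  shows "x \<preceq> bjoin (bcompl a) c \<longleftrightarrow> bmeet x a \<preceq> c"
proof
  note j = bjoin[OF bcompl_in_B[OF a] c]
  assume A: "x \<preceq> bjoin (bcompl a) c"
  have "bmeet x a = bmeet a x" using bmeet_comm[OF x a] .
  also have "\<dots> \<preceq> bmeet a (bjoin (bcompl a) c)" by (rule bmeet_mono) (use A a x j in auto)
  also have "bmeet a (bjoin (bcompl a) c) = bjoin (bmeet a (bcompl a)) (bmeet a c)" by (rule distrib) (use a c in auto)
  finally have 1: "bmeet x a \<preceq> bjoin (bmeet a (bcompl a)) (bmeet a c)" .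
  have 2: "bjoin (bmeet a (bcompl a)) (bmeet a c) \<preceq> c" by (rule bjoin_le) (use a c in \<open>auto simp: bmeet_le2 bmeet_bcompl\<close>)
  show "bmeet x a \<preceq> c" by (rule le_trans[OF 1 2]) (use x a c in \<open>auto intro!: bjoin_in_B\<close>)
next
  note j = bjoin[OF bcompl_in_B[OF a] c]
  assume A: "bmeet x a \<preceq> c"
  have "x = bmeet x (bjoin a (bcompl a))" using x a by (simp add: bjoin_bcompl bmeet_btop)
  also have "\<dots> = bjoin (bmeet x a) (bmeet x (bcompl a))" by (rule distrib) (use x a in auto)
  finally have eq: "x = bjoin (bmeet x a) (bmeet x (bcompl a))" .
  have "bjoin (bmeet x a) (bmeet x (bcompl a)) \<preceq> bjoin (bcompl a) c"
  proof (rule bjoin_le)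
    show "bmeet x a \<preceq> bjoin (bcompl a) c" by (rule le_trans[OF A j(3)]) (use x a c j in auto)
    show "bmeet x (bcompl a) \<preceq> bjoin (bcompl a) c"
      by (rule le_trans[OF bmeet_le2 j(2)]) (use x a c j in auto)
  qed (use x a j in auto)
  then show "x \<preceq> bjoin (bcompl a) c" using eq by simp
qed

lemma le_bcompl_iff:
  assumes x: "x \<in> elts B" and a: "a \<in> elts B"
  shows "x \<preceq> bcompl a \<longleftrightarrow> bmeet x a = bbot"
proof -
  have "bjoin (bcompl a) bbot = bcompl a"
    by (rule le_antisym, rule bjoin_le) (use a in \<open>auto intro!: le_jn1 bjoin_in_B\<close>)
  then show ?thesis using le_imp_iff[OF x a bbot_in_B] x a by (simp add: le_bbot_iff)
qed

lemma bmeet_bsup_le: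
  assumes "small X" "X \<subseteq> elts B" and a: "a \<in> elts B" and z: "z \<in> elts B"
    and le: "\<And>x. x \<in> X \<Longrightarrow> bmeet a x \<preceq> z"
  shows "bmeet a (bsup X) \<preceq> z"
proof -
  note S = bsup[OF assms(1,2)]
  have "bsup X \<preceq> bjoin (bcompl a) z"
  proof (rule S(3))
    fix x assume x: "x \<in> X"
    then have xB: "x \<in> elts B" using assms(2) by auto
    show "x \<preceq> bjoin (bcompl a) z"
      using le[OF x] bmeet_comm[OF xB a] le_imp_iff[OF xB a z] by simp
  qed (use a z in \<open>auto intro!: bjoin_in_B\<close>)
  then have "bmeet (bsup X) a \<preceq> z" using le_imp_iff[OF S(1) a z] by simp
  then show ?thesis using bmeet_comm[OF S(1) a] by simp
qed

lemma bmeet_bsup_eq_bbot: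
  assumes "small X" "X \<subseteq> elts B" and a: "a \<in> elts B" and "\<And>x. x \<in> X \<Longrightarrow> bmeet a x = bbot"
  shows "bmeet a (bsup X) = bbot"
proof -
  have "bmeet a (bsup X) \<preceq> bbot" by (rule bmeet_bsup_le[OF assms(1-3)]) (use assms(4) in auto)
  then show ?thesis using a bsup_in_B[OF assms(1,2)] by (simp add: le_bbot_iff)
qed

text \<open>
  Includes membership in \<open>B\<close> on both sides, so that transitivity has no side conditions.
\<close>

definition lesssim :: "'a \<Rightarrow> 'a \<Rightarrow> bool" (infix "\<lesssim>" 50) where
  "x \<lesssim> y \<longleftrightarrow> x \<in> elts B \<and> y \<in> elts B \<and> x \<preceq> y"

lemma definable_lesssim [definable_intros]: "defterm t \<Longrightarrow> defterm s \<Longrightarrow> definable (\<lambda>v. t v \<lesssim> s v)"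
  unfolding lesssim_def by (intro definable_intros B_in_V)

lemma lesssim_trans [trans]: "x \<lesssim> y \<Longrightarrow> y \<lesssim> z \<Longrightarrow> x \<lesssim> z"
  using le_trans by (auto simp: lesssim_def)

lemma lesssim_in_B: "x \<lesssim> y \<Longrightarrow> x \<in> elts B" "x \<lesssim> y \<Longrightarrow> y \<in> elts B"
  by (simp_all add: lesssim_def)

lemma lesssim_refl [simp]: "x \<in> elts B \<Longrightarrow> x \<lesssim> x"
  by (simp add: lesssim_def)

lemma lesssim_antisym: "x \<lesssim> y \<Longrightarrow> y \<lesssim> x \<Longrightarrow> x = y"
  using le_antisym by (auto simp: lesssim_def)

lemma lesssim_eqI:
  assumes "x \<in> elts B" "y \<in> elts B" "\<And>z. z \<in> elts B \<Longrightarrow> z \<lesssim> x \<longleftrightarrow> z \<lesssim> y"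
  shows "x = y"
  by (rule lesssim_antisym) (use assms lesssim_refl in blast)+

lemma lesssim_bmeet_iff: "x \<in> elts B \<Longrightarrow> y \<in> elts B \<Longrightarrow> z \<lesssim> bmeet x y \<longleftrightarrow> z \<lesssim> x \<and> z \<lesssim> y"
  using le_bmeet_iff by (auto simp: lesssim_def)

lemma bmeet_lesssim: "x \<in> elts B \<Longrightarrow> y \<in> elts B \<Longrightarrow> bmeet x y \<lesssim> x" "x \<in> elts B \<Longrightarrow> y \<in> elts B \<Longrightarrow> bmeet x y \<lesssim> y"
  by (simp_all add: lesssim_def bmeet_le1 bmeet_le2)

lemma lesssim_btop: "x \<in> elts B \<Longrightarrow> x \<lesssim> btop" and bbot_lesssim: "x \<in> elts B \<Longrightarrow> bbot \<lesssim> x"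
  by (simp_all add: lesssim_def)

lemma lesssim_bbot_iff: "x \<lesssim> bbot \<longleftrightarrow> x = bbot"
  using le_bbot_iff by (auto simp: lesssim_def)

text \<open>
  Infinite distributivity in forcing style: to bound \<open>y\<close> below a supremum it suffices to bound those \<open>y'\<close> below
  \<open>y\<close> that lie below a member of the family.  Later arguments about Boolean values are chains of such steps.
\<close>

lemma bsup_elim:
  assumes X: "small X" "X \<subseteq> elts B" and y: "y \<lesssim> bsup X" and z: "z \<in> elts B"
    and step: "\<And>x y'. x \<in> X \<Longrightarrow> y' \<lesssim> y \<Longrightarrow> y' \<lesssim> x \<Longrightarrow> y' \<lesssim> z"
  shows "y \<lesssim> z"
proof -
  note yB = lesssim_in_B(1)[OF y]
  have "bmeet y (bsup X) \<preceq> z"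
  proof (rule bmeet_bsup_le[OF X yB z])
    fix x assume x: "x \<in> X"
    then have xB: "x \<in> elts B" using X(2) by blast
    show "bmeet y x \<preceq> z" using step[OF x bmeet_lesssim[OF yB xB]] by (simp add: lesssim_def)
  qed
  moreover have "bmeet y (bsup X) = y"
    by (rule bmeet_absorb) (use y in \<open>simp_all add: lesssim_def\<close>)
  ultimately show ?thesis using yB z by (simp add: lesssim_def)
qed

lemma bsup_intro: "small X \<Longrightarrow> X \<subseteq> elts B \<Longrightarrow> x \<in> X \<Longrightarrow> y \<lesssim> x \<Longrightarrow> y \<lesssim> bsup X"
  by (rule lesssim_trans[of y x]) (auto simp: lesssim_def bsup_in_B bsup_upper)

lemma lesssim_imp_iff:
  assumes "a \<in> elts B" "c \<in> elts B" "x \<in> elts B"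
  shows "x \<lesssim> bjoin (bcompl a) c \<longleftrightarrow> (\<forall>y. y \<lesssim> x \<and> y \<lesssim> a \<longrightarrow> y \<lesssim> c)"
proof
  assume "x \<lesssim> bjoin (bcompl a) c"
  then have "bmeet x a \<lesssim> c" using le_imp_iff[OF assms(3,1,2)] assms by (simp add: lesssim_def)
  then show "\<forall>y. y \<lesssim> x \<and> y \<lesssim> a \<longrightarrow> y \<lesssim> c" using lesssim_bmeet_iff[OF assms(3,1)] lesssim_trans by blast
next
  assume "\<forall>y. y \<lesssim> x \<and> y \<lesssim> a \<longrightarrow> y \<lesssim> c"
  then have "bmeet x a \<lesssim> c" using bmeet_lesssim[OF assms(3,1)] by blast
  then show "x \<lesssim> bjoin (bcompl a) c"
    using le_imp_iff[OF assms(3,1,2)] assms by (simp add: lesssim_def bjoin_in_B)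
qed

lemma binf_eqI:
  assumes "X \<subseteq> elts B" "c \<in> elts B" "\<And>x. x \<in> X \<Longrightarrow> c \<preceq> x"
    "\<And>z. z \<in> elts B \<Longrightarrow> (\<And>x. x \<in> X \<Longrightarrow> z \<preceq> x) \<Longrightarrow> z \<preceq> c"
  shows "\<Sqinter>\<^bsub>\<BB>\<^esub> X = c"
proof -
  have U: "z \<in> Lower \<BB> X \<longleftrightarrow> z \<in> elts B \<and> (\<forall>x\<in>X. z \<preceq> x)" for z
    using assms(1) by (auto simp: Lower_def)
  have l: "greatest \<BB> c (Lower \<BB> X)" unfolding greatest_def using assms(2-4) U by auto
  have "greatest \<BB> (\<Sqinter>\<^bsub>\<BB>\<^esub> X) (Lower \<BB> X)" unfolding inf_def by (rule someI[of _ c]) (rule l)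
  from BL.greatest_unique[OF this l] show ?thesis .
qed

end

section \<open>Names\<close>

context zfc
begin

text \<open>
  A name refers to other names inside ordered pairs, so not to its own elements; induction on names therefore goes by
  rank rather than by membership.
\<close>

lemma rank_induct [consumes 2, case_names less]:
  assumes "x \<in> V" "definable (\<lambda>v. P (v 0))" "\<And>x. x \<in> V \<Longrightarrow> (\<And>y. y \<in> V \<Longrightarrow> rank y \<in> elts (rank x) \<Longrightarrow> P y) \<Longrightarrow> P x"
  shows "P x"
proof -
  note Pdfn = definable1_local[of P, OF assms(2)]
  have "\<forall>x\<in>V. rank x = a \<longrightarrow> P x" if "a \<in> V" for a
  proof (rule eps_induct[where P = "\<lambda>a. \<forall>x\<in>V. rank x = a \<longrightarrow> P x", OF that])
    show "definable (\<lambda>v. \<forall>x\<in>V. rank x = v 0 \<longrightarrow> P x)" by (intro definable_intros Pdfn)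
  next
    fix a assume IH: "\<And>b. b \<in> elts a \<Longrightarrow> \<forall>x\<in>V. rank x = b \<longrightarrow> P x"
    show "\<forall>x\<in>V. rank x = a \<longrightarrow> P x"
    proof (intro ballI impI)
      fix x assume x: "x \<in> V" "rank x = a"
      show "P x" by (rule assms(3)[OF x(1)]) (use IH x(2) in blast)
    qed
  qed
  then show ?thesis using assms(1) rank_in_V by blast
qed

lemma rank_opair:
  assumes "x \<in> V" "y \<in> V" "opair x y \<in> elts z" "z \<in> V"
  shows "rank x \<in> elts (rank z)"
proof -
  have o: "elts (opair x y) = {set_of {x}, set_of {x, y}}"
    using assms by (simp add: opair_def elts_set_of set_of_in_V)
  have 1: "rank x \<in> elts (rank (set_of {x}))"
    by (rule rank_mono) (use assms in \<open>simp_all add: elts_set_of set_of_in_V\<close>)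
  have 2: "rank (set_of {x}) \<in> elts (rank (opair x y))"
    by (rule rank_mono) (use o assms in auto)
  have 3: "rank (opair x y) \<in> elts (rank z)" by (rule rank_mono) (use assms in auto)
  show ?thesis
    by (rule rank_trans[OF rank_trans[OF 1 2] 3]) (use assms in auto)
qed

end

context zfc_cba
begin

text \<open>
  Being a name is equivalent to lying in a set closed in this sense (\<open>is_name_iff_closed\<close>): by foundation, the largest closed
  subset of a transitive set is also the least solution of the recursion for names.
\<close>

definition name_closed :: "'a \<Rightarrow> bool" where
  "name_closed M \<longleftrightarrow> (\<forall>y\<in>elts M. \<forall>p\<in>elts y. \<exists>\<sigma>\<in>elts M. \<exists>b\<in>elts B. p = opair \<sigma> b)"

lemma definable_name_closed [definable_intros]: "defterm t \<Longrightarrow> definable (\<lambda>v. name_closed (t v))"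
proof (rule definable1[where R = name_closed])
  show "definable (\<lambda>v. name_closed (v 0))" unfolding name_closed_def by (intro definable_intros B_in_V)
qed

lemma opair_in_transitive:
  assumes "transitive_set T" "y \<in> elts T" "opair \<sigma> b \<in> elts y" "\<sigma> \<in> V" "b \<in> V"
  shows "\<sigma> \<in> elts T"
proof -
  have "opair \<sigma> b \<in> elts T" using assms by (auto simp: transitive_set_def)
  from opair_components_in_transitive(1)[OF assms(1) this assms(4,5)] show ?thesis .
qed

lemma is_name_iff_closed: "is_name \<tau> \<longleftrightarrow> (\<exists>M\<in>V. name_closed M \<and> \<tau> \<in> elts M)"
proof
  assume "is_name \<tau>"
  then obtain t N where N: "N \<in> V"
    "elts N = {x \<in> elts t. \<forall>p\<in>elts x. \<exists>\<sigma>\<in>elts N. \<exists>b\<in>elts B. p = opair \<sigma> b}" "\<tau> \<in> elts N"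
    unfolding is_name_def by blast
  have "name_closed N" unfolding name_closed_def using N(2) by blast
  then show "\<exists>M\<in>V. name_closed M \<and> \<tau> \<in> elts M" using N by blast
next
  assume "\<exists>M\<in>V. name_closed M \<and> \<tau> \<in> elts M"
  then obtain M where M: "M \<in> V" "name_closed M" "\<tau> \<in> elts M" by blast
  obtain T where T: "transitive_set T" "\<tau> \<in> elts T" using ex_transitive_set elts_in_V[OF M(3)] by blast
  have TV: "T \<in> V" using T by (simp add: transitive_set_def)
  define X where "X = {y \<in> elts T. \<exists>M\<in>V. name_closed M \<and> elts M \<subseteq> elts T \<and> y \<in> elts M}"
  have sX: "small X"
    unfolding X_def by (rule small_Collect[OF small_elts[OF TV]]) (intro definable_intros TV)
  define N where "N = set_of X"
  have N: "N \<in> V" "elts N = X" using sX by (simp_all add: N_def small_set_of)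
  have closed: "\<exists>\<sigma>\<in>X. \<exists>b\<in>elts B. p = opair \<sigma> b" if y: "y \<in> X" and p: "p \<in> elts y" for y p
  proof -
    obtain M where M: "M \<in> V" "name_closed M" "elts M \<subseteq> elts T" "y \<in> elts M" using y unfolding X_def by blast
    then obtain \<sigma> b where s: "\<sigma> \<in> elts M" "b \<in> elts B" "p = opair \<sigma> b"
      using p unfolding name_closed_def by blast
    then have "\<sigma> \<in> X" using M unfolding X_def by blast
    then show ?thesis using s by blast
  qed
  have XT: "X \<subseteq> elts T" by (auto simp: X_def)
  have "elts N = {x \<in> elts T. \<forall>p\<in>elts x. \<exists>\<sigma>\<in>elts N. \<exists>b\<in>elts B. p = opair \<sigma> b}"
    unfolding N(2)
  proof (intro equalityI subsetI)
    fix x assume "x \<in> X"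
    then show "x \<in> {x \<in> elts T. \<forall>p\<in>elts x. \<exists>\<sigma>\<in>X. \<exists>b\<in>elts B. p = opair \<sigma> b}"
      using closed XT by blast
  next
    fix x assume "x \<in> {x \<in> elts T. \<forall>p\<in>elts x. \<exists>\<sigma>\<in>X. \<exists>b\<in>elts B. p = opair \<sigma> b}"
    then have x: "x \<in> elts T" "\<And>p. p \<in> elts x \<Longrightarrow> \<exists>\<sigma>\<in>X. \<exists>b\<in>elts B. p = opair \<sigma> b" by auto
    have s: "small (insert x X)" using sX elts_in_V[OF x(1)] by simp
    note S = small_set_of[OF s]
    have "name_closed (set_of (insert x X))"
      unfolding name_closed_def S(2) using x(2) closed by blast
    then have "\<exists>M\<in>V. name_closed M \<and> elts M \<subseteq> elts T \<and> x \<in> elts M"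
      by (intro bexI[of _ "set_of (insert x X)"]) (use S x(1) XT in auto)
    then show "x \<in> X" unfolding X_def using x(1) by blast
  qed
  moreover have "\<tau> \<in> elts N"
  proof -
    have s: "small {y \<in> elts M. y \<in> elts T}"
      by (rule small_Collect[OF small_elts[OF M(1)]]) (intro definable_intros TV)
    note S = small_set_of[OF s]
    have "name_closed (set_of {y \<in> elts M. y \<in> elts T})"
      unfolding name_closed_def S(2)
    proof (intro ballI)
      fix y p assume y: "y \<in> {y \<in> elts M. y \<in> elts T}" and p: "p \<in> elts y"
      then obtain \<sigma> b where s: "\<sigma> \<in> elts M" "b \<in> elts B" "p = opair \<sigma> b"
        using M(2) unfolding name_closed_def by blast
      have "\<sigma> \<in> elts T"
        by (rule opair_in_transitive[OF T(1), of y \<sigma> b]) (use y p s elts_in_V[OF s(1)] B_V[OF s(2)] in auto)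
      then show "\<exists>\<sigma>\<in>{y \<in> elts M. y \<in> elts T}. \<exists>b\<in>elts B. p = opair \<sigma> b" using s by blast
    qed
    then show ?thesis unfolding N(2) X_def using S T(2) M(3) by blast
  qed
  ultimately show "is_name \<tau>" unfolding is_name_def using T(1) N(1) by blast
qed

lemma is_name_in_V: "is_name \<tau> \<Longrightarrow> \<tau> \<in> V"
  unfolding is_name_iff_closed using elts_in_V by blast

lemma definable_is_name [definable_intros]: "defterm t \<Longrightarrow> definable (\<lambda>v. is_name (t v))"
  unfolding is_name_iff_closed by (rule definable1[where R = "\<lambda>x. \<exists>M\<in>V. name_closed M \<and> x \<in> elts M"]) (intro definable_intros)

lemma name_entry:
  assumes "is_name \<tau>" "p \<in> elts \<tau>"
  obtains \<sigma> b where "is_name \<sigma>" "b \<in> elts B" "p = opair \<sigma> b"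
proof -
  obtain M where M: "M \<in> V" "name_closed M" "\<tau> \<in> elts M" using assms(1) unfolding is_name_iff_closed by blast
  then obtain \<sigma> b where s: "\<sigma> \<in> elts M" "b \<in> elts B" "p = opair \<sigma> b"
    using assms(2) unfolding name_closed_def by blast
  then have "is_name \<sigma>" using M unfolding is_name_iff_closed by blast
  then show ?thesis using that s by blast
qed

lemma is_nameI:
  assumes t: "\<tau> \<in> V" and ent: "\<And>p. p \<in> elts \<tau> \<Longrightarrow> \<exists>\<sigma> b. is_name \<sigma> \<and> b \<in> elts B \<and> p = opair \<sigma> b"
  shows "is_name \<tau>"
proof -
  obtain T where T: "transitive_set T" "\<tau> \<in> elts T" using ex_transitive_set t by blast
  have TV: "T \<in> V" using T by (simp add: transitive_set_def)
  have "small {y \<in> elts T. is_name y}"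
    by (rule small_Collect[OF small_elts[OF TV]]) (intro definable_intros)
  then have "small (insert \<tau> {y \<in> elts T. is_name y})" using t by simp
  note S = small_set_of[OF this]
  have "name_closed (set_of (insert \<tau> {y \<in> elts T. is_name y}))"
    unfolding name_closed_def S(2)
  proof (intro ballI)
    fix y p assume y: "y \<in> insert \<tau> {y \<in> elts T. is_name y}" and p: "p \<in> elts y"
    have "\<exists>\<sigma> b. is_name \<sigma> \<and> b \<in> elts B \<and> p = opair \<sigma> b"
    proof (cases "y = \<tau>")
      case True
      then show ?thesis using ent p by blast
    next
      case False
      then have "is_name y" using y by blast
      then show ?thesis using name_entry[OF _ p] by metis
    qed
    then obtain \<sigma> b where s: "is_name \<sigma>" "b \<in> elts B" "p = opair \<sigma> b" by blast
    have "\<sigma> \<in> elts T"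
      by (rule opair_in_transitive[OF T(1), of y \<sigma> b]) (use y p s T(2) is_name_in_V[OF s(1)] B_V[OF s(2)] in auto)
    then show "\<exists>\<sigma>\<in>insert \<tau> {y \<in> elts T. is_name y}. \<exists>b\<in>elts B. p = opair \<sigma> b" using s by blast
  qed
  then have "\<exists>M\<in>V. name_closed M \<and> \<tau> \<in> elts M"
    by (intro bexI[of _ "set_of (insert \<tau> {y \<in> elts T. is_name y})"]) (use S in auto)
  then show ?thesis by (simp only: is_name_iff_closed)
qed

lemma entry:
  assumes "is_name \<tau>" "opair \<eta> b \<in> elts \<tau>" "\<eta> \<in> V" "b \<in> V"
  shows entry_name: "is_name \<eta>" and entry_B: "b \<in> elts B" and entry_rank: "rank \<eta> \<in> elts (rank \<tau>)"
proof -
  obtain \<sigma> c where s: "is_name \<sigma>" "c \<in> elts B" "opair \<eta> b = opair \<sigma> c"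
    using name_entry[OF assms(1,2)] by metis
  then have "\<eta> = \<sigma> \<and> b = c" using assms is_name_in_V[OF s(1)] B_V[OF s(2)] by simp
  then show "is_name \<eta>" "b \<in> elts B" using s by auto
  show "rank \<eta> \<in> elts (rank \<tau>)" by (rule rank_opair[OF assms(3,4,2) is_name_in_V[OF assms(1)]])
qed

lemma name_induct [consumes 2, case_names name]:
  assumes "is_name \<tau>" "definable (\<lambda>v. P (v 0))"
    "\<And>\<tau>. is_name \<tau> \<Longrightarrow> (\<And>\<eta> b. \<eta> \<in> V \<Longrightarrow> b \<in> V \<Longrightarrow> opair \<eta> b \<in> elts \<tau> \<Longrightarrow> P \<eta>) \<Longrightarrow> P \<tau>"
  shows "P \<tau>"
proof -
  note Pdfn = definable1_local[of P, OF assms(2)]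
  have "is_name \<tau> \<longrightarrow> P \<tau>"
  proof (rule rank_induct[where P = "\<lambda>\<tau>. is_name \<tau> \<longrightarrow> P \<tau>", OF is_name_in_V[OF assms(1)]])
    show "definable (\<lambda>v. is_name (v 0) \<longrightarrow> P (v 0))" by (intro definable_intros Pdfn)
  next
    fix x assume x: "x \<in> V" and IH: "\<And>y. y \<in> V \<Longrightarrow> rank y \<in> elts (rank x) \<Longrightarrow> is_name y \<longrightarrow> P y"
    show "is_name x \<longrightarrow> P x"
    proof
      assume n: "is_name x"
      show "P x"
      proof (rule assms(3)[OF n])
        fix \<eta> b assume "\<eta> \<in> V" "b \<in> V" "opair \<eta> b \<in> elts x"
        then show "P \<eta>" using entry[OF n] IH by blast
      qed
    qed
  qed
  then show ?thesis using assms(1) by blast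
qed

text \<open>
  The sets of names on which Boolean values can be computed.
\<close>

definition closed_names :: "'a \<Rightarrow> bool" where
  "closed_names N \<longleftrightarrow> N \<in> V \<and> (\<forall>\<tau>\<in>elts N. is_name \<tau> \<and> name_dom \<tau> \<subseteq> elts N)"

text \<open>
  These sets are closed, and for suitable \<open>x\<close> they contain any given names.
\<close>

definition names_below :: "'a \<Rightarrow> 'a" where
  "names_below x = cset (\<lambda>y. is_name y \<and> rank y \<in> elts (rank x))"

lemma defterm_names_below [definable_intros]: "defterm t \<Longrightarrow> defterm (\<lambda>v. names_below (t v))"
proof (rule defterm1[where F = names_below])
  show "defterm (\<lambda>v. names_below (v 0))" unfolding names_below_def by (intro definable_intros)
qed

lemma elts_names_below:
  assumes "x \<in> V" shows "elts (names_below x) = {y. is_name y \<and> rank y \<in> elts (rank x)}"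
proof -
  have eq: "{y \<in> V. is_name y \<and> rank y \<in> elts (rank x)} = {y \<in> {y \<in> V. rank y \<in> elts (rank x)}. is_name y}"
    by auto
  have "small {y \<in> V. is_name y \<and> rank y \<in> elts (rank x)}"
    unfolding eq by (rule small_Collect[OF small_rank_less[OF rank_in_V[OF assms]]]) (intro definable_intros)
  from elts_cset[OF this] show ?thesis unfolding names_below_def using is_name_in_V by auto
qed

lemma closed_names_below:
  assumes "x \<in> V" shows "closed_names (names_below x)"
  unfolding closed_names_def elts_names_below[OF assms]
proof (intro conjI ballI)
  show "names_below x \<in> V" by (simp add: names_below_def)
next
  fix \<tau> assume t: "\<tau> \<in> {y. is_name y \<and> rank y \<in> elts (rank x)}"
  then show "is_name \<tau>" by simp
  show "name_dom \<tau> \<subseteq> {y. is_name y \<and> rank y \<in> elts (rank x)}"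
  proof
    fix \<eta> assume "\<eta> \<in> name_dom \<tau>"
    then obtain b where b: "\<eta> \<in> V" "b \<in> V" "opair \<eta> b \<in> elts \<tau>" by (auto simp: name_dom_def)
    have "is_name \<tau>" using t by simp
    from entry[OF this b(3,1,2)] show "\<eta> \<in> {y. is_name y \<and> rank y \<in> elts (rank x)}"
      using t rank_trans[OF _ _ assms] by blast
  qed
qed

lemma closed_names_entry:
  assumes "closed_names N" "\<tau> \<in> elts N" "opair \<eta> b \<in> elts \<tau>" "\<eta> \<in> V" "b \<in> V"
  shows "\<eta> \<in> elts N" "b \<in> elts B"
proof -
  have "is_name \<tau>" "name_dom \<tau> \<subseteq> elts N" using assms(1,2) by (auto simp: closed_names_def)
  then show "\<eta> \<in> elts N" "b \<in> elts B" using entry(2)[of \<tau> \<eta> b] assms by (auto simp: name_dom_def)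
qed

section \<open>Boolean values on a set of names\<close>

text \<open>
  The Boolean values are computed by a recursion for equality alone, in the form
  \<open>x \<lesssim> [\<tau> = \<sigma>]\<close> iff \<open>x \<sqinter> b \<lesssim> [\<eta> \<in> \<sigma>]\<close> for all \<open>(\<eta>, b)\<close> in \<open>\<tau>\<close> and \<open>x \<sqinter> b \<lesssim> [\<eta> \<in> \<tau>]\<close> for all
  \<open>(\<eta>, b)\<close> in \<open>\<sigma>\<close>.  Unlike the defining equations, which ask for \<open>[\<eta> \<in> \<tau>]\<close> with \<open>\<eta>\<close> in the domain of \<open>\<tau>\<close>, it only
  uses \<open>[\<eta> = \<eta>']\<close> with \<open>\<eta>\<close> from \<open>\<tau>\<close> and \<open>\<eta>'\<close> from \<open>\<sigma>\<close>, so that it is a recursion on \<open>\<tau>\<close> for all \<open>\<sigma>\<close> in a fixed set.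
  Here \<open>mem_sum\<close> is \<open>[\<tau> \<in> \<sigma>]\<close>, and \<open>mem_sum_left\<close> is \<open>[\<sigma> \<in> \<tau>]\<close> with the arguments of equality exchanged.
\<close>

definition mem_sum :: "('a \<Rightarrow> 'a \<Rightarrow> 'a) \<Rightarrow> 'a \<Rightarrow> 'a \<Rightarrow> 'a" where
  "mem_sum e \<tau> \<sigma> = bsup {z \<in> elts B. \<exists>\<eta>\<in>V. \<exists>b\<in>V. opair \<eta> b \<in> elts \<sigma> \<and> z = bmeet (e \<tau> \<eta>) b}"

definition mem_sum_left :: "('a \<Rightarrow> 'a \<Rightarrow> 'a) \<Rightarrow> 'a \<Rightarrow> 'a \<Rightarrow> 'a" where
  "mem_sum_left e \<tau> \<sigma> = bsup {z \<in> elts B. \<exists>\<eta>\<in>V. \<exists>b\<in>V. opair \<eta> b \<in> elts \<tau> \<and> z = bmeet (e \<eta> \<sigma>) b}"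

definition eq_step :: "('a \<Rightarrow> 'a \<Rightarrow> 'a) \<Rightarrow> 'a \<Rightarrow> 'a \<Rightarrow> 'a" where
  "eq_step e \<tau> \<sigma> = bsup {x \<in> elts B.
     (\<forall>\<eta>\<in>V. \<forall>b\<in>V. opair \<eta> b \<in> elts \<tau> \<longrightarrow> bmeet x b \<preceq> mem_sum e \<eta> \<sigma>) \<and>
     (\<forall>\<eta>\<in>V. \<forall>b\<in>V. opair \<eta> b \<in> elts \<sigma> \<longrightarrow> bmeet x b \<preceq> mem_sum_left e \<tau> \<eta>)}"

abbreviation (input) app2 :: "'a \<Rightarrow> 'a \<Rightarrow> 'a \<Rightarrow> 'a" where
  "app2 g x y \<equiv> app0 (app0 g x) y"

lemma defterm_mem_sum_app2: "defterm r \<Longrightarrow> defterm t \<Longrightarrow> defterm s \<Longrightarrow> defterm (\<lambda>v. mem_sum (app2 (r v)) (t v) (s v))"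
proof (rule defterm3[where F = "\<lambda>g. mem_sum (app2 g)"])
  show "defterm (\<lambda>v. mem_sum (app2 (v 0)) (v (Suc 0)) (v (Suc (Suc 0))))"
    unfolding mem_sum_def by (intro defterm_bsup definable_intros)
qed

lemma defterm_mem_sum_left_app2: "defterm r \<Longrightarrow> defterm t \<Longrightarrow> defterm s \<Longrightarrow> defterm (\<lambda>v. mem_sum_left (app2 (r v)) (t v) (s v))"
proof (rule defterm3[where F = "\<lambda>g. mem_sum_left (app2 g)"])
  show "defterm (\<lambda>v. mem_sum_left (app2 (v 0)) (v (Suc 0)) (v (Suc (Suc 0))))"
    unfolding mem_sum_left_def by (intro defterm_bsup definable_intros)
qed

lemma defterm_eq_step_app2: "defterm r \<Longrightarrow> defterm t \<Longrightarrow> defterm s \<Longrightarrow> defterm (\<lambda>v. eq_step (app2 (r v)) (t v) (s v))"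
proof (rule defterm3[where F = "\<lambda>g. eq_step (app2 g)"])
  show "defterm (\<lambda>v. eq_step (app2 (v 0)) (v (Suc 0)) (v (Suc (Suc 0))))"
    unfolding eq_step_def by (intro defterm_bsup definable_intros defterm_mem_sum_app2 defterm_mem_sum_left_app2)
qed

lemma eq_step_cong:
  assumes "\<And>\<eta> b \<rho>. \<eta> \<in> V \<Longrightarrow> b \<in> V \<Longrightarrow> opair \<eta> b \<in> elts \<tau> \<Longrightarrow> e \<eta> \<rho> = e' \<eta> \<rho>"
  shows "eq_step e \<tau> \<sigma> = eq_step e' \<tau> \<sigma>"
proof -
  have 1: "mem_sum e \<eta> \<rho> = mem_sum e' \<eta> \<rho>" if "\<eta> \<in> V" "b \<in> V" "opair \<eta> b \<in> elts \<tau>" for \<eta> b \<rho>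
    unfolding mem_sum_def using assms[OF that] by simp
  have 2: "mem_sum_left e \<tau> \<rho> = mem_sum_left e' \<tau> \<rho>" for \<rho>
    unfolding mem_sum_left_def using assms by (intro arg_cong[where f = bsup]) (auto; metis)
  show ?thesis
    unfolding eq_step_def 2 using 1 by (intro arg_cong[where f = bsup]) (auto; metis)
qed

text \<open>
  The function \<open>\<sigma> \<mapsto> [\<tau> = \<sigma>]\<close> on \<open>N\<close>, computed from the rows collected in \<open>g\<close>.
\<close>

definition eq_row :: "'a \<Rightarrow> 'a \<Rightarrow> 'a \<Rightarrow> 'a" where
  "eq_row N g \<tau> = lam (elts N) (eq_step (app2 g) \<tau>)"

text \<open>
  The value for \<open>\<tau>\<close> depends on the values for elements of elements of elements of \<open>\<tau>\<close>, while \<open>rec_in\<close> only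
  gives access to elements.  So the recursion accumulates, in \<open>acc N x\<close>, the values for \<open>x\<close> and for all sets in its
  transitive closure.
\<close>

definition acc_insert :: "'a \<Rightarrow> 'a \<Rightarrow> 'a \<Rightarrow> 'a" where
  "acc_insert N u x = set_of (insert (opair x (eq_row N u x)) (elts u))"

definition acc_union :: "('a \<Rightarrow> 'a) \<Rightarrow> 'a \<Rightarrow> 'a" where
  "acc_union F x = set_of (\<Union>y\<in>elts x. elts (F y))"

definition acc :: "'a \<Rightarrow> 'a \<Rightarrow> 'a" where
  "acc N = rec_in (\<lambda>F x. acc_insert N (acc_union F x) x)"

lemma defterm_eq_step_row: assumes "g \<in> V" "\<tau> \<in> V" shows "defterm (\<lambda>v. eq_step (app2 g) \<tau> (v 0))"
  by (intro defterm_eq_step_app2 definable_intros assms)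

lemma defterm_eq_row [definable_intros]: "defterm r \<Longrightarrow> defterm t \<Longrightarrow> defterm s \<Longrightarrow> defterm (\<lambda>v. eq_row (r v) (t v) (s v))"
proof (rule defterm3[where F = eq_row])
  show "defterm (\<lambda>v. eq_row (v 0) (v (Suc 0)) (v (Suc (Suc 0))))"
    unfolding eq_row_def lam_def
  proof (rule defterm_set_of)
    fix v :: "nat \<Rightarrow> 'a" assume "range v \<subseteq> V"
    then have "v 0 \<in> V" "v (Suc 0) \<in> V" "v (Suc (Suc 0)) \<in> V" by auto
    then show "small ((\<lambda>x. opair x (eq_step (app2 (v (Suc 0))) (v (Suc (Suc 0))) x)) ` elts (v 0))"
      by (intro small_graph[where F = "eq_step (app2 (v (Suc 0))) (v (Suc (Suc 0)))"] small_elts defterm_eq_step_row)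
  next
    show "definable (\<lambda>v. v 0 \<in> (\<lambda>x. opair x (eq_step (app2 (v (Suc (Suc 0)))) (v (Suc (Suc (Suc 0)))) x)) ` elts (v (Suc 0)))"
      unfolding image_iff by (intro definable_intros defterm_eq_step_app2)
  qed
qed

lemma defterm_acc_insert [definable_intros]: "defterm r \<Longrightarrow> defterm t \<Longrightarrow> defterm s \<Longrightarrow> defterm (\<lambda>v. acc_insert (r v) (t v) (s v))"
  unfolding acc_insert_def by (intro definable_intros)

lemma small_acc_union: "g \<in> V \<Longrightarrow> x \<in> V \<Longrightarrow> small (\<Union>y\<in>elts x. elts (app0 g y))"
  by (rule small_UN[where F = "app0 g", OF small_elts]) (assumption, intro definable_intros)

lemma defterm_acc_union: "defterm t \<Longrightarrow> defterm s \<Longrightarrow> defterm (\<lambda>v. acc_union (app0 (t v)) (s v))"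
proof (rule defterm2[where F = "\<lambda>g. acc_union (app0 g)"])
  show "defterm (\<lambda>v. acc_union (app0 (v 0)) (v (Suc 0)))"
    unfolding acc_union_def
  proof (rule defterm_set_of)
    fix v :: "nat \<Rightarrow> 'a" assume "range v \<subseteq> V"
    then show "small (\<Union>y\<in>elts (v (Suc 0)). elts (app0 (v 0) y))" by (intro small_acc_union) auto
  next
    show "definable (\<lambda>v. v 0 \<in> (\<Union>y\<in>elts (v (Suc (Suc 0))). elts (app0 (v (Suc 0)) y)))"
      unfolding UN_iff by (intro definable_intros)
  qed
qed

lemma acc_cong:
  assumes "\<And>y. y \<in> elts x \<Longrightarrow> F y = G y"
  shows "acc_insert N (acc_union F x) x = acc_insert N (acc_union G x) x"
  using assms by (simp add: acc_union_def)

lemma defterm_acc_step: "defterm (\<lambda>v. acc_insert (v 0) (acc_union (app0 (v (Suc 0))) (v (Suc (Suc 0)))) (v (Suc (Suc 0))))"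
  by (intro definable_intros defterm_acc_union)

lemmas acc_rec =
  rec_in_in_V[where H = "\<lambda>N F x. acc_insert N (acc_union F x) x", OF acc_cong defterm_acc_step, folded acc_def]
  rec_in_unfold[where H = "\<lambda>N F x. acc_insert N (acc_union F x) x", OF acc_cong defterm_acc_step, folded acc_def]
  rec_in_defterm[where H = "\<lambda>N F x. acc_insert N (acc_union F x) x", OF acc_cong defterm_acc_step, folded acc_def]

lemma defterm_acc [definable_intros]: "defterm t \<Longrightarrow> defterm s \<Longrightarrow> defterm (\<lambda>v. acc (t v) (s v))"
  by (rule acc_rec(3)) auto

definition acc_below :: "'a \<Rightarrow> 'a \<Rightarrow> 'a" where "acc_below N x = acc_union (acc N) x"

definition eq_fun :: "'a \<Rightarrow> 'a \<Rightarrow> 'a" where "eq_fun N x = eq_row N (acc_below N x) x"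

lemma acc_below: assumes "N \<in> V" "x \<in> V"
  shows acc_below_in_V: "acc_below N x \<in> V" and elts_acc_below: "elts (acc_below N x) = (\<Union>y\<in>elts x. elts (acc N y))"
proof -
  have "defterm (\<lambda>v. acc N (v 0))" by (intro definable_intros assms)
  note S = small_set_of[OF small_UN[where F = "acc N", OF small_elts[OF assms(2)] this]]
  show "acc_below N x \<in> V" "elts (acc_below N x) = (\<Union>y\<in>elts x. elts (acc N y))"
    using S by (simp_all add: acc_below_def acc_union_def)
qed

lemma defterm_acc_below [definable_intros]: "defterm t \<Longrightarrow> defterm s \<Longrightarrow> defterm (\<lambda>v. acc_below (t v) (s v))"
proof (rule defterm2[where F = acc_below])
  show "defterm (\<lambda>v. acc_below (v 0) (v (Suc 0)))"
    unfolding acc_below_def acc_union_def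
  proof (rule defterm_set_of)
    fix v :: "nat \<Rightarrow> 'a" assume "range v \<subseteq> V"
    then have v: "v 0 \<in> V" "v (Suc 0) \<in> V" by auto
    have "defterm (\<lambda>w. acc (v 0) (w 0))" by (intro definable_intros v)
    then show "small (\<Union>y\<in>elts (v (Suc 0)). elts (acc (v 0) y))"
      by (rule small_UN[OF small_elts[OF v(2)]])
  next
    show "definable (\<lambda>v. v 0 \<in> (\<Union>y\<in>elts (v (Suc (Suc 0))). elts (acc (v (Suc 0)) y)))"
      unfolding UN_iff by (intro definable_intros)
  qed
qed

lemma defterm_eq_fun [definable_intros]: "defterm t \<Longrightarrow> defterm s \<Longrightarrow> defterm (\<lambda>v. eq_fun (t v) (s v))"
proof (rule defterm2[where F = eq_fun])
  show "defterm (\<lambda>v. eq_fun (v 0) (v (Suc 0)))" unfolding eq_fun_def by (intro definable_intros)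
qed

lemma eq_fun_in_V: "N \<in> V \<Longrightarrow> x \<in> V \<Longrightarrow> eq_fun N x \<in> V"
  unfolding eq_fun_def eq_row_def by (rule lam_in_V[OF small_elts defterm_eq_step_row[OF acc_below_in_V]])

lemma elts_acc:
  assumes "N \<in> V" "x \<in> V"
  shows "elts (acc N x) = insert (opair x (eq_fun N x)) (elts (acc_below N x))"
proof -
  have "acc N x = acc_insert N (acc_below N x) x"
    unfolding acc_below_def by (rule acc_rec(2)[OF _ assms]) simp_all
  then show ?thesis
    using eq_fun_in_V[OF assms] acc_below_in_V[OF assms] assms(2)
    by (simp add: acc_insert_def elts_set_of flip: eq_fun_def)
qed

lemma acc_graph:
  assumes N: "N \<in> V" and x: "x \<in> V"
  shows "\<forall>p\<in>elts (acc N x). \<exists>z\<in>V. p = opair z (eq_fun N z)"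
proof (rule eps_induct[where P = "\<lambda>x. \<forall>p\<in>elts (acc N x). \<exists>z\<in>V. p = opair z (eq_fun N z)", OF x])
  show "definable (\<lambda>v. \<forall>p\<in>elts (acc N (v 0)). \<exists>z\<in>V. p = opair z (eq_fun N z))" by (intro definable_intros N)
next
  fix x assume x: "x \<in> V" and IH: "\<And>y. y \<in> elts x \<Longrightarrow> \<forall>p\<in>elts (acc N y). \<exists>z\<in>V. p = opair z (eq_fun N z)"
  show "\<forall>p\<in>elts (acc N x). \<exists>z\<in>V. p = opair z (eq_fun N z)"
    unfolding elts_acc[OF N x] elts_acc_below[OF N x] using IH x by blast
qed

text \<open>
  The values accumulated at the first component of a pair are handed on through its singleton and through the pair, and so reach \<open>x\<close>.
\<close>

lemma app_acc_below:
  assumes N: "N \<in> V" and x: "x \<in> V" and z: "z \<in> V" and b: "b \<in> V" and zx: "opair z b \<in> elts x"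
  shows "app0 (acc_below N x) z = eq_fun N z"
  unfolding app0_def
proof (rule the0_equality[OF eq_fun_in_V[OF N z]])
  let ?s = "set_of {z}"
  have s: "?s \<in> V" "elts ?s = {z}" using z by (simp_all add: set_of_in_V elts_set_of)
  have "?s \<in> elts (opair z b)" using z b by (simp add: opair_def elts_set_of set_of_in_V)
  then have "elts (acc N ?s) \<subseteq> elts (acc N (opair z b))"
    using elts_acc[OF N] elts_acc_below[OF N] z b by auto
  moreover have "elts (acc N z) \<subseteq> elts (acc N ?s)"
    using elts_acc[OF N s(1)] elts_acc_below[OF N s(1)] s(2) by auto
  moreover have "opair z (eq_fun N z) \<in> elts (acc N z)" using elts_acc[OF N z] by simp
  ultimately show "opair z (eq_fun N z) \<in> elts (acc_below N x)"
    using elts_acc_below[OF N x] zx by blast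
next
  fix y assume y: "y \<in> V" "opair z y \<in> elts (acc_below N x)"
  then obtain w where w: "w \<in> elts x" "opair z y \<in> elts (acc N w)" using elts_acc_below[OF N x] by blast
  then obtain z' where z': "z' \<in> V" "opair z y = opair z' (eq_fun N z')"
    using acc_graph[OF N elts_in_V[OF w(1)]] by blast
  then show "y = eq_fun N z" using z y(1) eq_fun_in_V[OF N z'(1)] by simp
qed

definition beq_on :: "'a \<Rightarrow> 'a \<Rightarrow> 'a \<Rightarrow> 'a" where "beq_on N \<tau> \<sigma> = app0 (eq_fun N \<tau>) \<sigma>"

lemma defterm_beq_on [definable_intros]: "defterm r \<Longrightarrow> defterm t \<Longrightarrow> defterm s \<Longrightarrow> defterm (\<lambda>v. beq_on (r v) (t v) (s v))"
  unfolding beq_on_def by (intro definable_intros)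

lemma beq_on_unfold:
  assumes N: "N \<in> V" and t: "\<tau> \<in> V" and s: "\<sigma> \<in> elts N"
  shows "beq_on N \<tau> \<sigma> = eq_step (beq_on N) \<tau> \<sigma>"
proof -
  have "beq_on N \<tau> \<sigma> = eq_step (app2 (acc_below N \<tau>)) \<tau> \<sigma>"
    unfolding beq_on_def eq_fun_def eq_row_def
    by (rule app0_lam[OF small_elts[OF N] defterm_eq_step_row[OF acc_below_in_V[OF N t] t] s])
  also have "\<dots> = eq_step (beq_on N) \<tau> \<sigma>"
    by (rule eq_step_cong) (simp add: beq_on_def app_acc_below[OF N t])
  finally show ?thesis .
qed

end

section \<open>Boolean equality is a congruence\<close>

context zfc
begin

definition lam2 :: "'a \<Rightarrow> ('a \<Rightarrow> 'a \<Rightarrow> 'a) \<Rightarrow> 'a" where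
  "lam2 N F = set_of {opair (opair x y) (F x y) | x y. x \<in> elts N \<and> y \<in> elts N}"

lemma lam2:
  assumes NV: "N \<in> V" and F: "defterm (\<lambda>v. F (v 0) (v (Suc 0)))"
  shows fun_on_lam2: "fun_on (lam2 N F) {opair \<tau> \<sigma> | \<tau> \<sigma>. \<tau> \<in> elts N \<and> \<sigma> \<in> elts N}"
    and app_lam2: "\<And>\<tau> \<sigma>. \<tau> \<in> elts N \<Longrightarrow> \<sigma> \<in> elts N \<Longrightarrow> app (lam2 N F) (opair \<tau> \<sigma>) = F \<tau> \<sigma>"
proof -
  have N_V: "x \<in> V" if "x \<in> elts N" for x using that by (rule elts_in_V)
  have FV: "F x y \<in> V" if "x \<in> elts N" "y \<in> elts N" for x y
    using defterm_closed[OF F, of "scons x (\<lambda>_. y)"] N_V[OF that(1)] N_V[OF that(2)] by auto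
  have "small {opair (opair x y) (F x y) | x y. x \<in> elts N \<and> y \<in> elts N}"
    by (rule small_image2[OF small_elts[OF NV] small_elts[OF NV], where F = "\<lambda>x y. opair (opair x y) (F x y)"])
      (intro definable_intros F)
  note S = small_set_of[OF this, folded lam2_def]
  have graph: "opair (opair x y) z \<in> elts (lam2 N F) \<longleftrightarrow> z = F x y" if "x \<in> elts N" "y \<in> elts N" "z \<in> V" for x y z
  proof
    assume "opair (opair x y) z \<in> elts (lam2 N F)"
    then obtain x' y' where xy: "x' \<in> elts N" "y' \<in> elts N" "opair (opair x y) z = opair (opair x' y') (F x' y')"
      unfolding S(2) by blast
    then show "z = F x y" using that FV[OF xy(1,2)] N_V[OF that(1)] N_V[OF that(2)] N_V[OF xy(1)] N_V[OF xy(2)] by simp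
  qed (use that in \<open>auto simp: S(2)\<close>)
  show f: "fun_on (lam2 N F) {opair \<tau> \<sigma> | \<tau> \<sigma>. \<tau> \<in> elts N \<and> \<sigma> \<in> elts N}"
    unfolding fun_on_def
  proof (intro conjI ballI)
    show "lam2 N F \<in> V" by (rule S)
  next
    fix p assume "p \<in> elts (lam2 N F)"
    then show "\<exists>x\<in>{opair \<tau> \<sigma> | \<tau> \<sigma>. \<tau> \<in> elts N \<and> \<sigma> \<in> elts N}. \<exists>y\<in>V. p = opair x y"
      unfolding S(2) using FV by blast
  next
    fix x assume "x \<in> {opair \<tau> \<sigma> | \<tau> \<sigma>. \<tau> \<in> elts N \<and> \<sigma> \<in> elts N}"
    then obtain \<tau> \<sigma> where ts: "\<tau> \<in> elts N" "\<sigma> \<in> elts N" "x = opair \<tau> \<sigma>" by blast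
    show "\<exists>!y. y \<in> V \<and> opair x y \<in> elts (lam2 N F)"
      unfolding ts(3) by (rule ex1I[of _ "F \<tau> \<sigma>"]) (use graph[OF ts(1,2)] FV[OF ts(1,2)] in auto)
  qed
  fix \<tau> \<sigma> assume ts: "\<tau> \<in> elts N" "\<sigma> \<in> elts N"
  then have x: "opair \<tau> \<sigma> \<in> {opair \<tau> \<sigma> | \<tau> \<sigma>. \<tau> \<in> elts N \<and> \<sigma> \<in> elts N}" by blast
  show "app (lam2 N F) (opair \<tau> \<sigma>) = F \<tau> \<sigma>"
    using graph[OF ts fun_on_app_in_V[OF f x]] fun_on_app_graph[OF f x] by simp
qed

end

context zfc_cba
begin

context
  fixes N
  assumes N: "closed_names N"
begin

private lemma NV: "N \<in> V" using N by (simp add: closed_names_def)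

private lemma N_name: "\<tau> \<in> elts N \<Longrightarrow> is_name \<tau>" using N by (auto simp: closed_names_def)

private lemma N_V: "\<tau> \<in> elts N \<Longrightarrow> \<tau> \<in> V" by (rule elts_in_V)

private lemmas N_entry = closed_names_entry[OF N]

private abbreviation (input) e where "e \<equiv> beq_on N"
private abbreviation (input) m where "m \<equiv> mem_sum (beq_on N)"

private lemma small_mem_sum: "\<tau> \<in> V \<Longrightarrow> \<sigma> \<in> V \<Longrightarrow> small {z \<in> elts B. \<exists>\<eta>\<in>V. \<exists>b\<in>V. opair \<eta> b \<in> elts \<sigma> \<and> z = bmeet (e \<tau> \<eta>) b}"
  by (rule small_B_Collect) (intro definable_intros NV)

lemma defterm_mem_sum_beq_on: "defterm t \<Longrightarrow> defterm s \<Longrightarrow> defterm (\<lambda>v. m (t v) (s v))"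
proof (rule defterm2[where F = m])
  show "defterm (\<lambda>v. m (v 0) (v (Suc 0)))" unfolding mem_sum_def by (intro defterm_bsup definable_intros NV)
qed

lemma defterm_mem_sum_left_beq_on: "defterm t \<Longrightarrow> defterm s \<Longrightarrow> defterm (\<lambda>v. mem_sum_left e (t v) (s v))"
proof (rule defterm2[where F = "mem_sum_left e"])
  show "defterm (\<lambda>v. mem_sum_left e (v 0) (v (Suc 0)))" unfolding mem_sum_left_def by (intro defterm_bsup definable_intros NV)
qed

lemma mem_sum_in_B: "\<tau> \<in> V \<Longrightarrow> \<sigma> \<in> V \<Longrightarrow> m \<tau> \<sigma> \<in> elts B"
  unfolding mem_sum_def by (rule bsup_in_B[OF small_mem_sum]) auto

private lemma small_eq_step: "\<tau> \<in> V \<Longrightarrow> \<sigma> \<in> V \<Longrightarrow> small {x \<in> elts B.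
     (\<forall>\<eta>\<in>V. \<forall>b\<in>V. opair \<eta> b \<in> elts \<tau> \<longrightarrow> bmeet x b \<preceq> m \<eta> \<sigma>) \<and>
     (\<forall>\<eta>\<in>V. \<forall>b\<in>V. opair \<eta> b \<in> elts \<sigma> \<longrightarrow> bmeet x b \<preceq> mem_sum_left e \<tau> \<eta>)}"
  by (rule small_B_Collect) (intro definable_intros NV defterm_mem_sum_beq_on defterm_mem_sum_left_beq_on)

lemma beq_on_in_B: assumes "\<tau> \<in> elts N" "\<sigma> \<in> elts N" shows "e \<tau> \<sigma> \<in> elts B"
  unfolding beq_on_unfold[OF NV N_V[OF assms(1)] assms(2)] eq_step_def
  by (rule bsup_in_B[OF small_eq_step[OF N_V N_V]]) (use assms in auto)

lemma mem_sum_intro: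
  assumes "\<tau> \<in> elts N" "\<sigma> \<in> elts N" "opair \<eta> b \<in> elts \<sigma>" "\<eta> \<in> V" "b \<in> V" "y \<lesssim> e \<tau> \<eta>" "y \<lesssim> b"
  shows "y \<lesssim> m \<tau> \<sigma>"
  unfolding mem_sum_def
proof (rule bsup_intro[OF small_mem_sum[OF N_V[OF assms(1)] N_V[OF assms(2)]]])
  show "bmeet (e \<tau> \<eta>) b \<in> {z \<in> elts B. \<exists>\<eta>\<in>V. \<exists>b\<in>V. opair \<eta> b \<in> elts \<sigma> \<and> z = bmeet (e \<tau> \<eta>) b}"
    using assms(3-5) lesssim_in_B[OF assms(6)] lesssim_in_B[OF assms(7)] by auto
  show "y \<lesssim> bmeet (e \<tau> \<eta>) b" using assms(6,7) lesssim_in_B[OF assms(6)] lesssim_in_B[OF assms(7)] by (simp add: lesssim_bmeet_iff)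
qed auto

lemma mem_sum_elim:
  assumes "\<tau> \<in> elts N" "\<sigma> \<in> elts N" "y \<lesssim> m \<tau> \<sigma>" "z \<in> elts B"
    and step: "\<And>\<eta> b y'. opair \<eta> b \<in> elts \<sigma> \<Longrightarrow> \<eta> \<in> elts N \<Longrightarrow> b \<in> elts B \<Longrightarrow> y' \<lesssim> y \<Longrightarrow> y' \<lesssim> e \<tau> \<eta> \<Longrightarrow> y' \<lesssim> b \<Longrightarrow> y' \<lesssim> z"
  shows "y \<lesssim> z"
proof (rule bsup_elim[OF small_mem_sum[OF N_V[OF assms(1)] N_V[OF assms(2)]] _ assms(3)[unfolded mem_sum_def] assms(4)])
  fix x y' assume x: "x \<in> {z \<in> elts B. \<exists>\<eta>\<in>V. \<exists>b\<in>V. opair \<eta> b \<in> elts \<sigma> \<and> z = bmeet (e \<tau> \<eta>) b}"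
    and y': "y' \<lesssim> y" "y' \<lesssim> x"
  then obtain \<eta> b where n: "\<eta> \<in> V" "b \<in> V" "opair \<eta> b \<in> elts \<sigma>" "x = bmeet (e \<tau> \<eta>) b" by blast
  note nb = N_entry[OF assms(2) n(3,1,2)]
  have "y' \<lesssim> e \<tau> \<eta> \<and> y' \<lesssim> b"
    using y'(2) unfolding n(4) using lesssim_bmeet_iff beq_on_in_B[OF assms(1) nb(1)] nb(2) by blast
  then show "y' \<lesssim> z" using step[OF n(3) nb y'(1)] by blast
qed auto

lemma mem_sum_left_eq_mem_sum:
  assumes "\<tau> \<in> elts N" "\<And>\<eta> b. opair \<eta> b \<in> elts \<tau> \<Longrightarrow> \<eta> \<in> elts N \<Longrightarrow> b \<in> elts B \<Longrightarrow> e \<eta> \<sigma> = e \<sigma> \<eta>"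
  shows "mem_sum_left e \<tau> \<sigma> = m \<sigma> \<tau>"
proof -
  have "e \<eta> \<sigma> = e \<sigma> \<eta>" if "\<eta> \<in> V" "b \<in> V" "opair \<eta> b \<in> elts \<tau>" for \<eta> b
    using assms(2)[OF that(3)] N_entry[OF assms(1) that(3,1,2)] by blast
  then show ?thesis unfolding mem_sum_left_def mem_sum_def by (intro arg_cong[where f = bsup]) (auto; metis)
qed

text \<open>
  Exchanging the names exchanges the two conditions in the recursion, up to symmetry of the values for names of smaller rank.
\<close>

lemma beq_on_sym: assumes t: "\<tau> \<in> elts N" and s: "\<sigma> \<in> elts N" shows "e \<tau> \<sigma> = e \<sigma> \<tau>"
proof -
  have "\<tau> \<in> elts N \<longrightarrow> (\<forall>\<sigma>\<in>elts N. e \<tau> \<sigma> = e \<sigma> \<tau>)"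
  proof (rule name_induct[where P = "\<lambda>\<tau>. \<tau> \<in> elts N \<longrightarrow> (\<forall>\<sigma>\<in>elts N. e \<tau> \<sigma> = e \<sigma> \<tau>)", OF N_name[OF t]])
    show "definable (\<lambda>v. v 0 \<in> elts N \<longrightarrow> (\<forall>\<sigma>\<in>elts N. e (v 0) \<sigma> = e \<sigma> (v 0)))" by (intro definable_intros NV)
  next
    fix \<tau> assume IH: "\<And>\<eta> b. \<eta> \<in> V \<Longrightarrow> b \<in> V \<Longrightarrow> opair \<eta> b \<in> elts \<tau> \<Longrightarrow> \<eta> \<in> elts N \<longrightarrow> (\<forall>\<sigma>\<in>elts N. e \<eta> \<sigma> = e \<sigma> \<eta>)"
    show "\<tau> \<in> elts N \<longrightarrow> (\<forall>\<sigma>\<in>elts N. e \<tau> \<sigma> = e \<sigma> \<tau>)"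
    proof (intro impI ballI)
      fix \<sigma> assume t: "\<tau> \<in> elts N" and s: "\<sigma> \<in> elts N"
      have IH': "e \<eta> \<rho> = e \<rho> \<eta>" if "\<eta> \<in> V" "b \<in> V" "opair \<eta> b \<in> elts \<tau>" "\<rho> \<in> elts N" for \<eta> b \<rho>
        using IH[OF that(1-3)] N_entry[OF t that(3,1,2)] that(4) by blast
      have 1: "mem_sum_left e \<sigma> \<eta> = m \<eta> \<sigma>" if n: "\<eta> \<in> V" "b \<in> V" "opair \<eta> b \<in> elts \<tau>" for \<eta> b
        by (rule mem_sum_left_eq_mem_sum[OF s]) (rule IH'[OF n, symmetric])
      have 2: "mem_sum_left e \<tau> \<eta> = m \<eta> \<tau>" if "\<eta> \<in> elts N" for \<eta>
        by (rule mem_sum_left_eq_mem_sum[OF t]) (use IH' that N_V B_V in blast)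
      have 3: "mem_sum_left e \<tau> \<eta> = m \<eta> \<tau>" if "\<eta> \<in> V" "b \<in> V" "opair \<eta> b \<in> elts \<sigma>" for \<eta> b
        by (rule 2[OF N_entry(1)[OF s that(3,1,2)]])
      have "eq_step e \<tau> \<sigma> = eq_step e \<sigma> \<tau>"
        unfolding eq_step_def
      proof (rule arg_cong[where f = bsup], rule Collect_cong, rule conj_cong[OF refl])
        fix x
        have a: "(\<forall>\<eta>\<in>V. \<forall>b\<in>V. opair \<eta> b \<in> elts \<tau> \<longrightarrow> bmeet x b \<preceq> m \<eta> \<sigma>) \<longleftrightarrow>
            (\<forall>\<eta>\<in>V. \<forall>b\<in>V. opair \<eta> b \<in> elts \<tau> \<longrightarrow> bmeet x b \<preceq> mem_sum_left e \<sigma> \<eta>)"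
          using 1 by (intro ball_cong refl) auto
        have b: "(\<forall>\<eta>\<in>V. \<forall>b\<in>V. opair \<eta> b \<in> elts \<sigma> \<longrightarrow> bmeet x b \<preceq> mem_sum_left e \<tau> \<eta>) \<longleftrightarrow>
            (\<forall>\<eta>\<in>V. \<forall>b\<in>V. opair \<eta> b \<in> elts \<sigma> \<longrightarrow> bmeet x b \<preceq> m \<eta> \<tau>)"
          using 3 by (intro ball_cong refl) auto
        show "(\<forall>\<eta>\<in>V. \<forall>b\<in>V. opair \<eta> b \<in> elts \<tau> \<longrightarrow> bmeet x b \<preceq> m \<eta> \<sigma>) \<and>
            (\<forall>\<eta>\<in>V. \<forall>b\<in>V. opair \<eta> b \<in> elts \<sigma> \<longrightarrow> bmeet x b \<preceq> mem_sum_left e \<tau> \<eta>) \<longleftrightarrow>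
            (\<forall>\<eta>\<in>V. \<forall>b\<in>V. opair \<eta> b \<in> elts \<sigma> \<longrightarrow> bmeet x b \<preceq> m \<eta> \<tau>) \<and>
            (\<forall>\<eta>\<in>V. \<forall>b\<in>V. opair \<eta> b \<in> elts \<tau> \<longrightarrow> bmeet x b \<preceq> mem_sum_left e \<sigma> \<eta>)"
          unfolding a b by (rule conj_commute)
      qed
      then show "e \<tau> \<sigma> = e \<sigma> \<tau>"
        using beq_on_unfold[OF NV N_V[OF t] s] beq_on_unfold[OF NV N_V[OF s] t] by simp
    qed
  qed
  then show ?thesis using t s by blast
qed

private lemma mem_sum_left_mem_sum: "\<tau> \<in> elts N \<Longrightarrow> \<sigma> \<in> elts N \<Longrightarrow> mem_sum_left e \<tau> \<sigma> = m \<sigma> \<tau>"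
  by (rule mem_sum_left_eq_mem_sum) (auto intro: beq_on_sym)

lemma beq_on_elim1:
  assumes t: "\<tau> \<in> elts N" and s: "\<sigma> \<in> elts N" and y: "y \<lesssim> e \<tau> \<sigma>" "y \<lesssim> b"
    and n: "opair \<eta> b \<in> elts \<tau>" "\<eta> \<in> V" "b \<in> V"
  shows "y \<lesssim> m \<eta> \<sigma>"
proof -
  let ?X = "{x \<in> elts B.
     (\<forall>\<eta>\<in>V. \<forall>b\<in>V. opair \<eta> b \<in> elts \<tau> \<longrightarrow> bmeet x b \<preceq> m \<eta> \<sigma>) \<and>
     (\<forall>\<eta>\<in>V. \<forall>b\<in>V. opair \<eta> b \<in> elts \<sigma> \<longrightarrow> bmeet x b \<preceq> mem_sum_left e \<tau> \<eta>)}"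
  have eq: "e \<tau> \<sigma> = bsup ?X" using beq_on_unfold[OF NV N_V[OF t] s] by (simp add: eq_step_def)
  have mB: "m \<eta> \<sigma> \<in> elts B" by (rule mem_sum_in_B[OF n(2) N_V[OF s]])
  show ?thesis
  proof (rule bsup_elim[OF small_eq_step[OF N_V[OF t] N_V[OF s]] _ y(1)[unfolded eq] mB])
    fix x y' assume x: "x \<in> ?X" and y': "y' \<lesssim> y" "y' \<lesssim> x"
    have bB: "b \<in> elts B" by (rule lesssim_in_B(2)[OF y(2)])
    have "bmeet x b \<lesssim> m \<eta> \<sigma>" using x n mB bB by (auto simp: lesssim_def)
    moreover have "y' \<lesssim> bmeet x b" using y' lesssim_trans[OF y'(1) y(2)] x bB by (auto simp: lesssim_bmeet_iff)
    ultimately show "y' \<lesssim> m \<eta> \<sigma>" using lesssim_trans by blast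
  qed auto
qed

lemma beq_on_elim2:
  assumes t: "\<tau> \<in> elts N" and s: "\<sigma> \<in> elts N" and y: "y \<lesssim> e \<tau> \<sigma>" "y \<lesssim> b"
    and n: "opair \<eta> b \<in> elts \<sigma>" "\<eta> \<in> V" "b \<in> V"
  shows "y \<lesssim> m \<eta> \<tau>"
  by (rule beq_on_elim1[OF s t _ y(2) n]) (use y(1) beq_on_sym[OF t s] in simp)

lemma beq_on_intro:
  assumes t: "\<tau> \<in> elts N" and s: "\<sigma> \<in> elts N" and y: "y \<in> elts B"
    and 1: "\<And>\<eta> b y'. opair \<eta> b \<in> elts \<tau> \<Longrightarrow> \<eta> \<in> elts N \<Longrightarrow> b \<in> elts B \<Longrightarrow> y' \<lesssim> y \<Longrightarrow> y' \<lesssim> b \<Longrightarrow> y' \<lesssim> m \<eta> \<sigma>"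
    and 2: "\<And>\<eta> b y'. opair \<eta> b \<in> elts \<sigma> \<Longrightarrow> \<eta> \<in> elts N \<Longrightarrow> b \<in> elts B \<Longrightarrow> y' \<lesssim> y \<Longrightarrow> y' \<lesssim> b \<Longrightarrow> y' \<lesssim> m \<eta> \<tau>"
  shows "y \<lesssim> e \<tau> \<sigma>"
  unfolding beq_on_unfold[OF NV N_V[OF t] s] eq_step_def
proof (rule bsup_intro[OF small_eq_step[OF N_V[OF t] N_V[OF s]] _ _ lesssim_refl[OF y]])
  show "y \<in> {x \<in> elts B.
     (\<forall>\<eta>\<in>V. \<forall>b\<in>V. opair \<eta> b \<in> elts \<tau> \<longrightarrow> bmeet x b \<preceq> m \<eta> \<sigma>) \<and>
     (\<forall>\<eta>\<in>V. \<forall>b\<in>V. opair \<eta> b \<in> elts \<sigma> \<longrightarrow> bmeet x b \<preceq> mem_sum_left e \<tau> \<eta>)}"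
  proof (intro CollectI conjI ballI impI)
    fix \<eta> b assume n: "\<eta> \<in> V" "b \<in> V" "opair \<eta> b \<in> elts \<tau>"
    note nb = N_entry[OF t n(3,1,2)]
    show "bmeet y b \<preceq> m \<eta> \<sigma>" using 1[OF n(3) nb bmeet_lesssim[OF y nb(2)]] by (simp add: lesssim_def)
  next
    fix \<eta> b assume n: "\<eta> \<in> V" "b \<in> V" "opair \<eta> b \<in> elts \<sigma>"
    note nb = N_entry[OF s n(3,1,2)]
    show "bmeet y b \<preceq> mem_sum_left e \<tau> \<eta>"
      using 2[OF n(3) nb bmeet_lesssim[OF y nb(2)]] mem_sum_left_mem_sum[OF t nb(1)] by (simp add: lesssim_def)
  qed (rule y)
qed auto

lemma beq_on_refl: assumes t: "\<tau> \<in> elts N" shows "e \<tau> \<tau> = btop"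
proof -
  have "\<tau> \<in> elts N \<longrightarrow> e \<tau> \<tau> = btop"
  proof (rule name_induct[where P = "\<lambda>\<tau>. \<tau> \<in> elts N \<longrightarrow> e \<tau> \<tau> = btop", OF N_name[OF t]])
    show "definable (\<lambda>v. v 0 \<in> elts N \<longrightarrow> e (v 0) (v 0) = btop)" by (intro definable_intros NV btop_in_V)
  next
    fix \<tau> assume IH: "\<And>\<eta> b. \<eta> \<in> V \<Longrightarrow> b \<in> V \<Longrightarrow> opair \<eta> b \<in> elts \<tau> \<Longrightarrow> \<eta> \<in> elts N \<longrightarrow> e \<eta> \<eta> = btop"
    show "\<tau> \<in> elts N \<longrightarrow> e \<tau> \<tau> = btop"
    proof
      assume t: "\<tau> \<in> elts N"
      have *: "y' \<lesssim> m \<eta> \<tau>" if "opair \<eta> b \<in> elts \<tau>" "\<eta> \<in> elts N" "b \<in> elts B" "y' \<lesssim> b" for \<eta> b y'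
      proof (rule mem_sum_intro[OF that(2) t that(1) N_V[OF that(2)] B_V[OF that(3)] _ that(4)])
        show "y' \<lesssim> e \<eta> \<eta>"
          using IH[OF N_V[OF that(2)] B_V[OF that(3)] that(1)] that(2) lesssim_btop[OF lesssim_in_B(1)[OF that(4)]] by simp
      qed
      have "btop \<lesssim> e \<tau> \<tau>" by (rule beq_on_intro[OF t t]) (use * in auto)
      then show "e \<tau> \<tau> = btop" using lesssim_antisym lesssim_btop lesssim_in_B(2) by blast
    qed
  qed
  then show ?thesis using t by blast
qed

lemma beq_on_refl_lesssim: "\<tau> \<in> elts N \<Longrightarrow> y \<in> elts B \<Longrightarrow> y \<lesssim> e \<tau> \<tau>"
  by (simp add: beq_on_refl lesssim_btop)

text \<open>
  Induction on \<open>\<tau>\<close> for all \<open>\<sigma>\<close> and \<open>\<rho>\<close> at once.  Going from \<open>\<tau>\<close> through \<open>\<sigma>\<close> to \<open>\<rho>\<close> leads to a composition starting in the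
  domain of \<open>\<tau>\<close>; going back from \<open>\<rho>\<close> leads to one ending there, which symmetry turns around.
\<close>

lemma beq_on_trans:
  assumes t: "\<tau> \<in> elts N" and "\<sigma> \<in> elts N" "\<rho> \<in> elts N" and y: "y \<lesssim> e \<tau> \<sigma>" "y \<lesssim> e \<sigma> \<rho>"
  shows "y \<lesssim> e \<tau> \<rho>"
proof -
  let ?P = "\<lambda>\<tau>. \<forall>\<sigma>\<in>elts N. \<forall>\<rho>\<in>elts N. \<forall>y\<in>V. y \<lesssim> e \<tau> \<sigma> \<longrightarrow> y \<lesssim> e \<sigma> \<rho> \<longrightarrow> y \<lesssim> e \<tau> \<rho>"
  have "\<tau> \<in> elts N \<longrightarrow> ?P \<tau>"
  proof (rule name_induct[where P = "\<lambda>\<tau>. \<tau> \<in> elts N \<longrightarrow> ?P \<tau>", OF N_name[OF t]])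
    show "definable (\<lambda>v. v 0 \<in> elts N \<longrightarrow> ?P (v 0))" by (intro definable_intros NV)
  next
    fix \<tau> assume IH: "\<And>\<eta> b. \<eta> \<in> V \<Longrightarrow> b \<in> V \<Longrightarrow> opair \<eta> b \<in> elts \<tau> \<Longrightarrow> \<eta> \<in> elts N \<longrightarrow> ?P \<eta>"
    show "\<tau> \<in> elts N \<longrightarrow> ?P \<tau>"
    proof (intro impI ballI)
      fix \<sigma> \<rho> y assume t: "\<tau> \<in> elts N" and s: "\<sigma> \<in> elts N" and r: "\<rho> \<in> elts N"
        and y: "y \<lesssim> e \<tau> \<sigma>" "y \<lesssim> e \<sigma> \<rho>"
      have IH': "w \<lesssim> e \<eta> \<rho>'" if "opair \<eta> b \<in> elts \<tau>" "\<eta> \<in> elts N" "b \<in> elts B" "\<sigma>' \<in> elts N" "\<rho>' \<in> elts N"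
        "w \<lesssim> e \<eta> \<sigma>'" "w \<lesssim> e \<sigma>' \<rho>'" for \<eta> b \<sigma>' \<rho>' w
        using IH[OF N_V[OF that(2)] B_V[OF that(3)] that(1), rule_format, OF that(2,4,5) B_V[OF lesssim_in_B(1)[OF that(6)]] that(6,7)] .
      show "y \<lesssim> e \<tau> \<rho>"
      proof (rule beq_on_intro[OF t r lesssim_in_B(1)[OF y(1)]])
        fix \<eta> b y1 assume n: "opair \<eta> b \<in> elts \<tau>" "\<eta> \<in> elts N" "b \<in> elts B" and y1: "y1 \<lesssim> y" "y1 \<lesssim> b"
        have zB: "m \<eta> \<rho> \<in> elts B" by (rule mem_sum_in_B[OF N_V[OF n(2)] N_V[OF r]])
        have "y1 \<lesssim> m \<eta> \<sigma>"
          by (rule beq_on_elim1[OF t s lesssim_trans[OF y1(1) y(1)] y1(2) n(1) N_V[OF n(2)] B_V[OF n(3)]])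
        then show "y1 \<lesssim> m \<eta> \<rho>"
        proof (rule mem_sum_elim[OF n(2) s _ zB])
          fix \<eta>' b' y2 assume n': "opair \<eta>' b' \<in> elts \<sigma>" "\<eta>' \<in> elts N" "b' \<in> elts B"
            and y2: "y2 \<lesssim> y1" "y2 \<lesssim> e \<eta> \<eta>'" "y2 \<lesssim> b'"
          have "y2 \<lesssim> m \<eta>' \<rho>"
            by (rule beq_on_elim1[OF s r lesssim_trans[OF lesssim_trans[OF y2(1) y1(1)] y(2)] y2(3) n'(1) N_V[OF n'(2)] B_V[OF n'(3)]])
          then show "y2 \<lesssim> m \<eta> \<rho>"
          proof (rule mem_sum_elim[OF n'(2) r _ zB])
            fix \<eta>'' b'' y3 assume n'': "opair \<eta>'' b'' \<in> elts \<rho>" "\<eta>'' \<in> elts N" "b'' \<in> elts B"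
              and y3: "y3 \<lesssim> y2" "y3 \<lesssim> e \<eta>' \<eta>''" "y3 \<lesssim> b''"
            have "y3 \<lesssim> e \<eta> \<eta>''" by (rule IH'[OF n n'(2) n''(2) lesssim_trans[OF y3(1) y2(2)] y3(2)])
            then show "y3 \<lesssim> m \<eta> \<rho>"
              by (rule mem_sum_intro[OF n(2) r n''(1) N_V[OF n''(2)] B_V[OF n''(3)] _ y3(3)])
          qed
        qed
      next
        fix \<eta> b y1 assume n: "opair \<eta> b \<in> elts \<rho>" "\<eta> \<in> elts N" "b \<in> elts B" and y1: "y1 \<lesssim> y" "y1 \<lesssim> b"
        have zB: "m \<eta> \<tau> \<in> elts B" by (rule mem_sum_in_B[OF N_V[OF n(2)] N_V[OF t]])
        have "y1 \<lesssim> m \<eta> \<sigma>"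
          by (rule beq_on_elim2[OF s r lesssim_trans[OF y1(1) y(2)] y1(2) n(1) N_V[OF n(2)] B_V[OF n(3)]])
        then show "y1 \<lesssim> m \<eta> \<tau>"
        proof (rule mem_sum_elim[OF n(2) s _ zB])
          fix \<eta>' b' y2 assume n': "opair \<eta>' b' \<in> elts \<sigma>" "\<eta>' \<in> elts N" "b' \<in> elts B"
            and y2: "y2 \<lesssim> y1" "y2 \<lesssim> e \<eta> \<eta>'" "y2 \<lesssim> b'"
          have "y2 \<lesssim> m \<eta>' \<tau>"
            by (rule beq_on_elim2[OF t s lesssim_trans[OF lesssim_trans[OF y2(1) y1(1)] y(1)] y2(3) n'(1) N_V[OF n'(2)] B_V[OF n'(3)]])
          then show "y2 \<lesssim> m \<eta> \<tau>"
          proof (rule mem_sum_elim[OF n'(2) t _ zB])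
            fix \<eta>'' b'' y3 assume n'': "opair \<eta>'' b'' \<in> elts \<tau>" "\<eta>'' \<in> elts N" "b'' \<in> elts B"
              and y3: "y3 \<lesssim> y2" "y3 \<lesssim> e \<eta>' \<eta>''" "y3 \<lesssim> b''"
            have "y3 \<lesssim> e \<eta>'' \<eta>"
            proof (rule IH'[OF n'' n'(2) n(2)])
              show "y3 \<lesssim> e \<eta>'' \<eta>'" using y3(2) beq_on_sym[OF n'(2) n''(2)] by simp
              show "y3 \<lesssim> e \<eta>' \<eta>" using lesssim_trans[OF y3(1) y2(2)] beq_on_sym[OF n(2) n'(2)] by simp
            qed
            then have "y3 \<lesssim> e \<eta> \<eta>''" using beq_on_sym[OF n(2) n''(2)] by simp
            then show "y3 \<lesssim> m \<eta> \<tau>"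
              by (rule mem_sum_intro[OF n(2) t n''(1) N_V[OF n''(2)] B_V[OF n''(3)] _ y3(3)])
          qed
        qed
      qed
    qed
  qed
  then show ?thesis using assms B_V[OF lesssim_in_B(1)[OF y(1)]] by blast
qed

lemma mem_sum_subst_right:
  assumes n: "\<eta> \<in> elts N" and t: "\<tau> \<in> elts N" and s: "\<sigma> \<in> elts N" and y: "y \<lesssim> m \<eta> \<tau>" "y \<lesssim> e \<tau> \<sigma>"
  shows "y \<lesssim> m \<eta> \<sigma>"
proof (rule mem_sum_elim[OF n t y(1)])
  show zB: "m \<eta> \<sigma> \<in> elts B" by (rule mem_sum_in_B[OF N_V[OF n] N_V[OF s]])
  fix \<zeta> b y1 assume z: "opair \<zeta> b \<in> elts \<tau>" "\<zeta> \<in> elts N" "b \<in> elts B" and y1: "y1 \<lesssim> y" "y1 \<lesssim> e \<eta> \<zeta>" "y1 \<lesssim> b"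
  have "y1 \<lesssim> m \<zeta> \<sigma>"
    by (rule beq_on_elim1[OF t s lesssim_trans[OF y1(1) y(2)] y1(3) z(1) N_V[OF z(2)] B_V[OF z(3)]])
  then show "y1 \<lesssim> m \<eta> \<sigma>"
  proof (rule mem_sum_elim[OF z(2) s _ zB])
    fix \<xi> c y2 assume x: "opair \<xi> c \<in> elts \<sigma>" "\<xi> \<in> elts N" "c \<in> elts B" and y2: "y2 \<lesssim> y1" "y2 \<lesssim> e \<zeta> \<xi>" "y2 \<lesssim> c"
    have "y2 \<lesssim> e \<eta> \<xi>" by (rule beq_on_trans[OF n z(2) x(2) lesssim_trans[OF y2(1) y1(2)] y2(2)])
    then show "y2 \<lesssim> m \<eta> \<sigma>"
      by (rule mem_sum_intro[OF n s x(1) N_V[OF x(2)] B_V[OF x(3)] _ y2(3)])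
  qed
qed

text \<open>
  The value of inclusion in the defining equations.
\<close>

definition sub_val :: "'a \<Rightarrow> 'a \<Rightarrow> 'a" where
  "sub_val \<tau> \<sigma> = bsup {x \<in> elts B. \<forall>\<eta>\<in>V. \<forall>b\<in>V. opair \<eta> b \<in> elts \<tau> \<longrightarrow> bmeet x (m \<eta> \<tau>) \<preceq> m \<eta> \<sigma>}"

private lemma small_sub_val: "\<tau> \<in> V \<Longrightarrow> \<sigma> \<in> V \<Longrightarrow>
    small {x \<in> elts B. \<forall>\<eta>\<in>V. \<forall>b\<in>V. opair \<eta> b \<in> elts \<tau> \<longrightarrow> bmeet x (m \<eta> \<tau>) \<preceq> m \<eta> \<sigma>}"
  by (rule small_B_Collect) (intro definable_intros defterm_mem_sum_beq_on)

lemma defterm_sub_val: "defterm t \<Longrightarrow> defterm s \<Longrightarrow> defterm (\<lambda>v. sub_val (t v) (s v))"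
proof (rule defterm2[where F = sub_val])
  show "defterm (\<lambda>v. sub_val (v 0) (v (Suc 0)))" unfolding sub_val_def by (intro defterm_bsup definable_intros defterm_mem_sum_beq_on)
qed

lemma sub_val_in_B: "\<tau> \<in> V \<Longrightarrow> \<sigma> \<in> V \<Longrightarrow> sub_val \<tau> \<sigma> \<in> elts B"
  unfolding sub_val_def by (rule bsup_in_B[OF small_sub_val]) auto

lemma lesssim_sub_val_iff:
  assumes t: "\<tau> \<in> elts N" and s: "\<sigma> \<in> elts N" and x: "x \<in> elts B"
  shows "x \<lesssim> sub_val \<tau> \<sigma> \<longleftrightarrow>
    (\<forall>\<eta>\<in>V. \<forall>b\<in>V. opair \<eta> b \<in> elts \<tau> \<longrightarrow> (\<forall>y. y \<lesssim> x \<and> y \<lesssim> m \<eta> \<tau> \<longrightarrow> y \<lesssim> m \<eta> \<sigma>))"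
proof
  note tV = N_V[OF t] and sV = N_V[OF s]
  assume A: "x \<lesssim> sub_val \<tau> \<sigma>"
  show "\<forall>\<eta>\<in>V. \<forall>b\<in>V. opair \<eta> b \<in> elts \<tau> \<longrightarrow> (\<forall>y. y \<lesssim> x \<and> y \<lesssim> m \<eta> \<tau> \<longrightarrow> y \<lesssim> m \<eta> \<sigma>)"
  proof (intro ballI impI allI)
    fix \<eta> b y assume n: "\<eta> \<in> V" "b \<in> V" "opair \<eta> b \<in> elts \<tau>" and y: "y \<lesssim> x \<and> y \<lesssim> m \<eta> \<tau>"
    have "y \<lesssim> sub_val \<tau> \<sigma>" using y A lesssim_trans by blast
    then show "y \<lesssim> m \<eta> \<sigma>"
      unfolding sub_val_def
    proof (rule bsup_elim[OF small_sub_val[OF tV sV], rotated])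
      show mB: "m \<eta> \<sigma> \<in> elts B" by (rule mem_sum_in_B[OF n(1) sV])
      have mB': "m \<eta> \<tau> \<in> elts B" by (rule mem_sum_in_B[OF n(1) tV])
      fix z y' assume z: "z \<in> {x \<in> elts B. \<forall>\<eta>\<in>V. \<forall>b\<in>V. opair \<eta> b \<in> elts \<tau> \<longrightarrow> bmeet x (m \<eta> \<tau>) \<preceq> m \<eta> \<sigma>}"
        and y': "y' \<lesssim> y" "y' \<lesssim> z"
      have "bmeet z (m \<eta> \<tau>) \<lesssim> m \<eta> \<sigma>" using z n mB mB' by (auto simp: lesssim_def)
      moreover have "y' \<lesssim> bmeet z (m \<eta> \<tau>)" using z y' y mB' lesssim_trans by (subst lesssim_bmeet_iff) blast+
      ultimately show "y' \<lesssim> m \<eta> \<sigma>" using lesssim_trans by blast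
    qed auto
  qed
next
  note tV = N_V[OF t] and sV = N_V[OF s]
  assume A: "\<forall>\<eta>\<in>V. \<forall>b\<in>V. opair \<eta> b \<in> elts \<tau> \<longrightarrow> (\<forall>y. y \<lesssim> x \<and> y \<lesssim> m \<eta> \<tau> \<longrightarrow> y \<lesssim> m \<eta> \<sigma>)"
  show "x \<lesssim> sub_val \<tau> \<sigma>"
    unfolding sub_val_def
  proof (rule bsup_intro[OF small_sub_val[OF tV sV] _ _ lesssim_refl[OF x]])
    show "x \<in> {x \<in> elts B. \<forall>\<eta>\<in>V. \<forall>b\<in>V. opair \<eta> b \<in> elts \<tau> \<longrightarrow> bmeet x (m \<eta> \<tau>) \<preceq> m \<eta> \<sigma>}"
    proof (intro CollectI conjI ballI impI x)
      fix \<eta> b assume n: "\<eta> \<in> V" "b \<in> V" "opair \<eta> b \<in> elts \<tau>"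
      have mB': "m \<eta> \<tau> \<in> elts B" by (rule mem_sum_in_B[OF n(1) tV])
      have "bmeet x (m \<eta> \<tau>) \<lesssim> m \<eta> \<sigma>" using A n bmeet_lesssim[OF x mB'] by blast
      then show "bmeet x (m \<eta> \<tau>) \<preceq> m \<eta> \<sigma>" by (simp add: lesssim_def)
    qed
  qed auto
qed

text \<open>
  The recursion for equality and the defining equations agree because \<open>[\<eta> \<in> \<tau>] \<sqinter> [\<tau> = \<sigma>] \<lesssim> [\<eta> \<in> \<sigma>]\<close> and because
  \<open>b \<lesssim> [\<eta> \<in> \<tau>]\<close> for an entry \<open>(\<eta>, b)\<close> of \<open>\<tau>\<close>.
\<close>

lemma beq_on_eq_sub_val:
  assumes t: "\<tau> \<in> elts N" and s: "\<sigma> \<in> elts N"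
  shows "e \<tau> \<sigma> = bmeet (sub_val \<tau> \<sigma>) (sub_val \<sigma> \<tau>)"
proof -
  note sB = sub_val_in_B[OF N_V[OF t] N_V[OF s]] sub_val_in_B[OF N_V[OF s] N_V[OF t]]
  have half: "x \<lesssim> sub_val \<tau> \<sigma>" if x: "x \<lesssim> e \<tau> \<sigma>" and t: "\<tau> \<in> elts N" and s: "\<sigma> \<in> elts N" for x \<tau> \<sigma>
    unfolding lesssim_sub_val_iff[OF t s lesssim_in_B(1)[OF x]]
  proof (intro ballI impI allI, elim conjE)
    fix \<eta> b y assume n: "\<eta> \<in> V" "b \<in> V" "opair \<eta> b \<in> elts \<tau>" and y: "y \<lesssim> x" "y \<lesssim> m \<eta> \<tau>"
    show "y \<lesssim> m \<eta> \<sigma>"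
      by (rule mem_sum_subst_right[OF N_entry(1)[OF t n(3,1,2)] t s y(2) lesssim_trans[OF y(1) x]])
  qed
  have sub: "y' \<lesssim> m \<eta> \<sigma>" if x: "x \<lesssim> sub_val \<tau> \<sigma>" and t: "\<tau> \<in> elts N" and s: "\<sigma> \<in> elts N"
    and n: "opair \<eta> b \<in> elts \<tau>" "\<eta> \<in> elts N" "b \<in> elts B" and y': "y' \<lesssim> x" "y' \<lesssim> b" for x \<tau> \<sigma> \<eta> b y'
  proof -
    have "y' \<lesssim> m \<eta> \<tau>"
      by (rule mem_sum_intro[OF n(2) t n(1) N_V[OF n(2)] B_V[OF n(3)] beq_on_refl_lesssim[OF n(2) lesssim_in_B(1)[OF y'(1)]] y'(2)])
    then show ?thesis
      using x[unfolded lesssim_sub_val_iff[OF t s lesssim_in_B(1)[OF x]]] N_V[OF n(2)] B_V[OF n(3)] n(1) y'(1) by blast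
  qed
  show ?thesis
  proof (rule lesssim_eqI)
    fix x assume x: "x \<in> elts B"
    show "x \<lesssim> e \<tau> \<sigma> \<longleftrightarrow> x \<lesssim> bmeet (sub_val \<tau> \<sigma>) (sub_val \<sigma> \<tau>)"
    proof
      assume A: "x \<lesssim> e \<tau> \<sigma>"
      have "x \<lesssim> sub_val \<tau> \<sigma>" by (rule half[OF A t s])
      moreover have "x \<lesssim> sub_val \<sigma> \<tau>" by (rule half[OF _ s t]) (use A beq_on_sym[OF t s] in simp)
      ultimately show "x \<lesssim> bmeet (sub_val \<tau> \<sigma>) (sub_val \<sigma> \<tau>)" using sB by (simp add: lesssim_bmeet_iff)
    next
      assume "x \<lesssim> bmeet (sub_val \<tau> \<sigma>) (sub_val \<sigma> \<tau>)"
      then have A: "x \<lesssim> sub_val \<tau> \<sigma>" "x \<lesssim> sub_val \<sigma> \<tau>" using sB by (simp_all add: lesssim_bmeet_iff)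
      show "x \<lesssim> e \<tau> \<sigma>" by (rule beq_on_intro[OF t s x]) (rule sub[OF A(1) t s] sub[OF A(2) s t], assumption+)+
    qed
  qed (use beq_on_in_B[OF t s] sB in auto)
qed

lemma bv_functions_beq_on: "bv_functions N (lam2 N m) (lam2 N sub_val) (lam2 N e)"
proof -
  have d: "defterm (\<lambda>v. m (v 0) (v (Suc 0)))" "defterm (\<lambda>v. sub_val (v 0) (v (Suc 0)))" "defterm (\<lambda>v. e (v 0) (v (Suc 0)))"
    by (intro defterm_mem_sum_beq_on defterm_sub_val definable_intros NV)+
  note a = app_lam2[OF NV d(1)] app_lam2[OF NV d(2)] app_lam2[OF NV d(3)]
  have eqs: "app (lam2 N m) (opair \<tau> \<sigma>) =
          \<Squnion>\<^bsub>\<BB>\<^esub> {app (lam2 N e) (opair \<tau> \<eta>) \<sqinter>\<^bsub>\<BB>\<^esub> b | \<eta> b. \<eta> \<in> V \<and> b \<in> V \<and> opair \<eta> b \<in> elts \<sigma>} \<and>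
        app (lam2 N sub_val) (opair \<tau> \<sigma>) =
          \<Sqinter>\<^bsub>\<BB>\<^esub> {complement \<BB> (app (lam2 N m) (opair \<eta> \<tau>)) \<squnion>\<^bsub>\<BB>\<^esub> app (lam2 N m) (opair \<eta> \<sigma>) | \<eta>. \<eta> \<in> name_dom \<tau>} \<and>
        app (lam2 N e) (opair \<tau> \<sigma>) = app (lam2 N sub_val) (opair \<tau> \<sigma>) \<sqinter>\<^bsub>\<BB>\<^esub> app (lam2 N sub_val) (opair \<sigma> \<tau>)"
    if t: "\<tau> \<in> elts N" and s: "\<sigma> \<in> elts N" for \<tau> \<sigma>
  proof (intro conjI)
    have "{app (lam2 N e) (opair \<tau> \<eta>) \<sqinter>\<^bsub>\<BB>\<^esub> b | \<eta> b. \<eta> \<in> V \<and> b \<in> V \<and> opair \<eta> b \<in> elts \<sigma>} =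
      {z \<in> elts B. \<exists>\<eta>\<in>V. \<exists>b\<in>V. opair \<eta> b \<in> elts \<sigma> \<and> z = bmeet (e \<tau> \<eta>) b}" (is "?L = ?R")
    proof -
      have *: "app (lam2 N e) (opair \<tau> \<eta>) \<sqinter>\<^bsub>\<BB>\<^esub> b = bmeet (e \<tau> \<eta>) b \<and> bmeet (e \<tau> \<eta>) b \<in> elts B"
        if n: "\<eta> \<in> V" "b \<in> V" "opair \<eta> b \<in> elts \<sigma>" for \<eta> b
        using a(3)[OF t N_entry(1)[OF s n(3,1,2)]] beq_on_in_B[OF t N_entry(1)[OF s n(3,1,2)]] N_entry(2)[OF s n(3,1,2)]
        by (simp add: bmeet_eq_meet[symmetric])
      show ?thesis
      proof (intro equalityI subsetI)
        fix z assume "z \<in> ?L"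
        then obtain \<eta> b where n: "\<eta> \<in> V" "b \<in> V" "opair \<eta> b \<in> elts \<sigma>" "z = app (lam2 N e) (opair \<tau> \<eta>) \<sqinter>\<^bsub>\<BB>\<^esub> b" by blast
        then show "z \<in> ?R" using *[OF n(1-3)] by auto
      next
        fix z assume "z \<in> ?R"
        then obtain \<eta> b where n: "\<eta> \<in> V" "b \<in> V" "opair \<eta> b \<in> elts \<sigma>" "z = bmeet (e \<tau> \<eta>) b" by blast
        then show "z \<in> ?L" using *[OF n(1-3)] by (intro CollectI exI[of _ \<eta>] exI[of _ b]) simp
      qed
    qed
    then show "app (lam2 N m) (opair \<tau> \<sigma>) = \<Squnion>\<^bsub>\<BB>\<^esub> {app (lam2 N e) (opair \<tau> \<eta>) \<sqinter>\<^bsub>\<BB>\<^esub> b | \<eta> b. \<eta> \<in> V \<and> b \<in> V \<and> opair \<eta> b \<in> elts \<sigma>}"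
      unfolding a(1)[OF t s] by (simp add: mem_sum_def)
  next
    let ?X = "{complement \<BB> (app (lam2 N m) (opair \<eta> \<tau>)) \<squnion>\<^bsub>\<BB>\<^esub> app (lam2 N m) (opair \<eta> \<sigma>) | \<eta>. \<eta> \<in> name_dom \<tau>}"
    have dom: "\<eta> \<in> elts N \<and> (\<exists>b\<in>V. opair \<eta> b \<in> elts \<tau>)" if "\<eta> \<in> name_dom \<tau>" for \<eta>
      using that N_entry(1)[OF t] by (auto simp: name_dom_def)
    have mB: "m \<eta> \<rho> \<in> elts B" if "\<eta> \<in> elts N" "\<rho> \<in> elts N" for \<eta> \<rho> by (rule mem_sum_in_B[OF N_V[OF that(1)] N_V[OF that(2)]])
    have X: "?X = {bjoin (bcompl (m \<eta> \<tau>)) (m \<eta> \<sigma>) | \<eta>. \<eta> \<in> name_dom \<tau>}"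
    proof -
      have "complement \<BB> (app (lam2 N m) (opair \<eta> \<tau>)) \<squnion>\<^bsub>\<BB>\<^esub> app (lam2 N m) (opair \<eta> \<sigma>) = bjoin (bcompl (m \<eta> \<tau>)) (m \<eta> \<sigma>)"
        if "\<eta> \<in> name_dom \<tau>" for \<eta>
        using a(1)[OF _ t] a(1)[OF _ s] dom[OF that] by simp
      then show ?thesis by (auto; metis)
    qed
    have sB: "sub_val \<tau> \<sigma> \<in> elts B" by (rule sub_val_in_B[OF N_V[OF t] N_V[OF s]])
    have iff: "x \<lesssim> sub_val \<tau> \<sigma> \<longleftrightarrow> (\<forall>z\<in>?X. x \<lesssim> z)" if x: "x \<in> elts B" for x
    proof -
      have "(\<forall>z\<in>?X. x \<lesssim> z) \<longleftrightarrow> (\<forall>\<eta>\<in>name_dom \<tau>. x \<lesssim> bjoin (bcompl (m \<eta> \<tau>)) (m \<eta> \<sigma>))" unfolding X by blast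
      also have "\<dots> \<longleftrightarrow> (\<forall>\<eta>\<in>name_dom \<tau>. \<forall>y. y \<lesssim> x \<and> y \<lesssim> m \<eta> \<tau> \<longrightarrow> y \<lesssim> m \<eta> \<sigma>)"
        by (intro ball_cong refl lesssim_imp_iff x mB t s) (use dom in blast)+
      also have "\<dots> \<longleftrightarrow> x \<lesssim> sub_val \<tau> \<sigma>"
        unfolding lesssim_sub_val_iff[OF t s x] name_dom_def by blast
      finally show ?thesis by (rule sym)
    qed
    have XB: "?X \<subseteq> elts B"
    proof -
      have "bjoin (bcompl (m \<eta> \<tau>)) (m \<eta> \<sigma>) \<in> elts B" if "\<eta> \<in> name_dom \<tau>" for \<eta>
        by (intro bjoin_in_B bcompl_in_B mB t s) (use dom[OF that] in auto)
      then show ?thesis unfolding X by blast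
    qed
    have "\<Sqinter>\<^bsub>\<BB>\<^esub> ?X = sub_val \<tau> \<sigma>"
    proof (rule binf_eqI[OF XB sB])
      show "sub_val \<tau> \<sigma> \<preceq> x" if "x \<in> ?X" for x
        using iff[OF sB] lesssim_refl[OF sB] that unfolding lesssim_def by blast
      show "z \<preceq> sub_val \<tau> \<sigma>" if "z \<in> elts B" "\<And>x. x \<in> ?X \<Longrightarrow> z \<preceq> x" for z
        using iff[OF that(1)] that XB unfolding lesssim_def by blast
    qed
    then show "app (lam2 N sub_val) (opair \<tau> \<sigma>) = \<Sqinter>\<^bsub>\<BB>\<^esub> ?X" unfolding a(2)[OF t s] by (rule sym)
  next
    show "app (lam2 N e) (opair \<tau> \<sigma>) = app (lam2 N sub_val) (opair \<tau> \<sigma>) \<sqinter>\<^bsub>\<BB>\<^esub> app (lam2 N sub_val) (opair \<sigma> \<tau>)"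
      unfolding a(2)[OF t s] a(2)[OF s t] a(3)[OF t s] beq_on_eq_sub_val[OF t s]
      by (rule bmeet_eq_meet[OF sub_val_in_B[OF N_V[OF t] N_V[OF s]] sub_val_in_B[OF N_V[OF s] N_V[OF t]]])
  qed
  show ?thesis
    unfolding bv_functions_def Let_def
    using NV N fun_on_lam2[OF NV d(1)] fun_on_lam2[OF NV d(2)] fun_on_lam2[OF NV d(3)] eqs
    unfolding closed_names_def by blast
qed

end

text \<open>
  By the equations, the value of equality at \<open>\<tau>\<close> and \<open>\<sigma>\<close> is determined by its values at names whose ranks
  are below the larger of the two ranks.  Since ranks are linearly ordered, induction on a bound \<open>a\<close> for both ranks applies.
\<close>

lemma bv_functions_unique:
  assumes 1: "bv_functions N m s e" and 2: "bv_functions N' m' s' e'"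
    and t: "\<tau> \<in> elts N" "\<tau> \<in> elts N'" and s: "\<sigma> \<in> elts N" "\<sigma> \<in> elts N'"
  shows "app e (opair \<tau> \<sigma>) = app e' (opair \<tau> \<sigma>)" "app m (opair \<tau> \<sigma>) = app m' (opair \<tau> \<sigma>)"
proof -
  have N: "closed_names N" "closed_names N'"
    using 1 2 unfolding bv_functions_def closed_names_def by blast+
  then have NV: "N \<in> V" "N' \<in> V" by (simp_all add: closed_names_def)
  let ?D = "{opair \<tau> \<sigma> | \<tau> \<sigma>. \<tau> \<in> elts N \<and> \<sigma> \<in> elts N}"
  let ?D' = "{opair \<tau> \<sigma> | \<tau> \<sigma>. \<tau> \<in> elts N' \<and> \<sigma> \<in> elts N'}"
  have f: "fun_on e ?D" "fun_on e' ?D'" using 1 2 unfolding bv_functions_def Let_def by blast+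
  have fV: "e \<in> V" "e' \<in> V" using f by (simp_all add: fun_on_def)
  have a0: "app0 e (opair \<tau> \<sigma>) = app e (opair \<tau> \<sigma>)" if "\<tau> \<in> elts N" "\<sigma> \<in> elts N" for \<tau> \<sigma>
    by (rule app0_eq[OF f(1)]) (use that in blast)
  have a0': "app0 e' (opair \<tau> \<sigma>) = app e' (opair \<tau> \<sigma>)" if "\<tau> \<in> elts N'" "\<sigma> \<in> elts N'" for \<tau> \<sigma>
    by (rule app0_eq[OF f(2)]) (use that in blast)
  have eqs: "app m (opair \<tau> \<sigma>) = \<Squnion>\<^bsub>\<BB>\<^esub> {app e (opair \<tau> \<eta>) \<sqinter>\<^bsub>\<BB>\<^esub> b | \<eta> b. \<eta> \<in> V \<and> b \<in> V \<and> opair \<eta> b \<in> elts \<sigma>}"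
     "app s (opair \<tau> \<sigma>) = \<Sqinter>\<^bsub>\<BB>\<^esub> {complement \<BB> (app m (opair \<eta> \<tau>)) \<squnion>\<^bsub>\<BB>\<^esub> app m (opair \<eta> \<sigma>) | \<eta>. \<eta> \<in> name_dom \<tau>}"
     "app e (opair \<tau> \<sigma>) = app s (opair \<tau> \<sigma>) \<sqinter>\<^bsub>\<BB>\<^esub> app s (opair \<sigma> \<tau>)"
     if "\<tau> \<in> elts N" "\<sigma> \<in> elts N" for \<tau> \<sigma>
    using 1 that unfolding bv_functions_def by blast+
  have eqs': "app m' (opair \<tau> \<sigma>) = \<Squnion>\<^bsub>\<BB>\<^esub> {app e' (opair \<tau> \<eta>) \<sqinter>\<^bsub>\<BB>\<^esub> b | \<eta> b. \<eta> \<in> V \<and> b \<in> V \<and> opair \<eta> b \<in> elts \<sigma>}"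
     "app s' (opair \<tau> \<sigma>) = \<Sqinter>\<^bsub>\<BB>\<^esub> {complement \<BB> (app m' (opair \<eta> \<tau>)) \<squnion>\<^bsub>\<BB>\<^esub> app m' (opair \<eta> \<sigma>) | \<eta>. \<eta> \<in> name_dom \<tau>}"
     "app e' (opair \<tau> \<sigma>) = app s' (opair \<tau> \<sigma>) \<sqinter>\<^bsub>\<BB>\<^esub> app s' (opair \<sigma> \<tau>)"
     if "\<tau> \<in> elts N'" "\<sigma> \<in> elts N'" for \<tau> \<sigma>
    using 2 that unfolding bv_functions_def by blast+
  have mstep: "app m (opair \<tau> \<sigma>) = app m' (opair \<tau> \<sigma>)"
    if t: "\<tau> \<in> elts N" "\<tau> \<in> elts N'" and s: "\<sigma> \<in> elts N" "\<sigma> \<in> elts N'"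
      and e: "\<And>\<eta> b. \<eta> \<in> V \<Longrightarrow> b \<in> V \<Longrightarrow> opair \<eta> b \<in> elts \<sigma> \<Longrightarrow> app e (opair \<tau> \<eta>) = app e' (opair \<tau> \<eta>)" for \<tau> \<sigma>
    unfolding eqs(1)[OF t(1) s(1)] eqs'(1)[OF t(2) s(2)]
    using e by (intro arg_cong[where f = bsup]) (auto; metis)
  have main: "app0 e (opair \<tau> \<sigma>) = app0 e' (opair \<tau> \<sigma>)"
    if t: "\<tau> \<in> elts N" "\<tau> \<in> elts N'" and s: "\<sigma> \<in> elts N" "\<sigma> \<in> elts N'" for \<tau> \<sigma>
  proof -
    let ?P = "\<lambda>a. \<forall>\<tau>\<in>elts N. \<tau> \<in> elts N' \<longrightarrow> (\<forall>\<sigma>\<in>elts N. \<sigma> \<in> elts N' \<longrightarrow>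
      rank \<tau> \<in> elts a \<longrightarrow> rank \<sigma> \<in> elts a \<longrightarrow> app0 e (opair \<tau> \<sigma>) = app0 e' (opair \<tau> \<sigma>))"
    have P: "?P a" if "a \<in> V" for a
    proof (rule eps_induct[where P = ?P, OF that])
      show "definable (\<lambda>v. ?P (v 0))" by (intro definable_intros NV fV)
    next
      fix a assume a: "a \<in> V" and IH: "\<And>b. b \<in> elts a \<Longrightarrow> ?P b"
      show "?P a"
      proof (intro ballI impI)
        fix \<tau> \<sigma> assume t: "\<tau> \<in> elts N" "\<tau> \<in> elts N'" and s: "\<sigma> \<in> elts N" "\<sigma> \<in> elts N'"
          and r: "rank \<tau> \<in> elts a" "rank \<sigma> \<in> elts a"
        note tV = elts_in_V[OF t(1)] and sV = elts_in_V[OF s(1)]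
        \<comment> \<open>the name of larger rank\<close>
        define \<mu> where "\<mu> = (if rank \<tau> \<in> elts (rank \<sigma>) then \<sigma> else \<tau>)"
        have \<mu>: "\<mu> \<in> V" "rank \<mu> \<in> elts a" using tV sV r by (auto simp: \<mu>_def)
        have below: "elts (rank \<tau>) \<subseteq> elts (rank \<mu>)" "elts (rank \<sigma>) \<subseteq> elts (rank \<mu>)"
          using rank_linear[OF tV sV] rank_transitive[OF tV] rank_transitive[OF sV] by (auto simp: \<mu>_def)
        have IHe: "app e (opair \<eta> \<zeta>) = app e' (opair \<eta> \<zeta>)"
          if "\<eta> \<in> elts N" "\<eta> \<in> elts N'" "\<zeta> \<in> elts N" "\<zeta> \<in> elts N'" "rank \<eta> \<in> elts (rank \<mu>)" "rank \<zeta> \<in> elts (rank \<mu>)" for \<eta> \<zeta>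
        proof -
          have "app0 e (opair \<eta> \<zeta>) = app0 e' (opair \<eta> \<zeta>)" using IH[OF \<mu>(2)] that by blast
          then show ?thesis using a0[OF that(1,3)] a0'[OF that(2,4)] by simp
        qed
        have entr: "\<eta> \<in> elts N \<and> \<eta> \<in> elts N' \<and> rank \<eta> \<in> elts (rank \<mu>)"
          if n: "\<eta> \<in> V" "b \<in> V" "opair \<eta> b \<in> elts \<rho>" and r: "\<rho> = \<tau> \<or> \<rho> = \<sigma>" for \<eta> b \<rho>
        proof -
          have r': "\<rho> \<in> elts N" "\<rho> \<in> elts N'" using r t s by auto
          have "is_name \<rho>" using r'(1) N(1) by (simp add: closed_names_def)
          then show ?thesis
            using closed_names_entry(1)[OF N(1) r'(1) n(3,1,2)] closed_names_entry(1)[OF N(2) r'(2) n(3,1,2)]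
              entry(3)[OF _ n(3,1,2)] below r by blast
        qed
        have meq: "app m (opair \<eta> \<rho>) = app m' (opair \<eta> \<rho>)"
          if "\<eta> \<in> elts N" "\<eta> \<in> elts N'" "rank \<eta> \<in> elts (rank \<mu>)" and r: "\<rho> = \<tau> \<or> \<rho> = \<sigma>" for \<eta> \<rho>
        proof (rule mstep[OF that(1,2)])
          show "\<rho> \<in> elts N" "\<rho> \<in> elts N'" using r t s by auto
          fix \<zeta> b assume n: "\<zeta> \<in> V" "b \<in> V" "opair \<zeta> b \<in> elts \<rho>"
          show "app e (opair \<eta> \<zeta>) = app e' (opair \<eta> \<zeta>)" using IHe entr[OF n r] that by blast
        qed
        have seq: "app s (opair \<rho> \<rho>') = app s' (opair \<rho> \<rho>')"
          if r: "\<rho> = \<tau> \<or> \<rho> = \<sigma>" "\<rho>' = \<tau> \<or> \<rho>' = \<sigma>" for \<rho> \<rho>'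
        proof -
          have r': "\<rho> \<in> elts N" "\<rho> \<in> elts N'" "\<rho>' \<in> elts N" "\<rho>' \<in> elts N'" using r t s by auto
          have "app m (opair \<eta> \<rho>) = app m' (opair \<eta> \<rho>) \<and> app m (opair \<eta> \<rho>') = app m' (opair \<eta> \<rho>')"
            if nd: "\<eta> \<in> name_dom \<rho>" for \<eta>
          proof -
            obtain b where n: "\<eta> \<in> V" "b \<in> V" "opair \<eta> b \<in> elts \<rho>" using nd by (auto simp: name_dom_def)
            show ?thesis using meq entr[OF n r(1)] r by blast
          qed
          then show ?thesis unfolding eqs(2)[OF r'(1,3)] eqs'(2)[OF r'(2,4)]
            by (intro arg_cong[where f = "Lattice.inf \<BB>"]) (auto; metis)
        qed
        have "app e (opair \<tau> \<sigma>) = app e' (opair \<tau> \<sigma>)"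
          unfolding eqs(3)[OF t(1) s(1)] eqs'(3)[OF t(2) s(2)] using seq by simp
        then show "app0 e (opair \<tau> \<sigma>) = app0 e' (opair \<tau> \<sigma>)" using a0[OF t(1) s(1)] a0'[OF t(2) s(2)] by simp
      qed
    qed
    note tV = elts_in_V[OF t(1)] and sV = elts_in_V[OF s(1)]
    have S: "set_of {\<tau>, \<sigma>} \<in> V" "elts (set_of {\<tau>, \<sigma>}) = {\<tau>, \<sigma>}" using tV sV by (simp_all add: set_of_in_V elts_set_of)
    have "rank \<tau> \<in> elts (rank (set_of {\<tau>, \<sigma>}))" "rank \<sigma> \<in> elts (rank (set_of {\<tau>, \<sigma>}))"
      using S by (auto intro!: rank_mono)
    then show ?thesis using P[OF rank_in_V[OF S(1)]] t s by blast
  qed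
  show "app e (opair \<tau> \<sigma>) = app e' (opair \<tau> \<sigma>)" using main[OF t s] a0[OF t(1) s(1)] a0'[OF t(2) s(2)] by simp
  show "app m (opair \<tau> \<sigma>) = app m' (opair \<tau> \<sigma>)"
  proof (rule mstep[OF t s])
    fix \<eta> b assume n: "\<eta> \<in> V" "b \<in> V" "opair \<eta> b \<in> elts \<sigma>"
    have h: "\<eta> \<in> elts N" "\<eta> \<in> elts N'"
      using closed_names_entry(1)[OF N(1) s(1) n(3,1,2)] closed_names_entry(1)[OF N(2) s(2) n(3,1,2)] by auto
    show "app e (opair \<tau> \<eta>) = app e' (opair \<tau> \<eta>)"
      using main[OF t h] a0[OF t(1) h(1)] a0'[OF t(2) h(2)] by simp
  qed
qed

lemma bv_eq_beq_on:
  assumes "closed_names N" "\<tau> \<in> elts N" "\<sigma> \<in> elts N"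
  shows "bv_eq \<tau> \<sigma> = beq_on N \<tau> \<sigma>" "bv_mem \<tau> \<sigma> = mem_sum (beq_on N) \<tau> \<sigma>"
proof -
  have NV: "N \<in> V" using assms(1) by (simp add: closed_names_def)
  note F = bv_functions_beq_on[OF assms(1)]
  have a: "app (lam2 N (beq_on N)) (opair \<tau> \<sigma>) = beq_on N \<tau> \<sigma>"
    by (rule app_lam2[OF NV _ assms(2,3)]) (intro definable_intros NV)
  have b: "app (lam2 N (mem_sum (beq_on N))) (opair \<tau> \<sigma>) = mem_sum (beq_on N) \<tau> \<sigma>"
    by (rule app_lam2[OF NV _ assms(2,3)]) (intro definable_intros NV defterm_mem_sum_beq_on[OF assms(1)])
  show "bv_eq \<tau> \<sigma> = beq_on N \<tau> \<sigma>"
    unfolding bv_eq_def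
  proof (rule the_equality)
    show "\<exists>N' m s e. bv_functions N' m s e \<and> \<tau> \<in> elts N' \<and> \<sigma> \<in> elts N' \<and> beq_on N \<tau> \<sigma> = app e (opair \<tau> \<sigma>)"
      using F assms a by metis
    fix b assume "\<exists>N m s e. bv_functions N m s e \<and> \<tau> \<in> elts N \<and> \<sigma> \<in> elts N \<and> b = app e (opair \<tau> \<sigma>)"
    then obtain N' m s e where "bv_functions N' m s e" "\<tau> \<in> elts N'" "\<sigma> \<in> elts N'" "b = app e (opair \<tau> \<sigma>)" by blast
    then show "b = beq_on N \<tau> \<sigma>" using bv_functions_unique(1)[OF _ F _ assms(2) _ assms(3)] a by simp
  qed
  show "bv_mem \<tau> \<sigma> = mem_sum (beq_on N) \<tau> \<sigma>"
    unfolding bv_mem_def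
  proof (rule the_equality)
    show "\<exists>N' m s e. bv_functions N' m s e \<and> \<tau> \<in> elts N' \<and> \<sigma> \<in> elts N' \<and> mem_sum (beq_on N) \<tau> \<sigma> = app m (opair \<tau> \<sigma>)"
      using F assms b by metis
    fix b' assume "\<exists>N m s e. bv_functions N m s e \<and> \<tau> \<in> elts N \<and> \<sigma> \<in> elts N \<and> b' = app m (opair \<tau> \<sigma>)"
    then obtain N' m s e where "bv_functions N' m s e" "\<tau> \<in> elts N'" "\<sigma> \<in> elts N'" "b' = app m (opair \<tau> \<sigma>)" by blast
    then show "b' = mem_sum (beq_on N) \<tau> \<sigma>" using bv_functions_unique(2)[OF _ F _ assms(2) _ assms(3)] b by simp
  qed
qed

end

context zfc_cba
begin

section \<open>Boolean values of arbitrary names\<close>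

text \<open>
  The Boolean values of equality and membership as total definable terms; they agree with \<open>bv_eq\<close> and \<open>bv_mem\<close> on names.  The
  set of names used in the computation depends on the arguments, but the values do not (\<open>beq_beq_on\<close>).
\<close>

definition beq :: "'a \<Rightarrow> 'a \<Rightarrow> 'a" where
  "beq \<tau> \<sigma> = beq_on (names_below (set_of {\<tau>, \<sigma>})) \<tau> \<sigma>"

definition bmem :: "'a \<Rightarrow> 'a \<Rightarrow> 'a" where "bmem = mem_sum beq"

lemma defterm_beq [definable_intros]: "defterm t \<Longrightarrow> defterm s \<Longrightarrow> defterm (\<lambda>v. beq (t v) (s v))"
  unfolding beq_def by (intro definable_intros)

lemma defterm_bmem [definable_intros]: "defterm t \<Longrightarrow> defterm s \<Longrightarrow> defterm (\<lambda>v. bmem (t v) (s v))"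
proof (rule defterm2[where F = bmem])
  show "defterm (\<lambda>v. bmem (v 0) (v (Suc 0)))" unfolding bmem_def mem_sum_def by (intro defterm_bsup definable_intros)
qed

lemma ex_closed_names:
  assumes "is_name \<tau>" "is_name \<sigma>" "is_name \<rho>"
  shows "\<exists>N. closed_names N \<and> \<tau> \<in> elts N \<and> \<sigma> \<in> elts N \<and> \<rho> \<in> elts N"
proof -
  note V = assms[THEN is_name_in_V]
  have S: "set_of {\<tau>, \<sigma>, \<rho>} \<in> V" "elts (set_of {\<tau>, \<sigma>, \<rho>}) = {\<tau>, \<sigma>, \<rho>}"
    using V by (simp_all add: set_of_in_V elts_set_of)
  have "\<xi> \<in> elts (names_below (set_of {\<tau>, \<sigma>, \<rho>}))" if "\<xi> \<in> {\<tau>, \<sigma>, \<rho>}" for \<xi>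
    unfolding elts_names_below[OF S(1)] using that assms rank_mono[OF _ S(1), of \<xi>] S(2) by auto
  then show ?thesis using closed_names_below[OF S(1)] by blast
qed

lemma beq_beq_on:
  assumes "closed_names N" "\<tau> \<in> elts N" "\<sigma> \<in> elts N"
  shows "beq \<tau> \<sigma> = beq_on N \<tau> \<sigma>"
proof -
  have n: "is_name \<tau>" "is_name \<sigma>" using assms by (auto simp: closed_names_def)
  note V = n[THEN is_name_in_V]
  have S: "set_of {\<tau>, \<sigma>} \<in> V" "elts (set_of {\<tau>, \<sigma>}) = {\<tau>, \<sigma>}"
    using V by (simp_all add: set_of_in_V elts_set_of)
  have in_N: "\<xi> \<in> elts (names_below (set_of {\<tau>, \<sigma>}))" if "\<xi> \<in> {\<tau>, \<sigma>}" for \<xi>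
    unfolding elts_names_below[OF S(1)] using that n rank_mono[OF _ S(1), of \<xi>] S(2) by auto
  have "beq \<tau> \<sigma> = bv_eq \<tau> \<sigma>"
    unfolding beq_def by (rule bv_eq_beq_on(1)[symmetric, OF closed_names_below[OF S(1)]]) (simp_all add: in_N)
  then show ?thesis using bv_eq_beq_on(1)[OF assms] by simp
qed

lemma bmem_beq_on:
  assumes N: "closed_names N" and t: "\<tau> \<in> elts N" and s: "\<sigma> \<in> elts N"
  shows "bmem \<tau> \<sigma> = mem_sum (beq_on N) \<tau> \<sigma>"
proof -
  have "beq \<tau> \<eta> = beq_on N \<tau> \<eta>" if "\<eta> \<in> V" "b \<in> V" "opair \<eta> b \<in> elts \<sigma>" for \<eta> b
    by (rule beq_beq_on[OF N t closed_names_entry(1)[OF N s that(3,1,2)]])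
  then show ?thesis unfolding bmem_def mem_sum_def by (intro arg_cong[where f = bsup]) (auto; metis)
qed

lemma bv_eq_beq: assumes "is_name \<tau>" "is_name \<sigma>" shows "bv_eq \<tau> \<sigma> = beq \<tau> \<sigma>"
proof -
  obtain N where "closed_names N" "\<tau> \<in> elts N" "\<sigma> \<in> elts N" using ex_closed_names[OF assms assms(2)] by blast
  then show ?thesis using beq_beq_on bv_eq_beq_on(1) by simp
qed

lemma bv_mem_bmem: assumes "is_name \<tau>" "is_name \<sigma>" shows "bv_mem \<tau> \<sigma> = bmem \<tau> \<sigma>"
proof -
  obtain N where "closed_names N" "\<tau> \<in> elts N" "\<sigma> \<in> elts N" using ex_closed_names[OF assms assms(2)] by blast
  then show ?thesis using bmem_beq_on bv_eq_beq_on(2) by simp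
qed

lemma beq_in_B [simp]: assumes "is_name \<tau>" "is_name \<sigma>" shows "beq \<tau> \<sigma> \<in> elts B"
proof -
  obtain N where "closed_names N" "\<tau> \<in> elts N" "\<sigma> \<in> elts N" using ex_closed_names[OF assms assms(2)] by blast
  then show ?thesis using beq_beq_on beq_on_in_B by simp
qed

lemma bmem_in_B [simp]: assumes "is_name \<tau>" "is_name \<sigma>" shows "bmem \<tau> \<sigma> \<in> elts B"
proof -
  obtain N where "closed_names N" "\<tau> \<in> elts N" "\<sigma> \<in> elts N" using ex_closed_names[OF assms assms(2)] by blast
  then show ?thesis using bmem_beq_on mem_sum_in_B elts_in_V by metis
qed

lemma beq_refl [simp]: assumes "is_name \<tau>" shows "beq \<tau> \<tau> = btop"
proof -
  obtain N where "closed_names N" "\<tau> \<in> elts N" using ex_closed_names[OF assms assms assms] by blast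
  then show ?thesis using beq_beq_on beq_on_refl by simp
qed

lemma beq_sym: assumes "is_name \<tau>" "is_name \<sigma>" shows "beq \<tau> \<sigma> = beq \<sigma> \<tau>"
proof -
  obtain N where "closed_names N" "\<tau> \<in> elts N" "\<sigma> \<in> elts N" using ex_closed_names[OF assms assms(2)] by blast
  then show ?thesis using beq_beq_on beq_on_sym by simp
qed

lemma beq_trans:
  assumes n: "is_name \<tau>" "is_name \<sigma>" "is_name \<rho>" and y: "y \<lesssim> beq \<tau> \<sigma>" "y \<lesssim> beq \<sigma> \<rho>"
  shows "y \<lesssim> beq \<tau> \<rho>"
proof -
  obtain N where N: "closed_names N" "\<tau> \<in> elts N" "\<sigma> \<in> elts N" "\<rho> \<in> elts N" using ex_closed_names[OF n] by blast
  show ?thesis using beq_on_trans[OF N, of y] y beq_beq_on[OF N(1,2,3)] beq_beq_on[OF N(1,3,4)] beq_beq_on[OF N(1,2,4)] by simp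
qed

lemma bmem_intro:
  assumes n: "is_name \<tau>" "is_name \<sigma>" and "opair \<eta> b \<in> elts \<sigma>" "\<eta> \<in> V" "b \<in> V" and y: "y \<lesssim> beq \<tau> \<eta>" "y \<lesssim> b"
  shows "y \<lesssim> bmem \<tau> \<sigma>"
proof -
  obtain N where N: "closed_names N" "\<tau> \<in> elts N" "\<sigma> \<in> elts N" using ex_closed_names[OF n n(2)] by blast
  note h = closed_names_entry(1)[OF N(1,3) assms(3-5)]
  show ?thesis using mem_sum_intro[OF N assms(3-5), of y] y beq_beq_on[OF N(1,2) h] bmem_beq_on[OF N] by simp
qed

lemma bmem_elim:
  assumes n: "is_name \<tau>" "is_name \<sigma>" and y: "y \<lesssim> bmem \<tau> \<sigma>" and z: "z \<in> elts B"
    and step: "\<And>\<eta> b y'. opair \<eta> b \<in> elts \<sigma> \<Longrightarrow> is_name \<eta> \<Longrightarrow> b \<in> elts B \<Longrightarrow> y' \<lesssim> y \<Longrightarrow> y' \<lesssim> beq \<tau> \<eta> \<Longrightarrow> y' \<lesssim> b \<Longrightarrow> y' \<lesssim> z"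
  shows "y \<lesssim> z"
proof -
  obtain N where N: "closed_names N" "\<tau> \<in> elts N" "\<sigma> \<in> elts N" using ex_closed_names[OF n n(2)] by blast
  show ?thesis
  proof (rule mem_sum_elim[OF N _ z])
    show "y \<lesssim> mem_sum (beq_on N) \<tau> \<sigma>" using y bmem_beq_on[OF N] by simp
    fix \<eta> b y' assume h: "opair \<eta> b \<in> elts \<sigma>" "\<eta> \<in> elts N" "b \<in> elts B" "y' \<lesssim> y" "y' \<lesssim> beq_on N \<tau> \<eta>" "y' \<lesssim> b"
    have "is_name \<eta>" using N(1) h(2) by (simp add: closed_names_def)
    then show "y' \<lesssim> z" using step[OF h(1) _ h(3,4) _ h(6)] h(5) beq_beq_on[OF N(1,2) h(2)] by simp
  qed
qed

lemma beq_intro: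
  assumes n: "is_name \<tau>" "is_name \<sigma>" and y: "y \<in> elts B"
    and 1: "\<And>\<eta> b y'. opair \<eta> b \<in> elts \<tau> \<Longrightarrow> is_name \<eta> \<Longrightarrow> b \<in> elts B \<Longrightarrow> y' \<lesssim> y \<Longrightarrow> y' \<lesssim> b \<Longrightarrow> y' \<lesssim> bmem \<eta> \<sigma>"
    and 2: "\<And>\<eta> b y'. opair \<eta> b \<in> elts \<sigma> \<Longrightarrow> is_name \<eta> \<Longrightarrow> b \<in> elts B \<Longrightarrow> y' \<lesssim> y \<Longrightarrow> y' \<lesssim> b \<Longrightarrow> y' \<lesssim> bmem \<eta> \<tau>"
  shows "y \<lesssim> beq \<tau> \<sigma>"
proof -
  obtain N where N: "closed_names N" "\<tau> \<in> elts N" "\<sigma> \<in> elts N" using ex_closed_names[OF n n(2)] by blast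
  have nm: "is_name \<eta>" if "\<eta> \<in> elts N" for \<eta> using N(1) that by (simp add: closed_names_def)
  have "y \<lesssim> beq_on N \<tau> \<sigma>"
  proof (rule beq_on_intro[OF N y])
    fix \<eta> b y' assume h: "opair \<eta> b \<in> elts \<tau>" "\<eta> \<in> elts N" "b \<in> elts B" "y' \<lesssim> y" "y' \<lesssim> b"
    show "y' \<lesssim> mem_sum (beq_on N) \<eta> \<sigma>" using 1[OF h(1) nm[OF h(2)] h(3-5)] bmem_beq_on[OF N(1) h(2) N(3)] by simp
  next
    fix \<eta> b y' assume h: "opair \<eta> b \<in> elts \<sigma>" "\<eta> \<in> elts N" "b \<in> elts B" "y' \<lesssim> y" "y' \<lesssim> b"
    show "y' \<lesssim> mem_sum (beq_on N) \<eta> \<tau>" using 2[OF h(1) nm[OF h(2)] h(3-5)] bmem_beq_on[OF N(1) h(2) N(2)] by simp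
  qed
  then show ?thesis using beq_beq_on[OF N] by simp
qed

lemma bmem_subst_right:
  assumes n: "is_name \<eta>" "is_name \<tau>" "is_name \<sigma>" and y: "y \<lesssim> bmem \<eta> \<tau>" "y \<lesssim> beq \<tau> \<sigma>"
  shows "y \<lesssim> bmem \<eta> \<sigma>"
proof -
  obtain N where N: "closed_names N" "\<eta> \<in> elts N" "\<tau> \<in> elts N" "\<sigma> \<in> elts N" using ex_closed_names[OF n] by blast
  show ?thesis
    using mem_sum_subst_right[OF N, of y] y bmem_beq_on[OF N(1,2,3)] bmem_beq_on[OF N(1,2,4)] beq_beq_on[OF N(1,3,4)] by simp
qed

lemma bmem_subst_left:
  assumes n: "is_name \<eta>" "is_name \<tau>" "is_name \<sigma>" and y: "y \<lesssim> beq \<eta> \<tau>" "y \<lesssim> bmem \<tau> \<sigma>"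
  shows "y \<lesssim> bmem \<eta> \<sigma>"
proof (rule bmem_elim[OF n(2,3) y(2) bmem_in_B[OF n(1,3)]])
  fix \<zeta> b y' assume h: "opair \<zeta> b \<in> elts \<sigma>" "is_name \<zeta>" "b \<in> elts B" "y' \<lesssim> y" "y' \<lesssim> beq \<tau> \<zeta>" "y' \<lesssim> b"
  show "y' \<lesssim> bmem \<eta> \<sigma>"
    by (rule bmem_intro[OF n(1,3) h(1) is_name_in_V[OF h(2)] B_V[OF h(3)] _ h(6)])
      (rule beq_trans[OF n(1,2) h(2) lesssim_trans[OF h(4) y(1)] h(5)])
qed

section \<open>Check names\<close>

lemma small_check_aux: "f \<in> V \<Longrightarrow> x \<in> V \<Longrightarrow> small {opair (app0 f y) btop | y. y \<in> elts x}"
  unfolding setcompr_eq_image Collect_mem_eq by (rule small_image[OF small_elts]) (assumption, intro definable_intros btop_in_V)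

lemma check_cong:
  fixes F G :: "'a \<Rightarrow> 'a"
  assumes "\<And>y. y \<in> elts x \<Longrightarrow> F y = G y"
  shows "set_of {opair (F y) btop | y. y \<in> elts x} = set_of {opair (G y) btop | y. y \<in> elts x}"
  using assms by (intro arg_cong[where f = set_of]) (auto; metis)

lemma defterm_check_step: "defterm (\<lambda>v. set_of {opair (app0 (v (Suc 0)) y) btop | y. y \<in> elts (v (Suc (Suc 0)))})"
proof (rule defterm_set_of)
  fix v :: "nat \<Rightarrow> 'a" assume "range v \<subseteq> V"
  then show "small {opair (app0 (v (Suc 0)) y) btop | y. y \<in> elts (v (Suc (Suc 0)))}" by (intro small_check_aux) auto
next
  have "definable (\<lambda>v. \<exists>y\<in>elts (v (Suc (Suc (Suc 0)))). v 0 = opair (app0 (v (Suc (Suc 0))) y) btop)"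
    by (intro definable_intros btop_in_V)
  then show "definable (\<lambda>v. v 0 \<in> {opair (app0 (v (Suc (Suc 0))) y) btop | y. y \<in> elts (v (Suc (Suc (Suc 0))))})"
    by (rule definable_cong) blast
qed

lemmas check_rec =
  rec_in_in_V[where H = "\<lambda>_ F x. set_of {opair (F y) btop | y. y \<in> elts x}", OF check_cong defterm_check_step emp(1), folded check_def]
  rec_in_unfold[where H = "\<lambda>_ F x. set_of {opair (F y) btop | y. y \<in> elts x}", OF check_cong defterm_check_step emp(1), folded check_def]
  rec_in_defterm[where H = "\<lambda>_ F x. set_of {opair (F y) btop | y. y \<in> elts x}", OF check_cong defterm_check_step defterm_const[OF emp(1)], folded check_def]

lemma check_in_V [simp]: "x \<in> V \<Longrightarrow> check x \<in> V"
  by (rule check_rec(1)) auto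

lemma defterm_check [definable_intros]: "defterm t \<Longrightarrow> defterm (\<lambda>v. check (t v))"
  by (rule check_rec(3)) auto

lemma elts_check:
  assumes "x \<in> V" shows "elts (check x) = {opair (check y) btop | y. y \<in> elts x}"
proof -
  have eq: "check x = set_of {opair (check y) btop | y. y \<in> elts x}" by (rule check_rec(2)[OF _ assms]) auto
  have sm: "small {opair (check y) btop | y. y \<in> elts x}"
    unfolding setcompr_eq_image Collect_mem_eq
    by (rule small_image[OF small_elts[OF assms]]) (intro definable_intros btop_in_V)
  show ?thesis by (subst eq) (rule elts_set_of[OF sm])
qed

lemma is_name_check [simp]: assumes "x \<in> V" shows "is_name (check x)"
proof (rule eps_induct[where P = "\<lambda>x. is_name (check x)", OF assms])
  show "definable (\<lambda>v. is_name (check (v 0)))" by (intro definable_intros)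
next
  fix x assume x: "x \<in> V" and IH: "\<And>y. y \<in> elts x \<Longrightarrow> is_name (check y)"
  show "is_name (check x)"
  proof (rule is_nameI[OF check_in_V[OF x]])
    fix p assume "p \<in> elts (check x)"
    then obtain y where y: "y \<in> elts x" "p = opair (check y) btop" unfolding elts_check[OF x] by blast
    then show "\<exists>\<sigma> b. is_name \<sigma> \<and> b \<in> elts B \<and> p = opair \<sigma> b" using IH[OF y(1)] btop_in_B by blast
  qed
qed

lemma check_entry:
  assumes "x \<in> V" "opair \<eta> b \<in> elts (check x)" "\<eta> \<in> V" "b \<in> V"
  obtains y where "y \<in> elts x" "\<eta> = check y" "b = btop"
proof -
  obtain y where y: "y \<in> elts x" "opair \<eta> b = opair (check y) btop" using assms(2) elts_check[OF assms(1)] by blast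
  then show ?thesis using that assms(3,4) elts_in_V[OF y(1)] by simp
qed

lemma bmem_check_intro:
  assumes "is_name \<tau>" "x \<in> V" "w \<in> elts x" "y \<lesssim> beq \<tau> (check w)"
  shows "y \<lesssim> bmem \<tau> (check x)"
proof (rule bmem_intro[OF assms(1) is_name_check[OF assms(2)]])
  show "opair (check w) btop \<in> elts (check x)" using elts_check[OF assms(2)] assms(3) by blast
  show "check w \<in> V" by (rule check_in_V[OF elts_in_V[OF assms(3)]])
  show "y \<lesssim> btop" by (rule lesssim_btop[OF lesssim_in_B(1)[OF assms(4)]])
qed (rule btop_in_V, rule assms(4))

lemma bmem_check_elim:
  assumes "is_name \<tau>" "x \<in> V" "y \<lesssim> bmem \<tau> (check x)" "z \<in> elts B"
    and step: "\<And>w y'. w \<in> elts x \<Longrightarrow> y' \<lesssim> y \<Longrightarrow> y' \<lesssim> beq \<tau> (check w) \<Longrightarrow> y' \<lesssim> z"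
  shows "y \<lesssim> z"
proof (rule bmem_elim[OF assms(1) is_name_check[OF assms(2)] assms(3,4)])
  fix \<eta> b y' assume h: "opair \<eta> b \<in> elts (check x)" "is_name \<eta>" "b \<in> elts B" "y' \<lesssim> y" "y' \<lesssim> beq \<tau> \<eta>"
  obtain w where "w \<in> elts x" "\<eta> = check w" by (rule check_entry[OF assms(2) h(1) is_name_in_V[OF h(2)] B_V[OF h(3)]])
  then show "y' \<lesssim> z" using step h(4,5) by blast
qed

text \<open>
  If \<open>z\<close> lies in only one of \<open>x\<close> and \<open>y\<close>, equality of the check names would put \<open>z\<close> into the other one, hence would equate \<open>z\<close>
  with a different set.
\<close>

lemma beq_check_neq_aux:
  assumes "x \<in> V" shows "\<forall>y\<in>V. x \<noteq> y \<longrightarrow> beq (check x) (check y) = bbot"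
proof (rule eps_induct[where P = "\<lambda>x. \<forall>y\<in>V. x \<noteq> y \<longrightarrow> beq (check x) (check y) = bbot", OF assms])
  show "definable (\<lambda>v. \<forall>y\<in>V. v 0 \<noteq> y \<longrightarrow> beq (check (v 0)) (check y) = bbot)" by (intro definable_intros bbot_in_V)
next
  fix x assume x: "x \<in> V" and IH: "\<And>z. z \<in> elts x \<Longrightarrow> \<forall>y\<in>V. z \<noteq> y \<longrightarrow> beq (check z) (check y) = bbot"
  show "\<forall>y\<in>V. x \<noteq> y \<longrightarrow> beq (check x) (check y) = bbot"
  proof (intro ballI impI)
    fix y assume y: "y \<in> V" and neq: "x \<noteq> y"
    let ?e = "beq (check x) (check y)"
    have eB: "?e \<in> elts B" using x y by simp
    have "elts x \<noteq> elts y" using extensionality[OF x y] neq by blast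
    then consider z where "z \<in> elts x" "z \<notin> elts y" | z where "z \<in> elts y" "z \<notin> elts x" by blast
    then have "?e \<lesssim> bbot"
    proof cases
      case 1
      note zV = elts_in_V[OF 1(1)]
      have "?e \<lesssim> bmem (check z) (check x)"
        by (rule bmem_check_intro[OF is_name_check[OF zV] x 1(1)]) (simp add: zV lesssim_btop[OF eB])
      then have "?e \<lesssim> bmem (check z) (check y)"
        by (rule bmem_subst_right[OF is_name_check[OF zV] is_name_check[OF x] is_name_check[OF y]]) (use eB in simp)
      then show ?thesis
      proof (rule bmem_check_elim[OF is_name_check[OF zV] y _ bbot_in_B])
        fix w y' assume w: "w \<in> elts y" "y' \<lesssim> beq (check z) (check w)"
        have "z \<noteq> w" using w(1) 1(2) by auto
        then have "beq (check z) (check w) = bbot" using bspec[OF IH[OF 1(1)] elts_in_V[OF w(1)]] by simp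
        then show "y' \<lesssim> bbot" using w(2) by simp
      qed
    next
      case 2
      note zV = elts_in_V[OF 2(1)]
      have "?e \<lesssim> bmem (check z) (check y)"
        by (rule bmem_check_intro[OF is_name_check[OF zV] y 2(1)]) (simp add: zV lesssim_btop[OF eB])
      then have "?e \<lesssim> bmem (check z) (check x)"
        by (rule bmem_subst_right[OF is_name_check[OF zV] is_name_check[OF y] is_name_check[OF x]])
          (use eB beq_sym[OF is_name_check[OF x] is_name_check[OF y]] in simp)
      then show ?thesis
      proof (rule bmem_check_elim[OF is_name_check[OF zV] x _ bbot_in_B])
        fix w y' assume w: "w \<in> elts x" "y' \<lesssim> beq (check z) (check w)"
        have "w \<noteq> z" using w(1) 2(2) by auto
        then have "beq (check w) (check z) = bbot" using bspec[OF IH[OF w(1)] zV] by simp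
        then show "y' \<lesssim> bbot" using w beq_sym[OF is_name_check[OF zV] is_name_check[OF elts_in_V[OF w(1)]]] by simp
      qed
    qed
    then show "?e = bbot" by (simp add: lesssim_bbot_iff)
  qed
qed

lemma beq_check_neq: "x \<in> V \<Longrightarrow> y \<in> V \<Longrightarrow> x \<noteq> y \<Longrightarrow> beq (check x) (check y) = bbot"
  using beq_check_neq_aux by blast

lemma beq_two_checks:
  assumes "is_name \<tau>" "x \<in> V" "w \<in> V" "x \<noteq> w" "y \<lesssim> beq \<tau> (check x)" "y \<lesssim> beq \<tau> (check w)"
  shows "y = bbot"
proof -
  have "y \<lesssim> beq (check x) (check w)"
    using beq_trans[OF is_name_check[OF assms(2)] assms(1) is_name_check[OF assms(3)] _ assms(6)] assms(5)
      beq_sym[OF assms(1) is_name_check[OF assms(2)]] by simp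
  then show ?thesis using beq_check_neq[OF assms(2-4)] by (simp add: lesssim_bbot_iff)
qed

text \<open>
  The total definable version of \<open>bv_ground\<close>.
\<close>

definition bground :: "'a \<Rightarrow> 'a" where "bground \<tau> = bsup {z \<in> elts B. \<exists>x\<in>V. z = beq \<tau> (check x)}"

lemma defterm_bground [definable_intros]: "defterm t \<Longrightarrow> defterm (\<lambda>v. bground (t v))"
proof (rule defterm1[where F = bground])
  show "defterm (\<lambda>v. bground (v 0))" unfolding bground_def by (intro defterm_bsup definable_intros)
qed

lemma small_bground: "\<tau> \<in> V \<Longrightarrow> small {z \<in> elts B. \<exists>x\<in>V. z = beq \<tau> (check x)}"
  by (intro small_B_Collect definable_intros)

lemma bv_ground_bground: assumes "is_name \<tau>" shows "bv_ground \<tau> = bground \<tau>"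
proof -
  have "{bv_eq \<tau> (check x) | x. x \<in> V} = {z \<in> elts B. \<exists>x\<in>V. z = beq \<tau> (check x)}"
  proof (intro equalityI subsetI)
    fix z assume "z \<in> {bv_eq \<tau> (check x) | x. x \<in> V}"
    then obtain x where "x \<in> V" "z = bv_eq \<tau> (check x)" by blast
    then show "z \<in> {z \<in> elts B. \<exists>x\<in>V. z = beq \<tau> (check x)}"
      using bv_eq_beq[OF assms is_name_check] beq_in_B[OF assms is_name_check] by auto
  next
    fix z assume "z \<in> {z \<in> elts B. \<exists>x\<in>V. z = beq \<tau> (check x)}"
    then obtain x where x: "x \<in> V" "z = beq \<tau> (check x)" by blast
    show "z \<in> {bv_eq \<tau> (check x) | x. x \<in> V}"
      by (intro CollectI exI[of _ x]) (simp add: x bv_eq_beq[OF assms])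
  qed
  then show ?thesis by (simp add: bv_ground_def bground_def)
qed

lemma bground_in_B [simp]: "is_name \<tau> \<Longrightarrow> bground \<tau> \<in> elts B"
  unfolding bground_def by (rule bsup_in_B[OF small_bground[OF is_name_in_V]]) auto

lemma bground_intro: assumes "is_name \<tau>" "x \<in> V" "y \<lesssim> beq \<tau> (check x)" shows "y \<lesssim> bground \<tau>"
  unfolding bground_def by (rule bsup_intro[OF small_bground[OF is_name_in_V[OF assms(1)]] _ _ assms(3)]) (use assms in auto)

lemma bground_elim:
  assumes "is_name \<tau>" "y \<lesssim> bground \<tau>" "z \<in> elts B"
    and "\<And>x y'. x \<in> V \<Longrightarrow> y' \<lesssim> y \<Longrightarrow> y' \<lesssim> beq \<tau> (check x) \<Longrightarrow> y' \<lesssim> z"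
  shows "y \<lesssim> z"
  by (rule bsup_elim[OF small_bground[OF is_name_in_V[OF assms(1)]] _ assms(2)[unfolded bground_def] assms(3)])
    (use assms(4) in auto)

section \<open>Mixing\<close>

text \<open>
  A name that equals \<open>g i\<close> with value at least \<open>d i\<close>: below \<open>d i\<close>, disjointness leaves only the entries for the elements of \<open>g i\<close>.
\<close>

definition mixname :: "'a \<Rightarrow> 'a \<Rightarrow> 'a \<Rightarrow> 'a" where
  "mixname I d g = set_of {opair (check k) (app0 d i) | i k. i \<in> elts I \<and> k \<in> elts (app0 g i)}"

lemma small_mixname:
  assumes "I \<in> V" "d \<in> V" "g \<in> V"
  shows "small {opair (check k) (app0 d i) | i k. i \<in> elts I \<and> k \<in> elts (app0 g i)}"
  by (rule small_image_Sigma[where G = "app0 g" and F = "\<lambda>i k. opair (check k) (app0 d i)", OF small_elts[OF assms(1)]])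
    (intro definable_intros assms)+

lemma defterm_mixname [definable_intros]: "defterm r \<Longrightarrow> defterm t \<Longrightarrow> defterm s \<Longrightarrow> defterm (\<lambda>v. mixname (r v) (t v) (s v))"
proof (rule defterm3[where F = mixname])
  show "defterm (\<lambda>v. mixname (v 0) (v (Suc 0)) (v (Suc (Suc 0))))"
    unfolding mixname_def
  proof (rule defterm_set_of)
    fix v :: "nat \<Rightarrow> 'a" assume "range v \<subseteq> V"
    then have "v 0 \<in> V" "v (Suc 0) \<in> V" "v (Suc (Suc 0)) \<in> V" by auto
    then show "small {opair (check k) (app0 (v (Suc 0)) i) | i k. i \<in> elts (v 0) \<and> k \<in> elts (app0 (v (Suc (Suc 0))) i)}"
      by (rule small_mixname)
  next
    have "definable (\<lambda>v. \<exists>i\<in>elts (v (Suc 0)). \<exists>k\<in>elts (app0 (v (Suc (Suc (Suc 0)))) i).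
        v 0 = opair (check k) (app0 (v (Suc (Suc 0))) i))" by (intro definable_intros)
    then show "definable (\<lambda>v. v 0 \<in> {opair (check k) (app0 (v (Suc (Suc 0))) i) | i k.
        i \<in> elts (v (Suc 0)) \<and> k \<in> elts (app0 (v (Suc (Suc (Suc 0)))) i)})"
      by (rule definable_cong) blast
  qed
qed

lemma mixname:
  assumes V: "I \<in> V" "d \<in> V" "g \<in> V" and dB: "\<And>i. i \<in> elts I \<Longrightarrow> app0 d i \<in> elts B"
  shows is_name_mixname: "is_name (mixname I d g)"
    and beq_mixname: "\<And>i. (\<And>i j. i \<in> elts I \<Longrightarrow> j \<in> elts I \<Longrightarrow> i \<noteq> j \<Longrightarrow> bmeet (app0 d i) (app0 d j) = bbot)
      \<Longrightarrow> i \<in> elts I \<Longrightarrow> app0 d i \<lesssim> beq (mixname I d g) (check (app0 g i))"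
proof -
  note S = small_set_of[OF small_mixname[OF V], folded mixname_def]
  show n: "is_name (mixname I d g)"
  proof (rule is_nameI[OF S(1)])
    fix p assume "p \<in> elts (mixname I d g)"
    then obtain i k where ik: "i \<in> elts I" "k \<in> elts (app0 g i)" "p = opair (check k) (app0 d i)" unfolding S(2) by blast
    then show "\<exists>\<sigma> b. is_name \<sigma> \<and> b \<in> elts B \<and> p = opair \<sigma> b"
      using dB is_name_check[OF elts_in_V[OF ik(2)]] by blast
  qed
  fix i assume disj: "\<And>i j. i \<in> elts I \<Longrightarrow> j \<in> elts I \<Longrightarrow> i \<noteq> j \<Longrightarrow> bmeet (app0 d i) (app0 d j) = bbot" and i: "i \<in> elts I"
  have gV: "app0 g i \<in> V" by simp
  show "app0 d i \<lesssim> beq (mixname I d g) (check (app0 g i))"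
  proof (rule beq_intro[OF n is_name_check[OF gV] dB[OF i]])
    fix \<eta> b y' assume h: "opair \<eta> b \<in> elts (mixname I d g)" "is_name \<eta>" "b \<in> elts B" "y' \<lesssim> app0 d i" "y' \<lesssim> b"
    obtain j k where jk: "j \<in> elts I" "k \<in> elts (app0 g j)" "opair \<eta> b = opair (check k) (app0 d j)"
      using h(1) unfolding S(2) by blast
    have kV: "k \<in> V" using jk(2) by (rule elts_in_V)
    have eq: "\<eta> = check k" "b = app0 d j" using jk(3) is_name_in_V[OF h(2)] B_V[OF h(3)] kV by simp_all
    show "y' \<lesssim> bmem \<eta> (check (app0 g i))"
    proof (cases "j = i")
      case True
      then show ?thesis unfolding eq(1)
        using bmem_check_intro[OF is_name_check[OF kV] gV, of k y'] jk(2) kV lesssim_btop[OF lesssim_in_B(1)[OF h(4)]] by simp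
    next
      case False
      then have "bmeet (app0 d i) (app0 d j) = bbot" using disj i jk(1) by blast
      then have "y' \<lesssim> bbot" using h(4,5) eq(2) lesssim_bmeet_iff[OF dB[OF i] dB[OF jk(1)]] by metis
      then show ?thesis using lesssim_trans[OF _ bbot_lesssim] bmem_in_B[OF h(2) is_name_check[OF gV]] by blast
    qed
  next
    fix \<eta> b y' assume h: "opair \<eta> b \<in> elts (check (app0 g i))" "is_name \<eta>" "b \<in> elts B" "y' \<lesssim> app0 d i"
    obtain k where k: "k \<in> elts (app0 g i)" "\<eta> = check k"
      by (rule check_entry[OF gV h(1) is_name_in_V[OF h(2)] B_V[OF h(3)]])
    have "opair (check k) (app0 d i) \<in> elts (mixname I d g)" unfolding S(2) using i k by blast
    then show "y' \<lesssim> bmem \<eta> (mixname I d g)" unfolding k(2)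
      using bmem_intro[OF is_name_check[OF elts_in_V[OF k(1)]] n, of "check k" "app0 d i" y'] h(4)
        elts_in_V[OF k(1)] lesssim_btop[OF lesssim_in_B(1)[OF h(4)]] by simp
  qed
qed

end

section \<open>Completeness properties of the ultrafilter\<close>

locale boolean_ultrafilter = zfc_cba V E B L
  for V :: "'a set" and E :: "'a \<Rightarrow> 'a \<Rightarrow> bool" and B L :: 'a +
  fixes u :: "'a set"
  assumes u: "ultrafilter_on \<BB> u"
begin

lemma u_in_B: "x \<in> u \<Longrightarrow> x \<in> elts B" and btop_in_u: "btop \<in> u" and bbot_notin_u: "bbot \<notin> u"
  using u by (auto simp: ultrafilter_on_def)

lemma u_up: "x \<in> u \<Longrightarrow> x \<lesssim> y \<Longrightarrow> y \<in> u"
  using u unfolding ultrafilter_on_def lesssim_def by auto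

lemma u_bmeet: assumes "x \<in> u" "y \<in> u" shows "bmeet x y \<in> u"
proof -
  have "\<forall>x\<in>u. \<forall>y\<in>u. x \<sqinter>\<^bsub>\<BB>\<^esub> y \<in> u" using u by (simp add: ultrafilter_on_def)
  then show ?thesis using assms bmeet_eq_meet[OF u_in_B[OF assms(1)] u_in_B[OF assms(2)]] by simp
qed

lemma u_bcompl: "x \<in> elts B \<Longrightarrow> x \<notin> u \<Longrightarrow> bcompl x \<in> u"
  using u unfolding ultrafilter_on_def by auto

lemma u_disjoint: "x \<in> u \<Longrightarrow> y \<in> u \<Longrightarrow> bmeet x y \<noteq> bbot"
  using u_bmeet bbot_notin_u by metis

lemma lesssim_of_bmeet_bcompl:
  assumes "x \<in> elts B" "a \<in> elts B" "bmeet x (bcompl a) = bbot" shows "x \<lesssim> a"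
proof -
  have "x = bmeet x (bjoin a (bcompl a))" using assms by (simp add: bjoin_bcompl bmeet_btop)
  also have "\<dots> = bjoin (bmeet x a) (bmeet x (bcompl a))" by (rule distrib) (use assms in auto)
  finally have "x = bjoin (bmeet x a) bbot" using assms(3) by simp
  moreover have "bjoin (bmeet x a) bbot \<preceq> a" by (rule bjoin_le) (use assms in \<open>auto simp: bmeet_le2\<close>)
  ultimately show ?thesis using assms by (simp add: lesssim_def)
qed

lemma sequence_inf:
  assumes f: "fun_on a (elts omega)" and B: "\<forall>n\<in>elts omega. app a n \<in> elts B"
  shows "\<Sqinter>\<^bsub>\<BB>\<^esub> (app a ` elts omega) \<in> elts B"
    and "\<And>n. n \<in> elts omega \<Longrightarrow> \<Sqinter>\<^bsub>\<BB>\<^esub> (app a ` elts omega) \<lesssim> app a n"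
    and "\<And>z. z \<in> elts B \<Longrightarrow> (\<And>n. n \<in> elts omega \<Longrightarrow> z \<lesssim> app a n) \<Longrightarrow> z \<lesssim> \<Sqinter>\<^bsub>\<BB>\<^esub> (app a ` elts omega)"
proof -
  have aV: "a \<in> V" using f by (simp add: fun_on_def)
  have eq: "app a ` elts omega = app0 a ` elts omega" using app0_eq[OF f] by auto
  have "small (app0 a ` elts omega)"
    by (rule small_image[OF small_elts[OF omega_in_V]]) (intro definable_intros aV)
  then have sm: "small (app a ` elts omega)" by (simp add: eq)
  have sub: "app a ` elts omega \<subseteq> elts B" using B by auto
  note I = binf[OF sm sub]
  show 1: "\<Sqinter>\<^bsub>\<BB>\<^esub> (app a ` elts omega) \<in> elts B" by (rule I(1))
  show "\<Sqinter>\<^bsub>\<BB>\<^esub> (app a ` elts omega) \<lesssim> app a n" if "n \<in> elts omega" for n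
    using I(2)[of "app a n"] 1 B that by (simp add: lesssim_def)
  show "z \<lesssim> \<Sqinter>\<^bsub>\<BB>\<^esub> (app a ` elts omega)" if "z \<in> elts B" "\<And>n. n \<in> elts omega \<Longrightarrow> z \<lesssim> app a n" for z
    using I(3)[OF that(1)] that 1 by (auto simp: lesssim_def)
qed

lemma countably_complete_imp_weakly:
  "countably_complete u \<Longrightarrow> weakly_countably_complete u"
  unfolding countably_complete_def weakly_countably_complete_def using bbot_notin_u by metis

text \<open>
  If the infimum \<open>I\<close> is not in \<open>u\<close>, its complement is, and meeting the sequence with it gives a sequence of members of \<open>u\<close> with infimum
  \<open>\<bottom>\<close>.
\<close>

lemma weakly_imp_countably_complete:
  assumes weak: "weakly_countably_complete u"
  shows "countably_complete u"
  unfolding countably_complete_def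
proof (intro allI impI, elim conjE)
  fix a assume f: "fun_on a (elts omega)" and "\<forall>n\<in>elts omega. app a n \<in> u"
  then have au: "\<And>n. n \<in> elts omega \<Longrightarrow> app a n \<in> u" by blast
  have aB: "\<And>n. n \<in> elts omega \<Longrightarrow> app a n \<in> elts B" using au u_in_B by blast
  have aV: "a \<in> V" using f by (simp add: fun_on_def)
  define I where "I = \<Sqinter>\<^bsub>\<BB>\<^esub> (app a ` elts omega)"
  have "\<forall>n\<in>elts omega. app a n \<in> elts B" using aB by blast
  note inf = sequence_inf[OF f this, folded I_def]
  have "I \<in> u"
  proof (rule ccontr)
    assume "I \<notin> u"
    then have c: "bcompl I \<in> u" using u_bcompl[OF inf(1)] by blast
    note cV = B_V[OF u_in_B[OF c]]
    have "defterm (\<lambda>v. bmeet (app0 a (v 0)) (bcompl I))" by (intro definable_intros aV cV)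
    note l = lam[OF small_elts[OF omega_in_V] this]
    have val: "app (lam (elts omega) (\<lambda>n. bmeet (app0 a n) (bcompl I))) n = bmeet (app a n) (bcompl I)" if "n \<in> elts omega" for n
      using l(3)[OF that] app0_eq[OF f that] by simp
    have in_u: "app (lam (elts omega) (\<lambda>n. bmeet (app0 a n) (bcompl I))) n \<in> u" if "n \<in> elts omega" for n
      unfolding val[OF that] by (rule u_bmeet[OF au[OF that] c])
    define J where "J = \<Sqinter>\<^bsub>\<BB>\<^esub> (app (lam (elts omega) (\<lambda>n. bmeet (app0 a n) (bcompl I))) ` elts omega)"
    have valB: "\<forall>n\<in>elts omega. app (lam (elts omega) (\<lambda>n. bmeet (app0 a n) (bcompl I))) n \<in> elts B" using in_u u_in_B by blast
    note J = sequence_inf[OF l(2) valB, folded J_def]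
    have J_le: "J \<lesssim> app a n \<and> J \<lesssim> bcompl I" if n: "n \<in> elts omega" for n
      using J(2)[OF n] lesssim_bmeet_iff[OF aB[OF n] u_in_B[OF c]] unfolding val[OF n] by blast
    have "J \<lesssim> I" by (rule inf(3)) (use J(1) J_le in auto)
    then have "J \<lesssim> bmeet (bcompl I) I" using J_le[OF emp_in_omega] inf(1) u_in_B[OF c] by (simp add: lesssim_bmeet_iff)
    moreover have "bmeet (bcompl I) I = bbot"
      using bmeet_bcompl[OF inf(1)] bmeet_comm[OF inf(1) u_in_B[OF c]] by simp
    ultimately have "J = bbot" by (simp add: lesssim_bbot_iff)
    moreover have "J \<noteq> bbot"
      using weak l(2) in_u unfolding weakly_countably_complete_def J_def by blast
    ultimately show False by blast
  qed
  then show "\<Sqinter>\<^bsub>\<BB>\<^esub> (app a ` elts omega) \<in> u" by (simp add: I_def)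
qed

text \<open>
  Otherwise \<open>I\<close> could be added to the antichain.
\<close>

lemma max_antichain_disjoint:
  assumes A: "countable_maximal_antichain A" and I: "I \<in> elts B" and disj: "\<And>x. x \<in> elts A \<Longrightarrow> bmeet I x = bbot"
  shows "I = bbot"
proof (rule ccontr)
  assume "I \<noteq> bbot"
  have AV: "A \<in> V" and anti: "antichain_in \<BB> (elts A)"
    and max: "\<And>A'. A' \<in> V \<Longrightarrow> antichain_in \<BB> (elts A') \<Longrightarrow> elts A \<subseteq> elts A' \<Longrightarrow> elts A' = elts A"
    using A unfolding countable_maximal_antichain_def by blast+
  have AB: "x \<in> elts B" if "x \<in> elts A" for x using anti that by (auto simp: antichain_in_def)
  have sA: "small (insert I (elts A))" using AV B_V[OF I] by simp
  note SA = small_set_of[OF sA]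
  have "antichain_in \<BB> (elts (set_of (insert I (elts A))))"
    unfolding antichain_in_def SA(2)
  proof (intro conjI ballI impI)
    show "insert I (elts A) \<subseteq> carrier \<BB>" using I AB by auto
    show "bbot \<notin> insert I (elts A)" using \<open>I \<noteq> bbot\<close> anti by (auto simp: antichain_in_def)
    fix x y assume xy: "x \<in> insert I (elts A)" "y \<in> insert I (elts A)" "x \<noteq> y"
    have B: "x \<in> elts B" "y \<in> elts B" using xy I AB by auto
    have "bmeet x y = bbot"
    proof (cases "x = I \<or> y = I")
      case True
      then show ?thesis using disj xy bmeet_comm[OF B] by auto
    next
      case False
      then show ?thesis using xy anti bmeet_eq_meet[OF B] by (auto simp: antichain_in_def)
    qed
    then show "x \<sqinter>\<^bsub>\<BB>\<^esub> y = bbot" using bmeet_eq_meet[OF B] by simp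
  qed
  then have "elts (set_of (insert I (elts A))) = elts A" using SA by (intro max) auto
  then have "I \<in> elts A" using SA(2) by auto
  then have "bmeet I I = bbot" by (rule disj)
  then show False using \<open>I \<noteq> bbot\<close> bmeet_absorb[of I I] I by simp
qed

text \<open>
  If \<open>u\<close> misses the antichain, it contains the complements of its elements.  The sequence \<open>a\<close> lists these complements along the injection \<open>f\<close>; its
  value at an index \<open>n\<close> outside the range of \<open>f\<close> is \<open>\<top>\<close>, as there is then no condition on \<open>z\<close>.
\<close>

lemma weakly_imp_meets:
  assumes weak: "weakly_countably_complete u"
  shows "meets_countable_maximal_antichains u"
  unfolding meets_countable_maximal_antichains_def
proof (intro allI impI notI)
  fix A assume A: "countable_maximal_antichain A" and disj: "u \<inter> elts A = {}"
  have AV: "A \<in> V" and anti: "antichain_in \<BB> (elts A)"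
    using A unfolding countable_maximal_antichain_def by blast+
  obtain f where f: "fun_on f (elts A)" "app f ` elts A \<subseteq> elts omega" "inj_on (app f) (elts A)"
    using A unfolding countable_maximal_antichain_def countable_in_def by blast
  have fV: "f \<in> V" using f(1) by (simp add: fun_on_def)
  have AB: "x \<in> elts B" if "x \<in> elts A" for x using anti that by (auto simp: antichain_in_def)
  have f0: "app0 f x = app f x" if "x \<in> elts A" for x by (rule app0_eq[OF f(1) that])
  define a where "a n = bsup {z \<in> elts B. \<forall>x\<in>elts A. app0 f x = n \<longrightarrow> bmeet z x = bbot}" for n
  have sm: "small {z \<in> elts B. \<forall>x\<in>elts A. app0 f x = n \<longrightarrow> bmeet z x = bbot}" if "n \<in> V" for n
    by (intro small_B_Collect definable_intros fV AV bbot_in_V that)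
  have "defterm (\<lambda>v. a (v 0))" unfolding a_def by (intro defterm_bsup definable_intros fV AV bbot_in_V)
  note s = lam[OF small_elts[OF omega_in_V] this]
  have aB: "a n \<in> elts B" if "n \<in> V" for n unfolding a_def by (rule bsup_in_B[OF sm[OF that]]) auto
  have a_disj: "bmeet (a (app f x)) x = bbot" if x: "x \<in> elts A" for x
  proof -
    have nV: "app f x \<in> V" by (rule fun_on_app_in_V[OF f(1) x])
    have "bmeet x (a (app f x)) = bbot"
      unfolding a_def
    proof (rule bmeet_bsup_eq_bbot[OF sm[OF nV] _ AB[OF x]])
      fix z assume "z \<in> {z \<in> elts B. \<forall>xa\<in>elts A. app0 f xa = app f x \<longrightarrow> bmeet z xa = bbot}"
      then show "bmeet x z = bbot" using f0[OF x] x bmeet_comm[OF AB[OF x]] by auto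
    qed auto
    then show ?thesis using bmeet_comm[OF aB[OF nV] AB[OF x]] by simp
  qed
  have a_in_u: "a n \<in> u" if n: "n \<in> elts omega" for n
  proof -
    note nV = elts_in_V[OF n]
    have in_u: "z \<lesssim> a n" if "z \<in> elts B" "\<forall>x\<in>elts A. app0 f x = n \<longrightarrow> bmeet z x = bbot" for z
      unfolding a_def by (rule bsup_intro[OF sm[OF nV] _ _ lesssim_refl[OF that(1)]]) (use that in auto)
    show ?thesis
    proof (cases "\<exists>x\<in>elts A. app f x = n")
      case True
      then obtain x where x: "x \<in> elts A" "app f x = n" by blast
      have "bcompl x \<in> u" using u_bcompl[OF AB[OF x(1)]] disj x(1) by blast
      moreover have "bcompl x \<lesssim> a n"
      proof (rule in_u, simp add: AB[OF x(1)], intro ballI impI)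
        fix x' assume x': "x' \<in> elts A" "app0 f x' = n"
        then have "x' = x" using f0 x inj_onD[OF f(3)] by metis
        then show "bmeet (bcompl x) x' = bbot" using bmeet_bcompl[OF AB[OF x(1)]] bmeet_comm[of x "bcompl x"] AB[OF x(1)] by simp
      qed
      ultimately show ?thesis by (rule u_up)
    next
      case False
      then have "btop \<lesssim> a n" by (intro in_u) (use f0 in auto)
      then show ?thesis by (rule u_up[OF btop_in_u])
    qed
  qed
  define I where "I = \<Sqinter>\<^bsub>\<BB>\<^esub> (app (lam (elts omega) a) ` elts omega)"
  have inf: "I \<in> elts B" "\<And>n. n \<in> elts omega \<Longrightarrow> I \<lesssim> app (lam (elts omega) a) n"
    using sequence_inf[OF s(2)] s(3) a_in_u u_in_B unfolding I_def by simp_all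
  have "\<forall>n\<in>elts omega. app (lam (elts omega) a) n \<in> u" using s(3) a_in_u by simp
  then have "I \<noteq> bbot" using weak s(2) unfolding weakly_countably_complete_def I_def by blast
  have I_disj: "bmeet I x = bbot" if x: "x \<in> elts A" for x
  proof -
    have n: "app f x \<in> elts omega" using f(2) x by blast
    have "I \<lesssim> a (app f x)" using inf(2)[OF n] s(3)[OF n] by simp
    then have "bmeet I x \<lesssim> bmeet (a (app f x)) x"
      using bmeet_lesssim[OF inf(1) AB[OF x]] lesssim_trans aB[OF elts_in_V[OF n]] AB[OF x] by (subst lesssim_bmeet_iff) blast+
    then show ?thesis using a_disj[OF x] by (simp add: lesssim_bbot_iff)
  qed
  show False using max_antichain_disjoint[OF A inf(1)] I_disj \<open>I \<noteq> bbot\<close> by blast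
qed

text \<open>
  \<open>- a n \<sqinter> (\<Sqinter>k\<in>n. a k)\<close>, the Boolean value of ``\<open>n\<close> is the first index at which \<open>a\<close> fails''.  A natural number is the set of
  its predecessors, so that the earlier indices are the elements of \<open>n\<close>.
\<close>

definition first_fail :: "'a \<Rightarrow> 'a \<Rightarrow> 'a" where
  "first_fail a n = bsup {z \<in> elts B. (\<forall>k\<in>elts n. z \<lesssim> app0 a k) \<and> bmeet z (app0 a n) = bbot}"

lemma defterm_first_fail [definable_intros]: "defterm t \<Longrightarrow> defterm s \<Longrightarrow> defterm (\<lambda>v. first_fail (t v) (s v))"
proof (rule defterm2[where F = first_fail])
  show "defterm (\<lambda>v. first_fail (v 0) (v (Suc 0)))"
    unfolding first_fail_def by (intro defterm_bsup definable_intros bbot_in_V)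
qed

context
  fixes a
  assumes f: "fun_on a (elts omega)" and au: "\<forall>n\<in>elts omega. app a n \<in> u"
    and inf_bbot: "\<Sqinter>\<^bsub>\<BB>\<^esub> (app a ` elts omega) = bbot"
begin

lemma seq_in_V: "a \<in> V" using f by (simp add: fun_on_def)

lemma seq_in_u: "n \<in> elts omega \<Longrightarrow> app0 a n \<in> u" using app0_eq[OF f] au by simp

lemma seq_in_B: "n \<in> elts omega \<Longrightarrow> app0 a n \<in> elts B" by (rule u_in_B[OF seq_in_u])

lemma below_seq: assumes "x \<in> elts B" "\<And>n. n \<in> elts omega \<Longrightarrow> x \<lesssim> app0 a n" shows "x = bbot"
proof -
  have aB: "\<forall>n\<in>elts omega. app a n \<in> elts B" using au u_in_B by blast
  have "x \<lesssim> \<Sqinter>\<^bsub>\<BB>\<^esub> (app a ` elts omega)"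
  proof (rule sequence_inf(3)[OF f aB assms(1)])
    fix n assume n: "n \<in> elts omega"
    show "x \<lesssim> app a n" using assms(2)[OF n] app0_eq[OF f n] by simp
  qed
  then show ?thesis by (simp add: inf_bbot lesssim_bbot_iff)
qed

lemma small_first_fail: "n \<in> V \<Longrightarrow> small {z \<in> elts B. (\<forall>k\<in>elts n. z \<lesssim> app0 a k) \<and> bmeet z (app0 a n) = bbot}"
  by (intro small_B_Collect definable_intros seq_in_V bbot_in_V)

lemma first_fail_in_B: "n \<in> V \<Longrightarrow> first_fail a n \<in> elts B"
  unfolding first_fail_def by (rule bsup_in_B[OF small_first_fail]) auto

lemma first_fail_below:
  assumes n: "n \<in> elts omega" and y: "y \<lesssim> first_fail a n" and k: "k \<in> elts n"
  shows "y \<lesssim> app0 a k"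
proof (rule bsup_elim[OF small_first_fail[OF elts_in_V[OF n]] _ y[unfolded first_fail_def]])
  show "app0 a k \<in> elts B" using seq_in_B omega_transitive[OF n] k by blast
  fix x y' assume "x \<in> {z \<in> elts B. (\<forall>k\<in>elts n. z \<lesssim> app0 a k) \<and> bmeet z (app0 a n) = bbot}" "y' \<lesssim> x"
  then show "y' \<lesssim> app0 a k" using k lesssim_trans by blast
qed auto

lemma first_fail_disjoint_seq:
  assumes n: "n \<in> elts omega" shows "bmeet (app0 a n) (first_fail a n) = bbot"
  unfolding first_fail_def
proof (rule bmeet_bsup_eq_bbot[OF small_first_fail[OF elts_in_V[OF n]] _ seq_in_B[OF n]])
  fix x assume "x \<in> {z \<in> elts B. (\<forall>k\<in>elts n. z \<lesssim> app0 a k) \<and> bmeet z (app0 a n) = bbot}"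
  then show "bmeet (app0 a n) x = bbot" using bmeet_comm[OF seq_in_B[OF n]] by auto
qed auto

lemma first_fail_less_disjoint:
  assumes n: "n \<in> elts omega" and k: "k \<in> elts n"
  shows "bmeet (first_fail a n) (first_fail a k) = bbot"
proof -
  have ko: "k \<in> elts omega" using omega_transitive[OF n] k by blast
  have B: "first_fail a n \<in> elts B" "first_fail a k \<in> elts B"
    using first_fail_in_B elts_in_V[OF n] elts_in_V[OF k] by simp_all
  let ?y = "bmeet (first_fail a n) (first_fail a k)"
  have "?y \<lesssim> app0 a k" by (rule first_fail_below[OF n bmeet_lesssim(1)[OF B] k])
  then have "?y \<lesssim> bmeet (app0 a k) (first_fail a k)"
    using bmeet_lesssim(2)[OF B] seq_in_B[OF ko] B by (simp add: lesssim_bmeet_iff)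
  then show ?thesis using first_fail_disjoint_seq[OF ko] by (simp add: lesssim_bbot_iff)
qed

lemma first_fail_disjoint:
  assumes n: "n \<in> elts omega" and k: "k \<in> elts omega" and "n \<noteq> k"
  shows "bmeet (first_fail a n) (first_fail a k) = bbot"
proof -
  consider "k \<in> elts n" | "n \<in> elts k" using omega_linear[OF n] k assms(3) by blast
  then show ?thesis
  proof cases
    case 1
    then show ?thesis by (rule first_fail_less_disjoint[OF n])
  next
    case 2
    then show ?thesis using first_fail_less_disjoint[OF k]
        bmeet_comm[OF first_fail_in_B[OF elts_in_V[OF n]] first_fail_in_B[OF elts_in_V[OF k]]] by simp
  qed
qed

text \<open>
  An element disjoint from all \<open>first_fail a n\<close> lies below every \<open>a n\<close>, by induction.
\<close>

lemma first_fail_total: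
  assumes x: "x \<in> elts B" and xD: "\<And>n. n \<in> elts omega \<Longrightarrow> bmeet x (first_fail a n) = bbot"
  shows "x = bbot"
proof (rule below_seq[OF x])
  note xV = B_V[OF x]
  have below: "\<forall>k\<in>elts n. x \<lesssim> app0 a k" if "n \<in> elts omega" for n
  proof (rule omega_induct[where P = "\<lambda>n. \<forall>k\<in>elts n. x \<lesssim> app0 a k", OF that])
    show "definable (\<lambda>v. \<forall>k\<in>elts (v 0). x \<lesssim> app0 a k)" by (intro definable_intros xV seq_in_V)
    show "\<forall>k\<in>elts emp. x \<lesssim> app0 a k" by simp
  next
    fix n assume n: "n \<in> elts omega" and IH: "\<forall>k\<in>elts n. x \<lesssim> app0 a k"
    note nV = elts_in_V[OF n] and an = seq_in_B[OF n]
    let ?y = "bmeet x (bcompl (app0 a n))"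
    have y: "?y \<lesssim> x" "?y \<lesssim> bcompl (app0 a n)" by (rule bmeet_lesssim[OF x bcompl_in_B[OF an]])+
    have 1: "bmeet ?y (app0 a n) = bbot"
      using le_bcompl_iff[OF lesssim_in_B(1)[OF y(1)] an] y(2) by (simp add: lesssim_def)
    have 2: "\<forall>k\<in>elts n. ?y \<lesssim> app0 a k" using IH lesssim_trans[OF y(1)] by blast
    have "?y \<lesssim> first_fail a n"
      unfolding first_fail_def
      by (rule bsup_intro[OF small_first_fail[OF nV] _ _ lesssim_refl[OF lesssim_in_B(1)[OF y(1)]]])
        (use 1 2 lesssim_in_B(1)[OF y(1)] in auto)
    then have "?y \<lesssim> bmeet x (first_fail a n)" using y(1) x first_fail_in_B[OF nV] by (simp add: lesssim_bmeet_iff)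
    then have "?y = bbot" using xD[OF n] by (simp add: lesssim_bbot_iff)
    then have "x \<lesssim> app0 a n" by (rule lesssim_of_bmeet_bcompl[OF x an])
    then show "\<forall>k\<in>elts (succ n). x \<lesssim> app0 a k" using IH nV by simp
  qed
  show "x \<lesssim> app0 a n" if "n \<in> elts omega" for n
    using below[OF succ_in_omega[OF that]] elts_in_V[OF that] by simp
qed

lemma first_fail_cover:
  assumes z: "z \<in> elts B" and le: "\<And>n. n \<in> elts omega \<Longrightarrow> first_fail a n \<lesssim> z"
  shows "z \<in> u"
proof -
  have "bcompl z = bbot"
  proof (rule first_fail_total[OF bcompl_in_B[OF z]])
    fix n assume n: "n \<in> elts omega"
    have B: "first_fail a n \<in> elts B" by (rule first_fail_in_B[OF elts_in_V[OF n]])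
    have "bmeet (bcompl z) (first_fail a n) \<lesssim> bmeet z (bcompl z)"
      using bmeet_lesssim[OF bcompl_in_B[OF z] B] lesssim_trans[OF _ le[OF n]] z by (simp add: lesssim_bmeet_iff)
    then show "bmeet (bcompl z) (first_fail a n) = bbot" using bmeet_bcompl[OF z] by (simp add: lesssim_bbot_iff)
  qed
  then show ?thesis using u_bcompl[OF z] bbot_notin_u by metis
qed

lemma first_fail_notin_u: assumes n: "n \<in> elts omega" shows "first_fail a n \<notin> u"
  using first_fail_disjoint_seq[OF n] u_disjoint[OF seq_in_u[OF n]] by blast

lemma missed_antichain: "\<not> meets_countable_maximal_antichains u"
proof
  assume meets: "meets_countable_maximal_antichains u"
  let ?D = "first_fail a"
  have sA: "small {x \<in> elts B. x \<noteq> bbot \<and> (\<exists>n\<in>elts omega. x = ?D n)}"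
    by (intro small_B_Collect definable_intros omega_in_V bbot_in_V seq_in_V)
  define A where "A = set_of {x \<in> elts B. x \<noteq> bbot \<and> (\<exists>n\<in>elts omega. x = ?D n)}"
  have A: "A \<in> V" "elts A = {x \<in> elts B. x \<noteq> bbot \<and> (\<exists>n\<in>elts omega. x = ?D n)}"
    using small_set_of[OF sA] by (simp_all add: A_def)
  have uniq: "n = k" if "n \<in> elts omega" "k \<in> elts omega" "?D n = ?D k" "?D n \<noteq> bbot" for n k
  proof (rule ccontr)
    assume "n \<noteq> k"
    then have "bmeet (?D n) (?D n) = bbot" using first_fail_disjoint[OF that(1,2)] that(3) by simp
    then show False using bmeet_absorb[of "?D n" "?D n"] first_fail_in_B[OF elts_in_V[OF that(1)]] that(4) by simp
  qed
  define ix where "ix x = the0 (\<lambda>n. n \<in> elts omega \<and> x = ?D n)" for x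
  have ix: "ix x \<in> elts omega \<and> x = ?D (ix x)" if xA: "x \<in> elts A" for x
  proof -
    obtain n where n: "n \<in> elts omega" "x = ?D n" and x: "x \<noteq> bbot" using xA unfolding A(2) by blast
    have "ix x = n" unfolding ix_def
    proof (rule the0_equality[OF elts_in_V[OF n(1)]])
      show "n \<in> elts omega \<and> x = ?D n" using n by blast
      fix k assume k: "k \<in> elts omega \<and> x = ?D k"
      show "k = n" by (rule uniq) (use k n x in simp_all)
    qed
    then show ?thesis using n by simp
  qed
  have "defterm (\<lambda>v. ix (v 0))" unfolding ix_def by (intro definable_intros omega_in_V seq_in_V)
  note l = lam[OF small_elts[OF A(1)] this]
  have "countable_in A"
    unfolding countable_in_def
  proof (intro exI conjI)
    show "fun_on (lam (elts A) ix) (elts A)" by (rule l)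
    show "app (lam (elts A) ix) ` elts A \<subseteq> elts omega" using l(3) ix by auto
    show "inj_on (app (lam (elts A) ix)) (elts A)"
    proof (rule inj_onI)
      fix x y assume xy: "x \<in> elts A" "y \<in> elts A" "app (lam (elts A) ix) x = app (lam (elts A) ix) y"
      then have "ix x = ix y" using l(3) by simp
      then show "x = y" using ix[OF xy(1)] ix[OF xy(2)] by simp
    qed
  qed
  moreover have "antichain_in \<BB> (elts A)"
    unfolding antichain_in_def
  proof (intro conjI ballI impI)
    show "elts A \<subseteq> carrier \<BB>" "bbot \<notin> elts A" unfolding A(2) by auto
    fix x y assume xy: "x \<in> elts A" "y \<in> elts A" "x \<noteq> y"
    then have B: "x \<in> elts B" "y \<in> elts B" unfolding A(2) by auto
    have "ix x \<noteq> ix y" using ix[OF xy(1)] ix[OF xy(2)] xy(3) by auto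
    then have "bmeet (?D (ix x)) (?D (ix y)) = bbot" using first_fail_disjoint ix xy by blast
    then have "bmeet x y = bbot" using ix[OF xy(1)] ix[OF xy(2)] by simp
    then show "x \<sqinter>\<^bsub>\<BB>\<^esub> y = bbot" using bmeet_eq_meet[OF B] by simp
  qed
  moreover have "elts A' = elts A" if A': "A' \<in> V" "antichain_in \<BB> (elts A')" "elts A \<subseteq> elts A'" for A'
  proof (rule ccontr)
    assume "elts A' \<noteq> elts A"
    then obtain x where x: "x \<in> elts A'" "x \<notin> elts A" using A'(3) by blast
    have xB: "x \<in> elts B" and xn: "x \<noteq> bbot" using A'(2) x(1) by (auto simp: antichain_in_def)
    have "x = bbot"
    proof (rule first_fail_total[OF xB])
      fix n assume n: "n \<in> elts omega"
      show "bmeet x (?D n) = bbot"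
      proof (cases "?D n = bbot")
        case True
        then show ?thesis using bmeet_bbot(1)[OF xB] by simp
      next
        case False
        have B: "?D n \<in> elts B" by (rule first_fail_in_B[OF elts_in_V[OF n]])
        then have "?D n \<in> elts A" unfolding A(2) using False n by blast
        then have "?D n \<in> elts A'" "x \<noteq> ?D n" using A'(3) x(2) by auto
        then have "x \<sqinter>\<^bsub>\<BB>\<^esub> ?D n = bbot" using A'(2) x(1) by (auto simp: antichain_in_def)
        then show ?thesis using bmeet_eq_meet[OF xB B] by simp
      qed
    qed
    then show False using xn by blast
  qed
  ultimately have "countable_maximal_antichain A"
    unfolding countable_maximal_antichain_def using A(1) by blast
  then have "u \<inter> elts A \<noteq> {}" using meets unfolding meets_countable_maximal_antichains_def by blast
  then show False using first_fail_notin_u unfolding A(2) by blast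
qed

end

lemma meets_imp_weakly:
  assumes "meets_countable_maximal_antichains u" shows "weakly_countably_complete u"
  unfolding weakly_countably_complete_def using missed_antichain assms by blast

end

section \<open>The Boolean ultrapower\<close>

context boolean_ultrafilter
begin

lemma beq_u_trans:
  assumes "is_name \<tau>" "is_name \<sigma>" "is_name \<rho>" "beq \<tau> \<sigma> \<in> u" "beq \<sigma> \<rho> \<in> u"
  shows "beq \<tau> \<rho> \<in> u"
proof (rule u_up[OF u_bmeet[OF assms(4,5)]])
  have B: "beq \<tau> \<sigma> \<in> elts B" "beq \<sigma> \<rho> \<in> elts B" using assms by simp_all
  show "bmeet (beq \<tau> \<sigma>) (beq \<sigma> \<rho>) \<lesssim> beq \<tau> \<rho>"
    by (rule beq_trans[OF assms(1-3) bmeet_lesssim[OF B]])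
qed

lemma bmem_u_cong:
  assumes n: "is_name \<tau>" "is_name \<sigma>" "is_name \<tau>'" "is_name \<sigma>'"
    and h: "beq \<tau> \<tau>' \<in> u" "beq \<sigma> \<sigma>' \<in> u" "bmem \<tau>' \<sigma>' \<in> u"
  shows "bmem \<tau> \<sigma> \<in> u"
proof -
  have B: "beq \<tau> \<tau>' \<in> elts B" "beq \<sigma> \<sigma>' \<in> elts B" "bmem \<tau>' \<sigma>' \<in> elts B" using n by simp_all
  let ?y = "bmeet (beq \<tau> \<tau>') (bmeet (beq \<sigma> \<sigma>') (bmem \<tau>' \<sigma>'))"
  have yu: "?y \<in> u" by (intro u_bmeet h)
  have y: "?y \<lesssim> beq \<tau> \<tau>'" "?y \<lesssim> beq \<sigma> \<sigma>'" "?y \<lesssim> bmem \<tau>' \<sigma>'"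
    using bmeet_lesssim[OF B(1) bmeet_in_B[OF B(2,3)]] lesssim_bmeet_iff[OF B(2,3)] by blast+
  have "?y \<lesssim> bmem \<tau> \<sigma>'" by (rule bmem_subst_left[OF n(1,3,4) y(1,3)])
  then have "?y \<lesssim> bmem \<tau> \<sigma>" by (rule bmem_subst_right[OF n(1,4,2)]) (use y(2) beq_sym[OF n(2,4)] in simp)
  then show ?thesis by (rule u_up[OF yu])
qed

lemma bground_u_cong:
  assumes n: "is_name \<tau>" "is_name \<sigma>" and h: "beq \<tau> \<sigma> \<in> u" "bground \<tau> \<in> u"
  shows "bground \<sigma> \<in> u"
proof (rule u_up[OF u_bmeet[OF h]])
  have B: "beq \<tau> \<sigma> \<in> elts B" "bground \<tau> \<in> elts B" using n by simp_all
  note y = bmeet_lesssim[OF B]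
  show "bmeet (beq \<tau> \<sigma>) (bground \<tau>) \<lesssim> bground \<sigma>"
  proof (rule bground_elim[OF n(1) y(2) bground_in_B[OF n(2)]])
    fix x y' assume x: "x \<in> V" and y': "y' \<lesssim> bmeet (beq \<tau> \<sigma>) (bground \<tau>)" "y' \<lesssim> beq \<tau> (check x)"
    have "y' \<lesssim> beq \<sigma> (check x)"
      by (rule beq_trans[OF n(2,1) is_name_check[OF x] _ y'(2)]) (use lesssim_trans[OF y'(1) y(1)] beq_sym[OF n] in simp)
    then show "y' \<lesssim> bground \<sigma>" by (rule bground_intro[OF n(2) x])
  qed
qed

lemma mem_name_class_iff:
  assumes "is_name \<tau>"
  shows "\<sigma> \<in> name_class u \<tau> \<longleftrightarrow> is_name \<sigma> \<and> beq \<tau> \<sigma> \<in> u \<and>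
    (\<forall>\<rho>. is_name \<rho> \<and> beq \<tau> \<rho> \<in> u \<longrightarrow> rank \<rho> \<notin> elts (rank \<sigma>))"
  unfolding name_class_def mem_Collect_eq using bv_eq_beq[OF assms] by auto

lemma name_class_eqI:
  assumes n: "is_name \<tau>" "is_name \<sigma>" and h: "beq \<tau> \<sigma> \<in> u"
  shows "name_class u \<tau> = name_class u \<sigma>"
proof -
  have h': "beq \<sigma> \<tau> \<in> u" using h beq_sym[OF n] by simp
  have iff: "beq \<tau> \<rho> \<in> u \<longleftrightarrow> beq \<sigma> \<rho> \<in> u" if "is_name \<rho>" for \<rho>
    using beq_u_trans[OF n(2,1) that h'] beq_u_trans[OF n that h] by blast
  show ?thesis
    by (rule Set.set_eqI) (auto simp: mem_name_class_iff[OF n(1)] mem_name_class_iff[OF n(2)] iff)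
qed

lemma ultrapower_mem_imp_bmem:
  assumes n: "is_name \<tau>" "is_name \<sigma>" and m: "ultrapower_mem u (name_class u \<tau>) (name_class u \<sigma>)"
  shows "bmem \<tau> \<sigma> \<in> u"
proof -
  obtain \<tau>' \<sigma>' where h: "\<tau>' \<in> name_class u \<tau>" "\<sigma>' \<in> name_class u \<sigma>" "bv_mem \<tau>' \<sigma>' \<in> u"
    using m unfolding ultrapower_mem_def by blast
  then have h': "is_name \<tau>'" "beq \<tau> \<tau>' \<in> u" "is_name \<sigma>'" "beq \<sigma> \<sigma>' \<in> u"
    using mem_name_class_iff[OF n(1)] mem_name_class_iff[OF n(2)] by blast+
  then show ?thesis using bmem_u_cong[OF n h'(1,3)] h(3) bv_mem_bmem by simp
qed

text \<open>
  If \<open>u\<close> contained no \<open>[\<tau> = n]\<close>, it would contain the infimum of their complements, which is disjoint from \<open>[\<tau> \<in> \<omega>]\<close>.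
\<close>

lemma ex_standard:
  assumes cc: "countably_complete u" and n: "is_name \<tau>" and m: "bmem \<tau> (check omega) \<in> u"
  shows "\<exists>n\<in>elts omega. beq \<tau> (check n) \<in> u"
proof (rule ccontr)
  assume no: "\<not> (\<exists>n\<in>elts omega. beq \<tau> (check n) \<in> u)"
  note tV = is_name_in_V[OF n]
  define a where "a n = bsup {z \<in> elts B. bmeet z (beq \<tau> (check n)) = bbot}" for n
  have sm: "small {z \<in> elts B. bmeet z (beq \<tau> (check n)) = bbot}" if "n \<in> V" for n
    by (intro small_B_Collect definable_intros tV bbot_in_V that)
  have "defterm (\<lambda>v. a (v 0))" unfolding a_def by (intro defterm_bsup definable_intros tV bbot_in_V)
  note l = lam[OF small_elts[OF omega_in_V] this]
  have aB: "a n \<in> elts B" if "n \<in> V" for n unfolding a_def by (rule bsup_in_B[OF sm[OF that]]) auto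
  have au: "a n \<in> u" if n': "n \<in> elts omega" for n
  proof -
    note nV = elts_in_V[OF n']
    have eB: "beq \<tau> (check n) \<in> elts B" using n nV by simp
    have c: "bcompl (beq \<tau> (check n)) \<in> u" using u_bcompl[OF eB] no n' by blast
    have "bmeet (bcompl (beq \<tau> (check n))) (beq \<tau> (check n)) = bbot"
      using bmeet_bcompl[OF eB] bmeet_comm[OF eB bcompl_in_B[OF eB]] by simp
    then have "bcompl (beq \<tau> (check n)) \<lesssim> a n"
      unfolding a_def by (intro bsup_intro[OF sm[OF nV] _ _ lesssim_refl[OF bcompl_in_B[OF eB]]]) (use eB in auto)
    then show ?thesis by (rule u_up[OF c])
  qed
  define I where "I = \<Sqinter>\<^bsub>\<BB>\<^esub> (app (lam (elts omega) a) ` elts omega)"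
  have lB: "\<forall>n\<in>elts omega. app (lam (elts omega) a) n \<in> elts B" using l(3) aB elts_in_V by simp
  note inf = sequence_inf[OF l(2) lB, folded I_def]
  have "\<forall>n\<in>elts omega. app (lam (elts omega) a) n \<in> u" using l(3) au by simp
  then have Iu: "I \<in> u" using cc l(2) unfolding countably_complete_def I_def by blast
  have mB: "bmem \<tau> (check omega) \<in> elts B" using n by simp
  note y = bmeet_lesssim[OF inf(1) mB]
  have "bmeet I (bmem \<tau> (check omega)) \<lesssim> bbot"
  proof (rule bmem_check_elim[OF n omega_in_V y(2) bbot_in_B])
    fix w y' assume w: "w \<in> elts omega" and y': "y' \<lesssim> bmeet I (bmem \<tau> (check omega))" "y' \<lesssim> beq \<tau> (check w)"
    note wV = elts_in_V[OF w]
    have eB: "beq \<tau> (check w) \<in> elts B" using n wV by simp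
    have "bmeet (beq \<tau> (check w)) (a w) = bbot"
      unfolding a_def
    proof (rule bmeet_bsup_eq_bbot[OF sm[OF wV] _ eB])
      fix z assume "z \<in> {z \<in> elts B. bmeet z (beq \<tau> (check w)) = bbot}"
      then show "bmeet (beq \<tau> (check w)) z = bbot" using bmeet_comm[OF eB] by auto
    qed auto
    moreover have "y' \<lesssim> a w" using lesssim_trans[OF lesssim_trans[OF y'(1) y(1)] inf(2)[OF w]] l(3)[OF w] by simp
    then have "y' \<lesssim> bmeet (beq \<tau> (check w)) (a w)" using y'(2) eB aB[OF wV] by (simp add: lesssim_bmeet_iff)
    ultimately show "y' \<lesssim> bbot" by simp
  qed
  then show False using u_disjoint[OF Iu m] by (simp add: lesssim_bbot_iff)
qed

lemma countably_complete_imp_omega_model: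
  assumes cc: "countably_complete u" shows "ultrapower_omega_model u"
  unfolding ultrapower_omega_model_def
proof (intro ballI impI)
  fix c assume "c \<in> ultrapower u" and m: "ultrapower_mem u c (ultrapower_map u omega)"
  then obtain \<tau> where t: "is_name \<tau>" "c = name_class u \<tau>" unfolding ultrapower_def by blast
  have "bmem \<tau> (check omega) \<in> u"
    by (rule ultrapower_mem_imp_bmem[OF t(1) is_name_check[OF omega_in_V]])
      (use m t(2) in \<open>simp add: ultrapower_map_def\<close>)
  from ex_standard[OF cc t(1) this] obtain n where n: "n \<in> elts omega" "beq \<tau> (check n) \<in> u" by blast
  have "c = ultrapower_map u n"
    unfolding t(2) ultrapower_map_def by (rule name_class_eqI[OF t(1) is_name_check[OF elts_in_V[OF n(1)]] n(2)])
  then show "\<exists>n\<in>elts omega. c = ultrapower_map u n" using n(1) by blast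
qed

text \<open>
  Dependent choice inside \<open>V\<close> applies because \<open>u\<close> is a set of \<open>V\<close>, hence a parameter for the relation from which the descending
  sequence of names is chosen.  Membership induction (\<open>key\<close>) then excludes every set as a value of a name of the sequence below \<open>I\<close>.
\<close>

lemma weakly_imp_wf:
  assumes UV: "U \<in> V" and uU: "u = elts U" and weak: "weakly_countably_complete u"
  shows "ultrapower_wf_in V u"
  unfolding ultrapower_wf_in_def Let_def
proof (intro ballI impI, elim conjE, rule ccontr)
  fix X assume XV: "X \<in> V" and ne: "elts ` elts X \<noteq> {}" and sub: "elts ` elts X \<subseteq> ultrapower u"
    and "\<not> (\<exists>c\<in>elts ` elts X. \<forall>d\<in>elts ` elts X. \<not> ultrapower_mem u d c)"
  then have step: "\<exists>y\<in>elts X. ultrapower_mem u (elts y) (elts x)" if "x \<in> elts X" for x using that by blast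
  have cls: "\<exists>\<tau>. is_name \<tau> \<and> bground \<tau> \<in> u \<and> elts x = name_class u \<tau>" if "x \<in> elts X" for x
  proof -
    have "elts x \<in> ultrapower u" using sub that by blast
    then obtain \<tau> where "is_name \<tau>" "bv_ground \<tau> \<in> u" "elts x = name_class u \<tau>" unfolding ultrapower_def by blast
    then show ?thesis using bv_ground_bground by auto
  qed
  \<comment> \<open>descend through the members of the classes, so that no representatives need to be chosen first\<close>
  define T where "T = big_union X"
  have T: "T \<in> V" "elts T = (\<Union>x\<in>elts X. elts x)" using XV by (simp_all add: T_def big_union)
  have Tn: "is_name \<sigma> \<and> bground \<sigma> \<in> u" if s: "\<sigma> \<in> elts T" for \<sigma>
  proof -
    obtain x where x: "x \<in> elts X" "\<sigma> \<in> elts x" using s T(2) by blast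
    obtain \<tau> where t: "is_name \<tau>" "bground \<tau> \<in> u" "elts x = name_class u \<tau>" using cls[OF x(1)] by blast
    then have "is_name \<sigma>" "beq \<tau> \<sigma> \<in> u" using x(2) mem_name_class_iff[OF t(1)] by auto
    then show ?thesis using bground_u_cong[OF t(1) _ _ t(2)] by blast
  qed
  have total: "\<exists>\<rho>\<in>elts T. bmem \<rho> \<sigma> \<in> elts U" if s: "\<sigma> \<in> elts T" for \<sigma>
  proof -
    obtain x where x: "x \<in> elts X" "\<sigma> \<in> elts x" using s T(2) by blast
    obtain y where y: "y \<in> elts X" "ultrapower_mem u (elts y) (elts x)" using step[OF x(1)] by blast
    then obtain \<rho> \<sigma>' where r: "\<rho> \<in> elts y" "\<sigma>' \<in> elts x" "bv_mem \<rho> \<sigma>' \<in> u" unfolding ultrapower_mem_def by blast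
    obtain \<tau> where t: "is_name \<tau>" "elts x = name_class u \<tau>" using cls[OF x(1)] by blast
    have s': "is_name \<sigma>" "beq \<tau> \<sigma> \<in> u" "is_name \<sigma>'" "beq \<tau> \<sigma>' \<in> u"
      using x(2) r(2) t(2) mem_name_class_iff[OF t(1)] by auto
    have rT: "\<rho> \<in> elts T" using r(1) y(1) T(2) by blast
    then have rn: "is_name \<rho>" using Tn by blast
    have "beq \<sigma> \<sigma>' \<in> u" by (rule beq_u_trans[OF s'(1) t(1) s'(3) _ s'(4)]) (use s'(2) beq_sym[OF s'(1) t(1)] in simp)
    then have "bmem \<rho> \<sigma> \<in> u"
      by (intro bmem_u_cong[OF rn s'(1) rn s'(3)]) (use btop_in_u rn r(3) bv_mem_bmem[OF rn s'(3)] in simp_all)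
    then show ?thesis using rT uU by blast
  qed
  obtain x0 where x0: "x0 \<in> elts X" using ne by blast
  obtain t0 where t0: "t0 \<in> elts T" using step[OF x0] x0 T(2) unfolding ultrapower_mem_def by blast
  have "definable (\<lambda>v. bmem (v (Suc 0)) (v 0) \<in> elts U)" by (intro definable_intros UV)
  from dependent_choice[where R = "\<lambda>\<sigma> \<rho>. bmem \<rho> \<sigma> \<in> elts U", OF T(1) this total t0]
  obtain f where f: "fun_on f (elts omega)" "\<And>n. n \<in> elts omega \<Longrightarrow> app f n \<in> elts T"
    "\<And>n. n \<in> elts omega \<Longrightarrow> bmem (app f (succ n)) (app f n) \<in> u" unfolding uU by blast
  have fV: "f \<in> V" using f(1) by (simp add: fun_on_def)
  have f0: "app0 f n = app f n" if "n \<in> elts omega" for n by (rule app0_eq[OF f(1) that])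
  have fn: "is_name (app0 f n)" "bground (app0 f n) \<in> u" if "n \<in> elts omega" for n
    using Tn[OF f(2)[OF that]] f0[OF that] by simp_all
  define a where "a n = bmeet (bmem (app0 f (succ n)) (app0 f n)) (bground (app0 f n))" for n
  have "defterm (\<lambda>v. a (v 0))" unfolding a_def by (intro definable_intros fV)
  note l = lam[OF small_elts[OF omega_in_V] this]
  have au: "a n \<in> u" if n: "n \<in> elts omega" for n
    unfolding a_def by (rule u_bmeet) (use f(3)[OF n] fn(2)[OF n] f0[OF n] f0[OF succ_in_omega[OF n]] in simp_all)
  have a_le: "y \<lesssim> bmem (app0 f (succ n)) (app0 f n) \<and> y \<lesssim> bground (app0 f n)" if n: "n \<in> elts omega" and y: "y \<lesssim> a n" for n y
    using y lesssim_bmeet_iff[OF bmem_in_B[OF fn(1)[OF succ_in_omega[OF n]] fn(1)[OF n]] bground_in_B[OF fn(1)[OF n]]]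
    unfolding a_def by blast
  define I where "I = \<Sqinter>\<^bsub>\<BB>\<^esub> (app (lam (elts omega) a) ` elts omega)"
  have lu: "\<And>n. n \<in> elts omega \<Longrightarrow> app (lam (elts omega) a) n \<in> u" using l(3) au by simp
  then have lB: "\<forall>n\<in>elts omega. app (lam (elts omega) a) n \<in> elts B" using u_in_B by blast
  note inf = sequence_inf[OF l(2) lB, folded I_def]
  have I_ne: "I \<noteq> bbot" using weak l(2) lu unfolding weakly_countably_complete_def I_def by blast
  have Ia: "I \<lesssim> a n" if "n \<in> elts omega" for n using inf(2)[OF that] l(3)[OF that] by simp
  note IV = B_V[OF inf(1)]
  have key: "\<forall>n\<in>elts omega. bmeet I (beq (app0 f n) (check x)) = bbot" if "x \<in> V" for x
  proof (rule eps_induct[where P = "\<lambda>x. \<forall>n\<in>elts omega. bmeet I (beq (app0 f n) (check x)) = bbot", OF that])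
    show "definable (\<lambda>v. \<forall>n\<in>elts omega. bmeet I (beq (app0 f n) (check (v 0))) = bbot)"
      by (intro definable_intros omega_in_V IV fV bbot_in_V)
  next
    fix x assume x: "x \<in> V" and IH: "\<And>w. w \<in> elts x \<Longrightarrow> \<forall>n\<in>elts omega. bmeet I (beq (app0 f n) (check w)) = bbot"
    show "\<forall>n\<in>elts omega. bmeet I (beq (app0 f n) (check x)) = bbot"
    proof
      fix n assume n: "n \<in> elts omega"
      note nm = fn(1)[OF n] fn(1)[OF succ_in_omega[OF n]]
      let ?y = "bmeet I (beq (app0 f n) (check x))"
      have y: "?y \<lesssim> I" "?y \<lesssim> beq (app0 f n) (check x)"
        using bmeet_lesssim[OF inf(1) beq_in_B[OF nm(1) is_name_check[OF x]]] by blast+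
      have "?y \<lesssim> bmem (app0 f (succ n)) (app0 f n)" using a_le[OF n lesssim_trans[OF y(1) Ia[OF n]]] by blast
      then have "?y \<lesssim> bmem (app0 f (succ n)) (check x)"
        by (rule bmem_subst_right[OF nm(2,1) is_name_check[OF x] _ y(2)])
      then have "?y \<lesssim> bbot"
      proof (rule bmem_check_elim[OF nm(2) x _ bbot_in_B])
        fix w y' assume w: "w \<in> elts x" and y': "y' \<lesssim> ?y" "y' \<lesssim> beq (app0 f (succ n)) (check w)"
        have "bmeet I (beq (app0 f (succ n)) (check w)) = bbot" using IH[OF w] succ_in_omega[OF n] by blast
        moreover have "y' \<lesssim> bmeet I (beq (app0 f (succ n)) (check w))"
          using lesssim_trans[OF y'(1) y(1)] y'(2) lesssim_bmeet_iff[OF inf(1) beq_in_B[OF nm(2) is_name_check[OF elts_in_V[OF w]]]] by blast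
        ultimately show "y' \<lesssim> bbot" by simp
      qed
      then show "?y = bbot" by (simp add: lesssim_bbot_iff)
    qed
  qed
  have "I \<lesssim> bground (app0 f emp)" using a_le[OF emp_in_omega Ia[OF emp_in_omega]] by blast
  then have "I \<lesssim> bbot"
  proof (rule bground_elim[OF fn(1)[OF emp_in_omega] _ bbot_in_B])
    fix x y' assume x: "x \<in> V" and y': "y' \<lesssim> I" "y' \<lesssim> beq (app0 f emp) (check x)"
    have "y' \<lesssim> bmeet I (beq (app0 f emp) (check x))"
      using y' lesssim_bmeet_iff[OF inf(1) beq_in_B[OF fn(1)[OF emp_in_omega] is_name_check[OF x]]] by blast
    then show "y' \<lesssim> bbot" using key[OF x] emp_in_omega by simp
  qed
  then show False using I_ne by (simp add: lesssim_bbot_iff)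
qed

end

section \<open>An ultrafilter in an outer model\<close>

locale outer_ultrafilter = boolean_ultrafilter V E B L u + W: zfc W E
  for V W :: "'a set" and E :: "'a \<Rightarrow> 'a \<Rightarrow> bool" and B L :: 'a and u :: "'a set" +
  fixes U :: 'a
  assumes ts: "transitive_substructure V W E" and UW: "U \<in> W" and uU: "u = W.elts U"
begin

lemma VW: "x \<in> V \<Longrightarrow> x \<in> W"
  using ts by (auto simp: transitive_substructure_def)

lemma elts_W: "x \<in> V \<Longrightarrow> W.elts x = elts x"
  using ts by (auto simp: transitive_substructure_def elts_def W.elts_def)

lemma set_of_W: "small X \<Longrightarrow> W.set_of X = set_of X"
  by (rule W.set_of_eqI) (simp_all add: small_set_of VW elts_W)

lemma opair_W: "x \<in> V \<Longrightarrow> y \<in> V \<Longrightarrow> W.opair x y = opair x y"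
  unfolding W.opair_def opair_def by (simp add: set_of_W set_of_in_V)

text \<open>
  The ground model need not be definable in the outer one.  But on a set of the ground model, a relation definable in the ground model is itself a
  set and so may occur in separation in the outer model.
\<close>

lemma ex_W_definable:
  assumes D: "D \<in> V" and Q: "definable (\<lambda>v. Q (v 0) (v (Suc 0)))"
  shows "\<exists>R. W.definable (\<lambda>v. R (v 0) (v (Suc 0))) \<and> (\<forall>x\<in>elts D. \<forall>y\<in>elts D. R x y \<longleftrightarrow> Q x y)"
proof -
  note Qdfn = definable2_local[of Q, OF Q]
  have sm: "small {opair x y | x y. x \<in> elts D \<and> y \<in> elts D}"
    by (rule small_image2[OF small_elts[OF D] small_elts[OF D]]) (intro definable_intros)
  have "small {p \<in> {opair x y | x y. x \<in> elts D \<and> y \<in> elts D}. \<exists>x\<in>elts D. \<exists>y\<in>elts D. p = opair x y \<and> Q x y}"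
    by (rule small_Collect[OF sm]) (intro definable_intros Qdfn D)
  from small_set_of[OF this] obtain q where q: "q \<in> V"
    "elts q = {p \<in> {opair x y | x y. x \<in> elts D \<and> y \<in> elts D}. \<exists>x\<in>elts D. \<exists>y\<in>elts D. p = opair x y \<and> Q x y}" by blast
  have "W.opair x y \<in> W.elts q \<longleftrightarrow> Q x y" if xy: "x \<in> elts D" "y \<in> elts D" for x y
  proof -
    note V = elts_in_V[OF xy(1)] elts_in_V[OF xy(2)]
    have "opair x y \<in> elts q \<longleftrightarrow> Q x y"
    proof
      assume "opair x y \<in> elts q"
      then obtain x' y' where xy': "x' \<in> elts D" "y' \<in> elts D" "opair x y = opair x' y'" "Q x' y'" unfolding q(2) by blast
      then show "Q x y" using V elts_in_V[OF xy'(1)] elts_in_V[OF xy'(2)] by simp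
    qed (use q(2) xy in blast)
    then show ?thesis using V q(1) by (simp add: opair_W elts_W)
  qed
  moreover have "W.definable (\<lambda>v. W.opair (v 0) (v (Suc 0)) \<in> W.elts q)"
    by (rule W.definable_in_elts, rule W.defterm_opair, rule W.defterm_var, rule W.defterm_var, rule W.defterm_const, rule VW, rule q)
  ultimately show ?thesis by (intro exI[of _ "\<lambda>x y. W.opair x y \<in> W.elts q"]) blast
qed

text \<open>
  The same for relations ``\<open>g x y \<in> u\<close>'', using \<open>u\<close> as a further parameter.
\<close>

lemma ex_W_definable_u:
  assumes D: "D \<in> V" and g: "defterm (\<lambda>v. g (v 0) (v (Suc 0)))"
  shows "\<exists>R. W.definable (\<lambda>v. R (v 0) (v (Suc 0))) \<and> (\<forall>x\<in>elts D. \<forall>y\<in>elts D. R x y \<longleftrightarrow> g x y \<in> u)"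
proof -
  let ?h = "lam2 D g"
  note l = lam2[OF D g]
  have hV: "?h \<in> V" using l(1) by (simp add: fun_on_def)
  have "(\<exists>b\<in>W.elts U. W.opair (W.opair x y) b \<in> W.elts ?h) \<longleftrightarrow> g x y \<in> u" if xy: "x \<in> elts D" "y \<in> elts D" for x y
  proof -
    note V = elts_in_V[OF xy(1)] elts_in_V[OF xy(2)]
    have dom: "opair x y \<in> {opair \<tau> \<sigma> | \<tau> \<sigma>. \<tau> \<in> elts D \<and> \<sigma> \<in> elts D}" using xy by blast
    have "W.opair (W.opair x y) b \<in> W.elts ?h \<longleftrightarrow> b = g x y" if "b \<in> u" for b
    proof -
      have bV: "b \<in> V" using that u_in_B B_V by blast
      have "opair (opair x y) b \<in> elts ?h \<longleftrightarrow> b = g x y"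
        using fun_on_graph_iff[OF l(1) dom bV] l(2)[OF xy] by simp
      then show ?thesis using V bV hV by (simp add: opair_W elts_W)
    qed
    then show ?thesis using uU by blast
  qed
  moreover have "W.definable (\<lambda>v. \<exists>b\<in>W.elts U. W.opair (W.opair (v 0) (v (Suc 0))) b \<in> W.elts ?h)"
    by (rule W.definable_bex, rule W.defterm_const, rule UW, rule W.definable_in_elts, rule W.defterm_opair, rule W.defterm_opair, (rule W.defterm_var)+,
        rule W.defterm_const, rule VW, rule hV)
  ultimately show ?thesis
    by (intro exI[of _ "\<lambda>x y. \<exists>b\<in>W.elts U. W.opair (W.opair x y) b \<in> W.elts ?h"]) blast
qed

text \<open>
  The ranks of the names equivalent to \<open>\<tau>\<close> form a set only in the outer model, where \<open>u\<close> is available; its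
  foundation axiom provides a minimal one.
\<close>

lemma name_class_nonempty:
  assumes n: "is_name \<tau>" shows "\<exists>\<sigma>. \<sigma> \<in> name_class u \<tau>"
proof -
  note tV = is_name_in_V[OF n]
  have S: "set_of {\<tau>} \<in> V" "elts (set_of {\<tau>}) = {\<tau>}" using tV by (simp_all add: set_of_in_V elts_set_of)
  define r where "r = rank (set_of {\<tau>})"
  define N where "N = names_below (set_of {\<tau>})"
  have rV: "r \<in> V" using S by (simp add: r_def)
  have NV: "N \<in> V" using closed_names_below[OF S(1)] by (simp add: N_def closed_names_def)
  have N: "elts N = {y. is_name y \<and> rank y \<in> elts r}" by (simp add: N_def r_def elts_names_below[OF S(1)])
  have sD: "small (elts N \<union> elts r)" using NV rV by (intro small_Un small_elts)
  define D where "D = set_of (elts N \<union> elts r)"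
  have D: "D \<in> V" "elts D = elts N \<union> elts r" using small_set_of[OF sD] by (simp_all add: D_def)
  have "defterm (\<lambda>v. beq \<tau> (v (Suc 0)))" by (intro definable_intros tV)
  from ex_W_definable_u[where g = "\<lambda>x y. beq \<tau> y", OF D(1) this] obtain R1 where
    R1: "W.definable (\<lambda>v. R1 (v 0) (v (Suc 0)))" "\<And>x y. x \<in> elts D \<Longrightarrow> y \<in> elts D \<Longrightarrow> R1 x y \<longleftrightarrow> beq \<tau> y \<in> u" by blast
  have "definable (\<lambda>v. rank (v (Suc 0)) = v 0)" by (intro definable_intros)
  from ex_W_definable[where Q = "\<lambda>x y. rank y = x", OF D(1) this] obtain R2 where
    R2: "W.definable (\<lambda>v. R2 (v 0) (v (Suc 0)))" "\<And>x y. x \<in> elts D \<Longrightarrow> y \<in> elts D \<Longrightarrow> R2 x y \<longleftrightarrow> rank y = x" by blast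
  have "W.definable (\<lambda>v. \<exists>y\<in>W.elts N. R1 y y \<and> R2 (v 0) y)"
    by (rule W.definable_bex, rule W.defterm_const, rule VW, rule NV, rule W.definable_and,
        rule W.definable2_local[OF R1(1)], rule W.defterm_var, rule W.defterm_var, rule W.definable2_local[OF R2(1)], rule W.defterm_var, rule W.defterm_var)
  from W.small_set_of[OF W.small_Collect[where P = "\<lambda>x. \<exists>y\<in>W.elts N. R1 y y \<and> R2 x y", OF W.small_elts[OF VW[OF rV]] this]]
  obtain K where K: "K \<in> W" "W.elts K = {x \<in> W.elts r. \<exists>y\<in>W.elts N. R1 y y \<and> R2 x y}" by blast
  have K': "W.elts K = {x \<in> elts r. \<exists>y\<in>elts N. beq \<tau> y \<in> u \<and> rank y = x}"
  proof (rule Set.set_eqI)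
    fix x
    have "R1 y y \<and> R2 x y \<longleftrightarrow> beq \<tau> y \<in> u \<and> rank y = x" if "x \<in> elts r" "y \<in> elts N" for y
      using R1(2)[of y y] R2(2)[of x y] that D(2) by blast
    then show "x \<in> W.elts K \<longleftrightarrow> x \<in> {x \<in> elts r. \<exists>y\<in>elts N. beq \<tau> y \<in> u \<and> rank y = x}"
      unfolding K(2) elts_W[OF rV] elts_W[OF NV] by blast
  qed
  have "rank \<tau> \<in> elts r" unfolding r_def using elts_rank[OF S(1)] S(2) by auto
  then have "rank \<tau> \<in> W.elts K" unfolding K' using N n btop_in_u by auto
  then obtain k where k: "k \<in> W.elts K" "W.elts k \<inter> W.elts K = {}" using W.foundation[OF K(1)] by blast
  then obtain \<sigma> where s: "k \<in> elts r" "\<sigma> \<in> elts N" "beq \<tau> \<sigma> \<in> u" "rank \<sigma> = k" unfolding K' by blast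
  have sn: "is_name \<sigma>" using s(2) N by simp
  have "rank \<rho> \<notin> elts (rank \<sigma>)" if r: "is_name \<rho>" "beq \<tau> \<rho> \<in> u" for \<rho>
  proof
    assume A: "rank \<rho> \<in> elts (rank \<sigma>)"
    have "rank \<rho> \<in> elts r" using rank_trans[OF A _ S(1)] s(1,4) by (simp add: r_def)
    then have "rank \<rho> \<in> W.elts K" unfolding K' using N r by auto
    moreover have "rank \<rho> \<in> W.elts k" using A s(4) elts_W[OF rank_in_V[OF is_name_in_V[OF sn]]] by simp
    ultimately show False using k(2) by blast
  qed
  then have "\<sigma> \<in> name_class u \<tau>" unfolding mem_name_class_iff[OF n] using sn s(3) by blast
  then show ?thesis by blast
qed

lemma name_class_eq_imp:
  assumes n: "is_name \<tau>" "is_name \<sigma>" and eq: "name_class u \<tau> = name_class u \<sigma>"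
  shows "beq \<tau> \<sigma> \<in> u"
proof -
  obtain \<rho> where r: "\<rho> \<in> name_class u \<tau>" using name_class_nonempty[OF n(1)] by blast
  have 1: "is_name \<rho>" "beq \<tau> \<rho> \<in> u" using r mem_name_class_iff[OF n(1)] by blast+
  have 2: "beq \<sigma> \<rho> \<in> u" using r eq mem_name_class_iff[OF n(2)] by blast
  show ?thesis by (rule beq_u_trans[OF n(1) 1(1) n(2) 1(2)]) (use 2 beq_sym[OF n(2) 1(1)] in simp)
qed

lemma ultrapower_memI:
  assumes n: "is_name \<tau>" "is_name \<sigma>" and m: "bmem \<tau> \<sigma> \<in> u"
  shows "ultrapower_mem u (name_class u \<tau>) (name_class u \<sigma>)"
proof -
  obtain \<tau>' \<sigma>' where h: "\<tau>' \<in> name_class u \<tau>" "\<sigma>' \<in> name_class u \<sigma>"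
    using name_class_nonempty[OF n(1)] name_class_nonempty[OF n(2)] by blast
  then have h': "is_name \<tau>'" "beq \<tau> \<tau>' \<in> u" "is_name \<sigma>'" "beq \<sigma> \<sigma>' \<in> u"
    using mem_name_class_iff[OF n(1)] mem_name_class_iff[OF n(2)] by blast+
  have "bmem \<tau>' \<sigma>' \<in> u"
    by (rule bmem_u_cong[OF h'(1,3) n _ _ m]) (use h' beq_sym[OF n(1) h'(1)] beq_sym[OF n(2) h'(3)] in simp_all)
  then show ?thesis unfolding ultrapower_mem_def using h bv_mem_bmem[OF h'(1,3)] by metis
qed

text \<open>
  The name \<open>\<tau>\<close> equals the natural number \<open>f x\<close> with value at least \<open>x\<close>, for each \<open>x\<close> in the antichain.  So \<open>\<tau>\<close> is a natural
  number with value \<open>\<top>\<close>, and if it is the standard \<open>k\<close>, then \<open>[\<tau> = k]\<close> lies below the \<open>x\<close> with \<open>f x = k\<close>.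
\<close>

lemma omega_model_imp_meets:
  assumes om: "ultrapower_omega_model u" shows "meets_countable_maximal_antichains u"
  unfolding meets_countable_maximal_antichains_def
proof (intro allI impI)
  fix A assume A: "countable_maximal_antichain A"
  have AV: "A \<in> V" and anti: "antichain_in \<BB> (elts A)"
    using A unfolding countable_maximal_antichain_def by blast+
  obtain f where f: "fun_on f (elts A)" "app f ` elts A \<subseteq> elts omega" "inj_on (app f) (elts A)"
    using A unfolding countable_maximal_antichain_def countable_in_def by blast
  have fV: "f \<in> V" using f(1) by (simp add: fun_on_def)
  have AB: "x \<in> elts B" if "x \<in> elts A" for x using anti that by (auto simp: antichain_in_def)
  have f0: "app0 f x = app f x" if "x \<in> elts A" for x by (rule app0_eq[OF f(1) that])
  have fo: "app0 f x \<in> elts omega" if "x \<in> elts A" for x using f0[OF that] f(2) that by auto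
  define d where "d = lam (elts A) (\<lambda>x. x)"
  note l = lam[where F = "\<lambda>x. x", OF small_elts[OF AV] defterm_var, folded d_def]
  have dn: "is_name (mixname A d f)" by (rule is_name_mixname[OF AV l(1) fV]) (use l(4) AB in simp)
  define \<tau> where "\<tau> = mixname A d f"
  have n: "is_name \<tau>" using dn by (simp add: \<tau>_def)
  have le: "x \<lesssim> beq \<tau> (check (app0 f x))" if x: "x \<in> elts A" for x
  proof -
    have "app0 d x \<lesssim> beq (mixname A d f) (check (app0 f x))"
    proof (rule beq_mixname[OF AV l(1) fV _ _ x])
      show "app0 d i \<in> elts B" if "i \<in> elts A" for i using l(4)[OF that] AB[OF that] by simp
      show "bmeet (app0 d i) (app0 d j) = bbot" if "i \<in> elts A" "j \<in> elts A" "i \<noteq> j" for i j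
        using that l(4) anti bmeet_eq_meet AB by (simp add: antichain_in_def)
    qed
    then show ?thesis using l(4)[OF x] by (simp add: \<tau>_def)
  qed
  have cover: "z \<in> u" if z: "z \<in> elts B" and h: "\<And>x. x \<in> elts A \<Longrightarrow> x \<lesssim> z" for z
  proof -
    have "bcompl z = bbot"
    proof (rule max_antichain_disjoint[OF A bcompl_in_B[OF z]])
      fix x assume x: "x \<in> elts A"
      have "bmeet (bcompl z) x \<lesssim> bmeet z (bcompl z)"
        using bmeet_lesssim[OF bcompl_in_B[OF z] AB[OF x]] lesssim_trans[OF _ h[OF x]] z by (simp add: lesssim_bmeet_iff)
      then show "bmeet (bcompl z) x = bbot" using bmeet_bcompl[OF z] by (simp add: lesssim_bbot_iff)
    qed
    then show ?thesis using u_bcompl[OF z] bbot_notin_u by metis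
  qed
  have "bmem \<tau> (check omega) \<in> u"
  proof (rule cover)
    show "x \<lesssim> bmem \<tau> (check omega)" if "x \<in> elts A" for x
      by (rule bmem_check_intro[OF n omega_in_V fo[OF that] le[OF that]])
  qed (use n in simp)
  moreover have "bground \<tau> \<in> u"
  proof (rule cover)
    show "x \<lesssim> bground \<tau>" if "x \<in> elts A" for x
      by (rule bground_intro[OF n elts_in_V[OF fo[OF that]] le[OF that]])
  qed (use n in simp)
  ultimately have "name_class u \<tau> \<in> ultrapower u"
    "ultrapower_mem u (name_class u \<tau>) (ultrapower_map u omega)"
    using n bv_ground_bground[OF n] ultrapower_memI[OF n is_name_check[OF omega_in_V]]
    unfolding ultrapower_def ultrapower_map_def by auto
  then obtain k where k: "k \<in> elts omega" "name_class u \<tau> = name_class u (check k)"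
    using om unfolding ultrapower_omega_model_def ultrapower_map_def by blast
  note kV = elts_in_V[OF k(1)]
  let ?q = "beq \<tau> (check k)"
  have qu: "?q \<in> u" by (rule name_class_eq_imp[OF n is_name_check[OF kV] k(2)])
  note qB = u_in_B[OF qu]
  have disj: "bmeet ?q x = bbot" if x: "x \<in> elts A" "app0 f x \<noteq> k" for x
  proof (rule beq_two_checks[OF n kV elts_in_V[OF fo[OF x(1)]]])
    show "k \<noteq> app0 f x" using x(2) by simp
    show "bmeet ?q x \<lesssim> ?q" by (rule bmeet_lesssim(1)[OF qB AB[OF x(1)]])
    show "bmeet ?q x \<lesssim> beq \<tau> (check (app0 f x))" by (rule lesssim_trans[OF bmeet_lesssim(2)[OF qB AB[OF x(1)]] le[OF x(1)]])
  qed
  have "\<exists>x\<in>elts A. app0 f x = k"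
  proof (rule ccontr)
    assume "\<not> (\<exists>x\<in>elts A. app0 f x = k)"
    then have "?q = bbot" using max_antichain_disjoint[OF A qB] disj by blast
    then show False using qu bbot_notin_u by simp
  qed
  then obtain x where x: "x \<in> elts A" "app0 f x = k" by blast
  note xB = AB[OF x(1)]
  let ?y = "bmeet ?q (bcompl x)"
  note y = bmeet_lesssim[OF qB bcompl_in_B[OF xB]]
  have "?y = bbot"
  proof (rule max_antichain_disjoint[OF A lesssim_in_B(1)[OF y(1)]])
    fix x' assume x': "x' \<in> elts A"
    note x'B = AB[OF x']
    have m: "bmeet ?y x' \<lesssim> ?y" "bmeet ?y x' \<lesssim> x'" by (rule bmeet_lesssim[OF lesssim_in_B(1)[OF y(1)] x'B])+
    show "bmeet ?y x' = bbot"
    proof (cases "x' = x")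
      case True
      then have "bmeet ?y x' \<lesssim> bmeet x (bcompl x)" using m lesssim_trans[OF m(1) y(2)] xB by (simp add: lesssim_bmeet_iff)
      then show ?thesis using bmeet_bcompl[OF xB] by (simp add: lesssim_bbot_iff)
    next
      case False
      then have "app0 f x' \<noteq> k" using x inj_onD[OF f(3)] f0 x' by metis
      then have "bmeet ?q x' = bbot" by (rule disj[OF x'])
      moreover have "bmeet ?y x' \<lesssim> bmeet ?q x'" using m(2) lesssim_trans[OF m(1) y(1)] qB x'B by (simp add: lesssim_bmeet_iff)
      ultimately show ?thesis by (simp add: lesssim_bbot_iff)
    qed
  qed
  then have "?q \<lesssim> x" by (rule lesssim_of_bmeet_bcompl[OF qB xB])
  then have "x \<in> u" by (rule u_up[OF qu])
  then show "u \<inter> elts A \<noteq> {}" using x(1) by blast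
qed

end

section \<open>Nonstandard natural numbers\<close>

context outer_ultrafilter
begin

context
  fixes a
  assumes f: "fun_on a (elts omega)" and au: "\<forall>n\<in>elts omega. app a n \<in> u"
    and inf_bbot: "\<Sqinter>\<^bsub>\<BB>\<^esub> (app a ` elts omega) = bbot"
begin

private lemmas aV = seq_in_V[OF f au inf_bbot]
private lemmas a_in_u = seq_in_u[OF f au inf_bbot]
private lemmas a_in_B = seq_in_B[OF f au inf_bbot]
private lemmas D_in_B = first_fail_in_B[OF f au inf_bbot]
private lemmas D_disjoint_seq = first_fail_disjoint_seq[OF f au inf_bbot]
private lemmas D_disjoint = first_fail_disjoint[OF f au inf_bbot]
private lemmas D_total = first_fail_total[OF f au inf_bbot]
private lemmas D_cover = first_fail_cover[OF f au inf_bbot]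

definition fail_fun :: 'a where "fail_fun = lam (elts omega) (first_fail a)"

lemma fail_fun: "fail_fun \<in> V" "n \<in> elts omega \<Longrightarrow> app0 fail_fun n = first_fail a n"
proof -
  have "defterm (\<lambda>v. first_fail a (v 0))" by (intro definable_intros aV)
  note l = lam[OF small_elts[OF omega_in_V] this]
  show "fail_fun \<in> V" "n \<in> elts omega \<Longrightarrow> app0 fail_fun n = first_fail a n"
    using l unfolding fail_fun_def by blast+
qed

definition omega_square :: 'a where
  "omega_square = set_of {opair x y | x y. x \<in> elts omega \<and> y \<in> elts omega}"

lemma omega_square: "omega_square \<in> V" "elts omega_square = {opair x y | x y. x \<in> elts omega \<and> y \<in> elts omega}"
proof -
  have "small {opair x y | x y. x \<in> elts omega \<and> y \<in> elts omega}"
    by (rule small_image2[OF small_elts[OF omega_in_V] small_elts[OF omega_in_V]]) (intro definable_intros)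
  from small_set_of[OF this, folded omega_square_def]
  show "omega_square \<in> V" "elts omega_square = {opair x y | x y. x \<in> elts omega \<and> y \<in> elts omega}" by blast+
qed

text \<open>
  Relations on \<open>\<omega>\<close> whose total application maps \<open>\<omega>\<close> to \<open>\<omega>\<close>; as subsets of \<open>omega_square\<close> they form a set.
\<close>

definition nat_funs :: 'a where
  "nat_funs = set_of {F \<in> {F \<in> V. elts F \<subseteq> elts omega_square}. \<forall>n\<in>elts omega. app0 F n \<in> elts omega}"

lemma nat_funs: "nat_funs \<in> V"
  "elts nat_funs = {F \<in> V. elts F \<subseteq> elts omega_square \<and> (\<forall>n\<in>elts omega. app0 F n \<in> elts omega)}"
proof -
  have "small {F \<in> {F \<in> V. elts F \<subseteq> elts omega_square}. \<forall>n\<in>elts omega. app0 F n \<in> elts omega}"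
    by (rule small_Collect[OF small_Pow[OF omega_square(1)]]) (intro definable_intros omega_in_V)
  note S = small_set_of[OF this, folded nat_funs_def]
  show "nat_funs \<in> V" by (rule S)
  show "elts nat_funs = {F \<in> V. elts F \<subseteq> elts omega_square \<and> (\<forall>n\<in>elts omega. app0 F n \<in> elts omega)}"
    unfolding S(2) by blast
qed

lemma lam_in_nat_funs:
  assumes G: "defterm (\<lambda>v. G (v 0))" and Gn: "\<And>n. n \<in> elts omega \<Longrightarrow> G n \<in> elts omega"
  shows "lam (elts omega) G \<in> elts nat_funs"
proof -
  note l = lam[OF small_elts[OF omega_in_V] G]
  have "elts (lam (elts omega) G) = (\<lambda>x. opair x (G x)) ` elts omega"
    unfolding lam_def by (rule elts_set_of[OF small_graph[OF small_elts[OF omega_in_V] G]])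
  then have "elts (lam (elts omega) G) \<subseteq> elts omega_square" unfolding omega_square(2) using Gn by blast
  then show ?thesis unfolding nat_funs(2) using l(1) l(4) Gn by simp
qed

text \<open>
  The name of the natural number \<open>F n\<close>, where \<open>n\<close> is the first index at which \<open>a\<close> fails.
\<close>

definition nat_name :: "'a \<Rightarrow> 'a" where "nat_name F = mixname omega fail_fun F"

lemma defterm_nat_name: "defterm t \<Longrightarrow> defterm (\<lambda>v. nat_name (t v))"
  unfolding nat_name_def by (rule defterm_mixname) (rule defterm_const, rule omega_in_V fail_fun(1))+

lemma is_name_nat_name: "F \<in> V \<Longrightarrow> is_name (nat_name F)"
  unfolding nat_name_def
  by (rule is_name_mixname[OF omega_in_V fail_fun(1)]) (use fail_fun(2) D_in_B elts_in_V in auto)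

lemma beq_nat_name:
  assumes F: "F \<in> V" and n: "n \<in> elts omega"
  shows "first_fail a n \<lesssim> beq (nat_name F) (check (app0 F n))"
proof -
  have "app0 fail_fun n \<lesssim> beq (mixname omega fail_fun F) (check (app0 F n))"
  proof (rule beq_mixname[OF omega_in_V fail_fun(1) F _ _ n])
    show "app0 fail_fun i \<in> elts B" if "i \<in> elts omega" for i
      using fail_fun(2)[OF that] D_in_B[OF elts_in_V[OF that]] by simp
    show "bmeet (app0 fail_fun i) (app0 fail_fun j) = bbot" if "i \<in> elts omega" "j \<in> elts omega" "i \<noteq> j" for i j
      using fail_fun(2) that D_disjoint by simp
  qed
  then show ?thesis using fail_fun(2)[OF n] by (simp add: nat_name_def)
qed

lemma bground_nat_name: assumes F: "F \<in> V" shows "bground (nat_name F) \<in> u"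
  by (rule D_cover[OF bground_in_B[OF is_name_nat_name[OF F]]])
    (rule bground_intro[OF is_name_nat_name[OF F] app0_in_V beq_nat_name[OF F]])

text \<open>
  The Boolean value of \<open>nat_name F\<close> being less than \<open>k\<close>.
\<close>

definition val_below :: "'a \<Rightarrow> 'a \<Rightarrow> 'a" where
  "val_below F k = bsup {z \<in> elts B. \<exists>n\<in>elts omega. app0 F n \<in> elts k \<and> z = first_fail a n}"

lemma defterm_val_below: "defterm t \<Longrightarrow> defterm s \<Longrightarrow> defterm (\<lambda>v. val_below (t v) (s v))"
proof (rule defterm2[where F = val_below])
  show "defterm (\<lambda>v. val_below (v 0) (v (Suc 0)))"
    unfolding val_below_def by (intro defterm_bsup definable_intros omega_in_V aV)
qed

lemma small_val_below: "F \<in> V \<Longrightarrow> k \<in> V \<Longrightarrow>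
    small {z \<in> elts B. \<exists>n\<in>elts omega. app0 F n \<in> elts k \<and> z = first_fail a n}"
  by (intro small_B_Collect definable_intros omega_in_V aV)

lemma val_below_in_B: "F \<in> V \<Longrightarrow> k \<in> V \<Longrightarrow> val_below F k \<in> elts B"
  unfolding val_below_def by (rule bsup_in_B[OF small_val_below]) auto

lemma val_below_intro:
  assumes "F \<in> V" "k \<in> V" "n \<in> elts omega" "app0 F n \<in> elts k" shows "first_fail a n \<lesssim> val_below F k"
  unfolding val_below_def
  by (rule bsup_intro[OF small_val_below[OF assms(1,2)] _ _ lesssim_refl[OF D_in_B[OF elts_in_V[OF assms(3)]]]])
    (use assms D_in_B[OF elts_in_V[OF assms(3)]] in auto)

definition nonstandard :: "'a \<Rightarrow> bool" where
  "nonstandard F \<longleftrightarrow> F \<in> elts nat_funs \<and> (\<forall>k\<in>elts omega. val_below F k \<notin> u)"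

lemma val_below_subset:
  assumes "F \<in> V" "k \<in> V" "F' \<in> V" "k' \<in> V"
    "\<And>n. n \<in> elts omega \<Longrightarrow> app0 F n \<in> elts k \<Longrightarrow> app0 F' n \<in> elts k'"
  shows "val_below F k \<lesssim> val_below F' k'"
proof (rule bsup_elim[OF small_val_below[OF assms(1,2)]])
  show "val_below F k \<lesssim> bsup {z \<in> elts B. \<exists>n\<in>elts omega. app0 F n \<in> elts k \<and> z = first_fail a n}"
    using val_below_in_B[OF assms(1,2)] by (simp add: val_below_def)
  fix x y' assume "x \<in> {z \<in> elts B. \<exists>n\<in>elts omega. app0 F n \<in> elts k \<and> z = first_fail a n}" and y': "y' \<lesssim> x"
  then obtain n where n: "n \<in> elts omega" "app0 F n \<in> elts k" "x = first_fail a n" by blast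
  have "first_fail a n \<lesssim> val_below F' k'" by (rule val_below_intro[OF assms(3,4) n(1) assms(5)[OF n(1,2)]])
  then show "y' \<lesssim> val_below F' k'" using y' n(3) lesssim_trans by blast
qed (use val_below_in_B[OF assms(3,4)] in auto)

lemma big_union_nat:
  assumes m: "m \<in> elts omega" shows "big_union m \<in> elts omega" "m \<noteq> emp \<Longrightarrow> big_union m \<in> elts m"
    "k \<in> elts omega \<Longrightarrow> big_union m \<in> elts k \<Longrightarrow> m \<in> elts (succ k)"
proof -
  consider "m = emp" | j where "j \<in> elts omega" "m = succ j" using nat_cases[OF m] by blast
  then have "big_union m \<in> elts omega \<and> (m \<noteq> emp \<longrightarrow> big_union m \<in> elts m) \<and>
    (\<forall>k\<in>elts omega. big_union m \<in> elts k \<longrightarrow> m \<in> elts (succ k))"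
  proof cases
    case 1
    have "emp \<in> elts (succ k)" if "k \<in> elts omega" for k
      using emp_least[OF that] elts_in_V[OF that] by auto
    then show ?thesis using 1 by (simp add: big_union_emp)
  next
    case 2
    have "big_union m = j" using 2 big_union_succ by simp
    then show ?thesis using 2 elts_in_V[OF 2(1)] succ_mono by auto
  qed
  then show "big_union m \<in> elts omega" "m \<noteq> emp \<Longrightarrow> big_union m \<in> elts m"
    "k \<in> elts omega \<Longrightarrow> big_union m \<in> elts k \<Longrightarrow> m \<in> elts (succ k)" by blast+
qed

text \<open>
  The union of a natural number is its predecessor, with \<open>0\<close> going to \<open>0\<close>.  The value of \<open>nat_name F\<close> being \<open>0\<close> is not in \<open>u\<close>, and
  outside of it the new name is an element of the old one.
\<close>

lemma nonstandard_pred: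
  assumes F: "nonstandard F"
  shows "\<exists>F'. nonstandard F' \<and> bmem (nat_name F') (nat_name F) \<in> u"
proof -
  have FV: "F \<in> V" and Fo: "\<And>n. n \<in> elts omega \<Longrightarrow> app0 F n \<in> elts omega"
    and Fu: "\<And>k. k \<in> elts omega \<Longrightarrow> val_below F k \<notin> u"
    using F unfolding nonstandard_def nat_funs(2) by blast+
  define F' where "F' = lam (elts omega) (\<lambda>n. big_union (app0 F n))"
  have G: "defterm (\<lambda>v. big_union (app0 F (v 0)))" by (intro definable_intros FV)
  note l = lam[OF small_elts[OF omega_in_V] G, folded F'_def]
  have F'f: "F' \<in> elts nat_funs" unfolding F'_def by (rule lam_in_nat_funs[OF G]) (rule big_union_nat(1)[OF Fo])
  have "val_below F' k \<notin> u" if k: "k \<in> elts omega" for k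
  proof
    note kV = elts_in_V[OF k]
    have "val_below F' k \<lesssim> val_below F (succ k)"
    proof (rule val_below_subset[OF l(1) kV FV succ(1)[OF kV]])
      fix n assume "n \<in> elts omega" "app0 F' n \<in> elts k"
      then show "app0 F n \<in> elts (succ k)" using l(4) big_union_nat(3)[OF Fo k] by simp
    qed
    moreover assume "val_below F' k \<in> u"
    ultimately show False using u_up Fu[OF succ_in_omega[OF k]] by blast
  qed
  then have ns: "nonstandard F'" using F'f by (simp add: nonstandard_def)
  have n: "is_name (nat_name F')" "is_name (nat_name F)" using is_name_nat_name l(1) FV by simp_all
  let ?M = "bmem (nat_name F') (nat_name F)"
  \<comment> \<open>the value of \<open>nat_name F\<close> being \<open>0\<close>\<close>
  let ?q = "val_below F (succ emp)"
  have MB: "?M \<in> elts B" using n by simp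
  have qB: "?q \<in> elts B" by (rule val_below_in_B[OF FV succ(1)[OF emp(1)]])
  let ?x = "bmeet (bcompl ?q) (bcompl ?M)"
  note x = bmeet_lesssim[OF bcompl_in_B[OF qB] bcompl_in_B[OF MB]]
  have "?x = bbot"
  proof (rule D_total[OF lesssim_in_B(1)[OF x(1)]])
    fix k assume k: "k \<in> elts omega"
    note DB = D_in_B[OF elts_in_V[OF k]]
    let ?y = "bmeet ?x (first_fail a k)"
    have y: "?y \<lesssim> ?x" "?y \<lesssim> first_fail a k" by (rule bmeet_lesssim[OF lesssim_in_B(1)[OF x(1)] DB])+
    show "?y = bbot"
    proof (cases "app0 F k = emp")
      case True
      then have "first_fail a k \<lesssim> ?q" by (intro val_below_intro[OF FV succ(1)[OF emp(1)] k]) simp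
      then have "?y \<lesssim> bmeet ?q (bcompl ?q)"
        using lesssim_trans[OF y(2)] lesssim_trans[OF y(1) x(1)] qB by (simp add: lesssim_bmeet_iff)
      then show ?thesis using bmeet_bcompl[OF qB] by (simp add: lesssim_bbot_iff)
    next
      case False
      have mem: "big_union (app0 F k) \<in> elts (app0 F k)" by (rule big_union_nat(2)[OF Fo[OF k] False])
      have bV: "big_union (app0 F k) \<in> V" by (rule elts_in_V[OF mem])
      have e1: "?y \<lesssim> beq (nat_name F') (check (big_union (app0 F k)))"
        using lesssim_trans[OF y(2) beq_nat_name[OF l(1) k]] l(4)[OF k] by simp
      have e2: "?y \<lesssim> beq (nat_name F) (check (app0 F k))" by (rule lesssim_trans[OF y(2) beq_nat_name[OF FV k]])
      have "?y \<lesssim> bmem (nat_name F') (check (app0 F k))" by (rule bmem_check_intro[OF n(1) app0_in_V mem e1])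
      then have "?y \<lesssim> ?M"
        by (rule bmem_subst_right[OF n(1) is_name_check[OF app0_in_V] n(2)])
          (use e2 beq_sym[OF n(2) is_name_check[OF app0_in_V]] in simp)
      then have "?y \<lesssim> bmeet ?M (bcompl ?M)" using lesssim_trans[OF y(1) x(2)] MB by (simp add: lesssim_bmeet_iff)
      then show ?thesis using bmeet_bcompl[OF MB] by (simp add: lesssim_bbot_iff)
    qed
  qed
  then have le: "bcompl ?q \<lesssim> ?M" by (rule lesssim_of_bmeet_bcompl[OF bcompl_in_B[OF qB] MB])
  have "bcompl ?q \<in> u" using u_bcompl[OF qB] Fu[OF succ_in_omega[OF emp_in_omega]] by blast
  then have "?M \<in> u" using u_up le by blast
  then show ?thesis using ns by blast
qed

text \<open>
  A finite meet of members of \<open>u\<close> is in \<open>u\<close>.  The induction on \<open>k\<close> mentions \<open>u\<close>, so it is carried out in the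
  outer model, as foundation for the set of counterexamples.
\<close>

lemma initial_inf_in_u:
  assumes k: "k \<in> elts omega"
  shows "bsup {z \<in> elts B. \<forall>n\<in>elts k. z \<lesssim> app0 a n} \<in> u"
proof -
  define h where "h k = bsup {z \<in> elts B. \<forall>n\<in>elts k. z \<lesssim> app0 a n}" for k
  have sm: "small {z \<in> elts B. \<forall>n\<in>elts k. z \<lesssim> app0 a n}" if "k \<in> V" for k
    by (intro small_B_Collect definable_intros aV that)
  have h_defterm: "defterm (\<lambda>v. h (v 0))" unfolding h_def by (intro defterm_bsup definable_intros aV)
  have hB: "h k \<in> elts B" if "k \<in> V" for k unfolding h_def by (rule bsup_in_B[OF sm[OF that]]) auto
  have h_intro: "z \<lesssim> h k" if "k \<in> V" "z \<in> elts B" "\<And>n. n \<in> elts k \<Longrightarrow> z \<lesssim> app0 a n" for z k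
    unfolding h_def by (rule bsup_intro[OF sm[OF that(1)] _ _ lesssim_refl[OF that(2)]]) (use that in auto)
  have h_le: "h k \<lesssim> app0 a n" if k: "k \<in> elts omega" and n: "n \<in> elts k" for k n
  proof (rule bsup_elim[OF sm[OF elts_in_V[OF k]]])
    show "h k \<lesssim> bsup {z \<in> elts B. \<forall>n\<in>elts k. z \<lesssim> app0 a n}"
      using hB[OF elts_in_V[OF k]] by (simp add: h_def)
    show "app0 a n \<in> elts B" using a_in_B omega_transitive[OF k] n by blast
    fix x y' assume "x \<in> {z \<in> elts B. \<forall>n\<in>elts k. z \<lesssim> app0 a n}" "y' \<lesssim> x"
    then show "y' \<lesssim> app0 a n" using n lesssim_trans by blast
  qed auto
  have "defterm (\<lambda>v. h (v (Suc 0)))" by (rule defterm1_local[of h, OF h_defterm defterm_var])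
  from ex_W_definable_u[where g = "\<lambda>x. h", OF omega_in_V this] obtain R where
    R: "W.definable (\<lambda>v. R (v 0) (v (Suc 0)))" "\<And>x y. x \<in> elts omega \<Longrightarrow> y \<in> elts omega \<Longrightarrow> R x y \<longleftrightarrow> h y \<in> u" by blast
  have "W.definable (\<lambda>v. \<not> R (v 0) (v 0))"
    by (rule W.definable_not, rule W.definable2_local[OF R(1)], rule W.defterm_var, rule W.defterm_var)
  from W.small_set_of[OF W.small_Collect[where P = "\<lambda>x. \<not> R x x", OF W.small_elts[OF VW[OF omega_in_V]] this]]
  obtain K where K: "K \<in> W" "W.elts K = {x \<in> W.elts omega. \<not> R x x}" by blast
  have K': "W.elts K = {x \<in> elts omega. h x \<notin> u}"
    unfolding K(2) elts_W[OF omega_in_V] using R(2) by blast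
  have "h k \<in> u"
  proof (rule ccontr)
    assume "h k \<notin> u"
    then have "W.elts K \<noteq> {}" unfolding K' using k by blast
    from W.foundation[OF K(1) this] obtain m where m: "m \<in> W.elts K" "W.elts m \<inter> W.elts K = {}" by blast
    have mo: "m \<in> elts omega" "h m \<notin> u" using m(1) unfolding K' by blast+
    have less: "h j \<in> u" if "j \<in> elts m" for j
      using m(2) that omega_transitive[OF mo(1)] elts_W[OF elts_in_V[OF mo(1)]] unfolding K' by blast
    consider "m = emp" | j where "j \<in> elts omega" "m = succ j" using nat_cases[OF mo(1)] by blast
    then show False
    proof cases
      case 1
      have "btop \<lesssim> h emp" by (rule h_intro) simp_all
      then show False using u_up[OF btop_in_u] mo(2) 1 by blast
    next
      case 2
      note jV = elts_in_V[OF 2(1)]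
      have hj: "h j \<in> u" using less 2(2) jV by simp
      let ?y = "bmeet (h j) (app0 a j)"
      have y: "?y \<lesssim> h j" "?y \<lesssim> app0 a j" by (rule bmeet_lesssim[OF hB[OF jV] a_in_B[OF 2(1)]])+
      have "?y \<lesssim> h (succ j)"
      proof (rule h_intro[OF succ(1)[OF jV] lesssim_in_B(1)[OF y(1)]])
        fix n assume "n \<in> elts (succ j)"
        then have "n = j \<or> n \<in> elts j" using jV by simp
        then show "?y \<lesssim> app0 a n" using y(2) lesssim_trans[OF y(1) h_le[OF 2(1)]] by blast
      qed
      then have "h m \<in> u" using u_up[OF u_bmeet[OF hj a_in_u[OF 2(1)]]] 2(2) by blast
      then show False using mo(2) by blast
    qed
  qed
  then show ?thesis by (simp add: h_def)
qed

text \<open>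
  The first index of failure is itself nonstandard: the value of it being less than \<open>k\<close> is disjoint from \<open>\<Sqinter>n\<in>k. a n\<close>, which is in \<open>u\<close>.
\<close>

lemma nonstandard_id: "nonstandard (lam (elts omega) (\<lambda>n. n))"
proof -
  note l = lam[where F = "\<lambda>n. n", OF small_elts[OF omega_in_V] defterm_var]
  let ?I = "lam (elts omega) (\<lambda>n. n)"
  have "val_below ?I k \<notin> u" if k: "k \<in> elts omega" for k
  proof
    assume v: "val_below ?I k \<in> u"
    note kV = elts_in_V[OF k]
    let ?h = "bsup {z \<in> elts B. \<forall>n\<in>elts k. z \<lesssim> app0 a n}"
    have hu: "?h \<in> u" by (rule initial_inf_in_u[OF k])
    have sm: "small {z \<in> elts B. \<forall>n\<in>elts k. z \<lesssim> app0 a n}" by (intro small_B_Collect definable_intros aV kV)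
    have "bmeet ?h (val_below ?I k) = bbot"
      unfolding val_below_def
    proof (rule bmeet_bsup_eq_bbot[OF small_val_below[OF l(1) kV] _ u_in_B[OF hu]])
      fix x assume "x \<in> {z \<in> elts B. \<exists>n\<in>elts omega. app0 ?I n \<in> elts k \<and> z = first_fail a n}"
      then obtain n where n: "n \<in> elts omega" "app0 ?I n \<in> elts k" "x = first_fail a n" by blast
      have nk: "n \<in> elts k" using n(2) l(4)[OF n(1)] by simp
      note DB = D_in_B[OF elts_in_V[OF n(1)]]
      have "?h \<lesssim> app0 a n"
      proof (rule bsup_elim[OF sm _ lesssim_refl[OF u_in_B[OF hu]] a_in_B[OF n(1)]])
        fix x y' assume "x \<in> {z \<in> elts B. \<forall>n\<in>elts k. z \<lesssim> app0 a n}" "y' \<lesssim> x"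
        then show "y' \<lesssim> app0 a n" using nk lesssim_trans by blast
      qed auto
      then have "bmeet ?h (first_fail a n) \<lesssim> bmeet (app0 a n) (first_fail a n)"
        using bmeet_lesssim[OF u_in_B[OF hu] DB] lesssim_trans a_in_B[OF n(1)] DB by (subst lesssim_bmeet_iff) blast+
      then show "bmeet ?h x = bbot" using D_disjoint_seq[OF n(1)] n(3) by (simp add: lesssim_bbot_iff)
    qed auto
    then show False using u_disjoint[OF hu v] by blast
  qed
  then show ?thesis unfolding nonstandard_def using lam_in_nat_funs[where G = "\<lambda>n. n", OF defterm_var] by blast
qed

text \<open>
  The classes of the names of nonstandard numbers form a set of the outer model without a minimal element.  Each class is bounded by the set \<open>N\<close> of
  names, since its members have at most the rank of the representative; \<open>R1\<close>, \<open>R2\<close>, \<open>R3\<close> are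
  relations available in the outer model from which classes and nonstandardness are defined there.
\<close>

lemma ill_founded: "\<not> ultrapower_wf_in W u"
proof
  assume wf: "ultrapower_wf_in W u"
  note nf = nat_funs
  have FV: "F \<in> V" if "nonstandard F" for F using that unfolding nonstandard_def nf(2) by blast
  have "defterm (\<lambda>v. nat_name (v 0))" by (rule defterm_nat_name[OF defterm_var])
  from small_set_of[OF small_image[where F = nat_name, OF small_elts[OF nf(1)] this]]
  obtain T where T: "T \<in> V" "elts T = nat_name ` elts nat_funs" by blast
  define N where "N = names_below T"
  have NV: "N \<in> V" using closed_names_below[OF T(1)] by (simp add: N_def closed_names_def)
  have N: "elts N = {y. is_name y \<and> rank y \<in> elts (rank T)}" by (simp add: N_def elts_names_below[OF T(1)])
  have down: "\<rho> \<in> elts N" if "is_name \<rho>" "rank \<rho> \<in> elts (rank \<sigma>)" "\<sigma> \<in> elts N" for \<rho> \<sigma>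
    using that rank_trans[OF that(2) _ T(1)] N by blast
  have cls_N: "name_class u (nat_name F) \<subseteq> elts N" if F: "F \<in> elts nat_funs" for F
  proof
    fix \<sigma> assume s: "\<sigma> \<in> name_class u (nat_name F)"
    have FV: "F \<in> V" using F by (rule elts_in_V)
    note n = is_name_nat_name[OF FV]
    note tV = is_name_in_V[OF n]
    have sn: "is_name \<sigma>" "rank (nat_name F) \<notin> elts (rank \<sigma>)"
      using s n btop_in_u unfolding mem_name_class_iff[OF n] by auto
    have "nat_name F \<in> elts T" using T(2) F by blast
    then have tT: "rank (nat_name F) \<in> elts (rank T)" by (rule rank_mono[OF _ T(1)])
    have "rank \<sigma> = rank (nat_name F) \<or> rank \<sigma> \<in> elts (rank (nat_name F))"
      using rank_linear[OF tV is_name_in_V[OF sn(1)]] sn(2) by auto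
    then have "rank \<sigma> \<in> elts (rank T)" using tT rank_trans[OF _ tT T(1)] by auto
    then show "\<sigma> \<in> elts N" using N sn(1) by simp
  qed
  have sD: "small (elts N \<union> (elts nat_funs \<union> elts omega))" using NV nf(1) by (intro small_Un small_elts) auto
  define D where "D = set_of (elts N \<union> (elts nat_funs \<union> elts omega))"
  have D: "D \<in> V" "elts D = elts N \<union> (elts nat_funs \<union> elts omega)" using small_set_of[OF sD] by (simp_all add: D_def)
  have "defterm (\<lambda>v. beq (nat_name (v 0)) (v (Suc 0)))" by (intro definable_intros defterm_nat_name)
  from ex_W_definable_u[where g = "\<lambda>F \<sigma>. beq (nat_name F) \<sigma>", OF D(1) this] obtain R1 where
    R1: "W.definable (\<lambda>v. R1 (v 0) (v (Suc 0)))" "\<And>x y. x \<in> elts D \<Longrightarrow> y \<in> elts D \<Longrightarrow> R1 x y \<longleftrightarrow> beq (nat_name x) y \<in> u" by blast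
  have "definable (\<lambda>v. rank (v 0) \<in> elts (rank (v (Suc 0))))" by (intro definable_intros)
  from ex_W_definable[where Q = "\<lambda>x y. rank x \<in> elts (rank y)", OF D(1) this] obtain R2 where
    R2: "W.definable (\<lambda>v. R2 (v 0) (v (Suc 0)))" "\<And>x y. x \<in> elts D \<Longrightarrow> y \<in> elts D \<Longrightarrow> R2 x y \<longleftrightarrow> rank x \<in> elts (rank y)" by blast
  have "defterm (\<lambda>v. val_below (v 0) (v (Suc 0)))" by (intro defterm_val_below definable_intros)
  from ex_W_definable_u[where g = val_below, OF D(1) this] obtain R3 where
    R3: "W.definable (\<lambda>v. R3 (v 0) (v (Suc 0)))" "\<And>x y. x \<in> elts D \<Longrightarrow> y \<in> elts D \<Longrightarrow> R3 x y \<longleftrightarrow> val_below x y \<in> u" by blast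
  note R1d = W.definable2_local[OF R1(1)] and R2d = W.definable2_local[OF R2(1)] and R3d = W.definable2_local[OF R3(1)]
  have NW: "N \<in> W" and fW: "nat_funs \<in> W" and oW: "omega \<in> W" using NV nf(1) VW by auto
  have eW: "W.elts N = elts N" "W.elts nat_funs = elts nat_funs" "W.elts omega = elts omega"
    using NV nf(1) elts_W by auto
  define cl where "cl F \<sigma> \<longleftrightarrow> R1 F \<sigma> \<and> (\<forall>\<rho>\<in>W.elts N. R1 F \<rho> \<longrightarrow> \<not> R2 \<rho> \<sigma>)" for F \<sigma>
  have cl: "cl F \<sigma> \<longleftrightarrow> \<sigma> \<in> name_class u (nat_name F)" if F: "F \<in> elts nat_funs" and s: "\<sigma> \<in> elts N" for F \<sigma>
  proof -
    have n: "is_name (nat_name F)" by (rule is_name_nat_name[OF elts_in_V[OF F]])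
    have FD: "F \<in> elts D" and sD: "\<sigma> \<in> elts D" using F s D(2) by auto
    have "cl F \<sigma> \<longleftrightarrow> beq (nat_name F) \<sigma> \<in> u \<and> (\<forall>\<rho>\<in>elts N. beq (nat_name F) \<rho> \<in> u \<longrightarrow> rank \<rho> \<notin> elts (rank \<sigma>))"
    proof -
      have "R1 F \<rho> \<longleftrightarrow> beq (nat_name F) \<rho> \<in> u" "R2 \<rho> \<sigma> \<longleftrightarrow> rank \<rho> \<in> elts (rank \<sigma>)" if "\<rho> \<in> elts N" for \<rho>
        using R1(2)[OF FD] R2(2)[OF _ sD] that D(2) by auto
      then show ?thesis unfolding cl_def eW(1) using s by simp
    qed
    also have "\<dots> \<longleftrightarrow> \<sigma> \<in> name_class u (nat_name F)"
      unfolding mem_name_class_iff[OF n] using s down[OF _ _ s] N by auto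
    finally show ?thesis .
  qed
  have cl_definable: "W.definable (\<lambda>v. cl (t v) (s v))" if "W.defterm t" "W.defterm s" for t s
  proof -
    have "W.definable (\<lambda>v. cl (v 0) (v (Suc 0)))"
      unfolding cl_def by (intro W.definable_intros R1d R2d NW)
    from W.definable2_local[of cl, OF this that] show ?thesis .
  qed
  have cls_eq: "{\<sigma> \<in> W.elts N. cl F \<sigma>} = name_class u (nat_name F)" if F: "F \<in> elts nat_funs" for F
    unfolding eW using cl[OF F] cls_N[OF F] by blast
  have ns: "nonstandard F \<longleftrightarrow> F \<in> elts nat_funs \<and> (\<forall>k\<in>W.elts omega. \<not> R3 F k)" for F
  proof -
    have "R3 F k \<longleftrightarrow> val_below F k \<in> u" if "F \<in> elts nat_funs" "k \<in> elts omega" for k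
      using R3(2)[of F k] that D(2) by blast
    then show ?thesis unfolding nonstandard_def eW by blast
  qed
  let ?Q = "\<lambda>x. \<exists>F\<in>W.elts nat_funs. (\<forall>k\<in>W.elts omega. \<not> R3 F k) \<and> (\<forall>\<sigma>\<in>W.elts N. \<sigma> \<in> W.elts x \<longleftrightarrow> cl F \<sigma>)"
  have "W.definable (\<lambda>v. ?Q (v 0))" by (intro W.definable_intros cl_definable R3d NW fW oW)
  from W.small_set_of[OF W.small_Collect[where P = ?Q, OF W.small_Pow[OF NW] this]]
  obtain X where X: "X \<in> W" "W.elts X = {x \<in> {x \<in> W. W.elts x \<subseteq> W.elts N}. ?Q x}" by blast
  have S: "W.elts ` W.elts X = {name_class u (nat_name F) | F. nonstandard F}"
  proof (intro equalityI subsetI)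
    fix c assume "c \<in> W.elts ` W.elts X"
    then obtain x where x: "c = W.elts x" "W.elts x \<subseteq> W.elts N" "?Q x" unfolding X(2) by blast
    then obtain F where F: "F \<in> W.elts nat_funs" "\<forall>k\<in>W.elts omega. \<not> R3 F k"
      "\<forall>\<sigma>\<in>W.elts N. \<sigma> \<in> W.elts x \<longleftrightarrow> cl F \<sigma>" by blast
    have Ff: "F \<in> elts nat_funs" using F(1) eW(2) by simp
    then have "nonstandard F" using F(2) ns by blast
    moreover have "c = {\<sigma> \<in> W.elts N. cl F \<sigma>}" using x(1,2) F(3) by blast
    ultimately show "c \<in> {name_class u (nat_name F) | F. nonstandard F}" using cls_eq[OF Ff] by blast
  next
    fix c assume "c \<in> {name_class u (nat_name F) | F. nonstandard F}"
    then obtain F where F: "nonstandard F" "c = name_class u (nat_name F)" by blast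
    then have Ff: "F \<in> elts nat_funs" "\<forall>k\<in>W.elts omega. \<not> R3 F k" using ns by blast+
    have FW: "F \<in> W" by (rule VW[OF elts_in_V[OF Ff(1)]])
    have "W.definable (\<lambda>v. cl F (v 0))" by (intro cl_definable W.definable_intros FW)
    from W.small_set_of[OF W.small_Collect[where P = "cl F", OF W.small_elts[OF NW] this]]
    obtain x where x: "x \<in> W" "W.elts x = {\<sigma> \<in> W.elts N. cl F \<sigma>}" by blast
    have "x \<in> W.elts X" unfolding X(2) using x Ff eW(2) by blast
    moreover have "c = W.elts x" unfolding x(2) cls_eq[OF Ff(1)] by (rule F(2))
    ultimately show "c \<in> W.elts ` W.elts X" by blast
  qed
  have "W.elts ` W.elts X \<noteq> {}" unfolding S using nonstandard_id by blast
  moreover have "W.elts ` W.elts X \<subseteq> ultrapower u"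
  proof
    fix c assume "c \<in> W.elts ` W.elts X"
    then obtain F where F: "nonstandard F" "c = name_class u (nat_name F)" unfolding S by blast
    note n = is_name_nat_name[OF FV[OF F(1)]]
    show "c \<in> ultrapower u"
      unfolding ultrapower_def F(2) using n bground_nat_name[OF FV[OF F(1)]] bv_ground_bground[OF n] by auto
  qed
  ultimately obtain c where c: "c \<in> W.elts ` W.elts X" "\<forall>d\<in>W.elts ` W.elts X. \<not> ultrapower_mem u d c"
    using wf X(1) unfolding ultrapower_wf_in_def Let_def by blast
  obtain F where F: "nonstandard F" "c = name_class u (nat_name F)" using c(1) unfolding S by blast
  obtain F' where F': "nonstandard F'" "bmem (nat_name F') (nat_name F) \<in> u" using nonstandard_pred[OF F(1)] by blast
  have "ultrapower_mem u (name_class u (nat_name F')) c"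
    unfolding F(2) by (rule ultrapower_memI[OF is_name_nat_name[OF FV[OF F'(1)]] is_name_nat_name[OF FV[OF F(1)]] F'(2)])
  moreover have "name_class u (nat_name F') \<in> W.elts ` W.elts X" unfolding S using F'(1) by blast
  ultimately show False using c(2) by blast
qed

end

lemma wf_imp_weakly: "ultrapower_wf_in W u \<Longrightarrow> weakly_countably_complete u"
  unfolding weakly_countably_complete_def using ill_founded by blast

end

section \<open>The equivalences\<close>

theorem theorem23:
  fixes V W :: "'a set" and E :: "'a \<Rightarrow> 'a \<Rightarrow> bool" and B L U :: 'a and u :: "'a set"
  assumes "membership_structure.zfc_model V E"
    and "membership_structure.zfc_model W E"
    and "transitive_substructure V W E"
    and "boolean_ultrapower.complete_boolean_algebra V E B L"
    and "U \<in> W" and "u = membership_structure.elts W E U"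
    and "ultrafilter_on (boolean_ultrapower.\<BB> V E B L) u"
  shows
    "(U \<in> V \<longrightarrow>
       (boolean_ultrapower.ultrapower_wf_in V E B L V u
          \<longleftrightarrow> boolean_ultrapower.ultrapower_omega_model V E B L u) \<and>
       (boolean_ultrapower.ultrapower_omega_model V E B L u
          \<longleftrightarrow> boolean_ultrapower.meets_countable_maximal_antichains V E B L u) \<and>
       (boolean_ultrapower.meets_countable_maximal_antichains V E B L u
          \<longleftrightarrow> boolean_ultrapower.countably_complete V E B L u) \<and>
       (boolean_ultrapower.countably_complete V E B L u
          \<longleftrightarrow> boolean_ultrapower.weakly_countably_complete V E B L u)) \<and>
     (boolean_ultrapower.ultrapower_omega_model V E B L u
        \<longleftrightarrow> boolean_ultrapower.meets_countable_maximal_antichains V E B L u) \<and>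
     (boolean_ultrapower.meets_countable_maximal_antichains V E B L u
        \<longleftrightarrow> boolean_ultrapower.countably_complete V E B L u) \<and>
     (boolean_ultrapower.countably_complete V E B L u
        \<longleftrightarrow> boolean_ultrapower.weakly_countably_complete V E B L u) \<and>
     (boolean_ultrapower.ultrapower_wf_in V E B L W u \<longrightarrow>
        boolean_ultrapower.ultrapower_omega_model V E B L u \<and>
        boolean_ultrapower.meets_countable_maximal_antichains V E B L u \<and>
        boolean_ultrapower.countably_complete V E B L u \<and>
        boolean_ultrapower.weakly_countably_complete V E B L u)"
proof -
  have Vz: "zfc V E" and Wz: "zfc W E" using assms(1,2) by (simp_all add: zfc_def)
  have "zfc_cba V E B L" using Vz assms(4) by (simp add: zfc_cba_def zfc_cba_axioms_def)
  then have buf: "boolean_ultrafilter V E B L u"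
    using assms(7) by (simp add: boolean_ultrafilter_def boolean_ultrafilter_axioms_def)
  have "outer_ultrafilter V W E B L u U"
    using buf Wz assms(3,5,6) by (simp add: outer_ultrafilter_def outer_ultrafilter_axioms_def)
  then interpret outer_ultrafilter V W E B L u U .
  have 34: "meets_countable_maximal_antichains u \<longleftrightarrow> countably_complete u"
    using meets_imp_weakly weakly_imp_countably_complete countably_complete_imp_weakly weakly_imp_meets by blast
  have 45: "countably_complete u \<longleftrightarrow> weakly_countably_complete u"
    using weakly_imp_countably_complete countably_complete_imp_weakly by blast
  have 23: "ultrapower_omega_model u \<longleftrightarrow> meets_countable_maximal_antichains u"
    using omega_model_imp_meets 34 countably_complete_imp_omega_model by blast
  have 1: "ultrapower_wf_in V u \<longleftrightarrow> weakly_countably_complete u" if UV: "U \<in> V"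
  proof -
    have uV: "u = elts U" using uU elts_W[OF UV] by simp
    have "transitive_substructure V V E" by (simp add: transitive_substructure_def)
    then have "outer_ultrafilter V V E B L u U"
      using buf Vz UV uV by (simp add: outer_ultrafilter_def outer_ultrafilter_axioms_def)
    then show ?thesis using outer_ultrafilter.wf_imp_weakly[of V V E B L u U] weakly_imp_wf[OF UV uV] by blast
  qed
  show ?thesis using 1 23 34 45 wf_imp_weakly by blast
qed

end
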